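(* Let $\mathcal{F}$ be a non-trivial minor-closed family of graphs and let $k\ge 3$ be fixed. There is a deterministic algorithm that, given a graph $G\in\mathcal{F}$ with $n$ vertices, finds an induced cycle of size $k$ in $G$ (if one exists) in $O(n\log n)$ time.
   Context: All graphs are finite, undirected and simple. A minor of a graph $G$ is a graph obtained from a subgraph of $G$ by a sequence of edge contractions. A family of graphs is minor-closed if it contains every minor of each of its members, and non-trivial if it does not contain all graphs. An induced cycle of size $k$ is a set of $k$ vertices whose induced subgraph is a cycle. The constant in $O(n\log n)$ may depend on $\mathcal{F}$ and $k$. *)

theory Defs
  imports Complex_Main "HOL-Library.Landau_Symbols"
begin

section \<open>Graphs and minors\<close>

text \<open>Every finite graph has an isomorphic copy on natural numbers, so a family of graphs is a
  set of graphs with vertices in \<^typ>\<open>nat\<close>.\<close>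

record ugraph =
  verts :: "nat set"
  edges :: "nat set set"

definition simple_graph :: "ugraph \<Rightarrow> bool" where
  "simple_graph G \<longleftrightarrow> finite (verts G) \<and> (\<forall>e\<in>edges G. e \<subseteq> verts G \<and> card e = 2)"

definition isomorphic :: "ugraph \<Rightarrow> ugraph \<Rightarrow> bool" where
  "isomorphic G H \<longleftrightarrow> (\<exists>f. bij_betw f (verts G) (verts H) \<and> edges H = (\<lambda>e. f ` e) ` edges G)"

definition subgraph :: "ugraph \<Rightarrow> ugraph \<Rightarrow> bool" where
  "subgraph H G \<longleftrightarrow> simple_graph H \<and> verts H \<subseteq> verts G \<and> edges H \<subseteq> edges G"

definition induced_subgraph :: "ugraph \<Rightarrow> nat set \<Rightarrow> ugraph" where
  "induced_subgraph G S = \<lparr>verts = S, edges = {e \<in> edges G. e \<subseteq> S}\<rparr>"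

text \<open>The vertex \<open>v\<close> is merged into \<open>u\<close>. The condition on the cardinality removes the loop
  arising from the contracted edge; parallel edges coincide because edges form a set.\<close>

definition contract :: "ugraph \<Rightarrow> nat \<Rightarrow> nat \<Rightarrow> ugraph" where
  "contract G u v =
     \<lparr>verts = verts G - {v},
      edges = {e \<in> (\<lambda>e. (\<lambda>x. if x = v then u else x) ` e) ` edges G. card e = 2}\<rparr>"

definition contracts_to :: "ugraph \<Rightarrow> ugraph \<Rightarrow> bool" where
  "contracts_to G H \<longleftrightarrow> (\<exists>u v. {u, v} \<in> edges G \<and> H = contract G u v)"

text \<open>Minors are taken up to isomorphism; hence minor-closed families are closed under
  isomorphism.\<close>

definition minor_of :: "ugraph \<Rightarrow> ugraph \<Rightarrow> bool" where
  "minor_of H G \<longleftrightarrow> (\<exists>G' H'. subgraph G' G \<and> contracts_to\<^sup>*\<^sup>* G' H' \<and> isomorphic H' H)"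

definition minor_closed :: "ugraph set \<Rightarrow> bool" where
  "minor_closed F \<longleftrightarrow> (\<forall>G\<in>F. \<forall>H. minor_of H G \<longrightarrow> H \<in> F)"

definition nontrivial_family :: "ugraph set \<Rightarrow> bool" where
  "nontrivial_family F \<longleftrightarrow> (\<exists>G. simple_graph G \<and> G \<notin> F)"

definition cycle_graph :: "nat \<Rightarrow> ugraph" where
  "cycle_graph l = \<lparr>verts = {..<l}, edges = {{i, (i + 1) mod l} | i. i < l}\<rparr>"

definition is_cycle :: "ugraph \<Rightarrow> bool" where
  "is_cycle H \<longleftrightarrow> (\<exists>l\<ge>3. isomorphic (cycle_graph l) H)"

definition induced_cycle :: "nat \<Rightarrow> ugraph \<Rightarrow> nat set \<Rightarrow> bool" where
  "induced_cycle k G S \<longleftrightarrow> S \<subseteq> verts G \<and> card S = k \<and> is_cycle (induced_subgraph G S)"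


section \<open>Deterministic word RAM\<close>

text \<open>Programs are while-programs over registers and a random-access memory, with
  three-address instructions of unit cost. Registers and memory cells hold natural numbers below a
  word bound \<open>W\<close>; an instruction that would produce a value of at least \<open>W\<close> has no transition, so
  a program that overflows does not terminate. Subtraction is truncated and division by zero
  yields zero.\<close>

type_synonym reg = nat

record state =
  regs :: "reg \<Rightarrow> nat"
  mem :: "nat \<Rightarrow> nat"

datatype rhs =
    Const nat
  | Copy reg
  | Add reg reg
  | Sub reg reg
  | Mul reg reg
  | Div reg reg
  | Load reg

datatype com =
    Skip
  | Assign reg rhs
  | Store reg reg
  | Seq com com
  | IfLess reg reg com com
  | WhileLess reg reg com

fun rhs_val :: "rhs \<Rightarrow> state \<Rightarrow> nat" where
  "rhs_val (Const a) s = a"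
| "rhs_val (Copy x) s = regs s x"
| "rhs_val (Add x y) s = regs s x + regs s y"
| "rhs_val (Sub x y) s = regs s x - regs s y"
| "rhs_val (Mul x y) s = regs s x * regs s y"
| "rhs_val (Div x y) s = regs s x div regs s y"
| "rhs_val (Load x) s = mem s (regs s x)"

text \<open>\<open>exec W c s t s'\<close>: with word bound \<open>W\<close>, program \<open>c\<close> started in state \<open>s\<close> halts after exactly
  \<open>t\<close> steps in state \<open>s'\<close>.\<close>

inductive exec :: "nat \<Rightarrow> com \<Rightarrow> state \<Rightarrow> nat \<Rightarrow> state \<Rightarrow> bool" for W :: nat where
  exec_Skip: "exec W Skip s 1 s"
| exec_Assign: "rhs_val r s < W \<Longrightarrow>
    exec W (Assign x r) s 1 (s\<lparr>regs := (regs s)(x := rhs_val r s)\<rparr>)"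
| exec_Store: "exec W (Store x y) s 1 (s\<lparr>mem := (mem s)(regs s x := regs s y)\<rparr>)"
| exec_Seq: "exec W c1 s t1 s1 \<Longrightarrow> exec W c2 s1 t2 s2 \<Longrightarrow> exec W (Seq c1 c2) s (t1 + t2) s2"
| exec_IfTrue: "regs s x < regs s y \<Longrightarrow> exec W c1 s t s' \<Longrightarrow>
    exec W (IfLess x y c1 c2) s (t + 1) s'"
| exec_IfFalse: "\<not> regs s x < regs s y \<Longrightarrow> exec W c2 s t s' \<Longrightarrow>
    exec W (IfLess x y c1 c2) s (t + 1) s'"
| exec_WhileFalse: "\<not> regs s x < regs s y \<Longrightarrow> exec W (WhileLess x y c) s 1 s"
| exec_WhileTrue: "regs s x < regs s y \<Longrightarrow> exec W c s t1 s1 \<Longrightarrow>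
    exec W (WhileLess x y c) s1 t2 s2 \<Longrightarrow> exec W (WhileLess x y c) s (t1 + t2 + 1) s2"

inductive_cases exec_SkipE: "exec W Skip s t s'"
inductive_cases exec_AssignE: "exec W (Assign x r) s t s'"
inductive_cases exec_StoreE: "exec W (Store x y) s t s'"
inductive_cases exec_SeqE: "exec W (Seq c1 c2) s t s'"
inductive_cases exec_IfE: "exec W (IfLess x y c1 c2) s t s'"
inductive_cases exec_WhileE: "exec W (WhileLess x y c) s t s'"

lemma exec_deterministic:
  "exec W c s t s' \<Longrightarrow> exec W c s u r \<Longrightarrow> t = u \<and> s' = r"
proof (induction arbitrary: u r rule: exec.induct)
  case (exec_Skip s)
  then show ?case by (auto elim: exec_SkipE)
next
  case (exec_Assign e s x)
  from exec_Assign.prems show ?case by (rule exec_AssignE) simp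
next
  case (exec_Store x y s)
  then show ?case by (auto elim: exec_StoreE)
next
  case (exec_Seq c1 s t1 s1 c2 t2 s2)
  from exec_Seq.prems obtain u1 r1 u2
    where "exec W c1 s u1 r1" "exec W c2 r1 u2 r" "u = u1 + u2"
    by (rule exec_SeqE)
  with exec_Seq.IH show ?case by metis
next
  case (exec_IfTrue s x y c1 t s' c2)
  from exec_IfTrue.prems exec_IfTrue.hyps(1) obtain u1 where "exec W c1 s u1 r" "u = u1 + 1"
    by (auto elim: exec_IfE)
  with exec_IfTrue.IH show ?case by metis
next
  case (exec_IfFalse s x y c2 t s' c1)
  from exec_IfFalse.prems exec_IfFalse.hyps(1) obtain u1 where "exec W c2 s u1 r" "u = u1 + 1"
    by (auto elim: exec_IfE)
  with exec_IfFalse.IH show ?case by metis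
next
  case (exec_WhileFalse s x y c)
  from exec_WhileFalse.prems show ?case
    by (rule exec_WhileE) (simp_all add: exec_WhileFalse.hyps)
next
  case (exec_WhileTrue s x y c t1 s1 t2 s2)
  from exec_WhileTrue.prems obtain u1 r1 u2
    where "exec W c s u1 r1" "exec W (WhileLess x y c) r1 u2 r" "u = u1 + u2 + 1"
    by (rule exec_WhileE) (simp_all add: exec_WhileTrue.hyps(1))
  with exec_WhileTrue.IH show ?case by metis
qed


section \<open>Input and output\<close>

text \<open>The list \<open>vs\<close> numbers the vertices of \<open>G\<close> as \<open>0, \<dots>, n - 1\<close>, and \<open>adj ! i\<close> lists, in any
  order, the numbers of the neighbours of \<open>vs ! i\<close>.\<close>

definition adjacency_lists :: "ugraph \<Rightarrow> nat list \<Rightarrow> nat list list \<Rightarrow> bool" where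
  "adjacency_lists G vs adj \<longleftrightarrow>
     distinct vs \<and> set vs = verts G \<and> length adj = length vs \<and>
     (\<forall>i<length vs. distinct (adj ! i) \<and>
        set (adj ! i) = {j. j < length vs \<and> {vs ! i, vs ! j} \<in> edges G})"

text \<open>Memory layout of the input: cell \<open>0\<close> holds \<open>n\<close>; the list of vertex \<open>i\<close> occupies the cells
  from address \<open>mem (1 + i)\<close> up to but excluding address \<open>mem (2 + i)\<close>.\<close>

definition encode_adj :: "nat list list \<Rightarrow> nat list" where
  "encode_adj adj = (let n = length adj in
     n # map (\<lambda>i. n + 2 + length (concat (take i adj))) [0..<n + 1] @ concat adj)"

definition init_state :: "nat list list \<Rightarrow> state" where
  "init_state adj =
     \<lparr>regs = (\<lambda>_. 0),
      mem = (\<lambda>a. if a < length (encode_adj adj) then encode_adj adj ! a else 0)\<rparr>"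

text \<open>Output: cell \<open>0\<close> holds \<open>0\<close> if there is no induced cycle of size \<open>k\<close>; otherwise it holds \<open>1\<close>
  and cells \<open>1, \<dots>, k\<close> hold the numbers of the vertices of such a cycle.\<close>

definition correct_output :: "nat \<Rightarrow> ugraph \<Rightarrow> nat list \<Rightarrow> state \<Rightarrow> bool" where
  "correct_output k G vs s \<longleftrightarrow>
     (if \<exists>S. induced_cycle k G S
      then mem s 0 = 1 \<and> (\<forall>i\<in>{1..k}. mem s i < length vs) \<and>
           induced_cycle k G ((\<lambda>i. vs ! mem s i) ` {1..k})
      else mem s 0 = 0)"

text \<open>Running time \<open>T n\<close> on graphs in \<open>F\<close> with \<open>n\<close> vertices, on machines with words of \<open>O(log n)\<close>
  bits (the word bound is polynomial in \<open>n\<close>).\<close>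

definition finds_induced_cycles_in_time ::
    "com \<Rightarrow> ugraph set \<Rightarrow> nat \<Rightarrow> (nat \<Rightarrow> nat) \<Rightarrow> bool" where
  "finds_induced_cycles_in_time P F k T \<longleftrightarrow>
     (\<exists>c. \<forall>G\<in>F. \<forall>vs adj. adjacency_lists G vs adj \<longrightarrow>
        (\<exists>t s. exec ((card (verts G) + 2) ^ c) P (init_state adj) t s \<and>
               t \<le> T (card (verts G)) \<and> correct_output k G vs s))"

end

theory Submission
  imports Defs "HOL-Library.Countable" "HOL-Real_Asymp.Real_Asymp"
begin

text \<open>
  By Mader's theorem the graphs of \<open>F\<close> and all their minors have at most \<open>d\<close> times as many edges as
  vertices, so their edges can be oriented with bounded out-degree in linear time, by repeatedly removing
  the edges at vertices of small degree.

  Some member of a family of \<open>O(log n)\<close> colourings separates a given induced \<open>k\<close>-cycle from all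
  out-neighbours of its vertices. The family comes from hash functions on a universe of size
  about \<open>sqrt n\<close>, found by the method of conditional expectations in linear time each; a vertex is hashed as the
  pair of its two base-\<open>sqrt n\<close> digits. Under a separating colouring, the induced cycle is a cycle that
  runs through the \<open>k\<close> colours in order and has no vertex with an out-neighbour in a non-consecutive
  colour class. Deleting such vertices is a local operation, and every correctly coloured cycle that
  remains is induced.

  To find a cycle through the colour classes \<open>0, \<dots>, k - 1\<close> in linear time, orient the graph between the last class
  and class \<open>0\<close>, splitting it into boundedly many star forests. The edge of the wanted cycle between these
  classes lies in one of them, and contracting that star forest merges the two classes. This gives a
  graph of \<open>F\<close> with one class fewer, so that after \<open>k - 1\<close> rounds the cycle is a loop that carries the
  contracted path as its label.

  The algorithm is written in a language of bounded loops and compiled to the word RAM with an exact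
  account of its running time.
\<close>

section \<open>A language of bounded loops over arrays\<close>

text \<open>Why logarithmically many functions suffice: the total of \<open>2 ^ agree\<close> over
  all pairs of digits stays polynomial, so every pair collides under at most
  \<open>4 * (l + 1)\<close> of them, where \<open>2 ^ l\<close> is about \<open>n\<close>. The
  vertices to be separated, \<open>k\<close> on the cycle and at most \<open>8 * d\<close>
  out-neighbours of each, form at most \<open>K * K\<close> pairs, fewer than a collision under each
  of the \<open>q * (l + 1)\<close> functions would require. The potential is a table over pairs;
  its quadratic size forces the universe down to \<open>sqrt n\<close>. Out-neighbours replace
  neighbours because degrees are unbounded, while every chord still leaves one of its two ends.
  Which hash value belongs to which position of the cycle is guessed by trying all
  \<open>(q * q) ^ k\<close> assignments, a constant number. The search branches
  \<open>2 * D\<close> ways on each of \<open>k - 1\<close> levels, again a constant. Contracting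
  only star forests keeps every level inside the family, hence sparse enough for the next
  orientation; contracting all edges between two classes at once could identify different vertices
  of a class and so create false cycles.\<close>

datatype ('v, 'a) aexp =
    N nat
  | V 'v
  | Pl "('v, 'a) aexp" "('v, 'a) aexp"
  | Mi "('v, 'a) aexp" "('v, 'a) aexp"
  | Ti "('v, 'a) aexp" "('v, 'a) aexp"
  | Dv "('v, 'a) aexp" "('v, 'a) aexp"
  | Ar 'a "('v, 'a) aexp"

text \<open>\<open>Get\<close> reads the input, which is never written. The bound of a
  \<open>For\<close> is evaluated once on entry, so every program terminates and \<open>ev\<close>,
  \<open>ok\<close> and \<open>cost\<close> can be primitive recursive.\<close>

datatype ('v, 'a) prog =
    Nop
  | Asg 'v "('v, 'a) aexp"
  | Put 'a "('v, 'a) aexp" "('v, 'a) aexp"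
  | Get 'v "('v, 'a) aexp"
  | Sq "('v, 'a) prog" "('v, 'a) prog" (infixr \<open>;;\<close> 60)
  | Cond "('v, 'a) aexp" "('v, 'a) prog" "('v, 'a) prog"
  | For 'v "('v, 'a) aexp" "('v, 'a) prog"

record ('v, 'a) st =
  vr :: "'v \<Rightarrow> nat"
  ar :: "'a \<Rightarrow> nat \<Rightarrow> nat"
  inp :: "nat list"

definition setv :: "'v \<Rightarrow> nat \<Rightarrow> ('v, 'a) st \<Rightarrow> ('v, 'a) st" where
  "setv x n s = s\<lparr>vr := (vr s)(x := n)\<rparr>"

definition seta :: "'a \<Rightarrow> nat \<Rightarrow> nat \<Rightarrow> ('v, 'a) st \<Rightarrow> ('v, 'a) st" where
  "seta a i n s = s\<lparr>ar := (ar s)(a := (ar s a)(i := n))\<rparr>"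

lemma st_simps [simp]:
  "vr (setv x n s) = (vr s)(x := n)" "ar (setv x n s) = ar s" "inp (setv x n s) = inp s"
  "vr (seta a i n s) = vr s" "ar (seta a i n s) = (ar s)(a := (ar s a)(i := n))"
  "inp (seta a i n s) = inp s"
  by (simp_all add: setv_def seta_def)

primrec aval :: "('v, 'a) aexp \<Rightarrow> ('v, 'a) st \<Rightarrow> nat" where
  "aval (N c) s = c"
| "aval (V x) s = vr s x"
| "aval (Pl e1 e2) s = aval e1 s + aval e2 s"
| "aval (Mi e1 e2) s = aval e1 s - aval e2 s"
| "aval (Ti e1 e2) s = aval e1 s * aval e2 s"
| "aval (Dv e1 e2) s = aval e1 s div aval e2 s"
| "aval (Ar a e) s = ar s a (aval e s)"

primrec iter :: "(nat \<Rightarrow> 's \<Rightarrow> 's) \<Rightarrow> nat \<Rightarrow> 's \<Rightarrow> 's" where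
  "iter f 0 s = s"
| "iter f (Suc n) s = f n (iter f n s)"

primrec ev :: "('v, 'a) prog \<Rightarrow> ('v, 'a) st \<Rightarrow> ('v, 'a) st" where
  "ev Nop s = s"
| "ev (Asg x e) s = setv x (aval e s) s"
| "ev (Put a i e) s = seta a (aval i s) (aval e s) s"
| "ev (Get x e) s = setv x (inp s ! aval e s) s"
| "ev (c1 ;; c2) s = ev c2 (ev c1 s)"
| "ev (Cond e c1 c2) s = (if 0 < aval e s then ev c1 s else ev c2 s)"
| "ev (For x e c) s = iter (\<lambda>i s. ev c (setv x i s)) (aval e s) s"

text \<open>\<open>ok b c s\<close>: every value that \<open>c\<close> stores when started in \<open>s\<close> is at most \<open>b\<close>, and the input is read
  within its bounds.\<close>

primrec ok :: "nat \<Rightarrow> ('v, 'a) prog \<Rightarrow> ('v, 'a) st \<Rightarrow> bool" where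
  "ok b Nop s = True"
| "ok b (Asg x e) s = (aval e s \<le> b)"
| "ok b (Put a i e) s = (aval e s \<le> b)"
| "ok b (Get x e) s = (aval e s < length (inp s) \<and> inp s ! aval e s \<le> b)"
| "ok b (c1 ;; c2) s = (ok b c1 s \<and> ok b c2 (ev c1 s))"
| "ok b (Cond e c1 c2) s = (if 0 < aval e s then ok b c1 s else ok b c2 s)"
| "ok b (For x e c) s =
     (aval e s \<le> b \<and>
      (\<forall>i<aval e s. ok b c (setv x i (iter (\<lambda>i s. ev c (setv x i s)) i s))))"

primrec ecost :: "('v, 'a) aexp \<Rightarrow> nat" where
  "ecost (N c) = 1"
| "ecost (V x) = 1"
| "ecost (Pl e1 e2) = ecost e1 + ecost e2 + 1"
| "ecost (Mi e1 e2) = ecost e1 + ecost e2 + 1"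
| "ecost (Ti e1 e2) = ecost e1 + ecost e2 + 1"
| "ecost (Dv e1 e2) = ecost e1 + ecost e2 + 1"
| "ecost (Ar a e) = ecost e + 6"

text \<open>The costs are the exact running times of the compiled programs below.\<close>

primrec cost :: "('v, 'a) prog \<Rightarrow> ('v, 'a) st \<Rightarrow> nat" where
  "cost Nop s = 1"
| "cost (Asg x e) s = ecost e + 1"
| "cost (Put a i e) s = ecost i + ecost e + 6"
| "cost (Get x e) s = ecost e + 1"
| "cost (c1 ;; c2) s = cost c1 s + cost c2 (ev c1 s)"
| "cost (Cond e c1 c2) s = ecost e + 2 + (if 0 < aval e s then cost c1 s else cost c2 s)"
| "cost (For x e c) s =
     ecost e + 2 + (\<Sum>i<aval e s. cost c (setv x i (iter (\<lambda>i s. ev c (setv x i s)) i s)) + 4)"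

text \<open>The length of the input is included because it is the base of all array
  addresses.\<close>

definition bdd :: "nat \<Rightarrow> ('v, 'a) st \<Rightarrow> bool" where
  "bdd b s \<longleftrightarrow> (\<forall>x. vr s x \<le> b) \<and> (\<forall>a i. ar s a i \<le> b) \<and> length (inp s) \<le> b"

lemma bdd_setv [simp]: "bdd b s \<Longrightarrow> n \<le> b \<Longrightarrow> bdd b (setv x n s)"
  by (auto simp: bdd_def)

lemma bdd_seta [simp]: "bdd b s \<Longrightarrow> n \<le> b \<Longrightarrow> bdd b (seta a i n s)"
  by (auto simp: bdd_def)

lemma bdd_var: "bdd b s \<Longrightarrow> vr s x \<le> b"
  and bdd_arr: "bdd b s \<Longrightarrow> ar s a i \<le> b"
  by (simp_all add: bdd_def)

lemma bdd_iter:
  assumes "\<And>i. i < n \<Longrightarrow> bdd b (iter f i s) \<Longrightarrow> bdd b (f i (iter f i s))" "bdd b s"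
  shows "bdd b (iter f n s)"
proof -
  have "m \<le> n \<Longrightarrow> bdd b (iter f m s)" for m
    by (induction m) (use assms in auto)
  then show ?thesis by simp
qed

lemma ok_bdd: "ok b c s \<Longrightarrow> bdd b s \<Longrightarrow> bdd b (ev c s)"
proof (induction c arbitrary: s)
  case (For x e c)
  show ?case
    unfolding ev.simps
  proof (rule bdd_iter)
    fix i assume i: "i < aval e s"
      and bd: "bdd b (iter (\<lambda>i s. ev c (setv x i s)) i s)"
    from For.prems i have "ok b c (setv x i (iter (\<lambda>i s. ev c (setv x i s)) i s))" by simp
    moreover from For.prems i bd have "bdd b (setv x i (iter (\<lambda>i s. ev c (setv x i s)) i s))"
      by simp
    ultimately show "bdd b (ev c (setv x i (iter (\<lambda>i s. ev c (setv x i s)) i s)))"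
      by (rule For.IH)
  qed (fact For.prems)
qed (auto split: if_splits)

lemma inp_iter: "(\<And>i s. inp (f i s) = inp s) \<Longrightarrow> inp (iter f n s) = inp s"
  by (induction n) auto

lemma inp_ev [simp]: "inp (ev c s) = inp s"
  by (induction c arbitrary: s) (auto simp: inp_iter)

primrec mvars :: "('v, 'a) prog \<Rightarrow> 'v set" where
  "mvars Nop = {}"
| "mvars (Asg x e) = {x}"
| "mvars (Put a i e) = {}"
| "mvars (Get x e) = {x}"
| "mvars (c1 ;; c2) = mvars c1 \<union> mvars c2"
| "mvars (Cond e c1 c2) = mvars c1 \<union> mvars c2"
| "mvars (For x e c) = insert x (mvars c)"

primrec marrs :: "('v, 'a) prog \<Rightarrow> 'a set" where
  "marrs Nop = {}"
| "marrs (Asg x e) = {}"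
| "marrs (Put a i e) = {a}"
| "marrs (Get x e) = {}"
| "marrs (c1 ;; c2) = marrs c1 \<union> marrs c2"
| "marrs (Cond e c1 c2) = marrs c1 \<union> marrs c2"
| "marrs (For x e c) = marrs c"

lemma iter_invariant: "(\<And>i s. g (f i s) = g s) \<Longrightarrow> g (iter f n s) = g s"
  by (induction n) auto

lemma ev_frame_var: "x \<notin> mvars c \<Longrightarrow> vr (ev c s) x = vr s x"
proof (induction c arbitrary: s)
  case (For y e c)
  then show ?case by (auto intro!: iter_invariant[where g = "\<lambda>s. vr s x"])
qed auto

lemma ev_frame_arr: "a \<notin> marrs c \<Longrightarrow> ar (ev c s) a = ar s a"
proof (induction c arbitrary: s)
  case (For y e c)
  then show ?case by (auto intro!: iter_invariant[where g = "\<lambda>s. ar s a"])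
qed auto

subsection \<open>Compilation\<close>

text \<open>A strict bound on the values, addresses included, that arise while a compiled expression
  is evaluated in a \<open>b\<close>-bounded state. It is polynomial in \<open>b\<close>, as a word
  bound polynomial in \<open>n\<close> requires.\<close>

primrec eb :: "('a \<Rightarrow> nat) \<Rightarrow> nat \<Rightarrow> ('v, 'a) aexp \<Rightarrow> nat \<Rightarrow> nat" where
  "eb ac C (N c) b = c + 1"
| "eb ac C (V x) b = b + 1"
| "eb ac C (Pl e1 e2) b = eb ac C e1 b + eb ac C e2 b"
| "eb ac C (Mi e1 e2) b = eb ac C e1 b + eb ac C e2 b"
| "eb ac C (Ti e1 e2) b = eb ac C e1 b * eb ac C e2 b + eb ac C e1 b + eb ac C e2 b"
| "eb ac C (Dv e1 e2) b = eb ac C e1 b + eb ac C e2 b"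
| "eb ac C (Ar a e) b = eb ac C e b * C + eb ac C e b + ac a + C + b + 1"

primrec pb :: "('a \<Rightarrow> nat) \<Rightarrow> nat \<Rightarrow> ('v, 'a) prog \<Rightarrow> nat \<Rightarrow> nat" where
  "pb ac C Nop b = 0"
| "pb ac C (Asg x e) b = eb ac C e b + b"
| "pb ac C (Put a i e) b = eb ac C (Ar a i) b + eb ac C e b"
| "pb ac C (Get x e) b = eb ac C e b + b"
| "pb ac C (c1 ;; c2) b = pb ac C c1 b + pb ac C c2 b"
| "pb ac C (Cond e c1 c2) b = eb ac C e b + pb ac C c1 b + pb ac C c2 b"
| "pb ac C (For x e c) b = eb ac C e b + b + 1 + pb ac C c b"

primrec earrs :: "('v, 'a) aexp \<Rightarrow> 'a set" where
  "earrs (N c) = {}"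
| "earrs (V x) = {}"
| "earrs (Pl e1 e2) = earrs e1 \<union> earrs e2"
| "earrs (Mi e1 e2) = earrs e1 \<union> earrs e2"
| "earrs (Ti e1 e2) = earrs e1 \<union> earrs e2"
| "earrs (Dv e1 e2) = earrs e1 \<union> earrs e2"
| "earrs (Ar a e) = insert a (earrs e)"

primrec arrs :: "('v, 'a) prog \<Rightarrow> 'a set" where
  "arrs Nop = {}"
| "arrs (Asg x e) = earrs e"
| "arrs (Put a i e) = insert a (earrs i \<union> earrs e)"
| "arrs (Get x e) = earrs e"
| "arrs (c1 ;; c2) = arrs c1 \<union> arrs c2"
| "arrs (Cond e c1 c2) = earrs e \<union> arrs c1 \<union> arrs c2"
| "arrs (For x e c) = earrs e \<union> arrs c"

text \<open>Quotient and remainder by \<open>C\<close>. It serves the interleaved memory layout, the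
  pairs of digits hashed into one number, and the keys \<open>u * n + v\<close> of end
  pairs.\<close>

lemma address_inject:
  assumes "i * C + p = j * C + q" "p < C" "q < (C :: nat)"
  shows "i = j \<and> p = q"
proof -
  have "(i * C + p) div C = (j * C + q) div C" using assms by simp
  then have "i = j" using assms(2,3) by simp
  then show ?thesis using assms by simp
qed

text \<open>Even registers hold the variables and odd registers are temporaries; temporary \<open>0\<close> holds the length
  of the input, from where on the arrays are interleaved with period \<open>C\<close>.\<close>

locale compiler =
  fixes vc :: "'v \<Rightarrow> nat" and ac :: "'a \<Rightarrow> nat" and C :: nat
  assumes inj_vc: "inj vc" and inj_ac: "inj ac"
begin

definition vreg :: "'v \<Rightarrow> nat" where "vreg x = 2 * vc x"
definition tmp :: "nat \<Rightarrow> nat" where "tmp h = 2 * h + 1"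

lemma reg_simps [simp]:
  "vreg x = vreg y \<longleftrightarrow> x = y" "tmp h = tmp h' \<longleftrightarrow> h = h'" "vreg x \<noteq> tmp h" "tmp h \<noteq> vreg x"
  using inj_vc by (auto simp: vreg_def tmp_def inj_eq) presburger+

definition addr :: "'a \<Rightarrow> nat \<Rightarrow> com" where
  "addr a h = Seq (Assign (tmp (h + 1)) (Const C)) (Seq (Assign (tmp h) (Mul (tmp h) (tmp (h + 1))))
     (Seq (Assign (tmp (h + 1)) (Const (ac a))) (Seq (Assign (tmp h) (Add (tmp h) (tmp (h + 1))))
       (Assign (tmp h) (Add (tmp h) (tmp 0))))))"

text \<open>The argument \<open>h\<close> is the height of a stack of temporaries: the value is left
  in \<open>tmp h\<close>, and no temporary below \<open>h\<close> changes. Evaluating the second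
  operand at \<open>h + 1\<close> thus protects the first.\<close>

primrec compe :: "('v, 'a) aexp \<Rightarrow> nat \<Rightarrow> com" where
  "compe (N c) h = Assign (tmp h) (Const c)"
| "compe (V x) h = Assign (tmp h) (Copy (vreg x))"
| "compe (Pl e1 e2) h =
     Seq (compe e1 h) (Seq (compe e2 (h + 1)) (Assign (tmp h) (Add (tmp h) (tmp (h + 1)))))"
| "compe (Mi e1 e2) h =
     Seq (compe e1 h) (Seq (compe e2 (h + 1)) (Assign (tmp h) (Sub (tmp h) (tmp (h + 1)))))"
| "compe (Ti e1 e2) h =
     Seq (compe e1 h) (Seq (compe e2 (h + 1)) (Assign (tmp h) (Mul (tmp h) (tmp (h + 1)))))"
| "compe (Dv e1 e2) h =
     Seq (compe e1 h) (Seq (compe e2 (h + 1)) (Assign (tmp h) (Div (tmp h) (tmp (h + 1)))))"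
| "compe (Ar a e) h = Seq (compe e h) (Seq (addr a h) (Assign (tmp h) (Load (tmp h))))"

text \<open>Bound and counter of a loop live in \<open>tmp h\<close> and \<open>tmp (h + 1)\<close>,
  and the body runs at height \<open>h + 2\<close>. The loop variable is only a copy of the counter,
  so assigning to it in the body does not affect the iteration, in agreement with
  \<open>ev\<close>.\<close>

primrec comp :: "('v, 'a) prog \<Rightarrow> nat \<Rightarrow> com" where
  "comp Nop h = Skip"
| "comp (Asg x e) h = Seq (compe e h) (Assign (vreg x) (Copy (tmp h)))"
| "comp (Put a i e) h =
     Seq (compe i h) (Seq (addr a h) (Seq (compe e (h + 1)) (Store (tmp h) (tmp (h + 1)))))"
| "comp (Get x e) h = Seq (compe e h) (Assign (vreg x) (Load (tmp h)))"
| "comp (c1 ;; c2) h = Seq (comp c1 h) (comp c2 h)"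
| "comp (Cond e c1 c2) h = Seq (compe e h) (Seq (Assign (tmp (h + 1)) (Const 0))
     (IfLess (tmp (h + 1)) (tmp h) (comp c1 h) (comp c2 h)))"
| "comp (For x e c) h = Seq (compe e h) (Seq (Assign (tmp (h + 1)) (Const 0))
     (WhileLess (tmp (h + 1)) (tmp h)
       (Seq (Assign (vreg x) (Copy (tmp (h + 1)))) (Seq (comp c (h + 2))
         (Seq (Assign (tmp (h + 2)) (Const 1))
           (Assign (tmp (h + 1)) (Add (tmp (h + 1)) (tmp (h + 2)))))))))"

definition simul :: "state \<Rightarrow> ('v, 'a) st \<Rightarrow> bool" where
  "simul r s \<longleftrightarrow> (\<forall>x. regs r (vreg x) = vr s x) \<and> regs r (tmp 0) = length (inp s) \<and>
     (\<forall>a i. ac a < C \<longrightarrow> mem r (length (inp s) + i * C + ac a) = ar s a i) \<and>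
     (\<forall>p<length (inp s). mem r p = inp s ! p)"

lemma exec_Seq': "exec W c1 s t1 s1 \<Longrightarrow> exec W c2 s1 t2 s2 \<Longrightarrow> t = t1 + t2 \<Longrightarrow> exec W (Seq c1 c2) s t s2"
  by (simp add: exec_Seq)

lemma exec_Assign': "v = rhs_val rh s \<Longrightarrow> v < W \<Longrightarrow> exec W (Assign x rh) s (Suc 0) (s\<lparr>regs := (regs s)(x := v)\<rparr>)"
  using exec_Assign[of rh s W x] by simp

lemma exec_addr:
  assumes "regs r (tmp 0) = z" "h \<ge> 1" "regs r (tmp h) = i"
    and W: "i * C + ac a + z < W" "C < W"
  shows "\<exists>r'. exec W (addr a h) r 5 r' \<and> mem r' = mem r \<and> regs r' (tmp h) = z + i * C + ac a \<and>
    (\<forall>x. x \<noteq> tmp h \<longrightarrow> x \<noteq> tmp (h + 1) \<longrightarrow> regs r' x = regs r x)"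
proof -
  define r1 where "r1 = r\<lparr>regs := (regs r)(tmp (h + 1) := C)\<rparr>"
  define r2 where "r2 = r1\<lparr>regs := (regs r1)(tmp h := i * C)\<rparr>"
  define r3 where "r3 = r2\<lparr>regs := (regs r2)(tmp (h + 1) := ac a)\<rparr>"
  define r4 where "r4 = r3\<lparr>regs := (regs r3)(tmp h := i * C + ac a)\<rparr>"
  define r5 where "r5 = r4\<lparr>regs := (regs r4)(tmp h := i * C + ac a + z)\<rparr>"
  have 1: "exec W (Assign (tmp (h + 1)) (Const C)) r 1 r1"
    using exec_Assign[of "Const C" r W] W by (simp add: r1_def)
  have 2: "exec W (Assign (tmp h) (Mul (tmp h) (tmp (h + 1)))) r1 1 r2"
    using exec_Assign[of "Mul (tmp h) (tmp (h + 1))" r1 W "tmp h"] W assms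
    by (simp add: r1_def r2_def)
  have 3: "exec W (Assign (tmp (h + 1)) (Const (ac a))) r2 1 r3"
    using exec_Assign[of "Const (ac a)" r2 W "tmp (h + 1)"] W by (simp add: r3_def)
  have 4: "exec W (Assign (tmp h) (Add (tmp h) (tmp (h + 1)))) r3 1 r4"
    using exec_Assign[of "Add (tmp h) (tmp (h + 1))" r3 W "tmp h"] W
    by (simp add: r4_def) (simp add: r3_def r2_def)
  have 5: "exec W (Assign (tmp h) (Add (tmp h) (tmp 0))) r4 1 r5"
    using exec_Assign[of "Add (tmp h) (tmp 0)" r4 W "tmp h"] W assms
    by (simp add: r5_def) (simp add: r4_def r3_def r2_def r1_def)
  have "exec W (addr a h) r 5 r5"
    using exec_Seq[OF 1 exec_Seq[OF 2 exec_Seq[OF 3 exec_Seq[OF 4 5]]]]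
    by (simp add: addr_def numeral_eq_Suc)
  then show ?thesis
    by (intro exI[of _ r5]) (use assms in \<open>auto simp: r5_def r4_def r3_def r2_def r1_def\<close>)
qed

lemma exec_compe_bin:
  assumes "exec W (compe e1 h) r t1 r1" "exec W (compe e2 (h + 1)) r1 t2 r2"
    and "mem r1 = mem r" "mem r2 = mem r1"
    and "\<forall>x. (\<forall>h'\<ge>h. x \<noteq> tmp h') \<longrightarrow> regs r1 x = regs r x"
    and "\<forall>x. (\<forall>h'\<ge>h + 1. x \<noteq> tmp h') \<longrightarrow> regs r2 x = regs r1 x"
    and "rhs_val rh r2 = v" "v < W"
  shows "\<exists>r'. exec W (Seq (compe e1 h) (Seq (compe e2 (h + 1)) (Assign (tmp h) rh))) r (t1 + t2 + 1) r' \<and>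
     mem r' = mem r \<and> regs r' (tmp h) = v \<and>
     (\<forall>x. (\<forall>h'\<ge>h. x \<noteq> tmp h') \<longrightarrow> regs r' x = regs r x)"
proof -
  have "exec W (Assign (tmp h) rh) r2 1 (r2\<lparr>regs := (regs r2)(tmp h := v)\<rparr>)"
    using exec_Assign[of rh r2 W] assms by simp
  from exec_Seq[OF assms(1) exec_Seq[OF assms(2) this]] show ?thesis
    by (intro exI[of _ "r2\<lparr>regs := (regs r2)(tmp h := v)\<rparr>"] conjI)
      (use assms in \<open>auto simp: add.assoc\<close>)
qed

lemma simul_cong:
  assumes "simul r s" "mem r' = mem r" "h \<ge> 1" "\<forall>x. (\<forall>h'\<ge>h. x \<noteq> tmp h') \<longrightarrow> regs r' x = regs r x"
  shows "simul r' s"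
  using assms by (simp add: simul_def)

text \<open>Bound and simulation go through one induction, since an instruction has a transition
  only if the bounds of its operands exclude an overflow.\<close>

lemma compe_sim:
  assumes "bdd b s" "\<forall>a\<in>earrs e. ac a < C" "simul r s" "eb ac C e b < W" "h \<ge> 1"
  shows "aval e s < eb ac C e b \<and>
    (\<exists>r'. exec W (compe e h) r (ecost e) r' \<and> mem r' = mem r \<and> regs r' (tmp h) = aval e s \<and>
      (\<forall>x. (\<forall>h'\<ge>h. x \<noteq> tmp h') \<longrightarrow> regs r' x = regs r x))"
  using assms(2-)
proof (induction e arbitrary: r h)
  case (N c)
  then show ?case
    using exec_Assign[of "Const c" r W "tmp h"] by (auto intro!: exI)
next
  case (V x)
  have "vr s x \<le> b" using assms(1) by (simp add: bdd_def)
  then show ?case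
    using exec_Assign[of "Copy (vreg x)" r W "tmp h"] V by (auto intro!: exI simp: simul_def)
next
  case (Pl e1 e2)
  from Pl.IH(1)[of r h] Pl.prems obtain r1 where 1: "aval e1 s < eb ac C e1 b"
    "exec W (compe e1 h) r (ecost e1) r1" "mem r1 = mem r" "regs r1 (tmp h) = aval e1 s"
    "\<forall>x. (\<forall>h'\<ge>h. x \<noteq> tmp h') \<longrightarrow> regs r1 x = regs r x" by auto
  have "simul r1 s" using simul_cong 1 Pl.prems by blast
  with Pl.IH(2)[of r1 "h + 1"] Pl.prems obtain r2 where 2: "aval e2 s < eb ac C e2 b"
    "exec W (compe e2 (h + 1)) r1 (ecost e2) r2" "mem r2 = mem r1" "regs r2 (tmp (h + 1)) = aval e2 s"
    "\<forall>x. (\<forall>h'\<ge>h + 1. x \<noteq> tmp h') \<longrightarrow> regs r2 x = regs r1 x" by auto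
  have "regs r2 (tmp h) = aval e1 s" using 1 2 by simp
  with 1 2 exec_compe_bin[OF 1(2) 2(2) 1(3) 2(3) 1(5) 2(5), of "Add (tmp h) (tmp (h + 1))"] Pl.prems
  show ?case by auto
next
  case (Mi e1 e2)
  from Mi.IH(1)[of r h] Mi.prems obtain r1 where 1: "aval e1 s < eb ac C e1 b"
    "exec W (compe e1 h) r (ecost e1) r1" "mem r1 = mem r" "regs r1 (tmp h) = aval e1 s"
    "\<forall>x. (\<forall>h'\<ge>h. x \<noteq> tmp h') \<longrightarrow> regs r1 x = regs r x" by auto
  have "simul r1 s" using simul_cong 1 Mi.prems by blast
  with Mi.IH(2)[of r1 "h + 1"] Mi.prems obtain r2 where 2: "aval e2 s < eb ac C e2 b"
    "exec W (compe e2 (h + 1)) r1 (ecost e2) r2" "mem r2 = mem r1" "regs r2 (tmp (h + 1)) = aval e2 s"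
    "\<forall>x. (\<forall>h'\<ge>h + 1. x \<noteq> tmp h') \<longrightarrow> regs r2 x = regs r1 x" by auto
  have "regs r2 (tmp h) = aval e1 s" using 1 2 by simp
  with 1 2 exec_compe_bin[OF 1(2) 2(2) 1(3) 2(3) 1(5) 2(5), of "Sub (tmp h) (tmp (h + 1))"] Mi.prems
  show ?case by auto
next
  case (Ti e1 e2)
  from Ti.IH(1)[of r h] Ti.prems obtain r1 where 1: "aval e1 s < eb ac C e1 b"
    "exec W (compe e1 h) r (ecost e1) r1" "mem r1 = mem r" "regs r1 (tmp h) = aval e1 s"
    "\<forall>x. (\<forall>h'\<ge>h. x \<noteq> tmp h') \<longrightarrow> regs r1 x = regs r x" by auto
  have "simul r1 s" using simul_cong 1 Ti.prems by blast
  with Ti.IH(2)[of r1 "h + 1"] Ti.prems obtain r2 where 2: "aval e2 s < eb ac C e2 b"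
    "exec W (compe e2 (h + 1)) r1 (ecost e2) r2" "mem r2 = mem r1" "regs r2 (tmp (h + 1)) = aval e2 s"
    "\<forall>x. (\<forall>h'\<ge>h + 1. x \<noteq> tmp h') \<longrightarrow> regs r2 x = regs r1 x" by auto
  have "aval e1 s * aval e2 s \<le> eb ac C e1 b * eb ac C e2 b" using 1 2 by (intro mult_mono) auto
  then have "aval e1 s * aval e2 s < eb ac C (Ti e1 e2) b" using 1 by simp
  moreover have "regs r2 (tmp h) = aval e1 s" using 1 2 by simp
  ultimately show ?case
    using 1 2 exec_compe_bin[OF 1(2) 2(2) 1(3) 2(3) 1(5) 2(5), of "Mul (tmp h) (tmp (h + 1))"] Ti.prems
    by auto
next
  case (Dv e1 e2)
  from Dv.IH(1)[of r h] Dv.prems obtain r1 where 1: "aval e1 s < eb ac C e1 b"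
    "exec W (compe e1 h) r (ecost e1) r1" "mem r1 = mem r" "regs r1 (tmp h) = aval e1 s"
    "\<forall>x. (\<forall>h'\<ge>h. x \<noteq> tmp h') \<longrightarrow> regs r1 x = regs r x" by auto
  have "simul r1 s" using simul_cong 1 Dv.prems by blast
  with Dv.IH(2)[of r1 "h + 1"] Dv.prems obtain r2 where 2: "aval e2 s < eb ac C e2 b"
    "exec W (compe e2 (h + 1)) r1 (ecost e2) r2" "mem r2 = mem r1" "regs r2 (tmp (h + 1)) = aval e2 s"
    "\<forall>x. (\<forall>h'\<ge>h + 1. x \<noteq> tmp h') \<longrightarrow> regs r2 x = regs r1 x" by auto
  have "aval e1 s div aval e2 s < eb ac C (Dv e1 e2) b"
    using 1(1) le_less_trans[OF div_le_dividend 1(1)] by (simp add: trans_less_add1)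
  moreover have "regs r2 (tmp h) = aval e1 s" using 1 2 by simp
  ultimately show ?case
    using 1 2 exec_compe_bin[OF 1(2) 2(2) 1(3) 2(3) 1(5) 2(5), of "Div (tmp h) (tmp (h + 1))"] Dv.prems
    by auto
next
  case (Ar a e)
  from Ar.IH[of r h] Ar.prems obtain r1 where 1: "aval e s < eb ac C e b"
    "exec W (compe e h) r (ecost e) r1" "mem r1 = mem r" "regs r1 (tmp h) = aval e s"
    "\<forall>x. (\<forall>h'\<ge>h. x \<noteq> tmp h') \<longrightarrow> regs r1 x = regs r x" by auto
  let ?z = "length (inp s)"
  have z: "?z \<le> b" "ar s a (aval e s) \<le> b" using assms(1) by (simp_all add: bdd_def)
  have "aval e s * C \<le> eb ac C e b * C" using 1 by (intro mult_le_mono1) simp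
  then have "aval e s * C + ac a + ?z < W" "C < W" using Ar.prems(3)[unfolded eb.simps] z by linarith+
  with exec_addr[of r1 ?z h "aval e s" a W] 1 Ar.prems
  obtain r2 where 2: "exec W (addr a h) r1 5 r2" "mem r2 = mem r1"
    "regs r2 (tmp h) = ?z + aval e s * C + ac a"
    "\<forall>x. x \<noteq> tmp h \<longrightarrow> x \<noteq> tmp (h + 1) \<longrightarrow> regs r2 x = regs r1 x"
    by (auto simp: simul_def)
  have "rhs_val (Load (tmp h)) r2 = aval (Ar a e) s"
    using 1 2 Ar.prems by (simp add: simul_def)
  then have "exec W (Assign (tmp h) (Load (tmp h))) r2 1 (r2\<lparr>regs := (regs r2)(tmp h := aval (Ar a e) s)\<rparr>)"
    using exec_Assign[of "Load (tmp h)" r2 W "tmp h"] z Ar.prems by simp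
  from exec_Seq[OF 1(2) exec_Seq[OF 2(1) this]]
  have "exec W (compe (Ar a e) h) r (ecost (Ar a e)) (r2\<lparr>regs := (regs r2)(tmp h := aval (Ar a e) s)\<rparr>)"
    by (simp add: numeral_eq_Suc)
  moreover have "aval (Ar a e) s < eb ac C (Ar a e) b" using z by simp
  ultimately show ?case
    by (intro conjI exI[of _ "r2\<lparr>regs := (regs r2)(tmp h := aval (Ar a e) s)\<rparr>"]) (use 1 2 in auto)
qed

lemma simul_setv: "simul r s \<Longrightarrow> simul (r\<lparr>regs := (regs r)(vreg x := v)\<rparr>) (setv x v s)"
  by (auto simp: simul_def)

lemma simul_seta:
  assumes "simul r s" "ac a < C"
  shows "simul (r\<lparr>mem := (mem r)(length (inp s) + i * C + ac a := v)\<rparr>) (seta a i v s)"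
  using assms inj_ac by (auto simp: simul_def inj_eq dest!: address_inject)

text \<open>Preservation of the temporaries below \<open>h\<close> is what protects the bounds and
  counters of the enclosing loops.\<close>

lemma comp_sim:
  assumes "ok b c s" "bdd b s" "simul r s" "pb ac C c b < W" "h \<ge> 1" "\<forall>a\<in>arrs c. ac a < C"
  shows "\<exists>r'. exec W (comp c h) r (cost c s) r' \<and> simul r' (ev c s) \<and>
      (\<forall>h'<h. regs r' (tmp h') = regs r (tmp h'))"
  using assms
proof (induction c arbitrary: r s h)
  case Nop
  then show ?case using exec_Skip by auto
next
  case (Asg x e)
  from compe_sim[of b s e r W h] Asg.prems obtain r1 where 1:
    "exec W (compe e h) r (ecost e) r1" "mem r1 = mem r" "regs r1 (tmp h) = aval e s"
    "\<forall>x. (\<forall>h'\<ge>h. x \<noteq> tmp h') \<longrightarrow> regs r1 x = regs r x" "aval e s < W" by auto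
  from 1 have "exec W (Assign (vreg x) (Copy (tmp h))) r1 1 (r1\<lparr>regs := (regs r1)(vreg x := aval e s)\<rparr>)"
    using exec_Assign[of "Copy (tmp h)" r1 W "vreg x"] by simp
  from exec_Seq[OF 1(1) this] simul_setv[OF simul_cong[OF Asg.prems(3) 1(2) Asg.prems(5) 1(4)]] 1
  show ?case by (intro exI conjI) auto
next
  case (Put a i e)
  from compe_sim[of b s i r W h] Put.prems obtain r1 where 1: "aval i s < eb ac C i b"
    "exec W (compe i h) r (ecost i) r1" "mem r1 = mem r" "regs r1 (tmp h) = aval i s"
    "\<forall>x. (\<forall>h'\<ge>h. x \<noteq> tmp h') \<longrightarrow> regs r1 x = regs r x" by auto
  let ?z = "length (inp s)"
  have z: "?z \<le> b" using Put.prems(2) by (simp add: bdd_def)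
  have "aval i s * C \<le> eb ac C i b * C" using 1 by (intro mult_le_mono1) simp
  then have "aval i s * C + ac a + ?z < W" "C < W" using Put.prems(4)[unfolded pb.simps eb.simps] z by linarith+
  with exec_addr[of r1 ?z h "aval i s" a W] 1 Put.prems
  obtain r2 where 2: "exec W (addr a h) r1 5 r2" "mem r2 = mem r1"
    "regs r2 (tmp h) = ?z + aval i s * C + ac a"
    "\<forall>x. x \<noteq> tmp h \<longrightarrow> x \<noteq> tmp (h + 1) \<longrightarrow> regs r2 x = regs r1 x"
    by (auto simp: simul_def)
  have "simul r2 s" using 1 2 Put.prems by (auto simp: simul_def)
  with compe_sim[of b s e r2 W "h + 1"] Put.prems obtain r3 where 3: "mem r3 = mem r2"
    "exec W (compe e (h + 1)) r2 (ecost e) r3" "regs r3 (tmp (h + 1)) = aval e s"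
    "\<forall>x. (\<forall>h'\<ge>h + 1. x \<noteq> tmp h') \<longrightarrow> regs r3 x = regs r2 x" by auto
  have "simul r3 s" using simul_cong[OF \<open>simul r2 s\<close> 3(1) _ 3(4)] by simp
  then have "simul (r3\<lparr>mem := (mem r3)(?z + aval i s * C + ac a := aval e s)\<rparr>) (ev (Put a i e) s)"
    using simul_seta[of r3 s a] Put.prems by simp
  moreover have "exec W (Store (tmp h) (tmp (h + 1))) r3 1
      (r3\<lparr>mem := (mem r3)(?z + aval i s * C + ac a := aval e s)\<rparr>)"
    using exec_Store[of W "tmp h" "tmp (h + 1)" r3] 2 3 by simp
  from exec_Seq[OF 1(2) exec_Seq[OF 2(1) exec_Seq[OF 3(2) this]]]
  have "exec W (comp (Put a i e) h) r (cost (Put a i e) s)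
      (r3\<lparr>mem := (mem r3)(?z + aval i s * C + ac a := aval e s)\<rparr>)"
    by (simp add: numeral_eq_Suc)
  ultimately show ?case using 1 2 3 by (intro exI conjI) auto
next
  case (Get x e)
  from compe_sim[of b s e r W h] Get.prems obtain r1 where 1:
    "exec W (compe e h) r (ecost e) r1" "mem r1 = mem r" "regs r1 (tmp h) = aval e s"
    "\<forall>x. (\<forall>h'\<ge>h. x \<noteq> tmp h') \<longrightarrow> regs r1 x = regs r x" by auto
  have "mem r1 (aval e s) = inp s ! aval e s" using 1 Get.prems by (auto simp: simul_def)
  then have "exec W (Assign (vreg x) (Load (tmp h))) r1 1 (r1\<lparr>regs := (regs r1)(vreg x := inp s ! aval e s)\<rparr>)"
    using exec_Assign[of "Load (tmp h)" r1 W "vreg x"] Get.prems 1 by simp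
  from exec_Seq[OF 1(1) this] simul_setv[OF simul_cong[OF Get.prems(3) 1(2) Get.prems(5) 1(4)]] 1
  show ?case by (intro exI conjI) auto
next
  case (Sq c1 c2)
  from Sq.IH(1)[of s r h] Sq.prems obtain r1 where 1: "exec W (comp c1 h) r (cost c1 s) r1"
    "simul r1 (ev c1 s)" "\<forall>h'<h. regs r1 (tmp h') = regs r (tmp h')" by auto
  have "bdd b (ev c1 s)" using Sq.prems by (auto intro: ok_bdd)
  with Sq.IH(2)[of "ev c1 s" r1 h] Sq.prems 1 obtain r2 where
    "exec W (comp c2 h) r1 (cost c2 (ev c1 s)) r2"
    "simul r2 (ev c2 (ev c1 s))" "\<forall>h'<h. regs r2 (tmp h') = regs r1 (tmp h')" by auto
  with 1 exec_Seq[OF 1(1) this(1)] show ?case by auto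
next
  case (Cond e c1 c2)
  from compe_sim[of b s e r W h] Cond.prems obtain r1 where 1:
    "exec W (compe e h) r (ecost e) r1" "mem r1 = mem r" "regs r1 (tmp h) = aval e s"
    "\<forall>x. (\<forall>h'\<ge>h. x \<noteq> tmp h') \<longrightarrow> regs r1 x = regs r x" "0 < W" by auto
  define r2 where "r2 = r1\<lparr>regs := (regs r1)(tmp (h + 1) := 0)\<rparr>"
  have 2: "exec W (Assign (tmp (h + 1)) (Const 0)) r1 1 r2"
    using exec_Assign[of "Const 0" r1 W "tmp (h + 1)"] 1 by (simp add: r2_def)
  have s2: "simul r2 s"
    using simul_cong[OF Cond.prems(3) 1(2) Cond.prems(5) 1(4)] by (simp add: r2_def simul_def)
  have r2: "\<forall>h'<h. regs r2 (tmp h') = regs r (tmp h')" "regs r2 (tmp h) = aval e s"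
    "regs r2 (tmp (h + 1)) = 0" using 1 by (auto simp: r2_def)
  show ?case
  proof (cases "0 < aval e s")
    case True
    with Cond.IH(1)[of s r2 h] Cond.prems s2 obtain r3 where 3: "exec W (comp c1 h) r2 (cost c1 s) r3"
      "simul r3 (ev c1 s)" "\<forall>h'<h. regs r3 (tmp h') = regs r2 (tmp h')" by auto
    have "exec W (IfLess (tmp (h + 1)) (tmp h) (comp c1 h) (comp c2 h)) r2 (cost c1 s + 1) r3"
      using 3 r2 True by (intro exec_IfTrue) auto
    from exec_Seq[OF 1(1) exec_Seq[OF 2 this]] True 3 r2 show ?thesis
      by (intro exI conjI) auto
  next
    case False
    with Cond.IH(2)[of s r2 h] Cond.prems s2 obtain r3 where 3: "exec W (comp c2 h) r2 (cost c2 s) r3"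
      "simul r3 (ev c2 s)" "\<forall>h'<h. regs r3 (tmp h') = regs r2 (tmp h')" by auto
    have "exec W (IfLess (tmp (h + 1)) (tmp h) (comp c1 h) (comp c2 h)) r2 (cost c2 s + 1) r3"
      using 3 r2 False by (intro exec_IfFalse) auto
    from exec_Seq[OF 1(1) exec_Seq[OF 2 this]] False 3 r2 show ?thesis
      by (intro exI conjI) auto
  qed
next
  case (For x e c)
  define n where "n = aval e s"
  define st where "st = (\<lambda>i. iter (\<lambda>i s. ev c (setv x i s)) i s)"
  have stS: "st (Suc i) = ev c (setv x i (st i))" for i by (simp add: st_def)
  from compe_sim[of b s e r W h] For.prems obtain r1 where 1: "aval e s < eb ac C e b"
    "exec W (compe e h) r (ecost e) r1" "mem r1 = mem r" "regs r1 (tmp h) = aval e s"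
    "\<forall>x. (\<forall>h'\<ge>h. x \<noteq> tmp h') \<longrightarrow> regs r1 x = regs r x" by auto
  define r2 where "r2 = r1\<lparr>regs := (regs r1)(tmp (h + 1) := 0)\<rparr>"
  have W: "n < W" "1 < W" using 1 For.prems by (auto simp: n_def)
  have 2: "exec W (Assign (tmp (h + 1)) (Const 0)) r1 1 r2"
    using exec_Assign[of "Const 0" r1 W "tmp (h + 1)"] W by (simp add: r2_def)
  have s2: "simul r2 s"
    using simul_cong[OF For.prems(3) 1(3) For.prems(5) 1(5)] by (simp add: r2_def simul_def)
  let ?body = "Seq (Assign (vreg x) (Copy (tmp (h + 1)))) (Seq (comp c (h + 2))
         (Seq (Assign (tmp (h + 2)) (Const 1))
           (Assign (tmp (h + 1)) (Add (tmp (h + 1)) (tmp (h + 2))))))"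
  let ?w = "WhileLess (tmp (h + 1)) (tmp h) ?body"
  have okn: "i < n \<Longrightarrow> ok b c (setv x i (st i))" for i
    using For.prems(1) by (simp add: n_def st_def)
  have bst: "i \<le> n \<Longrightarrow> bdd b (st i)" for i
  proof (induction i)
    case (Suc i)
    then have "bdd b (setv x i (st i))" using For.prems(1) by (simp add: n_def)
    with okn[of i] Suc show ?case by (auto simp: stS intro: ok_bdd)
  qed (simp add: st_def For.prems)
  \<comment> \<open>The claim is about the remaining iterations and is proved by downward induction
    on \<open>i\<close>, because \<open>exec_WhileTrue\<close> puts the first iteration in front of
    the rest. An iteration adds three assignments and one test to the cost of the body; the final
    \<open>+ 1\<close> is the failing test.\<close>
  have loop: "\<exists>r'. exec W ?w q ((\<Sum>j\<in>{i..<n}. cost c (setv x j (st j)) + 4) + 1) r' \<and> simul r' (st n) \<and>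
      (\<forall>h'<h. regs r' (tmp h') = regs q (tmp h'))"
    if "i \<le> n" "simul q (st i)" "regs q (tmp h) = n" "regs q (tmp (h + 1)) = i" for i q
    using that
  proof (induction i arbitrary: q rule: inc_induct)
    case base
    then have "exec W ?w q 1 q" by (intro exec_WhileFalse) simp
    with base show ?case by auto
  next
    case (step i)
    define q1 where "q1 = q\<lparr>regs := (regs q)(vreg x := i)\<rparr>"
    have e1: "exec W (Assign (vreg x) (Copy (tmp (h + 1)))) q 1 q1"
      using exec_Assign[of "Copy (tmp (h + 1))" q W "vreg x"] step W by (simp add: q1_def)
    have sq1: "simul q1 (setv x i (st i))" using step simul_setv by (simp add: q1_def)
    have "bdd b (setv x i (st i))" using bst[of i] step For.prems(1) by (simp add: n_def)
    then obtain q2 where e2: "exec W (comp c (h + 2)) q1 (cost c (setv x i (st i))) q2"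
      "simul q2 (st (Suc i))" "\<forall>h'<h + 2. regs q2 (tmp h') = regs q1 (tmp h')"
      using For.IH[of "setv x i (st i)" q1 "h + 2"] okn[of i] sq1 step For.prems by (auto simp: stS)
    define q3 where "q3 = q2\<lparr>regs := (regs q2)(tmp (h + 2) := 1)\<rparr>"
    have e3: "exec W (Assign (tmp (h + 2)) (Const 1)) q2 1 q3"
      using exec_Assign[of "Const 1" q2 W "tmp (h + 2)"] W by (simp add: q3_def)
    define q4 where "q4 = q3\<lparr>regs := (regs q3)(tmp (h + 1) := Suc i)\<rparr>"
    have q3: "regs q3 (tmp (h + 1)) = i" "regs q3 (tmp (h + 2)) = 1"
      using e2(3) step by (simp_all add: q3_def q1_def)
    have e4: "exec W (Assign (tmp (h + 1)) (Add (tmp (h + 1)) (tmp (h + 2)))) q3 1 q4"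
      using exec_Assign[of "Add (tmp (h + 1)) (tmp (h + 2))" q3 W "tmp (h + 1)"] W step q3
      by (simp add: q4_def)
    have body: "exec W ?body q (cost c (setv x i (st i)) + 3) q4"
      using exec_Seq[OF e1 exec_Seq[OF e2(1) exec_Seq[OF e3 e4]]] by (simp add: numeral_eq_Suc)
    have sq4: "simul q4 (st (Suc i))" using e2(2) For.prems(5) by (simp add: q4_def q3_def simul_def)
    have "regs q4 (tmp h) = n" "regs q4 (tmp (h + 1)) = Suc i"
      "\<forall>h'<h. regs q4 (tmp h') = regs q (tmp h')"
      using e2(3) step by (auto simp: q4_def q3_def q1_def)
    with step.IH[OF sq4] obtain r' where
      r': "exec W ?w q4 ((\<Sum>j\<in>{Suc i..<n}. cost c (setv x j (st j)) + 4) + 1) r'" "simul r' (st n)"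
      "\<forall>h'<h. regs r' (tmp h') = regs q (tmp h')" by auto
    have "exec W ?w q (cost c (setv x i (st i)) + 3 +
        ((\<Sum>j\<in>{Suc i..<n}. cost c (setv x j (st j)) + 4) + 1) + 1) r'"
      by (rule exec_WhileTrue[OF _ body r'(1)]) (use step in simp)
    moreover have "(\<Sum>j\<in>{i..<n}. cost c (setv x j (st j)) + 4)
        = cost c (setv x i (st i)) + 4 + (\<Sum>j\<in>{Suc i..<n}. cost c (setv x j (st j)) + 4)"
      using step by (simp add: sum.atLeast_Suc_lessThan)
    ultimately show ?case using r' by (intro exI[of _ r']) (simp add: numeral_eq_Suc)
  qed
  have "regs r2 (tmp h) = n" "regs r2 (tmp (h + 1)) = 0"
    "\<forall>h'<h. regs r2 (tmp h') = regs r (tmp h')" using 1 by (auto simp: r2_def n_def)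
  with loop[of 0 r2] s2 obtain r' where
    r': "exec W ?w r2 ((\<Sum>j\<in>{0..<n}. cost c (setv x j (st j)) + 4) + 1) r'" "simul r' (st n)"
    "\<forall>h'<h. regs r' (tmp h') = regs r (tmp h')" by (auto simp: st_def)
  have "exec W (comp (For x e c) h) r (cost (For x e c) s) r'"
    using exec_Seq[OF 1(2) exec_Seq[OF 2 r'(1)]]
    by (simp add: n_def st_def atLeast0LessThan add.commute add.left_commute)
  with r' show ?case by (auto simp: st_def n_def)
qed

end

section \<open>Edge density of minor-closed families\<close>

text \<open>Single steps only, and no closure under isomorphism. In this form the property passes to
  the cone families of the density proof, whose members must avoid the fixed apex.\<close>

definition graph_closed :: "ugraph set \<Rightarrow> bool" where
  "graph_closed F \<longleftrightarrow> (\<forall>G\<in>F. simple_graph G \<and> (\<forall>H. subgraph H G \<longrightarrow> H \<in> F) \<and>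
     (\<forall>u v. {u, v} \<in> edges G \<longrightarrow> contract G u v \<in> F))"

lemma isomorphic_refl: "isomorphic G G"
  unfolding isomorphic_def by (intro exI[of _ id]) (auto simp: bij_betw_def)

lemma subgraph_refl: "simple_graph G \<Longrightarrow> subgraph G G"
  by (simp add: subgraph_def)

lemma minor_closed_graph_closed:
  assumes "\<forall>G\<in>F. simple_graph G" "minor_closed F"
  shows "graph_closed F"
  unfolding graph_closed_def
proof (intro ballI conjI allI impI)
  fix G assume G: "G \<in> F"
  show "simple_graph G" using assms G by blast
  fix H assume "subgraph H G"
  then have "minor_of H G" unfolding minor_of_def using isomorphic_refl by blast
  then show "H \<in> F" using assms G by (auto simp: minor_closed_def)
next
  fix G u v assume G: "G \<in> F" and uv: "{u, v} \<in> edges G"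
  then have "subgraph G G" using assms subgraph_refl by blast
  moreover have "contracts_to\<^sup>*\<^sup>* G (contract G u v)" using uv by (intro r_into_rtranclp) (auto simp: contracts_to_def)
  ultimately have "minor_of (contract G u v) G"
    unfolding minor_of_def using isomorphic_refl by blast
  then show "contract G u v \<in> F" using assms G by (auto simp: minor_closed_def)
qed

lemma minor_closed_isomorphic:
  assumes "\<forall>G\<in>F. simple_graph G" "minor_closed F" "G \<in> F" "isomorphic G H"
  shows "H \<in> F"
proof -
  have "minor_of H G" unfolding minor_of_def
    using assms subgraph_refl[of G] by blast
  then show ?thesis using assms by (auto simp: minor_closed_def)
qed

section \<open>Mader's density bound\<close>

lemma finite_edges: "simple_graph G \<Longrightarrow> finite (edges G)"
  unfolding simple_graph_def by (rule finite_subset[of _ "Pow (verts G)"]) auto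

lemma edgeE:
  assumes "simple_graph G" "e \<in> edges G"
  obtains x y where "e = {x, y}" "x \<noteq> y" "x \<in> verts G" "y \<in> verts G"
  using assms unfolding simple_graph_def by (auto simp: card_2_iff)

definition cone :: "nat \<Rightarrow> ugraph \<Rightarrow> ugraph" where
  "cone w G = \<lparr>verts = insert w (verts G), edges = edges G \<union> {{w, x} | x. x \<in> verts G}\<rparr>"

lemma simple_cone: "simple_graph G \<Longrightarrow> w \<notin> verts G \<Longrightarrow> simple_graph (cone w G)"
  unfolding simple_graph_def cone_def by (auto simp: card_insert_if)

text \<open>The edges from \<open>w\<close> to \<open>u\<close> and to \<open>v\<close> fall
  together, and this is the only effect of the contraction on the added star.\<close>

lemma contract_cone:
  assumes "simple_graph G" "w \<notin> verts G" "{u, v} \<in> edges G"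
  shows "contract (cone w G) u v = cone w (contract G u v)"
proof -
  let ?r = "\<lambda>x. if x = v then u else x"
  have uv: "u \<in> verts G" "v \<in> verts G" "u \<noteq> v"
    using edgeE[OF assms(1,3)] by (auto simp: doubleton_eq_iff)
  have w: "w \<noteq> v" "w \<noteq> u" using uv assms by auto
  have "{e \<in> (`) ?r ` {{w, x} | x. x \<in> verts G}. card e = 2} = {{w, x} | x. x \<in> verts G - {v}}"
    (is "?L = ?R")
  proof (intro equalityI subsetI)
    fix e assume "e \<in> ?L"
    then obtain x where x: "x \<in> verts G" "e = {w, ?r x}" using w by auto
    then show "e \<in> ?R" using uv by auto
  next
    fix e assume "e \<in> ?R"
    then obtain x where x: "x \<in> verts G" "x \<noteq> v" "e = {w, x}" by auto
    then have "e = ?r ` {w, x}" "card e = 2" using w assms by (auto simp: card_insert_if)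
    with x show "e \<in> ?L" by blast
  qed
  then show ?thesis
    unfolding contract_def cone_def using w by (simp add: image_Un Collect_disj_eq conj_disj_distribR) blast
qed

text \<open>The graphs whose cone lies in a closed family form a closed family again; this is how a
  complete minor of a neighbourhood is extended by one vertex.\<close>

lemma graph_closed_cone:
  assumes "graph_closed F"
  shows "graph_closed {H. simple_graph H \<and> w \<notin> verts H \<and> cone w H \<in> F}"
  unfolding graph_closed_def
proof (intro ballI conjI allI impI)
  fix G assume "G \<in> {H. simple_graph H \<and> w \<notin> verts H \<and> cone w H \<in> F}"
  then have G: "simple_graph G" "w \<notin> verts G" "cone w G \<in> F" by auto
  show "simple_graph G" by fact
  show "H \<in> {H. simple_graph H \<and> w \<notin> verts H \<and> cone w H \<in> F}" if "subgraph H G" for H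
  proof -
    have H: "simple_graph H" "w \<notin> verts H" using that G by (auto simp: subgraph_def)
    then have "simple_graph (cone w H)" by (rule simple_cone)
    then have "subgraph (cone w H) (cone w G)"
      using that by (auto simp: subgraph_def cone_def)
    then show ?thesis using H G assms by (auto simp: graph_closed_def)
  qed
  show "contract G u v \<in> {H. simple_graph H \<and> w \<notin> verts H \<and> cone w H \<in> F}"
    if "{u, v} \<in> edges G" for u v
  proof -
    have uv: "u \<in> verts G" "v \<in> verts G" "u \<noteq> v"
      using edgeE[OF G(1) that] by (auto simp: doubleton_eq_iff)
    have "finite (verts G)" using G by (simp add: simple_graph_def)
    moreover have "(\<lambda>x. if x = v then u else x) ` e \<subseteq> verts G - {v}" if "e \<in> edges G" for e
      using G(1) that uv unfolding simple_graph_def by auto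
    ultimately have "simple_graph (contract G u v)"
      unfolding simple_graph_def contract_def by auto
    moreover have "{u, v} \<in> edges (cone w G)" using that by (simp add: cone_def)
    then have "contract (cone w G) u v \<in> F" using G assms by (auto simp: graph_closed_def)
    ultimately show ?thesis
      using contract_cone[OF G(1,2) that] G(2) by (simp add: contract_def)
  qed
qed

definition complete_graph :: "ugraph \<Rightarrow> bool" where
  "complete_graph G \<longleftrightarrow> simple_graph G \<and> (\<forall>x\<in>verts G. \<forall>y\<in>verts G. x \<noteq> y \<longrightarrow> {x, y} \<in> edges G)"

definition nbrs :: "ugraph \<Rightarrow> nat \<Rightarrow> nat set" where
  "nbrs G v = {x. {v, x} \<in> edges G}"

text \<open>A contraction loses the edge itself and, for every common neighbour \<open>x\<close>,
  one of the edges \<open>{u, x}\<close> and \<open>{v, x}\<close>. The set \<open>?A\<close> drops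
  \<open>{v, x}\<close>, and the renaming is injective on what remains.\<close>

lemma contract_edge_loss:
  assumes G: "simple_graph G" and uv: "{u, v} \<in> edges G"
  shows "card (edges G) \<le> card (edges (contract G u v)) + card (nbrs G u \<inter> nbrs G v) + 1"
proof -
  let ?r = "\<lambda>x. if x = v then u else x"
  let ?C = "{{v, x} | x. x \<in> nbrs G u \<inter> nbrs G v}"
  let ?A = "edges G - insert {u, v} ?C"
  have fin: "finite (edges G)" using G by (rule finite_edges)
  have ne: "u \<noteq> v" using edgeE[OF G uv] by (auto simp: doubleton_eq_iff)
  have finv: "finite (nbrs G u)"
    by (rule finite_subset[of _ "verts G"]) (use G in \<open>auto simp: nbrs_def simple_graph_def\<close>)
  have r2: "card (?r ` e) = 2" if "e \<in> ?A" for e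
  proof -
    have "e \<in> edges G" using that by blast
    then obtain x y where e: "e = {x, y}" "x \<noteq> y" using edgeE[OF G] by metis
    have "\<not> (x = u \<and> y = v)" "\<not> (x = v \<and> y = u)" using that e by blast+
    then have ne: "?r x \<noteq> ?r y" using e by auto
    have "?r ` e = {?r x, ?r y}" unfolding e(1) by (simp only: image_insert image_empty)
    moreover have "card {?r x, ?r y} = 2" by (rule card_2_iff[THEN iffD2]) (use ne in blast)
    ultimately show ?thesis by (simp only:)
  qed
  have inj: "inj_on ((`) ?r) ?A"
  proof (rule inj_onI)
    fix e f assume e: "e \<in> ?A" and f: "f \<in> ?A" and eq: "?r ` e = ?r ` f"
    \<comment> \<open>Two edges can be identified only as \<open>{u, p}\<close> and
      \<open>{v, p}\<close>; then \<open>p\<close> is a common neighbour and \<open>{v, p}\<close>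
      was removed from \<open>?A\<close>.\<close>
    have *: "\<not> ({v, p} \<in> ?A \<and> {u, p} \<in> ?A)" for p by (auto simp: nbrs_def)
    have form: "(?r ` e = e \<and> v \<notin> e) \<or> (\<exists>p. e = {v, p} \<and> ?r ` e = {u, p} \<and> p \<noteq> u)"
      if "e \<in> ?A" for e
    proof -
      have "e \<in> edges G" using that by blast
      then obtain x y where xy: "e = {x, y}" "x \<noteq> y" using edgeE[OF G] by metis
      consider "x = v" | "y = v" | "x \<noteq> v" "y \<noteq> v" by blast
      then show ?thesis
      proof cases
        case 1
        then have "e = {v, y}" "?r ` e = {u, y}" "y \<noteq> u" using xy that by (auto simp: insert_commute)
        then show ?thesis by blast
      next
        case 2
        then have "e = {v, x}" "?r ` e = {u, x}" "x \<noteq> u" using xy that by (auto simp: insert_commute)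
        then show ?thesis by blast
      next
        case 3
        then show ?thesis using xy by auto
      qed
    qed
    show "e = f"
      using form[OF e] form[OF f]
    proof (elim disjE conjE exE)
      fix p assume p: "?r ` e = e" "f = {v, p}" "?r ` f = {u, p}"
      have "e = {u, p}" using eq unfolding p(1,3) .
      then show "e = f" using *[of p] e f unfolding p(2) by blast
    next
      fix p assume p: "?r ` f = f" "e = {v, p}" "?r ` e = {u, p}"
      have "f = {u, p}" using eq unfolding p(1,3) by (rule sym)
      then show "e = f" using *[of p] e f unfolding p(2) by blast
    next
      fix p q assume "e = {v, p}" "?r ` e = {u, p}" "f = {v, q}" "?r ` f = {u, q}"
      then have "{u, p} = {u, q}" using eq by (simp only:)
      then have "p = q" by (auto simp: doubleton_eq_iff)
      then show "e = f" using \<open>e = {v, p}\<close> \<open>f = {v, q}\<close> by (simp only:)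
    qed (use eq in simp)
  qed
  have "?C = (\<lambda>x. {v, x}) ` (nbrs G u \<inter> nbrs G v)" by auto
  then have C: "card ?C \<le> card (nbrs G u \<inter> nbrs G v)" "finite ?C"
    using finv by (auto intro: card_image_le)
  have "card (edges G) \<le> card (?A \<union> insert {u, v} ?C)"
    by (rule card_mono) (use fin C in auto)
  also have "\<dots> \<le> card ?A + card (insert {u, v} ?C)" by (rule card_Un_le)
  finally have "card (edges G) \<le> card ?A + card (insert {u, v} ?C)" .
  moreover have "card (insert {u, v} ?C) \<le> card (nbrs G u \<inter> nbrs G v) + 1"
    using C by (simp add: card_insert_if)
  moreover have "card ?A \<le> card (edges (contract G u v))"
  proof -
    have "card ?A = card ((`) ?r ` ?A)" by (rule card_image[OF inj, symmetric])
    also have "\<dots> \<le> card (edges (contract G u v))"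
      by (rule card_mono) (use r2 fin in \<open>auto simp: contract_def\<close>)
    finally show ?thesis .
  qed
  ultimately show ?thesis by linarith
qed

lemma card_edges_contract_pos:
  assumes G: "simple_graph G" and uv: "{u, v} \<in> edges G"
  shows "card (verts (contract G u v)) + 1 = card (verts G)" "verts (contract G u v) \<noteq> {}"
proof -
  have "u \<in> verts G" "v \<in> verts G" "u \<noteq> v" "finite (verts G)"
    using edgeE[OF G uv] G by (auto simp: doubleton_eq_iff simple_graph_def)
  then show "card (verts (contract G u v)) + 1 = card (verts G)" "verts (contract G u v) \<noteq> {}"
    using card.remove[of "verts G" v] by (auto simp: contract_def)
qed

lemma induced_subgraph_subgraph:
  "simple_graph G \<Longrightarrow> S \<subseteq> verts G \<Longrightarrow> subgraph (induced_subgraph G S) G"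
  by (auto simp: subgraph_def induced_subgraph_def simple_graph_def finite_subset)

lemma sum_degrees:
  assumes "simple_graph G"
  shows "(\<Sum>v\<in>verts G. card (nbrs G v)) = 2 * card (edges G)"
proof -
  have fin: "finite (verts G)" "finite (edges G)"
    using assms finite_edges by (auto simp: simple_graph_def)
  have "card (nbrs G v) = card {e \<in> edges G. v \<in> e}" for v
  proof (rule bij_betw_same_card[of "\<lambda>x. {v, x}"])
    show "bij_betw (\<lambda>x. {v, x}) (nbrs G v) {e \<in> edges G. v \<in> e}"
      unfolding bij_betw_def
    proof
      show "inj_on (\<lambda>x. {v, x}) (nbrs G v)" by (auto simp: inj_on_def doubleton_eq_iff)
      show "(\<lambda>x. {v, x}) ` nbrs G v = {e \<in> edges G. v \<in> e}"
      proof (intro equalityI subsetI)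
        fix e assume "e \<in> {e \<in> edges G. v \<in> e}"
        then have e: "e \<in> edges G" "v \<in> e" by auto
        obtain x y where xy: "e = {x, y}" using edgeE[OF assms e(1)] by blast
        then have "e = {v, x} \<or> e = {v, y}" using e by auto
        then show "e \<in> (\<lambda>x. {v, x}) ` nbrs G v" using e by (auto simp: nbrs_def)
      qed (auto simp: nbrs_def)
    qed
  qed
  then have "(\<Sum>v\<in>verts G. card (nbrs G v)) = (\<Sum>v\<in>verts G. \<Sum>e\<in>edges G. if v \<in> e then 1 else 0)"
    using fin by (simp add: sum.If_cases Int_def conj_commute)
  also have "\<dots> = (\<Sum>e\<in>edges G. \<Sum>v\<in>verts G. if v \<in> e then 1 else 0)" by (rule sum.swap)
  also have "\<dots> = (\<Sum>e\<in>edges G. 2)"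
  proof (rule sum.cong)
    fix e assume e: "e \<in> edges G"
    then have "verts G \<inter> e = e" "card e = 2" using assms by (auto simp: simple_graph_def)
    then show "(\<Sum>v\<in>verts G. if v \<in> e then 1 else 0) = (2::nat)"
      using fin by (simp add: sum.If_cases Int_def[symmetric])
  qed simp
  finally show ?thesis by simp
qed

text \<open>In a minor-minimal dense graph every edge lies in many triangles, so the neighbourhood of any
  vertex is dense (Mader).\<close>

lemma dense_complete_minor:
  "graph_closed F \<Longrightarrow> G \<in> F \<Longrightarrow> verts G \<noteq> {} \<Longrightarrow> 2 ^ h * card (verts G) \<le> card (edges G) \<Longrightarrow>
    \<exists>K\<in>F. complete_graph K \<and> card (verts K) = h"
proof (induction h arbitrary: F G)
  case 0
  then have "subgraph \<lparr>verts = {}, edges = {}\<rparr> G" by (simp add: subgraph_def simple_graph_def)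
  then have "\<lparr>verts = {}, edges = {}\<rparr> \<in> F" using 0 by (auto simp: graph_closed_def)
  then show ?case by (intro bexI) (auto simp: complete_graph_def simple_graph_def)
next
  case (Suc h)
  define P where "P = (\<lambda>H :: ugraph. H \<in> F \<and> verts H \<noteq> {} \<and> 2 ^ Suc h * card (verts H) \<le> card (edges H))"
  define m :: "ugraph \<Rightarrow> nat" where "m = (\<lambda>H. card (verts H))"
  have "P G" using Suc.prems by (simp add: P_def)
  then obtain H where H: "P H" "\<And>K. P K \<Longrightarrow> m H \<le> m K"
    using ex_has_least_nat[of P G m] by auto
  have sH: "simple_graph H" using H(1) Suc.prems(1) by (auto simp: P_def graph_closed_def)
  have finv: "finite (verts H)" using sH by (simp add: simple_graph_def)
  \<comment> \<open>With fewer common neighbours, contracting \<open>{u, v}\<close> would cost at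
    most \<open>2 ^ Suc h\<close> edges and one vertex, so the smaller graph would still satisfy
    \<open>P\<close>, against minimality.\<close>
  have tri: "2 ^ Suc h \<le> card (nbrs H u \<inter> nbrs H v)" if uv: "{u, v} \<in> edges H" for u v
  proof (rule ccontr)
    assume "\<not> ?thesis"
    then have less: "card (nbrs H u \<inter> nbrs H v) + 1 \<le> 2 ^ Suc h" by simp
    let ?K = "contract H u v"
    have K: "card (verts ?K) + 1 = card (verts H)" "verts ?K \<noteq> {}"
      using card_edges_contract_pos[OF sH uv] by auto
    have "2 ^ Suc h * card (verts H) = 2 ^ Suc h * card (verts ?K) + 2 ^ Suc h"
      by (subst K(1)[symmetric]) (simp add: algebra_simps)
    then have "2 ^ Suc h * card (verts ?K) \<le> card (edges ?K)"
      using contract_edge_loss[OF sH uv] less H(1) by (simp add: P_def)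
    moreover have "?K \<in> F" using Suc.prems(1) H(1) uv by (auto simp: graph_closed_def P_def)
    ultimately have "m H \<le> m ?K" using K H(2) by (simp add: P_def)
    then show False using K by (simp add: m_def)
  qed
  have "card (verts H) \<noteq> 0" using H(1) finv by (simp add: P_def)
  then have "edges H \<noteq> {}" using H(1) by (auto simp: P_def)
  then obtain w x where wx: "{w, x} \<in> edges H" using edgeE[OF sH] by blast
  let ?N = "nbrs H w"
  define I where "I = induced_subgraph H ?N"
  have wN: "w \<notin> ?N" using edgeE[OF sH] by (auto simp: nbrs_def)
  have N: "?N \<subseteq> verts H" "x \<in> ?N" "w \<in> verts H"
    using sH wx by (auto simp: nbrs_def simple_graph_def)
  have sI: "simple_graph I"
    using induced_subgraph_subgraph[OF sH N(1)] by (simp add: I_def subgraph_def)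
  have "2 ^ Suc h \<le> card (nbrs I v)" if "v \<in> verts I" for v
  proof -
    have "nbrs I v = nbrs H w \<inter> nbrs H v"
      using that by (auto simp: I_def induced_subgraph_def nbrs_def)
    moreover have "{w, v} \<in> edges H" using that by (simp add: I_def induced_subgraph_def nbrs_def)
    ultimately show ?thesis using tri by simp
  qed
  \<comment> \<open>The degree sum counts every edge twice; this factor is paid for by the exponent
    dropping from \<open>Suc h\<close> to \<open>h\<close>.\<close>
  then have "(\<Sum>v\<in>verts I. 2 ^ Suc h) \<le> (\<Sum>v\<in>verts I. card (nbrs I v))" by (intro sum_mono)
  then have "2 ^ h * card (verts I) \<le> card (edges I)"
    using sum_degrees[OF sI] by (simp add: mult.commute)
  moreover have "verts I \<noteq> {}" using N by (auto simp: I_def induced_subgraph_def)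
  moreover have "subgraph (cone w I) H"
    using simple_cone[OF sI, of w] wN N
    by (auto simp: subgraph_def cone_def I_def induced_subgraph_def nbrs_def)
  then have "cone w I \<in> F" using Suc.prems(1) H(1) by (auto simp: P_def graph_closed_def)
  then have "I \<in> {K. simple_graph K \<and> w \<notin> verts K \<and> cone w K \<in> F}"
    using sI wN by (simp add: I_def induced_subgraph_def)
  ultimately obtain K where K: "K \<in> {K. simple_graph K \<and> w \<notin> verts K \<and> cone w K \<in> F}"
    "complete_graph K" "card (verts K) = h"
    using Suc.IH[OF graph_closed_cone[OF Suc.prems(1)], of I w] by blast
  have "complete_graph (cone w K)"
    using K simple_cone[of K w] by (auto simp: complete_graph_def cone_def insert_commute)
  moreover have "card (verts (cone w K)) = Suc h"
    using K by (auto simp: cone_def simple_graph_def)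
  ultimately show ?case using K by blast
qed

text \<open>The constant is \<open>2 ^ card (verts G0)\<close> for an omitted graph
  \<open>G0\<close>: a denser member would have a complete minor on as many vertices as
  \<open>G0\<close>, and this minor contains a copy of \<open>G0\<close>.\<close>

theorem minor_closed_density:
  assumes "\<forall>G\<in>F. simple_graph G" "minor_closed F" "nontrivial_family F"
  obtains d where "d \<ge> 1" "\<And>G. G \<in> F \<Longrightarrow> card (edges G) \<le> d * card (verts G)"
proof -
  from assms(3) obtain G0 where G0: "simple_graph G0" "G0 \<notin> F" by (auto simp: nontrivial_family_def)
  let ?h = "card (verts G0)"
  have cl: "graph_closed F" using assms minor_closed_graph_closed by blast
  have "card (edges G) \<le> 2 ^ ?h * card (verts G)" if G: "G \<in> F" for G
  proof (rule ccontr)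
    assume *: "\<not> ?thesis"
    have "verts G \<noteq> {}"
    proof
      assume "verts G = {}"
      then have "edges G = {}" using G assms(1) edgeE[of G] by blast
      then show False using * by simp
    qed
    then obtain K where K: "K \<in> F" "complete_graph K" "card (verts K) = ?h"
      using dense_complete_minor[OF cl G, of ?h] * by auto
    have fin: "finite (verts K)" "finite (verts G0)"
      using K G0 by (auto simp: complete_graph_def simple_graph_def)
    then obtain f where f: "bij_betw f (verts G0) (verts K)"
      using K(3) by (metis finite_same_card_bij)
    define g where "g = inv_into (verts G0) f"
    have g: "bij_betw g (verts K) (verts G0)" using f by (simp add: g_def bij_betw_inv_into)
    define H where "H = \<lparr>verts = verts K, edges = (\<lambda>e. f ` e) ` edges G0\<rparr>"
    have fe: "f ` e \<in> edges K \<and> card (f ` e) = 2 \<and> f ` e \<subseteq> verts K" if e: "e \<in> edges G0" for e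
    proof -
      obtain x y where xy: "e = {x, y}" "x \<noteq> y" "x \<in> verts G0" "y \<in> verts G0"
        using edgeE[OF G0(1) e] .
      then have "f x \<noteq> f y" "f x \<in> verts K" "f y \<in> verts K"
        using f by (auto simp: bij_betw_def inj_on_def)
      then show ?thesis using K(2) xy by (auto simp: complete_graph_def)
    qed
    have "subgraph H K" using fe fin by (auto simp: subgraph_def H_def simple_graph_def)
    then have "H \<in> F" using cl K by (auto simp: graph_closed_def)
    moreover have "isomorphic H G0"
      unfolding isomorphic_def
    proof (intro exI conjI)
      show "bij_betw g (verts H) (verts G0)" using g by (simp add: H_def)
      have "g ` f ` e = e" if "e \<in> edges G0" for e
      proof -
        have "e \<subseteq> verts G0" using that G0 by (simp add: simple_graph_def)
        then show ?thesis using f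
          by (metis bij_betw_imp_inj_on g_def inv_into_image_cancel)
      qed
      then have "(\<lambda>e. g ` e) ` edges H = edges G0" by (force simp: H_def image_image)
      then show "edges G0 = (\<lambda>e. g ` e) ` edges H" by simp
    qed
    ultimately show False using minor_closed_isomorphic assms G0 by blast
  qed
  then show ?thesis by (intro that[of "2 ^ ?h"]) auto
qed

text \<open>The leaves are contracted one at a time. As no centre lies in \<open>B\<close>,
  contracting \<open>b\<close> into \<open>g b\<close> moves neither another leaf nor a centre, and
  the star edges of the remaining leaves stay.\<close>

lemma contract_stars:
  assumes cl: "graph_closed F" and "finite B"
  shows "G \<in> F \<Longrightarrow> B \<subseteq> verts G \<Longrightarrow> (\<And>b. b \<in> B \<Longrightarrow> g b \<notin> B \<and> {b, g b} \<in> edges G) \<Longrightarrow>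
    \<lparr>verts = verts G - B, edges = {e \<in> (\<lambda>e. (\<lambda>x. if x \<in> B then g x else x) ` e) ` edges G. card e = 2}\<rparr> \<in> F"
  using assms(2)
proof (induction B arbitrary: G rule: finite_induct)
  case empty
  have "{e \<in> edges G. card e = 2} = edges G"
    using empty cl by (auto simp: graph_closed_def simple_graph_def)
  then show ?case using empty.prems(1) by (cases G) simp
next
  case (insert b B)
  let ?H = "contract G (g b) b"
  have sG: "simple_graph G" using insert.prems cl by (simp add: graph_closed_def)
  have gb: "g b \<notin> B" "g b \<noteq> b" "{g b, b} \<in> edges G"
    using insert.prems(3)[of b] by (auto simp: insert_commute)
  then have H: "?H \<in> F" using insert.prems(1) cl by (simp add: graph_closed_def)
  moreover have "B \<subseteq> verts ?H" using insert by (auto simp: contract_def)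
  moreover have "g b' \<notin> B \<and> {b', g b'} \<in> edges ?H" if b': "b' \<in> B" for b'
  proof
    show "g b' \<notin> B" using insert.prems(3)[of b'] b' by auto
    have "g b' \<noteq> b" "b' \<noteq> b" "{b', g b'} \<in> edges G" "g b' \<noteq> b'"
      using insert.prems(3)[of b'] b' insert.hyps by auto
    then show "{b', g b'} \<in> edges ?H"
      by (auto simp: contract_def intro!: image_eqI[of _ _ "{b', g b'}"])
  qed
  ultimately have "\<lparr>verts = verts ?H - B,
      edges = {e \<in> (\<lambda>e. (\<lambda>x. if x \<in> B then g x else x) ` e) ` edges ?H. card e = 2}\<rparr> \<in> F"
    by (rule insert.IH)
  moreover have "verts ?H - B = verts G - insert b B" by (auto simp: contract_def)
  moreover have "{e \<in> (\<lambda>e. (\<lambda>x. if x \<in> B then g x else x) ` e) ` edges ?H. card e = 2} =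
      {e \<in> (\<lambda>e. (\<lambda>x. if x \<in> insert b B then g x else x) ` e) ` edges G. card e = 2}" (is "?L = ?R")
  proof -
    let ?h = "\<lambda>x. if x \<in> B then g x else x" and ?c = "\<lambda>x. if x = b then g b else x"
      and ?k = "\<lambda>x. if x \<in> insert b B then g x else x"
    have comp: "?h ` ?c ` e = ?k ` e" for e
      unfolding image_image by (rule image_cong) (use gb insert.hyps in auto)
    \<comment> \<open>Loops may be discarded once at the end: an edge collapsed by the first
      contraction cannot regain two ends later.\<close>
    have two: "card (?c ` e) = 2" if e: "e \<in> edges G" "card (?h ` ?c ` e) = 2" for e
    proof -
      have "card e = 2" using sG e(1) by (simp add: simple_graph_def)
      then have fin: "finite e" by (metis card.infinite zero_neq_numeral)
      have "card (?h ` ?c ` e) \<le> card (?c ` e)" using fin by (intro card_image_le finite_imageI)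
      moreover have "card (?c ` e) \<le> card e" using fin by (intro card_image_le)
      ultimately show ?thesis using e(2) \<open>card e = 2\<close> by linarith
    qed
    have "?L = {e. \<exists>e'\<in>edges G. e = ?h ` ?c ` e' \<and> card e = 2 \<and> card (?c ` e') = 2}"
      by (auto simp: contract_def)
    also have "\<dots> = {e. \<exists>e'\<in>edges G. e = ?h ` ?c ` e' \<and> card e = 2}"
      using two by blast
    also have "\<dots> = ?R" unfolding comp by auto
    finally show ?thesis .
  qed
  ultimately show ?case by simp
qed

section \<open>Total correctness of bounded-loop programs\<close>

definition frame :: "('v, 'a) prog \<Rightarrow> ('v, 'a) st \<Rightarrow> ('v, 'a) st \<Rightarrow> bool" where
  "frame c s s' \<longleftrightarrow> (\<forall>x. x \<notin> mvars c \<longrightarrow> vr s' x = vr s x) \<and>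
     (\<forall>a. a \<notin> marrs c \<longrightarrow> ar s' a = ar s a) \<and> inp s' = inp s"

lemma frame_ev: "frame c s (ev c s)"
  by (simp add: frame_def ev_frame_var ev_frame_arr)

text \<open>Total correctness from one start state. Termination is automatic; what remains is that
  all stored values stay below the bound and that \<open>Q\<close> holds of the exact cost and the
  final state. Boundedness of the start state is a premise inside the definition, so it is never
  threaded through the rules by hand.\<close>

definition trq :: "nat \<Rightarrow> ('v, 'a) prog \<Rightarrow> ('v, 'a) st \<Rightarrow> (nat \<Rightarrow> ('v, 'a) st \<Rightarrow> bool) \<Rightarrow> bool" where
  "trq b c s Q \<longleftrightarrow> (bdd b s \<longrightarrow> ok b c s \<and> Q (cost c s) (ev c s))"

definition tri :: "nat \<Rightarrow> ('v, 'a) prog \<Rightarrow> ('v, 'a) st \<Rightarrow> nat \<Rightarrow> (('v, 'a) st \<Rightarrow> bool) \<Rightarrow> bool" where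
  "tri b c s T Q \<longleftrightarrow> trq b c s (\<lambda>t s'. t \<le> T \<and> Q s')"

lemma trq_conseq:
  assumes "trq b c s Q"
    and "\<And>t s'. bdd b s \<Longrightarrow> bdd b s' \<Longrightarrow> frame c s s' \<Longrightarrow> Q t s' \<Longrightarrow> Q' t s'"
  shows "trq b c s Q'"
  using assms frame_ev ok_bdd unfolding trq_def by blast

lemma tri_conseq:
  assumes "tri b c s T Q" "T \<le> T'"
    and "\<And>s'. bdd b s \<Longrightarrow> bdd b s' \<Longrightarrow> frame c s s' \<Longrightarrow> Q s' \<Longrightarrow> Q' s'"
  shows "tri b c s T' Q'"
  unfolding tri_def by (rule trq_conseq[OF assms(1)[unfolded tri_def]]) (use assms in auto)

lemma tri_Sq:
  assumes "tri b c1 s T1 R" and "\<And>s'. bdd b s' \<Longrightarrow> frame c1 s s' \<Longrightarrow> R s' \<Longrightarrow> tri b c2 s' T2 Q"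
  shows "tri b (c1 ;; c2) s (T1 + T2) Q"
  unfolding trq_def tri_def
proof
  assume b: "bdd b s"
  with assms(1) have 1: "ok b c1 s" "cost c1 s \<le> T1" "R (ev c1 s)" by (auto simp: trq_def tri_def)
  then have b1: "bdd b (ev c1 s)" using ok_bdd b by blast
  from assms(2)[OF b1 frame_ev 1(3)] b1 1
  show "ok b (c1 ;; c2) s \<and> cost (c1 ;; c2) s \<le> T1 + T2 \<and> Q (ev (c1 ;; c2) s)"
    by (auto simp: trq_def tri_def)
qed

text \<open>Amortised analysis: an iteration may cost \<open>B\<close> plus the drop of the
  potential \<open>\<phi>\<close>, and the drops telescope to at most \<open>\<phi> 0 s\<close>. The
  summand \<open>4\<close> is the overhead of the loop per iteration.\<close>

lemma trq_For:
  assumes e: "aval e s = n" "n \<le> b"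
    and I0: "I 0 s"
    and step: "\<And>i s'. i < n \<Longrightarrow> bdd b s' \<Longrightarrow> frame (For x e c) s s' \<Longrightarrow> I i s' \<Longrightarrow>
      trq b c (setv x i s') (\<lambda>t s''. t + 4 + \<phi> (Suc i) s'' \<le> B + \<phi> i s' \<and> I (Suc i) s'')"
  shows "tri b (For x e c) s (ecost e + 2 + n * B + \<phi> 0 s) (I n)"
  unfolding trq_def tri_def
proof
  assume b: "bdd b s"
  define st where "st = (\<lambda>i. iter (\<lambda>i s. ev c (setv x i s)) i s)"
  have fr: "frame (For x e c) s (st i)" for i
  proof (induction i)
    case (Suc i)
    then show ?case by (auto simp: frame_def st_def ev_frame_var ev_frame_arr)
  qed (simp add: st_def frame_def)
  have "i \<le> n \<Longrightarrow> bdd b (st i) \<and> I i (st i) \<and> (\<forall>j<i. ok b c (setv x j (st j))) \<and>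
      (\<Sum>j<i. cost c (setv x j (st j)) + 4) + \<phi> i (st i) \<le> i * B + \<phi> 0 s" for i
  proof (induction i)
    case 0
    then show ?case using b I0 by (simp add: st_def)
  next
    case (Suc i)
    then have IH: "bdd b (st i)" "I i (st i)" "\<forall>j<i. ok b c (setv x j (st j))"
      "(\<Sum>j<i. cost c (setv x j (st j)) + 4) + \<phi> i (st i) \<le> i * B + \<phi> 0 s" by auto
    have "bdd b (setv x i (st i))" using IH Suc.prems e by simp
    with step[OF _ IH(1) fr IH(2)] Suc.prems
    have *: "ok b c (setv x i (st i))" "I (Suc i) (ev c (setv x i (st i)))"
      "cost c (setv x i (st i)) + 4 + \<phi> (Suc i) (ev c (setv x i (st i))) \<le> B + \<phi> i (st i)"
      by (auto simp: trq_def)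
    moreover have "st (Suc i) = ev c (setv x i (st i))" by (simp add: st_def)
    moreover have "bdd b (ev c (setv x i (st i)))"
      using * ok_bdd \<open>bdd b (setv x i (st i))\<close> by blast
    ultimately show ?case using IH by (auto simp: less_Suc_eq)
  qed
  from this[of n] show "ok b (For x e c) s \<and> cost (For x e c) s \<le> ecost e + 2 + n * B + \<phi> 0 s \<and>
      I n (ev (For x e c) s)"
    using e by (auto simp: st_def)
qed

lemma tri_For:
  assumes e: "aval e s = n" "n \<le> b"
    and I0: "I 0 s"
    and step: "\<And>i s'. i < n \<Longrightarrow> bdd b s' \<Longrightarrow> frame (For x e c) s s' \<Longrightarrow> I i s' \<Longrightarrow>
      tri b c (setv x i s') B (I (Suc i))"
  shows "tri b (For x e c) s (ecost e + 2 + n * (B + 4)) (I n)"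
  using trq_For[where \<phi> = "\<lambda>_ _. 0" and B = "B + 4" and I = I, OF e I0 ] step
  by (auto simp: trq_def tri_def)

text \<open>A bound that does not depend on the state, meant for loop-free code; the value for
  \<open>For\<close> is a dummy that \<open>straight\<close> excludes.\<close>

primrec scost :: "('v, 'a) prog \<Rightarrow> nat" where
  "scost Nop = 1"
| "scost (Asg x e) = ecost e + 1"
| "scost (Put a i e) = ecost i + ecost e + 6"
| "scost (Get x e) = ecost e + 1"
| "scost (c1 ;; c2) = scost c1 + scost c2"
| "scost (Cond e c1 c2) = ecost e + 2 + max (scost c1) (scost c2)"
| "scost (For x e c) = 0"

primrec straight :: "('v, 'a) prog \<Rightarrow> bool" where
  "straight Nop = True"
| "straight (Asg x e) = True"
| "straight (Put a i e) = True"
| "straight (Get x e) = True"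
| "straight (c1 ;; c2) = (straight c1 \<and> straight c2)"
| "straight (Cond e c1 c2) = (straight c1 \<and> straight c2)"
| "straight (For x e c) = False"

lemma straight_cost: "straight c \<Longrightarrow> cost c s \<le> scost c"
proof (induction c arbitrary: s)
  case (Sq c1 c2)
  then show ?case by (auto intro: add_mono)
next
  case (Cond e c1 c2)
  then have "cost c1 s \<le> scost c1" "cost c2 s \<le> scost c2" by auto
  then show ?case by auto
qed auto

lemma tri_straight:
  assumes "straight c" "bdd b s \<Longrightarrow> ok b c s \<and> Q (ev c s)"
  shows "tri b c s (scost c) Q"
  using assms straight_cost by (auto simp: trq_def tri_def)

lemma tri_For_straight:
  assumes "aval e s = n" "n \<le> b" "straight c"
    and "I 0 s"
    and "\<And>i s'. i < n \<Longrightarrow> bdd b s' \<Longrightarrow> frame (For x e c) s s' \<Longrightarrow> I i s' \<Longrightarrow>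
      ok b c (setv x i s') \<and> I (Suc i) (ev c (setv x i s'))"
  shows "tri b (For x e c) s (ecost e + 2 + n * (scost c + 4)) (I n)"
  by (rule tri_For) (use assms in \<open>auto intro!: tri_straight\<close>)

text \<open>Subtraction is truncated, so the inner sum is the distance of the two values and the
  result is \<open>1\<close> for equal values and \<open>0\<close> otherwise. As any positive value
  counts as true, \<open>Ls\<close> is a plain difference.\<close>

abbreviation Eq :: "('v, 'a) aexp \<Rightarrow> ('v, 'a) aexp \<Rightarrow> ('v, 'a) aexp" where
  "Eq e1 e2 \<equiv> Mi (N 1) (Pl (Mi e1 e2) (Mi e2 e1))"

abbreviation Ls :: "('v, 'a) aexp \<Rightarrow> ('v, 'a) aexp \<Rightarrow> ('v, 'a) aexp" where
  "Ls e1 e2 \<equiv> Mi e2 e1"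

abbreviation Md :: "('v, 'a) aexp \<Rightarrow> ('v, 'a) aexp \<Rightarrow> ('v, 'a) aexp" where
  "Md e1 e2 \<equiv> Mi e1 (Ti (Dv e1 e2) e2)"

lemma mod_expr [simp]: "a - a div b * b = a mod (b::nat)"
  by (simp add: minus_div_mult_eq_mod)

section \<open>Programs on the word RAM\<close>

text \<open>The base \<open>n + 2\<close> is that of the word bound of the machine. It is at least
  \<open>2\<close>, so constants are absorbed for every \<open>n\<close>, including
  \<open>0\<close>.\<close>

definition poly_bd :: "(nat \<Rightarrow> nat) \<Rightarrow> bool" where
  "poly_bd f \<longleftrightarrow> (\<exists>c. \<forall>n. f n \<le> (n + 2) ^ c)"

lemma poly_bd_const: "poly_bd (\<lambda>n. a)"
proof -
  have "a \<le> (n + 2) ^ a" for n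
    by (rule order_trans[OF less_imp_le[OF less_exp] power_mono]) auto
  then show ?thesis unfolding poly_bd_def by blast
qed

lemma poly_bd_add: "poly_bd f \<Longrightarrow> poly_bd g \<Longrightarrow> poly_bd (\<lambda>n. f n + g n)"
proof -
  assume "poly_bd f" "poly_bd g"
  then obtain c d where c: "\<And>n. f n \<le> (n + 2) ^ c" and d: "\<And>n. g n \<le> (n + 2) ^ d"
    by (auto simp: poly_bd_def)
  have "f n + g n \<le> (n + 2) ^ (c + d + 1)" for n
  proof -
    have "f n \<le> (n + 2) ^ (c + d)" using c[of n] by (rule order_trans) (auto intro: power_increasing)
    moreover have "g n \<le> (n + 2) ^ (c + d)" using d[of n] by (rule order_trans) (auto intro: power_increasing)
    ultimately have "f n + g n \<le> 2 * (n + 2) ^ (c + d)" by simp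
    also have "\<dots> \<le> (n + 2) * (n + 2) ^ (c + d)" by (rule mult_right_mono) auto
    finally show ?thesis by simp
  qed
  then show ?thesis unfolding poly_bd_def by blast
qed

lemma poly_bd_mult: "poly_bd f \<Longrightarrow> poly_bd g \<Longrightarrow> poly_bd (\<lambda>n. f n * g n)"
proof -
  assume "poly_bd f" "poly_bd g"
  then obtain c d where c: "\<And>n. f n \<le> (n + 2) ^ c" and d: "\<And>n. g n \<le> (n + 2) ^ d"
    by (auto simp: poly_bd_def)
  have "f n * g n \<le> (n + 2) ^ (c + d)" for n
    unfolding power_add by (intro mult_mono c d) auto
  then show ?thesis unfolding poly_bd_def by blast
qed

lemma poly_bd_self: "poly_bd (\<lambda>n. n)"
  unfolding poly_bd_def by (intro exI[of _ 1]) auto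

lemma poly_bd_power: "poly_bd f \<Longrightarrow> poly_bd (\<lambda>n. f n ^ c)"
  by (induction c) (auto intro: poly_bd_mult poly_bd_const)

lemma poly_bd_eb: "poly_bd f \<Longrightarrow> poly_bd (\<lambda>n. eb ac C e (f n))"
proof (induction e)
  case (N c)
  then show ?case using poly_bd_const[of "c + 1"] by simp
next
  case (V x)
  then show ?case using poly_bd_add[OF V poly_bd_const[of 1]] by simp
next
  case (Ar a e)
  then show ?case
    using poly_bd_add[OF poly_bd_add[OF poly_bd_mult[OF Ar.IH poly_bd_const[of C]] Ar.IH]
      poly_bd_add[OF poly_bd_const[of "ac a + C + 1"] Ar.prems]] by (simp add: ac_simps)
qed (auto intro!: poly_bd_add poly_bd_mult)

lemma poly_bd_pb: "poly_bd f \<Longrightarrow> poly_bd (\<lambda>n. pb ac C c (f n))"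
proof (induction c)
  case Nop
  then show ?case using poly_bd_const[of 0] by simp
next
  case (Put a i e)
  then show ?case using poly_bd_add[OF poly_bd_eb[OF Put, of ac C "Ar a i"] poly_bd_eb[OF Put, of ac C e]]
    by simp
next
  case (For x e c)
  then show ?case
    using poly_bd_add[OF poly_bd_add[OF poly_bd_eb[OF For.prems, of ac C e] For.prems]
      poly_bd_add[OF poly_bd_const[of 1] For.IH[OF For.prems]]] by (simp add: ac_simps)
qed (auto intro!: poly_bd_add poly_bd_eb)

section \<open>From a bounded-loop program to a machine program with input and output\<close>

primrec outc :: "(nat \<Rightarrow> reg) \<Rightarrow> nat \<Rightarrow> com" where
  "outc f 0 = Skip"
| "outc f (Suc j) = Seq (outc f j) (Seq (Assign 3 (Const j)) (Store 3 (f j)))"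

lemma exec_outc:
  assumes "j < W" "\<And>i. f i \<noteq> 3"
  shows "\<exists>r'. exec W (outc f j) r (2 * j + 1) r' \<and> (\<forall>i. i \<noteq> 3 \<longrightarrow> regs r' i = regs r i) \<and>
    (\<forall>i<j. mem r' i = regs r (f i))"
  using assms(1)
proof (induction j)
  case 0
  then show ?case using exec_Skip by auto
next
  case (Suc j)
  then obtain r1 where 1: "exec W (outc f j) r (2 * j + 1) r1" "\<forall>i. i \<noteq> 3 \<longrightarrow> regs r1 i = regs r i"
    "\<forall>i<j. mem r1 i = regs r (f i)" by auto
  define r2 where "r2 = r1\<lparr>regs := (regs r1)(3 := j)\<rparr>"
  define r3 where "r3 = r2\<lparr>mem := (mem r2)(j := regs r2 (f j))\<rparr>"
  have 2: "exec W (Assign 3 (Const j)) r1 1 r2"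
    using exec_Assign[of "Const j" r1 W 3] Suc.prems by (simp add: r2_def)
  have 3: "exec W (Store 3 (f j)) r2 1 r3"
    using exec_Store[of W 3 "f j" r2] by (simp add: r3_def r2_def)
  show ?case
    using exec_Seq[OF 1(1) exec_Seq[OF 2 3]] 1 assms(2)
    by (intro exI[of _ r3]) (auto simp: r3_def r2_def less_Suc_eq)
qed

definition init_st :: "nat list list \<Rightarrow> ('v, 'a) st" where
  "init_st adj = \<lparr>vr = (\<lambda>_. 0), ar = (\<lambda>_ _. 0), inp = encode_adj adj\<rparr>"

lemma length_encode_adj: "length (encode_adj adj) = length adj + 2 + length (concat adj)"
  by (simp add: encode_adj_def Let_def)

lemma encode_adj_nth_0: "encode_adj adj ! 0 = length adj"
  by (simp add: encode_adj_def Let_def)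

lemma encode_adj_nth_start:
  "i \<le> length adj \<Longrightarrow> encode_adj adj ! (1 + i) = length adj + 2 + length (concat (take i adj))"
  unfolding encode_adj_def Let_def
  by (simp add: nth_append del: upt_Suc)

lemma concat_take_nth: "i < length xs \<Longrightarrow> j < length (xs ! i) \<Longrightarrow>
    concat xs ! (length (concat (take i xs)) + j) = xs ! i ! j"
  by (subst (1) id_take_nth_drop[of i xs]) (simp_all add: nth_append)

lemma encode_adj_nth_list:
  assumes "i < length adj" "j < length (adj ! i)"
  shows "encode_adj adj ! (length adj + 2 + length (concat (take i adj)) + j) = adj ! i ! j"
  unfolding encode_adj_def Let_def
  using concat_take_nth[OF assms] by (simp add: nth_append nth_Cons' del: upt_Suc)

lemma correct_output_cong:
  "(\<And>i. i \<le> k \<Longrightarrow> mem s i = mem s' i) \<Longrightarrow> correct_output k G vs s \<longleftrightarrow> correct_output k G vs s'"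
proof -
  assume *: "\<And>i. i \<le> k \<Longrightarrow> mem s i = mem s' i"
  then have "(\<lambda>i. vs ! mem s i) ` {1..k} = (\<lambda>i. vs ! mem s' i) ` {1..k}" by (intro image_cong) auto
  then show ?thesis using * by (auto simp: correct_output_def)
qed

lemma finite_arrs: "finite (arrs c)"
proof -
  have "finite (earrs e)" for e :: "('v, 'a) aexp" by (induction e) auto
  then show ?thesis by (induction c) auto
qed

text \<open>A prologue of four steps reads \<open>n\<close> from cell \<open>0\<close> and the
  length of the input from cell \<open>n + 1\<close>, which stores the end of the last list, and
  puts that length into register \<open>1\<close>, that is \<open>tmp 0\<close>. Writing the
  \<open>k + 1\<close> output cells takes \<open>2 * k + 3\<close> steps, hence the overhead
  \<open>2 * k + 7\<close>.\<close>

lemma ram_program: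
  fixes P :: "('v::countable, 'a::countable) prog" and out :: "nat \<Rightarrow> 'v"
  assumes P: "\<And>G vs adj. G \<in> F \<Longrightarrow> adjacency_lists G vs adj \<Longrightarrow>
      bdd ((card (verts G) + 2) ^ c0) (init_st adj :: ('v, 'a) st) \<and>
      tri ((card (verts G) + 2) ^ c0) P (init_st adj) (T (card (verts G)))
        (\<lambda>s. correct_output k G vs \<lparr>regs = (\<lambda>_. 0), mem = (\<lambda>i. vr s (out i))\<rparr>)"
  shows "\<exists>P'. finds_induced_cycles_in_time P' F k (\<lambda>n. T n + (2 * k + 7))"
proof -
  define C where "C = Suc (Max (insert 0 (to_nat ` arrs P)))"
  have fin: "finite (insert 0 (to_nat ` arrs P))" using finite_arrs by blast
  have C: "\<forall>a\<in>arrs P. to_nat a < C"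
    unfolding C_def using Max_ge[OF fin] by (auto simp: less_Suc_eq_le)
  interpret compiler "to_nat :: 'v \<Rightarrow> nat" "to_nat :: 'a \<Rightarrow> nat" C
    by unfold_locales (rule inj_to_nat)+
  define P' where "P' = Seq (Assign 3 (Load 3)) (Seq (Assign 5 (Const 1)) (Seq (Assign 3 (Add 3 5))
    (Seq (Assign 1 (Load 3)) (Seq (comp P 1) (outc (\<lambda>i. vreg (out i)) (Suc k))))))"
  \<comment> \<open>The extra summands make the word bound exceed \<open>b\<close> and the output
    addresses as well.\<close>
  have "poly_bd (\<lambda>n. pb to_nat C P ((n + 2) ^ c0) + ((n + 2) ^ c0 + (Suc (Suc k))))"
    by (intro poly_bd_add poly_bd_pb poly_bd_power poly_bd_self poly_bd_const)
  then obtain c where c: "\<And>n. pb to_nat C P ((n + 2) ^ c0) + ((n + 2) ^ c0 + Suc (Suc k)) \<le> (n + 2) ^ c"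
    by (auto simp: poly_bd_def)
  have "\<exists>t s. exec ((card (verts G) + 2) ^ c) P' (init_state adj) t s \<and>
      t \<le> T (card (verts G)) + (2 * k + 7) \<and> correct_output k G vs s"
    if G: "G \<in> F" and adj: "adjacency_lists G vs adj" for G vs adj
  proof -
    define n where "n = card (verts G)"
    define b where "b = (n + 2) ^ c0"
    define W where "W = (n + 2) ^ c"
    have W: "pb to_nat C P b < W" "b < W" "1 < W" "Suc k < W"
      using c[of n] unfolding W_def b_def by linarith+
    let ?s0 = "init_st adj :: ('v, 'a) st"
    have n: "length adj = n"
      using adj distinct_card[of vs] by (auto simp: adjacency_lists_def n_def)
    from P[OF G adj] have bdd: "bdd b ?s0" and
      P: "ok b P ?s0" "cost P ?s0 \<le> T n"
      "correct_output k G vs \<lparr>regs = (\<lambda>_. 0), mem = (\<lambda>i. vr (ev P ?s0) (out i))\<rparr>"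
      by (auto simp: trq_def tri_def b_def n_def)
    define z where "z = length (encode_adj adj)"
    have z: "z \<le> b" "n + 2 \<le> z"
      using bdd by (auto simp: bdd_def init_st_def z_def length_encode_adj n)
    define r0 where "r0 = init_state adj"
    define r1 where "r1 = r0\<lparr>regs := (regs r0)(3 := n)\<rparr>"
    define r2 where "r2 = r1\<lparr>regs := (regs r1)(5 := 1)\<rparr>"
    define r3 where "r3 = r2\<lparr>regs := (regs r2)(3 := n + 1)\<rparr>"
    define r4 where "r4 = r3\<lparr>regs := (regs r3)(1 := z)\<rparr>"
    have mem: "mem r4 = mem r0" "mem r3 = mem r0" by (simp_all add: r4_def r3_def r2_def r1_def)
    have m0: "mem r0 0 = n" "mem r0 (n + 1) = z"
      using encode_adj_nth_start[of "length adj" adj]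
      by (auto simp: r0_def init_state_def encode_adj_nth_0 length_encode_adj n z_def)
    have 1: "exec W (Assign 3 (Load 3)) r0 1 r1"
      using exec_Assign[of "Load 3" r0 W 3] m0 z W by (simp add: r1_def r0_def init_state_def)
    have 2: "exec W (Assign 5 (Const 1)) r1 1 r2"
      using exec_Assign[of "Const 1" r1 W 5] W by (simp add: r2_def)
    have 3: "exec W (Assign 3 (Add 3 5)) r2 1 r3"
      using exec_Assign[of "Add 3 5" r2 W 3] z W by (simp add: r3_def r2_def r1_def)
    have 4: "exec W (Assign 1 (Load 3)) r3 1 r4"
      using exec_Assign[of "Load 3" r3 W 1] z W m0 mem by (simp add: r4_def) (simp add: r3_def)
    have r4: "regs r4 = (\<lambda>_. 0)(3 := n + 1, 5 := 1, 1 := z)"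
      by (auto simp: r4_def r3_def r2_def r1_def r0_def init_state_def)
    have "simul r4 ?s0"
      unfolding simul_def
    proof (intro conjI allI impI)
      fix x :: 'v
      have "vreg x \<noteq> 3" "vreg x \<noteq> 5" "vreg x \<noteq> 1" unfolding vreg_def by presburger+
      then show "regs r4 (vreg x) = vr ?s0 x" by (simp add: r4 init_st_def)
    next
      show "regs r4 (tmp 0) = length (inp ?s0)" by (simp add: r4 tmp_def init_st_def z_def)
    next
      fix a :: 'a and i
      show "mem r4 (length (inp ?s0) + i * C + to_nat a) = ar ?s0 a i"
        by (simp add: mem r0_def init_state_def init_st_def)
    next
      fix p assume "p < length (inp ?s0)"
      then show "mem r4 p = inp ?s0 ! p" by (simp add: mem r0_def init_state_def init_st_def)
    qed
    from comp_sim[OF P(1) bdd this W(1) _ C] obtain r5 where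
      5: "exec W (comp P 1) r4 (cost P ?s0) r5" "simul r5 (ev P ?s0)" by auto
    have "vreg (out i) \<noteq> 3" for i unfolding vreg_def by presburger
    with exec_outc[OF W(4), of "\<lambda>i. vreg (out i)" r5] obtain r6 where
      6: "exec W (outc (\<lambda>i. vreg (out i)) (Suc k)) r5 (2 * Suc k + 1) r6"
      "\<forall>i<Suc k. mem r6 i = regs r5 (vreg (out i))" by blast
    have "correct_output k G vs r6 \<longleftrightarrow>
        correct_output k G vs \<lparr>regs = (\<lambda>_. 0), mem = (\<lambda>i. vr (ev P ?s0) (out i))\<rparr>"
      by (rule correct_output_cong) (use 5 6 in \<open>auto simp: simul_def\<close>)
    moreover have "exec W P' r0 (cost P ?s0 + (2 * k + 7)) r6"
      using exec_Seq[OF 1 exec_Seq[OF 2 exec_Seq[OF 3 exec_Seq[OF 4 exec_Seq[OF 5(1) 6(1)]]]]]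
      by (simp add: P'_def numeral_eq_Suc)
    ultimately show ?thesis using P unfolding W_def r0_def n_def
      by (intro exI[of _ "cost P ?s0 + (2 * k + 7)"] exI[of _ r6]) auto
  qed
  then show ?thesis unfolding finds_induced_cycles_in_time_def by blast
qed

section \<open>A small family of hash functions\<close>

definition agree :: "(nat \<Rightarrow> nat) list \<Rightarrow> nat \<Rightarrow> nat \<Rightarrow> nat" where
  "agree hs x y = length (filter (\<lambda>h. h x = h y) hs)"

text \<open>The potential of the method of conditional expectations: \<open>2 ^ agree\<close> is large for the pairs on which
  too many of the hash functions chosen so far collide, and the greedily chosen next function multiplies
  the total by at most \<open>1 + 1 / q\<close>.\<close>

definition pot :: "(nat \<Rightarrow> nat) list \<Rightarrow> nat \<Rightarrow> nat" where
  "pot hs M = (\<Sum>x<M. \<Sum>y<x. 2 ^ agree hs x y)"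

lemma pot_Nil: "pot [] M \<le> M * M"
proof -
  have "pot [] M = (\<Sum>x<M. x)" by (simp add: pot_def agree_def)
  also have "\<dots> \<le> (\<Sum>x<M. M)" by (rule sum_mono) auto
  finally show ?thesis by simp
qed

lemma agree_append: "agree (hs @ [h]) x y = agree hs x y + (if h x = h y then 1 else 0)"
  by (simp add: agree_def)

text \<open>A term doubles exactly when \<open>h\<close> collides on its pair, so the increase is
  the old potential of the colliding pairs.\<close>

lemma pot_append:
  "pot (hs @ [h]) M = pot hs M + (\<Sum>x<M. \<Sum>y<x. if h y = h x then 2 ^ agree hs x y else 0)"
  unfolding pot_def sum.distrib[symmetric]
  by (intro sum.cong refl) (auto simp: agree_append)

lemma pot_step:
  assumes "q \<ge> 1" "real (pot hs M) \<le> (1 + 1 / real q) ^ t * (M * M)"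
    and "q * (\<Sum>x<M. \<Sum>y<x. if h y = h x then 2 ^ agree hs x y else 0) \<le> pot hs M"
  shows "real (pot (hs @ [h]) M) \<le> (1 + 1 / real q) ^ Suc t * (M * M)"
proof -
  let ?S = "\<Sum>x<M. \<Sum>y<x. if h y = h x then 2 ^ agree hs x y else 0 :: nat"
  have "real q * real ?S \<le> real (pot hs M)"
    using assms(3) unfolding of_nat_mult[symmetric] of_nat_le_iff .
  then have "real ?S \<le> real (pot hs M) / real q"
    using assms(1) by (simp add: pos_le_divide_eq mult.commute)
  then have "real (pot (hs @ [h]) M) \<le> (1 + 1 / real q) * real (pot hs M)"
    unfolding pot_append of_nat_add by (simp add: algebra_simps)
  also have "\<dots> \<le> (1 + 1 / real q) * ((1 + 1 / real q) ^ t * (M * M))"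
    by (rule mult_left_mono) (use assms in auto)
  finally show ?thesis by simp
qed

text \<open>By \<open>1 + x \<le> exp x\<close> the \<open>q\<close>-th power is at most
  \<open>exp 1\<close>; rounding this up to \<open>4\<close> keeps the bound a power of two.\<close>

lemma growth_bound:
  assumes "q \<ge> 1" "t \<le> q * (l + 1)"
  shows "(1 + 1 / real q) ^ t \<le> 4 ^ (l + 1)"
proof -
  have "(1 + 1 / real q) ^ t \<le> (1 + 1 / real q) ^ (q * (l + 1))"
    by (rule power_increasing) (use assms in auto)
  also have "\<dots> = ((1 + 1 / real q) ^ q) ^ (l + 1)" by (simp only: power_mult)
  also have "\<dots> \<le> 4 ^ (l + 1)"
  proof (rule power_mono)
    have "(1 + 1 / real q) ^ q \<le> exp (1 / real q) ^ q" by (rule power_mono) (auto intro: exp_ge_add_one_self)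
    also have "\<dots> = exp 1" using assms(1) by (simp add: exp_of_nat_mult[symmetric])
    also have "\<dots> \<le> 4" using exp_le by simp
    finally show "(1 + 1 / real q) ^ q \<le> 4" .
  qed auto
  finally show ?thesis .
qed

text \<open>The exponent consists of \<open>2 * (l + 1)\<close> for the growth over at most
  \<open>q * (l + 1)\<close> functions and \<open>l + 2\<close> for the initial
  \<open>M * M\<close>.\<close>

lemma pot_bound:
  assumes "q \<ge> 1" "t \<le> q * (l + 1)" "M * M \<le> 2 ^ (l + 2)"
    and "real (pot hs M) \<le> (1 + 1 / real q) ^ t * (M * M)"
  shows "pot hs M \<le> 2 ^ (3 * l + 4)"
proof -
  have "real (M * M) \<le> real (2 ^ (l + 2))" using assms(3) unfolding of_nat_le_iff .
  then have "real (pot hs M) \<le> 4 ^ (l + 1) * 2 ^ (l + 2)"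
    by (intro order_trans[OF assms(4)] mult_mono growth_bound assms) auto
  also have "(4::real) ^ (l + 1) = 2 ^ (2 * (l + 1))" unfolding power_mult by simp
  also have "(2::real) ^ (2 * (l + 1)) * 2 ^ (l + 2) = 2 ^ (3 * l + 4)"
    unfolding power_add[symmetric] by (rule arg_cong[of _ _ "power 2"]) simp
  also have "\<dots> = real (2 ^ (3 * l + 4))" by simp
  finally show ?thesis unfolding of_nat_le_iff .
qed

text \<open>A single term \<open>2 ^ agree\<close> is at most the whole potential; its exponent
  \<open>3 * l + 4\<close> is rounded up to \<open>4 * (l + 1)\<close>.\<close>

lemma agree_bound:
  assumes "pot hs M \<le> 2 ^ (3 * l + 4)" "x < M" "y < M" "x \<noteq> y"
  shows "agree hs x y \<le> 4 * (l + 1)"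
proof -
  have *: "agree hs x y \<le> 4 * (l + 1)" if "x < M" "y < x" for x y
  proof -
    have "2 ^ agree hs x y \<le> (\<Sum>y<x. 2 ^ agree hs x y :: nat)"
      by (rule member_le_sum) (use that in auto)
    also have "\<dots> \<le> pot hs M"
      unfolding pot_def by (rule member_le_sum[where f = "\<lambda>x. \<Sum>y<x. 2 ^ agree hs x y"]) (use that in auto)
    also note assms(1)
    finally show ?thesis by simp
  qed
  have "agree hs x y = agree hs y x" unfolding agree_def by (rule arg_cong[of _ _ length]) (auto intro: filter_cong)
  then show ?thesis using assms *[of x y] *[of y x] by (cases x y rule: linorder_cases) auto
qed

definition hashv :: "nat \<Rightarrow> nat \<Rightarrow> (nat \<Rightarrow> nat) \<Rightarrow> nat \<Rightarrow> nat" where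
  "hashv q M h v = h (v div M) * q + h (v mod M)"

lemma card_UN_bound:
  "finite I \<Longrightarrow> (\<And>i. i \<in> I \<Longrightarrow> card (A i) \<le> m) \<Longrightarrow> card (\<Union>i\<in>I. A i) \<le> card I * m"
  using order_trans[OF card_UN_le sum_bounded_above[of I "\<lambda>i. card (A i)" m]] by simp

text \<open>Double counting. If no function were injective on \<open>U\<close>, every index would
  collide on some pair of \<open>U\<close>. Distinct vertices differ in one of their two digits, and
  a collision of \<open>hashv\<close> is a collision on that digit, so by \<open>agree_bound\<close>
  a pair accounts for at most \<open>4 * (l + 1)\<close> indices. This leaves at most
  \<open>K * K * 4 * (l + 1)\<close> indices, fewer than there are.\<close>

lemma separating_hash:
  assumes pot: "pot hs M \<le> 2 ^ (3 * l + 4)" and len: "length hs = (4 * (K * K) + 1) * (l + 1)"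
    and U: "finite U" "card U \<le> K" "U \<subseteq> {..<M * M}"
    and hq: "\<And>h x. h \<in> set hs \<Longrightarrow> x < M \<Longrightarrow> h x < q"
  shows "\<exists>i<length hs. inj_on (hashv q M (hs ! i)) U"
proof (rule ccontr)
  assume "\<not> ?thesis"
  then have ninj: "\<And>i. i < length hs \<Longrightarrow> \<not> inj_on (hashv q M (hs ! i)) U" by blast
  let ?I = "{(u, v). u \<in> U \<and> v \<in> U \<and> u \<noteq> v}"
  let ?A = "\<lambda>(u, v). {i. i < length hs \<and> hashv q M (hs ! i) u = hashv q M (hs ! i) v}"
  have I: "?I \<subseteq> U \<times> U" by auto
  have card: "card {i. i < length hs \<and> (hs ! i) x = (hs ! i) y} = agree hs x y" for x y
    by (simp add: agree_def length_filter_conv_card)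
  have "card (?A p) \<le> 4 * (l + 1)" if "p \<in> ?I" for p
  proof -
    obtain u v where p: "p = (u, v)" "u \<in> U" "v \<in> U" "u \<noteq> v" using \<open>p \<in> ?I\<close> by blast
    then have "u < M * M" "v < M * M" using U by auto
    moreover from this have "0 < M" by (cases M) auto
    ultimately have lt: "u div M < M" "v div M < M" "u mod M < M" "v mod M < M"
      by (auto intro: less_mult_imp_div_less)
    have eq: "(hs ! i) (u div M) = (hs ! i) (v div M) \<and> (hs ! i) (u mod M) = (hs ! i) (v mod M)"
      if "i < length hs" "hashv q M (hs ! i) u = hashv q M (hs ! i) v" for i
      using address_inject[of "(hs ! i) (u div M)" q "(hs ! i) (u mod M)" "(hs ! i) (v div M)" "(hs ! i) (v mod M)"]
        hq lt that by (simp add: hashv_def)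
    have "u div M \<noteq> v div M \<or> u mod M \<noteq> v mod M" using p by (metis div_mult_mod_eq)
    then obtain x y where xy: "x < M" "y < M" "x \<noteq> y"
      "\<And>i. i \<in> ?A p \<Longrightarrow> i < length hs \<and> (hs ! i) x = (hs ! i) y"
    proof
      assume "u div M \<noteq> v div M"
      with lt eq show ?thesis by (intro that[of "u div M" "v div M"]) (auto simp: p)
    next
      assume "u mod M \<noteq> v mod M"
      with lt eq show ?thesis by (intro that[of "u mod M" "v mod M"]) (auto simp: p)
    qed
    have "card (?A p) \<le> card {i. i < length hs \<and> (hs ! i) x = (hs ! i) y}"
      by (rule card_mono) (use xy(4) in auto)
    also have "\<dots> \<le> 4 * (l + 1)" unfolding card using agree_bound[OF pot xy(1-3)] .
    finally show ?thesis .
  qed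
  then have "card (\<Union>p\<in>?I. ?A p) \<le> card ?I * (4 * (l + 1))"
    using finite_subset[OF I] U(1) by (intro card_UN_bound) auto
  also have "\<dots> \<le> K * K * (4 * (l + 1))"
  proof (rule mult_le_mono1)
    have "card ?I \<le> card (U \<times> U)" by (rule card_mono) (use I U in auto)
    also have "\<dots> \<le> K * K" using U by (simp add: mult_mono)
    finally show "card ?I \<le> K * K" .
  qed
  finally have "card (\<Union>p\<in>?I. ?A p) \<le> K * K * (4 * (l + 1))" .
  moreover have "{..<length hs} \<subseteq> (\<Union>p\<in>?I. ?A p)"
  proof
    fix i assume "i \<in> {..<length hs}"
    then obtain u v where "u \<in> U" "v \<in> U" "u \<noteq> v" "hashv q M (hs ! i) u = hashv q M (hs ! i) v"
      using ninj[of i] by (auto simp: inj_on_def)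
    then show "i \<in> (\<Union>p\<in>?I. ?A p)" using \<open>i \<in> {..<length hs}\<close> by auto
  qed
  then have "length hs \<le> card (\<Union>p\<in>?I. ?A p)"
    using card_mono[of "\<Union>p\<in>?I. ?A p" "{..<length hs}"] finite_subset[OF I] U(1) by auto
  ultimately have "length hs \<le> K * K * (4 * (l + 1))" by linarith
  then show False unfolding len by (simp add: algebra_simps)
qed

section \<open>The greedy choice of one hash function\<close>

datatype vname =
    Vn | VM | Vl | Vm | Vlen | Vnew | Vrd | Vi | Vj | Ve | Vu | Vv | Vp | Vq | Vx | Vy | Vbest | Vt
  | Vfound | Vans | Vg | Vr | Vout nat

text \<open>The arrays carrying a number exist once per level: level \<open>R\<close> with
  \<open>R \<le> k\<close> describes a cyclic sequence of \<open>R\<close> classes, and level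
  \<open>k + 1\<close> holds the arcs of the input graph and its orientation.\<close>

datatype aname =
    LL | DEG | OC | TT | FF | COL | NX | BAD | PW | HH | WT | CST | ZZ
  | SRC nat | DST nat | CLS nat | WIT nat | LAB nat

instance vname :: countable by countable_datatype
instance aname :: countable by countable_datatype

type_synonym pst = "(vname, aname) st"
type_synonym pprog = "(vname, aname) prog"

definition hash_acc :: pprog where
  "hash_acc = Put CST (Ar HH (V Vy))
     (Pl (Ar CST (Ar HH (V Vy))) (Ar WT (Pl (Ti (V Vx) (V VM)) (V Vy))))"

definition hash_min :: pprog where
  "hash_min = Cond (Ls (Ar CST (V Vi)) (Ar CST (V Vbest))) (Asg Vbest (V Vi)) Nop"

definition hash_double :: pprog where
  "hash_double = Cond (Eq (Ar HH (V Vy)) (V Vbest))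
     (Put WT (Pl (Ti (V Vx) (V VM)) (V Vy))
       (Pl (Ar WT (Pl (Ti (V Vx) (V VM)) (V Vy))) (Ar WT (Pl (Ti (V Vx) (V VM)) (V Vy))))) Nop"

text \<open>Fixes the value at \<open>x\<close> when all smaller points have theirs: it takes the
  value whose class has the least total weight over the pairs with a smaller point. The last loop
  doubles the weights of the pairs that now collide.\<close>

definition hash_row :: "nat \<Rightarrow> pprog" where
  "hash_row q =
     For Vi (N q) (Put CST (V Vi) (N 0)) ;;
     For Vy (V Vx) hash_acc ;;
     Asg Vbest (N 0) ;;
     For Vi (N q) hash_min ;;
     Put HH (V Vx) (V Vbest) ;;
     For Vy (V Vx) hash_double"

definition hash_step :: "nat \<Rightarrow> pprog" where
  "hash_step q = For Vx (V VM) (hash_row q)"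

lemma mods_hash [simp]:
  "mvars hash_acc = {}" "marrs hash_acc = {CST}" "mvars hash_min = {Vbest}" "marrs hash_min = {}"
  "mvars hash_double = {}" "marrs hash_double = {WT}"
  "mvars (hash_row q) = {Vi, Vy, Vbest}" "marrs (hash_row q) = {CST, HH, WT}"
  "mvars (hash_step q) = {Vx, Vi, Vy, Vbest}" "marrs (hash_step q) = {CST, HH, WT}"
  by (auto simp: hash_acc_def hash_min_def hash_double_def hash_row_def hash_step_def)

definition hash_row_c :: "nat \<Rightarrow> nat" where
  "hash_row_c q = 30 + q * (scost (Put CST (V Vi) (N 0) :: pprog) + 4) + scost hash_acc + scost (Asg Vbest (N 0) :: pprog) +
     q * (scost hash_min + 4) + scost (Put HH (V Vx) (V Vbest) :: pprog) + scost hash_double"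

text \<open>The least of \<open>q\<close> class weights is at most their average.\<close>

lemma least_class:
  fixes w :: "nat \<Rightarrow> nat"
  assumes "\<And>y. y < x \<Longrightarrow> h y < q" "c < q"
    and least: "\<And>i. i < q \<Longrightarrow> (\<Sum>y<x. if h y = c then w y else 0) \<le> (\<Sum>y<x. if h y = i then w y else 0)"
  shows "q * (\<Sum>y<x. if h y = c then w y else 0) \<le> (\<Sum>y<x. w y)"
proof -
  have "q * (\<Sum>y<x. if h y = c then w y else 0) = (\<Sum>i<q. \<Sum>y<x. if h y = c then w y else 0)" by simp
  also have "\<dots> \<le> (\<Sum>i<q. \<Sum>y<x. if h y = i then w y else 0)" by (rule sum_mono) (use least in auto)
  also have "\<dots> = (\<Sum>y<x. \<Sum>i<q. if h y = i then w y else 0)" by (rule sum.swap)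
  also have "\<dots> = (\<Sum>y<x. w y)" by (rule sum.cong) (use assms(1) in auto)
  finally show ?thesis .
qed

text \<open>The number \<open>B\<close> bounds the weight of the whole row, hence every partial
  class weight; twice as much must fit because weights get doubled.\<close>

lemma hash_row_spec:
  fixes s :: pst
  assumes as: "vr s VM = M" "vr s Vx = x" "x < M" "M \<le> b" "1 \<le> q" "q \<le> b"
      "\<forall>y<x. ar s HH y < q" and WB: "(\<Sum>y<x. ar s WT (x * M + y)) \<le> B" "2 * B \<le> b"
  shows "tri b (hash_row q) s (hash_row_c q * (M + 1)) (\<lambda>s'. \<exists>c<q.
       q * (\<Sum>y<x. if ar s HH y = c then ar s WT (x * M + y) else 0) \<le> (\<Sum>y<x. ar s WT (x * M + y)) \<and>
       ar s' HH = (ar s HH)(x := c) \<and>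
       (\<forall>p. ar s' WT p = (if \<exists>y<x. p = x * M + y \<and> ar s HH y = c then 2 * ar s WT p else ar s WT p)))"
    (is "tri b _ s _ ?Q")
proof -
  define t1 where "t1 = ecost (N q :: (vname, aname) aexp) + 2 + q * (scost (Put CST (V Vi) (N 0) :: pprog) + 4)"
  define t4 where "t4 = ecost (N q :: (vname, aname) aexp) + 2 + q * (scost hash_min + 4)"
  define t3 where "t3 = scost (Asg Vbest (N 0) :: pprog)"
  define t5 where "t5 = scost (Put HH (V Vx) (V Vbest) :: pprog)"
    let ?h = "ar s HH" and ?w = "\<lambda>y. ar s WT (x * M + y)"
    let ?S = "\<lambda>m i. \<Sum>y<m. if ?h y = i then ?w y else 0"
    have SB: "?S m i \<le> B" if "m \<le> x" for m i
    proof -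
      have "?S m i \<le> (\<Sum>y<m. ?w y)" by (rule sum_mono) auto
      also have "\<dots> \<le> (\<Sum>y<x. ?w y)" by (rule sum_mono2) (use that in auto)
      finally show ?thesis using WB by simp
    qed
    have wB: "?w y \<le> B" if "y < x" for y
      using member_le_sum[of y "{..<x}" ?w] that WB by simp
    have "tri b (hash_row q) s (t1 + ((1 + 2 + x * (scost hash_acc + 4)) + (t3 + (t4 + (t5 + (1 + 2 + x * (scost hash_double + 4))))))) ?Q"
      unfolding hash_row_def
    proof (rule tri_Sq)
      show "tri b (For Vi (N q) (Put CST (V Vi) (N 0))) s t1 (\<lambda>s'. \<forall>i<q. ar s' CST i = 0)"
        unfolding t1_def
        by (rule tri_For_straight[where I = "\<lambda>m s'. \<forall>i<m. ar s' CST i = 0"])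
          (use as in \<open>auto simp: less_Suc_eq\<close>)
    next
      fix s1 :: pst assume s1: "frame (For Vi (N q) (Put CST (V Vi) (N 0))) s s1" "\<forall>i<q. ar s1 CST i = 0"
      then have f1: "vr s1 VM = M" "vr s1 Vx = x" "ar s1 HH = ?h" "ar s1 WT = ar s WT"
        using as by (auto simp: frame_def)
      show "tri b (For Vy (V Vx) hash_acc ;; Asg Vbest (N 0) ;; For Vi (N q) hash_min ;; Put HH (V Vx) (V Vbest) ;; For Vy (V Vx) hash_double)
        s1 ((1 + 2 + x * (scost hash_acc + 4)) + (t3 + (t4 + (t5 + (1 + 2 + x * (scost hash_double + 4)))))) ?Q"
      proof (rule tri_Sq)
        have "tri b (For Vy (V Vx) hash_acc) s1 (ecost (V Vx :: (vname, aname) aexp) + 2 + x * (scost hash_acc + 4))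
            (\<lambda>s'. \<forall>i<q. ar s' CST i = ?S x i)"
        proof (rule tri_For_straight[where I = "\<lambda>m s'. \<forall>i<q. ar s' CST i = ?S m i"])
          fix m and s' :: pst assume m: "m < x" "frame (For Vy (V Vx) hash_acc) s1 s'" "\<forall>i<q. ar s' CST i = ?S m i"
          then have f: "vr s' VM = M" "vr s' Vx = x" "ar s' HH = ?h" "ar s' WT = ar s WT"
            using f1 by (auto simp: frame_def hash_acc_def)
          have h: "?h m < q" using as m by auto
          have "?S (Suc m) (?h m) \<le> B" by (rule SB) (use m in simp)
          then have "ar s' CST (?h m) + ?w m \<le> b" using m h WB by simp
          then show "ok b hash_acc (setv Vy m s') \<and> (\<forall>i<q. ar (ev hash_acc (setv Vy m s')) CST i = ?S (Suc m) i)"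
            using f m h by (auto simp: hash_acc_def)
        qed (use as s1 f1 in \<open>auto simp: hash_acc_def\<close>)
        then show "tri b (For Vy (V Vx) hash_acc) s1 (1 + 2 + x * (scost hash_acc + 4)) (\<lambda>s'. \<forall>i<q. ar s' CST i = ?S x i)"
          by simp
      next
        fix s2 :: pst assume s2: "frame (For Vy (V Vx) hash_acc) s1 s2" "\<forall>i<q. ar s2 CST i = ?S x i"
        then have f2: "vr s2 VM = M" "vr s2 Vx = x" "ar s2 HH = ?h" "ar s2 WT = ar s WT"
          using f1 by (auto simp: frame_def hash_acc_def)
        show "tri b (Asg Vbest (N 0) ;; For Vi (N q) hash_min ;; Put HH (V Vx) (V Vbest) ;; For Vy (V Vx) hash_double)
          s2 (t3 + (t4 + (t5 + (1 + 2 + x * (scost hash_double + 4))))) ?Q"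
        proof (rule tri_Sq)
          show "tri b (Asg Vbest (N 0)) s2 t3 (\<lambda>s'. vr s' Vbest = 0)"
            unfolding t3_def by (rule tri_straight) auto
        next
          fix s3 :: pst assume s3: "frame (Asg Vbest (N 0)) s2 s3" "vr s3 Vbest = 0"
          then have f3: "vr s3 VM = M" "vr s3 Vx = x" "ar s3 HH = ?h" "ar s3 WT = ar s WT"
            "\<forall>i<q. ar s3 CST i = ?S x i"
            using f2 s2 by (auto simp: frame_def)
          show "tri b (For Vi (N q) hash_min ;; Put HH (V Vx) (V Vbest) ;; For Vy (V Vx) hash_double)
            s3 (t4 + (t5 + (1 + 2 + x * (scost hash_double + 4)))) ?Q"
          proof (rule tri_Sq)
            show "tri b (For Vi (N q) hash_min) s3 t4 (\<lambda>s'. vr s' Vbest < q \<and> (\<forall>i<q. ?S x (vr s' Vbest) \<le> ?S x i))"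
              unfolding t4_def
            proof (rule tri_For_straight[where I = "\<lambda>m s'. vr s' Vbest < q \<and> (\<forall>i<m. ?S x (vr s' Vbest) \<le> ?S x i)"])
              fix m and s' :: pst assume m: "m < q" "frame (For Vi (N q) hash_min) s3 s'" "bdd b s'"
                "vr s' Vbest < q \<and> (\<forall>i<m. ?S x (vr s' Vbest) \<le> ?S x i)"
              then have c: "\<forall>i<q. ar s' CST i = ?S x i" using f3 by (auto simp: frame_def hash_min_def)
              show "ok b hash_min (setv Vi m s') \<and> vr (ev hash_min (setv Vi m s')) Vbest < q \<and>
                (\<forall>i<Suc m. ?S x (vr (ev hash_min (setv Vi m s')) Vbest) \<le> ?S x i)"
              proof (cases "?S x m < ?S x (vr s' Vbest)")
                case True
                then have "\<forall>i<Suc m. ?S x m \<le> ?S x i" using m(4) by (auto simp: less_Suc_eq intro: less_imp_le less_le_trans)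
                then show ?thesis using True m c as by (simp add: hash_min_def)
              next
                case False
                then show ?thesis using m c by (auto simp: hash_min_def less_Suc_eq)
              qed
            qed (use as s3 f3 in \<open>auto simp: hash_min_def\<close>)
          next
            fix s4 :: pst assume s4: "frame (For Vi (N q) hash_min) s3 s4"
              "vr s4 Vbest < q \<and> (\<forall>i<q. ?S x (vr s4 Vbest) \<le> ?S x i)"
            define c where "c = vr s4 Vbest"
            have f4: "vr s4 VM = M" "vr s4 Vx = x" "ar s4 HH = ?h" "ar s4 WT = ar s WT"
              using f3 s4(1) by (auto simp: frame_def hash_min_def)
            have c: "c < q" "q * ?S x c \<le> (\<Sum>y<x. ?w y)"
              using least_class[of x ?h q c ?w] s4 as by (auto simp: c_def)
            show "tri b (Put HH (V Vx) (V Vbest) ;; For Vy (V Vx) hash_double)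
              s4 (t5 + (1 + 2 + x * (scost hash_double + 4))) ?Q"
            proof (rule tri_Sq)
              show "tri b (Put HH (V Vx) (V Vbest)) s4 t5 (\<lambda>s'. ar s' HH = ?h(x := c))"
                unfolding t5_def by (rule tri_straight) (auto simp: f4 c_def bdd_var)
            next
              fix s5 :: pst assume s5: "frame (Put HH (V Vx) (V Vbest)) s4 s5" "ar s5 HH = ?h(x := c)"
              then have f5: "vr s5 VM = M" "vr s5 Vx = x" "ar s5 WT = ar s WT" "vr s5 Vbest = c"
                using f4 by (auto simp: frame_def c_def)
              let ?I = "\<lambda>m (s' :: pst). \<forall>p. ar s' WT p =
                  (if \<exists>y<m. p = x * M + y \<and> ?h y = c then 2 * ar s WT p else ar s WT p)"
              have "tri b (For Vy (V Vx) hash_double) s5 (ecost (V Vx :: (vname, aname) aexp) + 2 + x * (scost hash_double + 4)) (?I x)"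
              proof (rule tri_For_straight[where I = ?I])
                fix m and s' :: pst assume m: "m < x" "frame (For Vy (V Vx) hash_double) s5 s'" "bdd b s'" "?I m s'"
                then have f: "vr s' VM = M" "vr s' Vx = x" "vr s' Vbest = c" "ar s' HH = ?h(x := c)"
                  using f5 s5 by (auto simp: frame_def hash_double_def)
                have WTm: "ar s' WT (x * M + m) = ?w m" using m(4) by auto
                have le: "?w m + ?w m \<le> b" using wB[OF m(1)] WB by simp
                show "ok b hash_double (setv Vy m s') \<and> ?I (Suc m) (ev hash_double (setv Vy m s'))"
                proof (cases "?h m = c")
                  case True
                  then show ?thesis using f m WTm le by (auto simp: hash_double_def less_Suc_eq)
                next
                  case False
                  then show ?thesis using f m by (auto simp: hash_double_def less_Suc_eq)
                qed
              qed (use as f5 in \<open>auto simp: hash_double_def\<close>)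
              then show "tri b (For Vy (V Vx) hash_double) s5 (1 + 2 + x * (scost hash_double + 4)) ?Q"
              proof (rule tri_conseq)
                fix s' :: pst assume s': "frame (For Vy (V Vx) hash_double) s5 s'" "?I x s'"
                then have "ar s' HH = ?h(x := c)" using s5 by (simp add: frame_def hash_double_def)
                then show "?Q s'" using c s'(2) by blast
              qed simp
            qed
          qed
        qed
      qed
    qed
    moreover have "t1 + ((1 + 2 + x * (scost hash_acc + 4)) + (t3 + (t4 + (t5 + (1 + 2 + x * (scost hash_double + 4))))))
        \<le> hash_row_c q * (M + 1)"
    proof -
      have "x * (scost hash_acc + 4) \<le> M * (scost hash_acc + 4)" "x * (scost hash_double + 4) \<le> M * (scost hash_double + 4)"
        using as(3) by (auto intro: mult_le_mono1)
      then show ?thesis by (simp add: hash_row_c_def t1_def t3_def t4_def t5_def algebra_simps)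
    qed
    ultimately show ?thesis by (rule tri_conseq)
qed

text \<open>Adding up the inequalities of the rows shows that colliding pairs carry at most the
  fraction \<open>1 / q\<close> of the potential, which is what \<open>pot_step\<close> asks
  for.\<close>

lemma hash_step_spec:
  fixes s :: pst
  assumes as: "vr s VM = M" "1 \<le> q" "q \<le> b" "M \<le> b"
     "\<forall>x<M. \<forall>y<x. ar s WT (x * M + y) = 2 ^ agree hs x y" "2 * pot hs M \<le> b"
  shows "tri b (hash_step q) s ((2 * hash_row_c q + 7) * (M * M + 1)) (\<lambda>s'.
       (\<forall>x<M. ar s' HH x < q) \<and>
       q * (\<Sum>x<M. \<Sum>y<x. if ar s' HH y = ar s' HH x then 2 ^ agree hs x y else 0) \<le> pot hs M \<and>
       (\<forall>x<M. \<forall>y<x. ar s' WT (x * M + y) = 2 ^ agree (hs @ [ar s' HH]) x y))"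
proof -
  define A where "A = hash_row_c q"
    let ?S = "\<lambda>x h. \<Sum>y<x. if h y = h x then 2 ^ agree hs x y else 0 :: nat"
    let ?P = "\<lambda>m. \<Sum>x<m. \<Sum>y<x. 2 ^ agree hs x y :: nat"
    \<comment> \<open>Rows below \<open>m\<close> of the weight table already describe the extended
      list of functions, the rows from \<open>m\<close> on still the old one.\<close>
    let ?I = "\<lambda>m (s' :: pst). (\<forall>x<m. ar s' HH x < q) \<and> q * (\<Sum>x<m. ?S x (ar s' HH)) \<le> ?P m \<and>
       (\<forall>x<m. \<forall>y<x. ar s' WT (x * M + y) = 2 ^ agree (hs @ [ar s' HH]) x y) \<and>
       (\<forall>x<M. m \<le> x \<longrightarrow> (\<forall>y<x. ar s' WT (x * M + y) = 2 ^ agree hs x y))"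
    have "tri b (For Vx (V VM) (hash_row q)) s (ecost (V VM :: (vname, aname) aexp) + 2 + M * (A * (M + 1) + 4)) (?I M)"
    proof (rule tri_For[where I = ?I])
      fix m and s' :: pst assume m: "m < M" "bdd b s'" "frame (For Vx (V VM) (hash_row q)) s s'" "?I m s'"
      have "vr s' VM = M" using m as by (auto simp: frame_def hash_row_def)
      moreover have wm: "(\<Sum>y<m. ar s' WT (m * M + y)) = (\<Sum>y<m. 2 ^ agree hs m y)"
        using m by (intro sum.cong) auto
      moreover have "(\<Sum>y<m. 2 ^ agree hs m y) \<le> pot hs M"
        unfolding pot_def by (rule member_le_sum[where f = "\<lambda>x. \<Sum>y<x. 2 ^ agree hs x y"]) (use m in auto)
      ultimately have "tri b (hash_row q) (setv Vx m s') (A * (M + 1)) (\<lambda>s''. \<exists>c<q.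
         q * (\<Sum>y<m. if ar (setv Vx m s') HH y = c then ar (setv Vx m s') WT (m * M + y) else 0)
           \<le> (\<Sum>y<m. ar (setv Vx m s') WT (m * M + y)) \<and>
         ar s'' HH = (ar (setv Vx m s') HH)(m := c) \<and>
         (\<forall>p. ar s'' WT p = (if \<exists>y<m. p = m * M + y \<and> ar (setv Vx m s') HH y = c
            then 2 * ar (setv Vx m s') WT p else ar (setv Vx m s') WT p)))"
        unfolding A_def by (intro hash_row_spec[where B = "pot hs M"]) (use as m in simp_all)
      then have "tri b (hash_row q) (setv Vx m s') (A * (M + 1)) (\<lambda>s''. \<exists>c<q.
         q * (\<Sum>y<m. if ar s' HH y = c then ar s' WT (m * M + y) else 0) \<le> (\<Sum>y<m. ar s' WT (m * M + y)) \<and>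
         ar s'' HH = (ar s' HH)(m := c) \<and>
         (\<forall>p. ar s'' WT p = (if \<exists>y<m. p = m * M + y \<and> ar s' HH y = c then 2 * ar s' WT p else ar s' WT p)))"
        unfolding st_simps .
      then show "tri b (hash_row q) (setv Vx m s') (A * (M + 1)) (?I (Suc m))"
      proof (rule tri_conseq)
        fix s'' :: pst
        assume "\<exists>c<q. q * (\<Sum>y<m. if ar s' HH y = c then ar s' WT (m * M + y) else 0) \<le> (\<Sum>y<m. ar s' WT (m * M + y)) \<and>
         ar s'' HH = (ar s' HH)(m := c) \<and>
         (\<forall>p. ar s'' WT p = (if \<exists>y<m. p = m * M + y \<and> ar s' HH y = c then 2 * ar s' WT p else ar s' WT p))"
        then obtain c where c: "c < q"
          "q * (\<Sum>y<m. if ar s' HH y = c then ar s' WT (m * M + y) else 0) \<le> (\<Sum>y<m. 2 ^ agree hs m y)"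
          "ar s'' HH = (ar s' HH)(m := c)"
          "\<And>p. ar s'' WT p = (if \<exists>y<m. p = m * M + y \<and> ar s' HH y = c then 2 * ar s' WT p else ar s' WT p)"
          unfolding wm by blast
        have same: "?S x (ar s'' HH) = ?S x (ar s' HH)" if "x < m" for x
          using that by (intro sum.cong) (auto simp: c)
        have "?S m (ar s'' HH) = (\<Sum>y<m. if ar s' HH y = c then ar s' WT (m * M + y) else 0)"
          using m by (intro sum.cong) (auto simp: c)
        then have "q * (\<Sum>x<Suc m. ?S x (ar s'' HH)) \<le> ?P (Suc m)"
          using c(2) m(4) same by (simp add: distrib_left)
        moreover have "ar s'' WT (x * M + y) = ar s' WT (x * M + y)" if "x \<noteq> m" "x < M" "y < x" for x y
          using that c(4) address_inject[of x M y m] m(1) by auto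
        moreover have "ar s'' WT (m * M + y) = 2 ^ agree (hs @ [ar s'' HH]) m y" if "y < m" for y
        proof -
          have "(\<exists>y'<m. m * M + y = m * M + y' \<and> ar s' HH y' = c) \<longleftrightarrow> ar s' HH y = c" using that by auto
          then show ?thesis using that m by (auto simp: c agree_append)
        qed
        moreover have "agree (hs @ [ar s'' HH]) x y = agree (hs @ [ar s' HH]) x y" if "x < m" "y < x" for x y
          using that by (simp add: agree_append c)
        ultimately show "?I (Suc m) s''"
          using m c by (auto simp: less_Suc_eq)
      qed simp
    qed (use as in \<open>auto\<close>)
    then show ?thesis
      unfolding hash_step_def A_def[symmetric]
    proof (rule tri_conseq)
      have "M \<le> M * M" by simp
      have "M * (A * (M + 1) + 4) = A * (M * M) + A * M + 4 * M" by (simp add: algebra_simps)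
      also have "\<dots> \<le> A * (M * M) + A * (M * M) + 4 * (M * M)"
        using \<open>M \<le> M * M\<close> by (intro add_mono mult_left_mono) auto
      finally show "ecost (V VM :: (vname, aname) aexp) + 2 + M * (A * (M + 1) + 4) \<le> (2 * A + 7) * (M * M + 1)"
        by (simp add: algebra_simps)
    next
      fix s' :: pst assume "?I M s'"
      then show "(\<forall>x<M. ar s' HH x < q) \<and> q * (\<Sum>x<M. ?S x (ar s' HH)) \<le> pot hs M \<and>
         (\<forall>x<M. \<forall>y<x. ar s' WT (x * M + y) = 2 ^ agree (hs @ [ar s' HH]) x y)" unfolding pot_def by blast
    qed
qed

section \<open>Orientation with bounded out-degree\<close>

text \<open>A label between \<open>1\<close> and \<open>D\<close> says that the source of an edge is its tail, a label between \<open>D + 1\<close> and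
  \<open>2 * D\<close> that its target is; different edges with the same tail have different labels.\<close>

definition tail :: "nat \<Rightarrow> (nat \<Rightarrow> nat) \<Rightarrow> (nat \<Rightarrow> nat) \<Rightarrow> nat \<Rightarrow> nat \<Rightarrow> nat" where
  "tail D sr ds l e = (if l \<le> D then sr e else ds e)"

definition labelled :: "nat \<Rightarrow> (nat \<Rightarrow> nat) \<Rightarrow> (nat \<Rightarrow> nat) \<Rightarrow> (nat \<Rightarrow> nat) \<Rightarrow> nat set \<Rightarrow> bool" where
  "labelled D sr ds lab A \<longleftrightarrow> (\<forall>e\<in>A. 1 \<le> lab e \<and> lab e \<le> 2 * D) \<and>
     (\<forall>e\<in>A. \<forall>e'\<in>A. lab e = lab e' \<longrightarrow> tail D sr ds (lab e) e = tail D sr ds (lab e') e' \<longrightarrow> e = e')"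

text \<open>The counter \<open>oc v\<close> is the number of label indices handed out with tail
  \<open>v\<close>; all indices in use lie below it, so \<open>oc v\<close> itself is always
  fresh.\<close>

definition oinv :: "nat \<Rightarrow> (nat \<Rightarrow> nat) \<Rightarrow> (nat \<Rightarrow> nat) \<Rightarrow> (nat \<Rightarrow> nat) \<Rightarrow> (nat \<Rightarrow> nat) \<Rightarrow> nat set \<Rightarrow> bool" where
  "oinv D sr ds lab oc A \<longleftrightarrow> labelled D sr ds lab A \<and>
     (\<forall>e\<in>A. (if lab e \<le> D then lab e - 1 else lab e - D - 1) < oc (tail D sr ds (lab e) e))"

lemma oinv_insert:
  assumes inv: "oinv D sr ds lab oc A" and e: "e \<notin> A" and oc: "oc u < D"
    and l: "l = oc u + 1 \<and> u = sr e \<or> l = oc u + 1 + D \<and> u = ds e"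
  shows "oinv D sr ds (lab(e := l)) (oc(u := oc u + 1)) (insert e A)"
proof -
  have l12: "1 \<le> l" "l \<le> 2 * D" and tl: "tail D sr ds l e = u"
    and idx: "(if l \<le> D then l - 1 else l - D - 1) = oc u"
    using l oc by (auto simp: tail_def)
  have ne: "f \<noteq> e" if "f \<in> A" for f using that e by blast
  have new: "\<not> (lab f = l \<and> tail D sr ds (lab f) f = u)" if "f \<in> A" for f
  proof
    assume "lab f = l \<and> tail D sr ds (lab f) f = u"
    moreover have "(if lab f \<le> D then lab f - 1 else lab f - D - 1) < oc (tail D sr ds (lab f) f)"
      using inv that by (simp add: oinv_def)
    ultimately show False using idx by auto
  qed
  have "labelled D sr ds (lab(e := l)) (insert e A)"
    unfolding labelled_def
  proof (intro conjI ballI impI)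
    fix f assume "f \<in> insert e A"
    then show "1 \<le> (lab(e := l)) f" "(lab(e := l)) f \<le> 2 * D"
      using inv l12 by (auto simp: oinv_def labelled_def)
  next
    fix f g assume f: "f \<in> insert e A" and g: "g \<in> insert e A"
      and eq: "(lab(e := l)) f = (lab(e := l)) g"
        "tail D sr ds ((lab(e := l)) f) f = tail D sr ds ((lab(e := l)) g) g"
    consider "f = e" "g = e" | "f = e" "g \<in> A" | "f \<in> A" "g = e" | "f \<in> A" "g \<in> A"
      using f g by blast
    then show "f = g"
    proof cases
      case 2
      then show ?thesis using eq new[of g] ne tl by auto
    next
      case 3
      then show ?thesis using eq new[of f] ne tl by auto
    next
      case 4
      then have "lab f = lab g" "tail D sr ds (lab f) f = tail D sr ds (lab g) g"
        using eq ne[of f] ne[of g] by auto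
      then show ?thesis using inv 4 by (auto simp: oinv_def labelled_def)
    qed simp
  qed
  moreover have "(if (lab(e := l)) f \<le> D then (lab(e := l)) f - 1 else (lab(e := l)) f - D - 1)
      < (oc(u := oc u + 1)) (tail D sr ds ((lab(e := l)) f) f)" if "f \<in> insert e A" for f
  proof (cases "f = e")
    case True
    then show ?thesis using tl idx by (auto split: if_splits)
  next
    case False
    then have "(if lab f \<le> D then lab f - 1 else lab f - D - 1) < oc (tail D sr ds (lab f) f)"
      using inv that by (simp add: oinv_def)
    then show ?thesis using False by (auto simp del: less_Suc_eq_le)
  qed
  ultimately show ?thesis unfolding oinv_def by blast
qed

section \<open>Degrees in an edge list and the halving argument\<close>

definition dg :: "(nat \<Rightarrow> nat) \<Rightarrow> (nat \<Rightarrow> nat) \<Rightarrow> nat list \<Rightarrow> nat \<Rightarrow> nat" where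
  "dg sr ds xs v = length (filter (\<lambda>e. sr e = v) xs) + length (filter (\<lambda>e. ds e = v) xs)"

lemma dg_Nil [simp]: "dg sr ds [] v = 0"
  by (simp add: dg_def)

lemma dg_append: "dg sr ds (xs @ [e]) v = dg sr ds xs v + (if sr e = v then 1 else 0) + (if ds e = v then 1 else 0)"
  by (simp add: dg_def)

lemma dg_take_Suc:
  "i < length xs \<Longrightarrow> dg sr ds (take (Suc i) xs) v =
     dg sr ds (take i xs) v + (if sr (xs ! i) = v then 1 else 0) + (if ds (xs ! i) = v then 1 else 0)"
  by (simp add: take_Suc_conv_app_nth dg_append)

lemma dg_take_le: "dg sr ds (take i xs) v \<le> dg sr ds xs v"
proof -
  have "dg sr ds xs v = dg sr ds (take i xs @ drop i xs) v" by simp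
  also have "\<dots> \<ge> dg sr ds (take i xs) v" unfolding dg_def filter_append by simp
  finally show ?thesis .
qed

lemma dg_le: "dg sr ds xs v \<le> 2 * length xs"
  unfolding dg_def using length_filter_le[of "\<lambda>e. sr e = v" xs] length_filter_le[of "\<lambda>e. ds e = v" xs]
  by linarith

lemma dg_pos: "e \<in> set xs \<Longrightarrow> v = sr e \<or> v = ds e \<Longrightarrow> 0 < dg sr ds xs v"
  unfolding dg_def by (auto simp: filter_empty_conv)

lemma sum_dg: "finite H \<Longrightarrow> (\<Sum>v\<in>H. dg sr ds xs v) \<le> 2 * length xs"
proof (induction xs rule: rev_induct)
  case (snoc e xs)
  have "(\<Sum>v\<in>H. dg sr ds (xs @ [e]) v) = (\<Sum>v\<in>H. dg sr ds xs v) +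
      (\<Sum>v\<in>H. if sr e = v then 1 else 0) + (\<Sum>v\<in>H. if ds e = v then 1 else 0)"
    by (simp add: dg_append sum.distrib)
  also have "\<dots> \<le> 2 * length xs + 1 + 1" using snoc by (intro add_mono) auto
  finally show ?case by simp
qed simp

text \<open>Hereditary density in terms of edge indices. Quantifying over all subsets makes it
  applicable to whatever edges survive a round.\<close>

definition dense_at :: "nat \<Rightarrow> (nat \<Rightarrow> nat) \<Rightarrow> (nat \<Rightarrow> nat) \<Rightarrow> nat set \<Rightarrow> bool" where
  "dense_at d sr ds A \<longleftrightarrow> (\<forall>X\<subseteq>A. card X \<le> d * card (sr ` X \<union> ds ` X))"

text \<open>An edge with an end of degree at most \<open>D\<close> is oriented out of that end at
  once; the core is what is left for the next round.\<close>

definition core :: "nat \<Rightarrow> (nat \<Rightarrow> nat) \<Rightarrow> (nat \<Rightarrow> nat) \<Rightarrow> nat list \<Rightarrow> nat \<Rightarrow> bool" where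
  "core D sr ds xs e \<longleftrightarrow> D < dg sr ds xs (sr e) \<and> D < dg sr ds xs (ds e)"

text \<open>Every vertex of \<open>?H\<close> has degree above \<open>4 * d\<close>, while all
  degrees together are at most \<open>2 * length xs\<close>; hence \<open>4 * d * card ?H\<close> is
  at most \<open>2 * length xs\<close>. By density at most \<open>d * card ?H\<close> edges survive,
  half of the list. This is the origin of \<open>D = 4 * d\<close>.\<close>

lemma core_halves:
  assumes "dense_at d sr ds A" "set xs \<subseteq> A" "distinct xs"
  shows "2 * length (filter (core (4 * d) sr ds xs) xs) \<le> length xs"
proof -
  let ?ys = "filter (core (4 * d) sr ds xs) xs"
  let ?X = "set ?ys" and ?H = "sr ` set ?ys \<union> ds ` set ?ys"
  have "?X \<subseteq> A" using assms by auto
  then have 1: "length ?ys \<le> d * card ?H"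
    using assms(1)[unfolded dense_at_def, rule_format, OF \<open>?X \<subseteq> A\<close>] distinct_card[of ?ys] assms(3)
    by (simp del: set_filter)
  have "card ?H * (4 * d + 1) = (\<Sum>v\<in>?H. 4 * d + 1)" by simp
  also have "\<dots> \<le> (\<Sum>v\<in>?H. dg sr ds xs v)"
    by (rule sum_mono) (auto simp: core_def Suc_le_eq)
  also have "\<dots> \<le> 2 * length xs" by (rule sum_dg) simp
  finally have "card ?H * (4 * d + 1) \<le> 2 * length xs" .
  then have "4 * (d * card ?H) \<le> 2 * length xs" by (simp add: algebra_simps)
  with 1 show ?thesis by linarith
qed

text \<open>Surviving edges are compacted within \<open>LL\<close> itself, which is safe because
  \<open>Vnew\<close> never overtakes \<open>Vi\<close>.\<close>

definition pass :: "nat \<Rightarrow> nat \<Rightarrow> pprog" where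
  "pass R D =
     Asg Ve (Ar LL (V Vi)) ;; Asg Vu (Ar (SRC R) (V Ve)) ;; Asg Vv (Ar (DST R) (V Ve)) ;;
     Cond (Ls (Ar DEG (V Vu)) (N (D + 1)))
       (Put (LAB R) (V Ve) (Pl (Ar OC (V Vu)) (N 1)) ;; Put OC (V Vu) (Pl (Ar OC (V Vu)) (N 1)))
       (Cond (Ls (Ar DEG (V Vv)) (N (D + 1)))
         (Put (LAB R) (V Ve) (Pl (Ar OC (V Vv)) (N (1 + D))) ;; Put OC (V Vv) (Pl (Ar OC (V Vv)) (N 1)))
         (Put LL (V Vnew) (V Ve) ;; Asg Vnew (Pl (V Vnew) (N 1))))"

text \<open>Degrees are cleared only at the ends of the remaining edges, so that a round costs time
  proportional to the current list and not to \<open>n\<close>.\<close>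

definition deg0 :: "nat \<Rightarrow> pprog" where
  "deg0 R = Put DEG (Ar (SRC R) (Ar LL (V Vi))) (N 0) ;; Put DEG (Ar (DST R) (Ar LL (V Vi))) (N 0)"

definition deg1 :: "nat \<Rightarrow> pprog" where
  "deg1 R =
     Put DEG (Ar (SRC R) (Ar LL (V Vi))) (Pl (Ar DEG (Ar (SRC R) (Ar LL (V Vi)))) (N 1)) ;;
     Put DEG (Ar (DST R) (Ar LL (V Vi))) (Pl (Ar DEG (Ar (DST R) (Ar LL (V Vi)))) (N 1))"

definition round :: "nat \<Rightarrow> nat \<Rightarrow> pprog" where
  "round R D =
     For Vi (V Vlen) (deg0 R) ;;
     For Vi (V Vlen) (deg1 R) ;;
     Asg Vnew (N 0) ;;
     For Vi (V Vlen) (pass R D) ;;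
     Asg Vlen (V Vnew)"

definition orient :: "nat \<Rightarrow> nat \<Rightarrow> pprog" where
  "orient R D = For Vi (V Vn) (Put OC (V Vi) (N 0)) ;; For Vrd (V Vr) (round R D)"

lemma mods_round [simp]:
  "mvars (deg0 R) = {}" "marrs (deg0 R) = {DEG}"
  "mvars (deg1 R) = {}" "marrs (deg1 R) = {DEG}"
  "mvars (pass R D) = {Ve, Vu, Vv, Vnew}" "marrs (pass R D) = {LAB R, OC, LL}"
  "mvars (round R D) = {Ve, Vu, Vv, Vi, Vlen, Vnew}" "marrs (round R D) = {DEG, LAB R, OC, LL}"
  "mvars (orient R D) = {Ve, Vu, Vv, Vi, Vlen, Vnew, Vrd}" "marrs (orient R D) = {DEG, LAB R, OC, LL}"
  by (auto simp: deg0_def deg1_def pass_def round_def orient_def)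

definition holds :: "pst \<Rightarrow> nat list \<Rightarrow> bool" where
  "holds s xs \<longleftrightarrow> vr s Vlen = length xs \<and> (\<forall>i<length xs. ar s LL i = xs ! i)"

text \<open>A vertex of degree at most \<open>D\<close> loses all its edges in this round and enters
  it with counter \<open>0\<close>, while a vertex of larger degree is no tail in this round. So a
  counter in use is bounded by the number of edges at its vertex seen so far.\<close>

lemma pass_spec:
  fixes s :: pst
  assumes bd: "bdd b s" and i: "i < length xs" "vr s Vi = i" and xs: "distinct xs" "set xs \<inter> A = {}"
    and D: "2 * D \<le> b" "2 * length xs \<le> b"
    and f: "ar s (SRC R) = sr" "ar s (DST R) = ds" "\<forall>e\<in>set xs. \<forall>v\<in>{sr e, ds e}. ar s DEG v = dg sr ds xs v"
    and oc0: "\<And>v. 0 < dg sr ds xs v \<Longrightarrow> oc0 v = 0"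
    and I: "vr s Vnew = length (filter (core D sr ds xs) (take i xs))"
      "\<forall>j<length (filter (core D sr ds xs) (take i xs)). ar s LL j = filter (core D sr ds xs) (take i xs) ! j"
      "\<forall>j<length xs. i \<le> j \<longrightarrow> ar s LL j = xs ! j"
      "oinv D sr ds (ar s (LAB R)) (ar s OC) (A \<union> {e \<in> set (take i xs). \<not> core D sr ds xs e})"
      "\<forall>v. ar s OC v \<le> oc0 v + dg sr ds (take i xs) v \<and> (D < dg sr ds xs v \<longrightarrow> ar s OC v = oc0 v)"
      "\<forall>e. e \<notin> set xs \<longrightarrow> ar s (LAB R) e = lab0 e"
  defines "s' \<equiv> ev (pass R D) s"
  shows "ok b (pass R D) s \<and> vr s' Vnew = length (filter (core D sr ds xs) (take (Suc i) xs)) \<and>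
      (\<forall>j<length (filter (core D sr ds xs) (take (Suc i) xs)). ar s' LL j = filter (core D sr ds xs) (take (Suc i) xs) ! j) \<and>
      (\<forall>j<length xs. Suc i \<le> j \<longrightarrow> ar s' LL j = xs ! j) \<and>
      oinv D sr ds (ar s' (LAB R)) (ar s' OC) (A \<union> {e \<in> set (take (Suc i) xs). \<not> core D sr ds xs e}) \<and>
      (\<forall>v. ar s' OC v \<le> oc0 v + dg sr ds (take (Suc i) xs) v \<and> (D < dg sr ds xs v \<longrightarrow> ar s' OC v = oc0 v)) \<and>
      (\<forall>e. e \<notin> set xs \<longrightarrow> ar s' (LAB R) e = lab0 e)"
proof -
  define e where "e = xs ! i"
  have e: "e \<in> set xs" using i by (simp add: e_def)
  have LLi: "ar s LL i = e" using I(3) i by (simp add: e_def)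
  have deg: "ar s DEG (sr e) = dg sr ds xs (sr e)" "ar s DEG (ds e) = dg sr ds xs (ds e)"
    using f(3) e by auto
  have eb: "e \<le> b" "sr e \<le> b" "ds e \<le> b"
    using bdd_arr[OF bd, of LL i] bdd_arr[OF bd, of "SRC R" e] bdd_arr[OF bd, of "DST R" e] LLi f by simp_all
  let ?ys = "filter (core D sr ds xs) (take i xs)"
  have take: "take (Suc i) xs = take i xs @ [e]" using i by (simp add: take_Suc_conv_app_nth e_def)
  have new: "e \<notin> A \<union> {e \<in> set (take i xs). \<not> core D sr ds xs e}"
  proof -
    have "e \<notin> A" using xs e by blast
    moreover have "e \<notin> set (take i xs)" using xs i by (auto simp: e_def in_set_conv_nth nth_eq_iff_index_eq)
    ultimately show ?thesis by blast
  qed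
  have ylen: "length ?ys \<le> i" using length_filter_le[of _ "take i xs"] i by (simp add: le_trans)
  \<comment> \<open>Strict, because the current edge is counted in the longer prefix but not yet in
    the counter.\<close>
  have bnd: "ar s OC v < D" if "v = sr e \<or> v = ds e" "dg sr ds xs v \<le> D" for v
  proof -
    have "0 < dg sr ds xs v" using that e dg_pos by blast
    then have "oc0 v = 0" by (rule oc0)
    then have "ar s OC v \<le> dg sr ds (take i xs) v" using I(5)[rule_format, of v] by simp
    also have "\<dots> < dg sr ds (take (Suc i) xs) v"
      using that by (auto simp: take dg_append)
    also have "\<dots> \<le> dg sr ds xs v" by (rule dg_take_le)
    finally show ?thesis using that by simp
  qed
  have newb: "length ?ys + 1 \<le> b" using ylen i D by linarith
  have mono: "dg sr ds (take i xs) v \<le> dg sr ds (take (Suc i) xs) v" for v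
    by (simp add: take dg_append)
  consider (src) "dg sr ds xs (sr e) \<le> D" | (dst) "D < dg sr ds xs (sr e)" "dg sr ds xs (ds e) \<le> D"
    | (keep) "core D sr ds xs e"
    unfolding core_def by linarith
  then show ?thesis
  proof cases
    case src
    let ?u = "sr e"
    have nc: "\<not> core D sr ds xs e" using src by (simp add: core_def)
    have oc: "ar s OC ?u < D" using bnd src by simp
    have upd: "vr s' Vnew = vr s Vnew" "ar s' LL = ar s LL"
      "ar s' (LAB R) = (ar s (LAB R))(e := ar s OC ?u + 1)" "ar s' OC = (ar s OC)(?u := ar s OC ?u + 1)"
      and ok: "ok b (pass R D) s"
      using src oc D bd eb by (auto simp: s'_def pass_def i f LLi deg)
    have set: "A \<union> {e \<in> set (take (Suc i) xs). \<not> core D sr ds xs e} =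
        insert e (A \<union> {e \<in> set (take i xs). \<not> core D sr ds xs e})" using nc by (auto simp: take)
    have "oinv D sr ds (ar s' (LAB R)) (ar s' OC) (A \<union> {e \<in> set (take (Suc i) xs). \<not> core D sr ds xs e})"
      unfolding set upd by (rule oinv_insert[OF I(4) new oc]) simp
    moreover have "ar s' OC v \<le> oc0 v + dg sr ds (take (Suc i) xs) v \<and> (D < dg sr ds xs v \<longrightarrow> ar s' OC v = oc0 v)" for v
      using I(5)[rule_format, of v] mono[of v] src by (auto simp: upd take dg_append)
    ultimately show ?thesis using I nc ok e by (auto simp: upd take)
  next
    case dst
    let ?u = "ds e"
    have nc: "\<not> core D sr ds xs e" using dst by (simp add: core_def)
    have oc: "ar s OC ?u < D" using bnd dst by simp
    have upd: "vr s' Vnew = vr s Vnew" "ar s' LL = ar s LL"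
      "ar s' (LAB R) = (ar s (LAB R))(e := ar s OC ?u + 1 + D)" "ar s' OC = (ar s OC)(?u := ar s OC ?u + 1)"
      and ok: "ok b (pass R D) s"
      using dst oc D bd eb by (auto simp: s'_def pass_def i f LLi deg)
    have set: "A \<union> {e \<in> set (take (Suc i) xs). \<not> core D sr ds xs e} =
        insert e (A \<union> {e \<in> set (take i xs). \<not> core D sr ds xs e})" using nc by (auto simp: take)
    have "oinv D sr ds (ar s' (LAB R)) (ar s' OC) (A \<union> {e \<in> set (take (Suc i) xs). \<not> core D sr ds xs e})"
      unfolding set upd by (rule oinv_insert[OF I(4) new oc]) simp
    moreover have "ar s' OC v \<le> oc0 v + dg sr ds (take (Suc i) xs) v \<and> (D < dg sr ds xs v \<longrightarrow> ar s' OC v = oc0 v)" for v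
      using I(5)[rule_format, of v] mono[of v] dst by (auto simp: upd take dg_append)
    ultimately show ?thesis using I nc ok e by (auto simp: upd take)
  next
    case keep
    have upd: "vr s' Vnew = vr s Vnew + 1" "ar s' LL = (ar s LL)(vr s Vnew := e)"
      "ar s' (LAB R) = ar s (LAB R)" "ar s' OC = ar s OC"
      and ok: "ok b (pass R D) s"
      using keep i newb D bd eb by (auto simp: s'_def pass_def i f LLi deg core_def I(1) bdd_arr bdd_var)
    have ys: "filter (core D sr ds xs) (take (Suc i) xs) = ?ys @ [e]" using keep by (simp add: take)
    have "ar s' LL j = (?ys @ [e]) ! j" if "j < length (?ys @ [e])" for j
      using that I(1,2) by (auto simp: upd nth_append less_Suc_eq)
    moreover have "ar s' LL j = xs ! j" if "j < length xs" "Suc i \<le> j" for j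
      using that I(1,3) ylen by (auto simp: upd)
    moreover have "oinv D sr ds (ar s' (LAB R)) (ar s' OC) (A \<union> {e \<in> set (take (Suc i) xs). \<not> core D sr ds xs e})"
    proof -
      have "{e \<in> set (take (Suc i) xs). \<not> core D sr ds xs e} = {e \<in> set (take i xs). \<not> core D sr ds xs e}"
        using keep by (auto simp: take)
      then show ?thesis using I(4) by (simp add: upd)
    qed
    moreover have "ar s' OC v \<le> oc0 v + dg sr ds (take (Suc i) xs) v \<and> (D < dg sr ds xs v \<longrightarrow> ar s' OC v = oc0 v)" for v
      using I(5)[rule_format, of v] mono[of v] by (auto simp: upd)
    moreover have "vr s' Vnew = length (?ys @ [e])" using I(1) by (simp add: upd)
    ultimately show ?thesis using I(6) ok unfolding ys by (simp add: upd)
  qed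
qed

definition round_c1 :: "nat \<Rightarrow> nat \<Rightarrow> nat" where
  "round_c1 R D = scost (deg0 R) + 4 + (scost (deg1 R) + 4 + (scost (pass R D) + 4))"

definition round_c2 :: nat where
  "round_c2 = 9 + scost (Asg Vnew (N 0) :: pprog) + scost (Asg Vlen (V Vnew) :: pprog)"

lemma round_spec:
  fixes s :: pst
  assumes h: "holds s xs" and xs: "distinct xs" "set xs \<inter> A = {}"
    and b: "2 * D \<le> b" "2 * length xs \<le> b"
    and sr: "sr = ar s (SRC R)" and ds: "ds = ar s (DST R)"
    and inv: "oinv D sr ds (ar s (LAB R)) (ar s OC) A"
    and oc: "\<And>v. 0 < dg sr ds xs v \<Longrightarrow> ar s OC v = 0"
  shows "tri b (round R D) s (round_c1 R D * length xs + round_c2) (\<lambda>s'. \<exists>ys. holds s' ys \<and> ys = filter (core D sr ds xs) xs \<and>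
       oinv D sr ds (ar s' (LAB R)) (ar s' OC) (A \<union> (set xs - set ys)) \<and>
       (\<forall>v. 0 < dg sr ds ys v \<longrightarrow> ar s' OC v = 0) \<and>
       (\<forall>e. e \<notin> set xs \<longrightarrow> ar s' (LAB R) e = ar s (LAB R) e))" (is "tri b _ s _ ?Q")
proof -
    let ?n = "length xs"
    let ?ys = "filter (core D sr ds xs) xs"
    have h': "vr s Vlen = ?n" "\<And>i. i < ?n \<Longrightarrow> ar s LL i = xs ! i" using h by (auto simp: holds_def)
    have "tri b (round R D) s ((1 + 2 + ?n * (scost (deg0 R) + 4)) + ((1 + 2 + ?n * (scost (deg1 R) + 4)) +
        (scost (Asg Vnew (N 0) :: pprog) + ((1 + 2 + ?n * (scost (pass R D) + 4)) + scost (Asg Vlen (V Vnew) :: pprog))))) ?Q"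
      unfolding round_def
    proof (rule tri_Sq)
      have "tri b (For Vi (V Vlen) (deg0 R)) s (ecost (V Vlen :: (vname, aname) aexp) + 2 + ?n * (scost (deg0 R) + 4))
          (\<lambda>s'. \<forall>j<?n. \<forall>v\<in>{sr (xs ! j), ds (xs ! j)}. ar s' DEG v = 0)"
      proof (rule tri_For_straight[where I = "\<lambda>m s'. \<forall>j<m. \<forall>v\<in>{sr (xs ! j), ds (xs ! j)}. ar s' DEG v = 0"])
        fix i and s' :: pst assume i: "i < ?n" "frame (For Vi (V Vlen) (deg0 R)) s s'"
          "\<forall>j<i. \<forall>v\<in>{sr (xs ! j), ds (xs ! j)}. ar s' DEG v = 0"
        then have "ar s' LL i = xs ! i" "ar s' (SRC R) = sr" "ar s' (DST R) = ds"
          using h' by (auto simp: frame_def sr ds)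
        then show "ok b (deg0 R) (setv Vi i s') \<and>
           (\<forall>j<Suc i. \<forall>v\<in>{sr (xs ! j), ds (xs ! j)}. ar (ev (deg0 R) (setv Vi i s')) DEG v = 0)"
          using i by (auto simp: deg0_def less_Suc_eq)
      qed (use h' b in \<open>auto simp: deg0_def\<close>)
      then show "tri b (For Vi (V Vlen) (deg0 R)) s (1 + 2 + ?n * (scost (deg0 R) + 4))
          (\<lambda>s'. \<forall>j<?n. \<forall>v\<in>{sr (xs ! j), ds (xs ! j)}. ar s' DEG v = 0)" by simp
    next
      fix s1 :: pst assume s1: "frame (For Vi (V Vlen) (deg0 R)) s s1"
        "\<forall>j<?n. \<forall>v\<in>{sr (xs ! j), ds (xs ! j)}. ar s1 DEG v = 0"
      have f1: "vr s1 Vlen = ?n" "ar s1 LL = ar s LL" "ar s1 (SRC R) = sr" "ar s1 (DST R) = ds"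
        "ar s1 OC = ar s OC" "ar s1 (LAB R) = ar s (LAB R)"
        using s1(1) h' by (auto simp: frame_def sr ds)
      show "tri b (For Vi (V Vlen) (deg1 R) ;; Asg Vnew (N 0) ;; For Vi (V Vlen) (pass R D) ;; Asg Vlen (V Vnew)) s1
        ((1 + 2 + ?n * (scost (deg1 R) + 4)) + (scost (Asg Vnew (N 0) :: pprog) + ((1 + 2 + ?n * (scost (pass R D) + 4)) + scost (Asg Vlen (V Vnew) :: pprog)))) ?Q"
      proof (rule tri_Sq)
        let ?I = "\<lambda>m (s' :: pst). \<forall>j<?n. \<forall>v\<in>{sr (xs ! j), ds (xs ! j)}. ar s' DEG v = dg sr ds (take m xs) v"
        have "tri b (For Vi (V Vlen) (deg1 R)) s1 (ecost (V Vlen :: (vname, aname) aexp) + 2 + ?n * (scost (deg1 R) + 4)) (?I ?n)"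
        proof (rule tri_For_straight[where I = ?I])
          fix i and s' :: pst assume i: "i < ?n" "frame (For Vi (V Vlen) (deg1 R)) s1 s'" "?I i s'"
          then have f: "ar s' LL i = xs ! i" "ar s' (SRC R) = sr" "ar s' (DST R) = ds"
            using h' f1 by (auto simp: frame_def)
          have le: "dg sr ds (take (Suc i) xs) v \<le> b" for v
            using dg_take_le[of sr ds "Suc i" xs v] dg_le[of sr ds xs v] b by linarith
          have at: "ar s' DEG (sr (xs ! i)) = dg sr ds (take i xs) (sr (xs ! i))"
            "ar s' DEG (ds (xs ! i)) = dg sr ds (take i xs) (ds (xs ! i))" using i by auto
          have "ok b (deg1 R) (setv Vi i s')"
            using le[of "sr (xs ! i)"] le[of "ds (xs ! i)"] i(1)
            by (auto simp: deg1_def f at dg_take_Suc split: if_splits)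
          moreover have "ar (ev (deg1 R) (setv Vi i s')) DEG =
              (\<lambda>v. ar s' DEG v + (if sr (xs ! i) = v then 1 else 0) + (if ds (xs ! i) = v then 1 else 0))"
            by (auto simp: deg1_def f fun_eq_iff)
          ultimately show "ok b (deg1 R) (setv Vi i s') \<and> ?I (Suc i) (ev (deg1 R) (setv Vi i s'))"
            using i by (simp add: dg_take_Suc)
        qed (use f1 b s1 in \<open>auto simp: deg1_def\<close>)
        then show "tri b (For Vi (V Vlen) (deg1 R)) s1 (1 + 2 + ?n * (scost (deg1 R) + 4)) (?I ?n)" by simp
      next
        fix s2 :: pst assume s2: "frame (For Vi (V Vlen) (deg1 R)) s1 s2"
          "\<forall>j<?n. \<forall>v\<in>{sr (xs ! j), ds (xs ! j)}. ar s2 DEG v = dg sr ds (take ?n xs) v"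
        have f2: "vr s2 Vlen = ?n" "ar s2 LL = ar s LL" "ar s2 (SRC R) = sr" "ar s2 (DST R) = ds"
          "ar s2 OC = ar s OC" "ar s2 (LAB R) = ar s (LAB R)"
          using s2(1) f1 by (auto simp: frame_def)
        have deg2: "\<forall>e\<in>set xs. \<forall>v\<in>{sr e, ds e}. ar s2 DEG v = dg sr ds xs v"
          using s2(2) by (auto simp: in_set_conv_nth)
        show "tri b (Asg Vnew (N 0) ;; For Vi (V Vlen) (pass R D) ;; Asg Vlen (V Vnew)) s2
          (scost (Asg Vnew (N 0) :: pprog) + ((1 + 2 + ?n * (scost (pass R D) + 4)) + scost (Asg Vlen (V Vnew) :: pprog))) ?Q"
        proof (rule tri_Sq)
          show "tri b (Asg Vnew (N 0)) s2 (scost (Asg Vnew (N 0) :: pprog)) (\<lambda>s'. vr s' Vnew = 0)"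
            by (rule tri_straight) auto
        next
          fix s3 :: pst assume s3: "frame (Asg Vnew (N 0)) s2 s3" "vr s3 Vnew = 0"
          have f3: "vr s3 Vlen = ?n" "ar s3 LL = ar s LL" "ar s3 (SRC R) = sr" "ar s3 (DST R) = ds"
            "ar s3 OC = ar s OC" "ar s3 (LAB R) = ar s (LAB R)" "ar s3 DEG = ar s2 DEG"
            using s3(1) f2 by (auto simp: frame_def)
          let ?f = "\<lambda>m. filter (core D sr ds xs) (take m xs)"
          let ?J = "\<lambda>m (s' :: pst). vr s' Vnew = length (?f m) \<and>
            (\<forall>j<length (?f m). ar s' LL j = ?f m ! j) \<and>
            (\<forall>j<?n. m \<le> j \<longrightarrow> ar s' LL j = xs ! j) \<and>
            oinv D sr ds (ar s' (LAB R)) (ar s' OC) (A \<union> {e \<in> set (take m xs). \<not> core D sr ds xs e}) \<and>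
            (\<forall>v. ar s' OC v \<le> ar s OC v + dg sr ds (take m xs) v \<and> (D < dg sr ds xs v \<longrightarrow> ar s' OC v = ar s OC v)) \<and>
            (\<forall>e. e \<notin> set xs \<longrightarrow> ar s' (LAB R) e = ar s (LAB R) e)"
          show "tri b (For Vi (V Vlen) (pass R D) ;; Asg Vlen (V Vnew)) s3
            ((1 + 2 + ?n * (scost (pass R D) + 4)) + scost (Asg Vlen (V Vnew) :: pprog)) ?Q"
          proof (rule tri_Sq)
            have "tri b (For Vi (V Vlen) (pass R D)) s3 (ecost (V Vlen :: (vname, aname) aexp) + 2 + ?n * (scost (pass R D) + 4)) (?J ?n)"
            proof (rule tri_For_straight[where I = ?J])
              fix i and s' :: pst assume i: "i < ?n" "bdd b s'" "frame (For Vi (V Vlen) (pass R D)) s3 s'" "?J i s'"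
              have f: "ar s' (SRC R) = sr" "ar s' (DST R) = ds" "ar s' DEG = ar s2 DEG"
                using i(3) f3 by (auto simp: frame_def)
              have "bdd b (setv Vi i s')" using i b by simp
              then show "ok b (pass R D) (setv Vi i s') \<and> ?J (Suc i) (ev (pass R D) (setv Vi i s'))"
              proof (rule pass_spec[where ?oc0.0 = "ar s OC" and ?lab0.0 = "ar s (LAB R)"])
                show "ar (setv Vi i s') (SRC R) = sr" "ar (setv Vi i s') (DST R) = ds"
                  "\<forall>e\<in>set xs. \<forall>v\<in>{sr e, ds e}. ar (setv Vi i s') DEG v = dg sr ds xs v"
                  using f deg2 by simp_all
                show "ar s OC v = 0" if "0 < dg sr ds xs v" for v using oc that by blast
                show "2 * D \<le> b" using b by simp
              qed (use i xs b in simp_all)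
            qed (use f3 b s3 inv h' in \<open>auto simp: pass_def\<close>)
            then show "tri b (For Vi (V Vlen) (pass R D)) s3 (1 + 2 + ?n * (scost (pass R D) + 4)) (?J ?n)" by simp
          next
            fix s4 :: pst assume s4: "frame (For Vi (V Vlen) (pass R D)) s3 s4" "?J ?n s4"
            show "tri b (Asg Vlen (V Vnew)) s4 (scost (Asg Vlen (V Vnew) :: pprog)) ?Q"
            proof (rule tri_straight)
              have yb: "length ?ys \<le> b" using b length_filter_le[of "core D sr ds xs" xs] by linarith
              have "A \<union> {e \<in> set xs. \<not> core D sr ds xs e} = A \<union> (set xs - set ?ys)" by auto
              \<comment> \<open>Vertices on surviving edges have degree above \<open>D\<close>, so
                none of them was a tail in this round.\<close>
              moreover have "0 < dg sr ds ?ys v \<longrightarrow> ar s4 OC v = 0" for v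
              proof
                assume "0 < dg sr ds ?ys v"
                then have "D < dg sr ds xs v"
                  by (auto simp: dg_def[of _ _ ?ys] filter_empty_conv core_def)
                then show "ar s4 OC v = 0" using s4(2) oc by auto
              qed
              ultimately show "ok b (Asg Vlen (V Vnew)) s4 \<and> ?Q (ev (Asg Vlen (V Vnew)) s4)"
                using s4(2) yb by (auto simp: holds_def)
            qed simp
          qed
        qed
      qed
    qed
    then show ?thesis
      by (rule tri_conseq) (simp_all add: round_c1_def round_c2_def algebra_simps)
qed

definition orient_c :: "nat \<Rightarrow> nat \<Rightarrow> nat" where
  "orient_c R D = 20 + scost (Put OC (V Vi) (N 0) :: pprog) + round_c2 + 2 * round_c1 R D"

text \<open>Each round at least halves the list, so \<open>r\<close> rounds empty it. The cost is a
  geometric series: the potential, \<open>2 * c1\<close> times the length of the list, drops by at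
  least the part of the cost of a round that depends on the length.\<close>

lemma orient_spec:
  fixes s :: pst
  assumes as: "vr s Vn = n" "vr s Vr = r" "n \<le> b" "r \<le> b" "8 * d \<le> b"
     "holds s xs" "distinct xs" "2 * length xs \<le> b" "sr = ar s (SRC R)" "ds = ar s (DST R)"
     "\<forall>e\<in>set xs. sr e < n \<and> ds e < n" "dense_at d sr ds (set xs)" "length xs < 2 ^ r"
  shows "tri b (orient R (4 * d)) s (orient_c R (4 * d) * (n + r + length xs + 1)) (\<lambda>s'.
       labelled (4 * d) sr ds (ar s' (LAB R)) (set xs) \<and>
       (\<forall>e. e \<notin> set xs \<longrightarrow> ar s' (LAB R) e = ar s (LAB R) e))" (is "tri b _ s _ ?Q")
proof -
  let ?D = "4 * d"
  define c1 where "c1 = round_c1 R ?D"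
  define c3 where "c3 = (Put OC (V Vi) (N 0) :: pprog)"
  have "tri b (orient R ?D) s ((1 + 2 + n * (scost c3 + 4)) + (1 + 2 + r * (round_c2 + 4) + 2 * c1 * length xs)) ?Q"
    unfolding orient_def c3_def[symmetric]
  proof (rule tri_Sq)
    have "tri b (For Vi (V Vn) c3) s (ecost (V Vn :: (vname, aname) aexp) + 2 + n * (scost c3 + 4))
        (\<lambda>s'. \<forall>v<n. ar s' OC v = 0)"
      by (rule tri_For_straight[where I = "\<lambda>m s'. \<forall>v<m. ar s' OC v = 0"])
        (use as in \<open>auto simp: c3_def less_Suc_eq\<close>)
    then show "tri b (For Vi (V Vn) c3) s (1 + 2 + n * (scost c3 + 4)) (\<lambda>s'. \<forall>v<n. ar s' OC v = 0)" by simp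
  next
    fix s1 :: pst assume s1: "frame (For Vi (V Vn) c3) s s1" "\<forall>v<n. ar s1 OC v = 0"
    have f1: "vr s1 Vr = r" "vr s1 Vlen = length xs" "ar s1 LL = ar s LL" "ar s1 (SRC R) = sr" "ar s1 (DST R) = ds"
      "ar s1 (LAB R) = ar s (LAB R)" using s1(1) as by (auto simp: frame_def c3_def holds_def)
    let ?J = "\<lambda>i (s' :: pst) ys. holds s' ys \<and> distinct ys \<and> set ys \<subseteq> set xs \<and> length ys * 2 ^ i \<le> length xs \<and>
       oinv ?D sr ds (ar s' (LAB R)) (ar s' OC) (set xs - set ys) \<and>
       (\<forall>v. 0 < dg sr ds ys v \<longrightarrow> ar s' OC v = 0) \<and>
       (\<forall>e. e \<notin> set xs \<longrightarrow> ar s' (LAB R) e = ar s (LAB R) e)"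
    let ?\<phi> = "\<lambda>i (s' :: pst). 2 * c1 * vr s' Vlen"
    have init: "?J 0 s1 xs"
    proof -
      have "ar s1 OC v = 0" if "0 < dg sr ds xs v" for v
      proof -
        have "\<exists>e\<in>set xs. sr e = v \<or> ds e = v" using that by (auto simp: dg_def filter_empty_conv)
        then show ?thesis using as(11) s1(2) by auto
      qed
      then show ?thesis using as f1 by (auto simp: holds_def oinv_def labelled_def)
    qed
    have "tri b (For Vrd (V Vr) (round R ?D)) s1
        (ecost (V Vr :: (vname, aname) aexp) + 2 + r * (round_c2 + 4) + ?\<phi> 0 s1) (\<lambda>s'. Ex (?J r s'))"
    proof (rule trq_For[where I = "\<lambda>i s'. Ex (?J i s')" and \<phi> = ?\<phi>])
      fix i and s' :: pst assume i: "i < r" "frame (For Vrd (V Vr) (round R ?D)) s1 s'" "Ex (?J i s')"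
      then obtain ys where ys: "?J i s' ys" by blast
      have f: "ar s' (SRC R) = sr" "ar s' (DST R) = ds" using i(2) f1 by (auto simp: frame_def)
      have "length ys \<le> length xs" using ys by (metis le_trans mult_le_mono2 nat_mult_1_right one_le_numeral one_le_power)
      then have "tri b (round R ?D) (setv Vrd i s') (c1 * length ys + round_c2) (\<lambda>s''. \<exists>zs. holds s'' zs \<and>
          zs = filter (core ?D sr ds ys) ys \<and>
          oinv ?D sr ds (ar s'' (LAB R)) (ar s'' OC) ((set xs - set ys) \<union> (set ys - set zs)) \<and>
          (\<forall>v. 0 < dg sr ds zs v \<longrightarrow> ar s'' OC v = 0) \<and>
          (\<forall>e. e \<notin> set ys \<longrightarrow> ar s'' (LAB R) e = ar (setv Vrd i s') (LAB R) e))"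
        unfolding c1_def
        by (intro round_spec) (use ys f as in \<open>auto simp: holds_def\<close>)
      then show "trq b (round R ?D) (setv Vrd i s')
          (\<lambda>t s''. t + 4 + ?\<phi> (Suc i) s'' \<le> round_c2 + 4 + ?\<phi> i s' \<and> Ex (?J (Suc i) s''))"
        unfolding tri_def
      proof (rule trq_conseq)
        fix t and s'' :: pst
        assume "t \<le> c1 * length ys + round_c2 \<and> (\<exists>zs. holds s'' zs \<and>
          zs = filter (core ?D sr ds ys) ys \<and>
          oinv ?D sr ds (ar s'' (LAB R)) (ar s'' OC) ((set xs - set ys) \<union> (set ys - set zs)) \<and>
          (\<forall>v. 0 < dg sr ds zs v \<longrightarrow> ar s'' OC v = 0) \<and>
          (\<forall>e. e \<notin> set ys \<longrightarrow> ar s'' (LAB R) e = ar (setv Vrd i s') (LAB R) e))"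
        then obtain zs where t: "t \<le> c1 * length ys + round_c2" and zs: "holds s'' zs"
          "zs = filter (core ?D sr ds ys) ys"
          "oinv ?D sr ds (ar s'' (LAB R)) (ar s'' OC) ((set xs - set ys) \<union> (set ys - set zs))"
          "\<forall>v. 0 < dg sr ds zs v \<longrightarrow> ar s'' OC v = 0"
          "\<forall>e. e \<notin> set ys \<longrightarrow> ar s'' (LAB R) e = ar (setv Vrd i s') (LAB R) e" by blast
        have half: "2 * length zs \<le> length ys"
          unfolding zs(2) by (rule core_halves[of d]) (use ys as in auto)
        have len: "vr s'' Vlen = length zs" "vr s' Vlen = length ys" using zs ys by (auto simp: holds_def)
        have "c1 * (2 * length zs) \<le> c1 * length ys" using half by (rule mult_left_mono) simp
        then have "t + 4 + ?\<phi> (Suc i) s'' \<le> round_c2 + 4 + ?\<phi> i s'"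
          using t unfolding len by linarith
        moreover have "length zs * 2 ^ Suc i \<le> length ys * 2 ^ i"
          using mult_right_mono[OF half, of "2 ^ i"] by simp
        then have "length zs * 2 ^ Suc i \<le> length xs" using ys by linarith
        moreover have "(set xs - set ys) \<union> (set ys - set zs) = set xs - set zs" using ys zs(2) by auto
        ultimately have "?J (Suc i) s'' zs" and "t + 4 + ?\<phi> (Suc i) s'' \<le> round_c2 + 4 + ?\<phi> i s'"
          using zs ys by auto
        then show "t + 4 + ?\<phi> (Suc i) s'' \<le> round_c2 + 4 + ?\<phi> i s' \<and> Ex (?J (Suc i) s'')" by blast
      qed
    qed (use as f1 init in auto)
    then show "tri b (For Vrd (V Vr) (round R ?D)) s1 (1 + 2 + r * (round_c2 + 4) + 2 * c1 * length xs) ?Q"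
    proof (rule tri_conseq)
      fix s' :: pst assume "Ex (?J r s')"
      then obtain ys where ys: "?J r s' ys" by blast
      have "length ys = 0"
      proof (rule ccontr)
        assume "length ys \<noteq> 0"
        then have "1 * 2 ^ r \<le> length ys * 2 ^ r" by (intro mult_le_mono1) (simp add: Suc_le_eq)
        then show False using ys as(13) by linarith
      qed
      then show "?Q s'" using ys by (simp add: oinv_def)
    qed (simp add: f1)
  qed
  then show ?thesis
    by (rule tri_conseq) (simp_all add: orient_c_def c1_def c3_def algebra_simps)
qed

section \<open>Contracting coloured cycles\<close>

text \<open>A walk with a label \<open>w\<close> recording all its vertices except the last, each as
  a base-\<open>n\<close> digit at the place given by its colour. Labels of consecutive walks add
  up, and the label of a closed walk that meets every colour once determines its vertices.\<close>

definition gpath :: "(nat \<Rightarrow> nat \<Rightarrow> bool) \<Rightarrow> (nat \<Rightarrow> nat) \<Rightarrow> nat \<Rightarrow> nat \<Rightarrow> nat \<Rightarrow> nat \<Rightarrow> nat \<Rightarrow> bool" where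
  "gpath E col n l u v w \<longleftrightarrow> (\<exists>f. f 0 = u \<and> f l = v \<and> (\<forall>i<l. E (f i) (f (Suc i))) \<and>
     w = (\<Sum>i<l. f i * n ^ col (f i)))"

lemma gpath_edge: "E u v \<Longrightarrow> gpath E col n 1 u v (u * n ^ col u)"
  unfolding gpath_def by (intro exI[of _ "\<lambda>i. if i = 0 then u else v"]) auto

lemma gpath_append:
  assumes "gpath E col n l u v w" "gpath E col n l' v x w'"
  shows "gpath E col n (l + l') u x (w + w')"
proof -
  obtain f where f: "f 0 = u" "f l = v" "\<And>i. i < l \<Longrightarrow> E (f i) (f (Suc i))"
    "w = (\<Sum>i<l. f i * n ^ col (f i))" using assms(1) by (auto simp: gpath_def)
  obtain g where g: "g 0 = v" "g l' = x" "\<And>i. i < l' \<Longrightarrow> E (g i) (g (Suc i))"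
    "w' = (\<Sum>i<l'. g i * n ^ col (g i))" using assms(2) by (auto simp: gpath_def)
  define h where "h i = (if i < l then f i else g (i - l))" for i
  have "E (h i) (h (Suc i))" if "i < l + l'" for i
  proof -
    consider "Suc i < l" | "Suc i = l" | "l \<le> i" by linarith
    then show ?thesis
    proof cases
      case 2
      then have "E (f i) (f (Suc i))" "f (Suc i) = g 0" using f g by auto
      then show ?thesis using 2 by (simp add: h_def)
    next
      case 3
      then show ?thesis using g(3)[of "i - l"] that by (simp add: h_def Suc_diff_le)
    qed (use f in \<open>auto simp: h_def\<close>)
  qed
  moreover have "(\<Sum>i<l + l'. h i * n ^ col (h i)) = w + w'"
  proof -
    have "(\<Sum>i<l + m. h i * n ^ col (h i)) = (\<Sum>i<l. f i * n ^ col (f i)) + (\<Sum>i<m. g i * n ^ col (g i))" for m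
      by (induction m) (simp_all add: h_def)
    then show ?thesis using f g by simp
  qed
  moreover have "h 0 = u" using f g by (cases l) (auto simp: h_def)
  moreover have "h (l + l') = x" using g by (simp add: h_def)
  ultimately show ?thesis unfolding gpath_def by (intro exI[of _ h]) auto
qed

lemma gpath_bound:
  assumes E: "\<And>u v. E u v \<Longrightarrow> u < n \<and> col u < k" and "gpath E col n l u v w" "l \<le> k"
  shows "w \<le> k * n ^ (k + 1)"
proof -
  obtain f where f: "\<And>i. i < l \<Longrightarrow> E (f i) (f (Suc i))"
    "w = (\<Sum>i<l. f i * n ^ col (f i))" using assms(2) by (auto simp: gpath_def)
  have "f i * n ^ col (f i) \<le> n ^ (k + 1)" if "i < l" for i
  proof -
    have fi: "f i < n" "col (f i) < k" using E f(1)[OF that] by auto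
    then have "n ^ col (f i) \<le> n ^ k" by (intro power_increasing) auto
    with fi have "f i * n ^ col (f i) \<le> n * n ^ k" by (intro mult_mono) auto
    then show ?thesis by simp
  qed
  then have "w \<le> (\<Sum>i<l. n ^ (k + 1))" unfolding f(2) by (intro sum_mono) auto
  also have "\<dots> \<le> k * n ^ (k + 1)" using assms(3) by (simp add: mult_le_mono1)
  finally show ?thesis .
qed

text \<open>The records \<open>e < M\<close> of class \<open>i < r\<close> stand for coloured paths from the part \<open>X i\<close> to the part
  \<open>X (i + 1)\<close>, cyclically; together they form a graph of the family.\<close>

definition sound :: "ugraph set \<Rightarrow> (nat \<Rightarrow> nat \<Rightarrow> bool) \<Rightarrow> (nat \<Rightarrow> nat) \<Rightarrow> nat \<Rightarrow> nat \<Rightarrow> nat \<Rightarrow> nat \<Rightarrow>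
    (nat \<Rightarrow> nat) \<Rightarrow> (nat \<Rightarrow> nat) \<Rightarrow> (nat \<Rightarrow> nat) \<Rightarrow> (nat \<Rightarrow> nat) \<Rightarrow> bool" where
  "sound F E col n k M r sr ds cl wt \<longleftrightarrow> (\<exists>X l.
     (\<forall>e<M. cl e < r \<longrightarrow> sr e \<in> X (cl e) \<and> ds e \<in> X (Suc (cl e) mod r) \<and>
        gpath E col n (l (cl e)) (sr e) (ds e) (wt e)) \<and>
     (\<forall>i<r. \<forall>j<r. i \<noteq> j \<longrightarrow> X i \<inter> X j = {}) \<and> (\<forall>i<r. X i \<subseteq> {..<n}) \<and> (\<Sum>i<r. l i) = k \<and>
     (2 \<le> r \<longrightarrow> (\<exists>U. \<lparr>verts = U, edges = {{sr e, ds e} | e. e < M \<and> cl e < r}\<rparr> \<in> F)))"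

text \<open>The completeness counterpart of \<open>sound\<close>: one record of each class, closing
  up cyclically. The search must succeed whenever such records exist.\<close>

definition surv :: "nat \<Rightarrow> nat \<Rightarrow> (nat \<Rightarrow> nat) \<Rightarrow> (nat \<Rightarrow> nat) \<Rightarrow> (nat \<Rightarrow> nat) \<Rightarrow> bool" where
  "surv M r sr ds cl \<longleftrightarrow> (\<exists>x. \<forall>i<r. \<exists>e<M. cl e = i \<and> sr e = x i \<and> ds e = x (Suc i mod r))"

text \<open>Combines \<open>contract_stars\<close> with passing to a subgraph, since only the
  surviving records are kept as edges.\<close>

lemma contract_stars_subgraph:
  assumes cl: "graph_closed F" and G: "\<lparr>verts = U, edges = ES\<rparr> \<in> F"
    and g: "\<And>b. b \<in> B \<Longrightarrow> g b \<notin> B \<and> {b, g b} \<in> ES"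
    and ES': "\<And>e'. e' \<in> ES' \<Longrightarrow> \<exists>x y. {x, y} \<in> ES \<and>
      e' = {if x \<in> B then g x else x, if y \<in> B then g y else y} \<and> card e' = 2"
  shows "\<lparr>verts = U - B, edges = ES'\<rparr> \<in> F"
proof -
  let ?G = "\<lparr>verts = U, edges = ES\<rparr>"
  let ?h = "\<lambda>x. if x \<in> B then g x else x"
  have sG: "simple_graph ?G" using cl G by (simp add: graph_closed_def)
  have BU: "B \<subseteq> verts ?G"
  proof
    fix b assume "b \<in> B"
    then have "{b, g b} \<in> edges ?G" using g by simp
    then have "{b, g b} \<subseteq> verts ?G" using sG unfolding simple_graph_def by blast
    then show "b \<in> verts ?G" by simp
  qed
  have "finite B" using BU sG finite_subset by (auto simp: simple_graph_def)
  from contract_stars[OF cl this G BU, of g] g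
  have H: "\<lparr>verts = U - B, edges = {e \<in> (\<lambda>e. ?h ` e) ` ES. card e = 2}\<rparr> \<in> F" (is "?H \<in> F") by simp
  then have sH: "simple_graph ?H" using cl unfolding graph_closed_def by blast
  have "ES' \<subseteq> edges ?H"
  proof
    fix e' assume "e' \<in> ES'"
    with ES' obtain x y where "{x, y} \<in> ES" "e' = {?h x, ?h y}" "card e' = 2" by blast
    moreover have "{?h x, ?h y} = ?h ` {x, y}" by (simp only: image_insert image_empty)
    ultimately have "e' \<in> (\<lambda>e. ?h ` e) ` ES" "card e' = 2" by (blast, blast)
    then show "e' \<in> edges ?H" by (simp only: ugraph.simps mem_Collect_eq simp_thms)
  qed
  then have "subgraph \<lparr>verts = U - B, edges = ES'\<rparr> ?H"
    using sH by (auto simp: subgraph_def simple_graph_def)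
  then show ?thesis using cl H unfolding graph_closed_def by blast
qed

text \<open>The class whose records have to be redirected: those of class \<open>r - 1\<close> end
  in the last part, those of class \<open>0\<close> start in part \<open>0\<close>. The end
  concerned is given by \<open>key\<close>.\<close>

definition target :: "bool \<Rightarrow> nat \<Rightarrow> nat" where
  "target fw r = (if fw then r - 1 else 0)"

definition key :: "bool \<Rightarrow> (nat \<Rightarrow> nat) \<Rightarrow> (nat \<Rightarrow> nat) \<Rightarrow> nat \<Rightarrow> nat" where
  "key fw sr ds e = (if fw then ds e else sr e)"

text \<open>One contraction step from level \<open>Suc r\<close> to level \<open>r\<close>. The records of class \<open>r\<close> run from the last part to part \<open>0\<close>. If
  \<open>fw\<close> holds, the vertices of the last part are merged into part \<open>0\<close>, and otherwise conversely;
  \<open>ff b - 1\<close> is the record along which \<open>b\<close> is merged.\<close>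

lemma sound_step:
  assumes cl: "graph_closed F" and S: "sound F E col n k M (Suc r) sr ds cl wt" and r: "1 \<le> r" "r \<le> k"
    and ff: "\<And>b. b < n \<Longrightarrow> ff b \<noteq> 0 \<Longrightarrow> ff b - 1 < M \<and> cl (ff b - 1) = r \<and> key (\<not> fw) sr ds (ff b - 1) = b"
    and cl': "\<And>e. e < M \<Longrightarrow> cl' e =
      (if cl e = target fw r \<and> ff (key fw sr ds e) = 0 then k else cl e)"
    and ch: "\<And>e. e < M \<Longrightarrow> cl e = target fw r \<Longrightarrow> ff (key fw sr ds e) \<noteq> 0 \<Longrightarrow>
      sr' e = (if fw then sr e else sr (ff (sr e) - 1)) \<and> ds' e = (if fw then ds (ff (ds e) - 1) else ds e) \<and>
      wt' e = wt e + wt (ff (key fw sr ds e) - 1)"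
    and same: "\<And>e. e < M \<Longrightarrow> cl e \<noteq> target fw r \<Longrightarrow> sr' e = sr e \<and> ds' e = ds e \<and> wt' e = wt e"
  shows "sound F E col n k M r sr' ds' cl' wt'"
proof -
  obtain X l where X: "\<forall>e<M. cl e < Suc r \<longrightarrow> sr e \<in> X (cl e) \<and> ds e \<in> X (Suc (cl e) mod Suc r) \<and>
        gpath E col n (l (cl e)) (sr e) (ds e) (wt e)"
     "\<forall>i<Suc r. \<forall>j<Suc r. i \<noteq> j \<longrightarrow> X i \<inter> X j = {}" "\<forall>i<Suc r. X i \<subseteq> {..<n}" "(\<Sum>i<Suc r. l i) = k"
     and "2 \<le> Suc r \<longrightarrow> (\<exists>U. \<lparr>verts = U, edges = {{sr e, ds e} | e. e < M \<and> cl e < Suc r}\<rparr> \<in> F)"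
    using S unfolding sound_def by blast
  note X = X[rule_format]
  have "2 \<le> Suc r" using r by simp
  then obtain U where G: "\<lparr>verts = U, edges = {{sr e, ds e} | e. e < M \<and> cl e < Suc r}\<rparr> \<in> F"
    using \<open>2 \<le> Suc r \<longrightarrow> _\<close> by blast
  have last: "sr e \<in> X r" "ds e \<in> X 0" "gpath E col n (l r) (sr e) (ds e) (wt e)" if "e < M" "cl e = r" for e
    using X(1)[OF that(1)] that by auto
  have nxt: "ds e \<in> X (Suc (cl e))" if "e < M" "cl e < r" for e using X(1)[of e] that by simp
  show ?thesis
  proof (cases fw)
    case True
    \<comment> \<open>Records of class \<open>r - 1\<close> absorb one of class \<open>r\<close>, so
      their lengths add and the total remains \<open>k\<close>.\<close>
    let ?l = "l(r - 1 := l (r - 1) + l r)"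
    have tg: "target fw r = r - 1" "\<And>e. key fw sr ds e = ds e" "\<And>e. key (\<not> fw) sr ds e = sr e"
      using True by (auto simp: target_def key_def)
    have chT: "sr' e = sr e \<and> ds' e = ds (ff (ds e) - 1) \<and> wt' e = wt e + wt (ff (ds e) - 1)"
      if "e < M" "cl e = r - 1" "ff (ds e) \<noteq> 0" for e
      using ch[OF that(1), unfolded tg] that True by simp
    \<comment> \<open>Class \<open>k\<close> means deleted: as \<open>r \<le> k\<close>, it is not
      below \<open>r\<close>. It is given to records whose end in the merged part has no star
      edge.\<close>
    have alive: "cl' e = cl e \<and> (cl e = r - 1 \<longrightarrow> ff (ds e) \<noteq> 0)" if "e < M" "cl' e < r" for e
      using cl'[OF that(1)] that r by (auto simp: tg split: if_splits)
    have mrg: "ff (ds e) - 1 < M \<and> cl (ff (ds e) - 1) = r \<and> sr (ff (ds e) - 1) = ds e"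
      if "e < M" "cl e = r - 1" "ff (ds e) \<noteq> 0" for e
    proof -
      have "ds e \<in> X r" using nxt[of e] that r by simp
      then have "ds e < n" using X(3)[of r] by auto
      then show ?thesis using ff[of "ds e"] that by (simp add: tg)
    qed
    have rec: "sr' e \<in> X (cl' e) \<and> ds' e \<in> X (Suc (cl' e) mod r) \<and> gpath E col n (?l (cl' e)) (sr' e) (ds' e) (wt' e)"
      if e: "e < M" "cl' e < r" for e
    proof (cases "cl e = r - 1")
      case c: True
      let ?g = "ff (ds e) - 1"
      have nz: "ff (ds e) \<noteq> 0" and cc: "cl' e = r - 1" using alive[OF e] c by auto
      have g: "?g < M" "cl ?g = r" "sr ?g = ds e" using mrg[OF e(1) c nz] by auto
      have new: "sr' e = sr e" "ds' e = ds ?g" "wt' e = wt e + wt ?g"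
        using chT[OF e(1) c nz] by auto
      have p1: "gpath E col n (l (r - 1)) (sr e) (ds e) (wt e)" using X(1)[OF e(1)] c r by simp
      have p2: "gpath E col n (l r) (ds e) (ds ?g) (wt ?g)" using last(3)[OF g(1,2)] g(3) by simp
      note p = gpath_append[OF p1 p2]
      show ?thesis using p new cc X(1)[OF e(1)] c r last(2)[OF g(1,2)] by simp
    next
      case c: False
      have cc: "cl' e = cl e" using alive[OF e] by auto
      have "Suc (cl e) < r" using cc e(2) c r by linarith
      then show ?thesis using same[OF e(1)] c cc e(2) X(1)[OF e(1)] nxt[OF e(1)] by (simp add: tg)
    qed
    \<comment> \<open>Restricted to \<open>2 \<le> r\<close>, because for \<open>r = 1\<close> the
      records become loops. For larger \<open>r\<close> the two ends lie in different parts, so no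
      surviving record collapses.\<close>
    have gr: "\<exists>U. \<lparr>verts = U, edges = {{sr' e, ds' e} | e. e < M \<and> cl' e < r}\<rparr> \<in> F" if r2: "2 \<le> r"
    proof (intro exI, rule contract_stars_subgraph[OF cl G])
      define B where "B = {b \<in> X r. ff b \<noteq> 0}"
      define g where "g b = ds (ff b - 1)" for b
      show "g b \<notin> B \<and> {b, g b} \<in> {{sr e, ds e} | e. e < M \<and> cl e < Suc r}" if "b \<in> B" for b
      proof -
        have "b < n" "ff b \<noteq> 0" using that X(3)[of r] by (auto simp: B_def)
        then have f: "ff b - 1 < M" "cl (ff b - 1) = r" "sr (ff b - 1) = b" using ff[of b] by (auto simp: tg)
        then have "g b \<in> X 0" using last by (simp add: g_def)
        moreover have "X 0 \<inter> X r = {}" using X(2)[of 0 r] r by simp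
        ultimately have "g b \<notin> B" by (auto simp: B_def)
        moreover have "{b, g b} = {sr (ff b - 1), ds (ff b - 1)}" using f by (simp add: g_def)
        moreover have "ff b - 1 < M \<and> cl (ff b - 1) < Suc r" using f by simp
        ultimately show ?thesis by blast
      qed
      fix e' assume "e' \<in> {{sr' e, ds' e} | e. e < M \<and> cl' e < r}"
      then obtain e where e: "e < M" "cl' e < r" "e' = {sr' e, ds' e}" by blast
      have cc: "cl' e = cl e" using alive[OF e(1,2)] by auto
      have ne: "sr' e \<noteq> ds' e"
      proof -
        have "Suc (cl' e) mod r \<noteq> cl' e"
        proof (cases "Suc (cl' e) = r")
          case False
          then show ?thesis using e(2) by simp
        qed (use r2 in auto)
        then have "X (cl' e) \<inter> X (Suc (cl' e) mod r) = {}"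
          using e(2) by (intro X(2)) (auto intro: less_SucI)
        then show ?thesis using rec[OF e(1,2)] by auto
      qed
      have sB: "sr e \<notin> B"
      proof -
        have "X (cl e) \<inter> X r = {}" using e(2) cc by (intro X(2)) auto
        then show ?thesis using X(1)[OF e(1)] e(2) cc by (auto simp: B_def)
      qed
      have "sr' e = (if sr e \<in> B then g (sr e) else sr e) \<and> ds' e = (if ds e \<in> B then g (ds e) else ds e)"
      proof (cases "cl e = r - 1")
        case c: True
        have nz: "ff (ds e) \<noteq> 0" using alive[OF e(1,2)] c by auto
        have "ds e \<in> B" using nxt[of e] e(1) c r nz by (simp add: B_def)
        then show ?thesis using sB chT[OF e(1) c nz] by (auto simp: g_def)
      next
        case c: False
        have "X (Suc (cl e)) \<inter> X r = {}" using e(2) cc c by (intro X(2)) auto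
        then have "ds e \<notin> B" using nxt[OF e(1)] e(2) cc by (auto simp: B_def)
        then show ?thesis using sB same[OF e(1)] c by (auto simp: tg)
      qed
      then show "\<exists>x y. {x, y} \<in> {{sr e, ds e} | e. e < M \<and> cl e < Suc r} \<and>
          e' = {if x \<in> B then g x else x, if y \<in> B then g y else y} \<and> card e' = 2"
        using e cc ne by (intro exI[of _ "sr e"] exI[of _ "ds e"]) auto
    qed
    have "(\<Sum>i<r. ?l i) = k"
    proof -
      obtain q where q: "r = Suc q" using r by (cases r) auto
      show ?thesis using X(4) by (simp add: q)
    qed
    then show ?thesis unfolding sound_def
      using rec X(2,3) gr by (intro exI[of _ X] exI[of _ ?l]) auto
  next
    case False
    let ?l = "l(0 := l r + l 0)"
    \<comment> \<open>Part \<open>0\<close> disappears into the last part, which becomes the new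
      part \<open>0\<close>.\<close>
    let ?X = "X(0 := X r)"
    have tg: "target fw r = 0" "\<And>e. key fw sr ds e = sr e" "\<And>e. key (\<not> fw) sr ds e = ds e"
      using False by (auto simp: target_def key_def)
    have chF: "sr' e = sr (ff (sr e) - 1) \<and> ds' e = ds e \<and> wt' e = wt e + wt (ff (sr e) - 1)"
      if "e < M" "cl e = 0" "ff (sr e) \<noteq> 0" for e
      using ch[OF that(1), unfolded tg] that False by simp
    have alive: "cl' e = cl e \<and> (cl e = 0 \<longrightarrow> ff (sr e) \<noteq> 0)" if "e < M" "cl' e < r" for e
      using cl'[OF that(1)] that r by (auto simp: tg split: if_splits)
    have mrg: "ff (sr e) - 1 < M \<and> cl (ff (sr e) - 1) = r \<and> ds (ff (sr e) - 1) = sr e"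
      if "e < M" "cl e = 0" "ff (sr e) \<noteq> 0" for e
    proof -
      have "sr e \<in> X 0" using X(1)[of e] that r by simp
      then have "sr e < n" using X(3)[of 0] by auto
      then show ?thesis using ff[of "sr e"] that by (simp add: tg)
    qed
    have wrap: "ds e \<in> ?X (Suc (cl e) mod r)" if "e < M" "cl e < r" for e
    proof (cases "Suc (cl e) = r")
      case True
      then show ?thesis using nxt[OF that] by simp
    next
      case False
      then show ?thesis using nxt[OF that] that by simp
    qed
    have rec: "sr' e \<in> ?X (cl' e) \<and> ds' e \<in> ?X (Suc (cl' e) mod r) \<and> gpath E col n (?l (cl' e)) (sr' e) (ds' e) (wt' e)"
      if e: "e < M" "cl' e < r" for e
    proof (cases "cl e = 0")
      case c: True
      let ?g = "ff (sr e) - 1"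
      have nz: "ff (sr e) \<noteq> 0" and cc: "cl' e = 0" using alive[OF e] c by auto
      have g: "?g < M" "cl ?g = r" "ds ?g = sr e" using mrg[OF e(1) c nz] by auto
      have new: "sr' e = sr ?g" "ds' e = ds e" "wt' e = wt e + wt ?g"
        using chF[OF e(1) c nz] by auto
      have p2: "gpath E col n (l 0) (sr e) (ds e) (wt e)" using X(1)[OF e(1)] c r by simp
      have p1: "gpath E col n (l r) (sr ?g) (sr e) (wt ?g)" using last(3)[OF g(1,2)] g(3) by simp
      note p = gpath_append[OF p1 p2]
      show ?thesis using p new cc wrap[OF e(1)] c r last(1)[OF g(1,2)] by (simp add: add.commute)
    next
      case c: False
      have cc: "cl' e = cl e" using alive[OF e] by auto
      then show ?thesis using same[OF e(1)] c cc e(2) X(1)[OF e(1)] wrap[OF e(1)] by (simp add: tg)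
    qed
    have disj: "?X i \<inter> ?X j = {}" if "i < r" "j < r" "i \<noteq> j" for i j
      using X(2)[of i j] X(2)[of r j] X(2)[of i r] that by auto
    have gr: "\<exists>U. \<lparr>verts = U, edges = {{sr' e, ds' e} | e. e < M \<and> cl' e < r}\<rparr> \<in> F" if r2: "2 \<le> r"
    proof (intro exI, rule contract_stars_subgraph[OF cl G])
      define B where "B = {b \<in> X 0. ff b \<noteq> 0}"
      define g where "g b = sr (ff b - 1)" for b
      show "g b \<notin> B \<and> {b, g b} \<in> {{sr e, ds e} | e. e < M \<and> cl e < Suc r}" if "b \<in> B" for b
      proof -
        have "b < n" "ff b \<noteq> 0" using that X(3)[of 0] by (auto simp: B_def)
        then have f: "ff b - 1 < M" "cl (ff b - 1) = r" "ds (ff b - 1) = b" using ff[of b] by (auto simp: tg)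
        then have "g b \<in> X r" using last by (simp add: g_def)
        moreover have "X 0 \<inter> X r = {}" using X(2)[of 0 r] r by simp
        ultimately have "g b \<notin> B" by (auto simp: B_def)
        moreover have "{b, g b} = {sr (ff b - 1), ds (ff b - 1)}" using f by (simp add: g_def insert_commute)
        moreover have "ff b - 1 < M \<and> cl (ff b - 1) < Suc r" using f by simp
        ultimately show ?thesis by blast
      qed
      fix e' assume "e' \<in> {{sr' e, ds' e} | e. e < M \<and> cl' e < r}"
      then obtain e where e: "e < M" "cl' e < r" "e' = {sr' e, ds' e}" by blast
      have cc: "cl' e = cl e" using alive[OF e(1,2)] by auto
      have ne: "sr' e \<noteq> ds' e"
      proof -
        have "Suc (cl' e) mod r \<noteq> cl' e"
        proof (cases "Suc (cl' e) = r")
          case False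
          then show ?thesis using e(2) by simp
        qed (use r2 in auto)
        then have "?X (cl' e) \<inter> ?X (Suc (cl' e) mod r) = {}"
          using e(2) by (intro disj) auto
        then show ?thesis using rec[OF e(1,2)] by auto
      qed
      have dB: "ds e \<notin> B"
      proof -
        have "X (Suc (cl e)) \<inter> X 0 = {}" using e(2) cc by (intro X(2)) auto
        then show ?thesis using nxt[OF e(1)] e(2) cc by (auto simp: B_def)
      qed
      have "sr' e = (if sr e \<in> B then g (sr e) else sr e) \<and> ds' e = (if ds e \<in> B then g (ds e) else ds e)"
      proof (cases "cl e = 0")
        case c: True
        have nz: "ff (sr e) \<noteq> 0" using alive[OF e(1,2)] c by auto
        have "sr e \<in> B" using X(1)[OF e(1)] c r nz by (simp add: B_def)
        then show ?thesis using dB chF[OF e(1) c nz] by (auto simp: g_def)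
      next
        case c: False
        have "X (cl e) \<inter> X 0 = {}" using e(2) cc c by (intro X(2)) auto
        then have "sr e \<notin> B" using X(1)[OF e(1)] e(2) cc by (auto simp: B_def)
        then show ?thesis using dB same[OF e(1)] c by (auto simp: tg)
      qed
      then show "\<exists>x y. {x, y} \<in> {{sr e, ds e} | e. e < M \<and> cl e < Suc r} \<and>
          e' = {if x \<in> B then g x else x, if y \<in> B then g y else y} \<and> card e' = 2"
        using e cc ne by (intro exI[of _ "sr e"] exI[of _ "ds e"]) auto
    qed
    have "(\<Sum>i<r. ?l i) = k"
    proof -
      obtain q where q: "r = Suc q" using r by (cases r) auto
      have "(\<Sum>i<Suc q. ?l i) = ?l 0 + (\<Sum>i<q. ?l (Suc i))" "(\<Sum>i<Suc q. l i) = l 0 + (\<Sum>i<q. l (Suc i))"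
        by (rule sum.lessThan_Suc_shift)+
      then show ?thesis using X(4) unfolding q by simp
    qed
    moreover have "?X i \<subseteq> {..<n}" if "i < r" for i using X(3)[of i] X(3)[of r] that by auto
    ultimately show ?thesis unfolding sound_def
      using rec disj gr by (intro exI[of _ ?X] exI[of _ ?l]) blast
  qed
qed

text \<open>If the record \<open>e0\<close> of class \<open>r\<close> on the cycle is the star edge
  stored at its merged end, then contracting it shortens the cycle by one record, and the redirected
  record of class \<open>target fw r\<close> closes the gap.\<close>

lemma surv_step:
  assumes x: "\<And>i. i < Suc r \<Longrightarrow> \<exists>e<M. cl e = i \<and> sr e = x i \<and> ds e = x (Suc i mod Suc r)" and r: "1 \<le> r"
    and e0: "sr e0 = x r" "ds e0 = x 0" "ff (if fw then x r else x 0) = Suc e0"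
    and cl': "\<And>e. e < M \<Longrightarrow> cl' e =
      (if cl e = target fw r \<and> ff (key fw sr ds e) = 0 then k else cl e)"
    and ch: "\<And>e. e < M \<Longrightarrow> cl e = target fw r \<Longrightarrow> ff (key fw sr ds e) \<noteq> 0 \<Longrightarrow>
      sr' e = (if fw then sr e else sr (ff (sr e) - 1)) \<and> ds' e = (if fw then ds (ff (ds e) - 1) else ds e) \<and>
      wt' e = wt e + wt (ff (key fw sr ds e) - 1)"
    and same: "\<And>e. e < M \<Longrightarrow> cl e \<noteq> target fw r \<Longrightarrow> sr' e = sr e \<and> ds' e = ds e \<and> wt' e = wt e"
  shows "surv M r sr' ds' cl'"
proof (cases fw)
  case True
  have tg: "target fw r = r - 1" "\<And>e. key fw sr ds e = ds e"
    using True by (auto simp: target_def key_def)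
    have chT: "sr' e = sr e \<and> ds' e = ds (ff (ds e) - 1) \<and> wt' e = wt e + wt (ff (ds e) - 1)"
      if "e < M" "cl e = r - 1" "ff (ds e) \<noteq> 0" for e
      using ch[OF that(1), unfolded tg] that True by simp
  have "\<exists>e<M. cl' e = i \<and> sr' e = x i \<and> ds' e = x (Suc i mod r)" if i: "i < r" for i
  proof -
    obtain e where e: "e < M" "cl e = i" "sr e = x i" "ds e = x (Suc i mod Suc r)" using x[of i] i by auto
    show ?thesis
    proof (cases "i = r - 1")
      case c: True
      then have d: "ds e = x r" "Suc i mod r = 0" using e r by auto
      have f: "ff (x r) = Suc e0" using e0(3) True by simp
      have "cl e = r - 1" "ff (ds e) \<noteq> 0" using d f e c by auto
      from chT[OF e(1) this] cl'[OF e(1), unfolded tg] show ?thesis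
        using e d f e0(2) by (intro exI[of _ e]) auto
    next
      case c: False
      then have "Suc i < r" using i by linarith
      then show ?thesis using cl'[OF e(1)] same[OF e(1)] e e0 c by (auto simp: tg)
    qed
  qed
  then show ?thesis unfolding surv_def by blast
next
  case False
  have tg: "target fw r = 0" "\<And>e. key fw sr ds e = sr e"
    using False by (auto simp: target_def key_def)
  let ?x = "x(0 := x r)"
    have chF: "sr' e = sr (ff (sr e) - 1) \<and> ds' e = ds e \<and> wt' e = wt e + wt (ff (sr e) - 1)"
      if "e < M" "cl e = 0" "ff (sr e) \<noteq> 0" for e
      using ch[OF that(1), unfolded tg] that False by simp
  have "\<exists>e<M. cl' e = i \<and> sr' e = ?x i \<and> ds' e = ?x (Suc i mod r)" if i: "i < r" for i
  proof -
    obtain e where e: "e < M" "cl e = i" "sr e = x i" "ds e = x (Suc i mod Suc r)" using x[of i] i by auto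
    have d: "ds e = ?x (Suc i mod r)" using e(4) i by (cases "Suc i = r") auto
    show ?thesis
    proof (cases "i = 0")
      case c: True
      have f: "ff (x 0) = Suc e0" using e0(3) False by simp
      have "cl e = 0" "ff (sr e) \<noteq> 0" using f e c by auto
      from chF[OF e(1) this] cl'[OF e(1), unfolded tg] show ?thesis
        using e(1-3) d f e0(1) c by (intro exI[of _ e]) auto
    next
      case c: False
      then show ?thesis using cl'[OF e(1)] same[OF e(1)] e(1-3) d e0 by (auto simp: tg)
    qed
  qed
  then show ?thesis unfolding surv_def by blast
qed

lemma sound_range:
  assumes "sound F E col n k M r sr ds cl wt" "e < M" "cl e < r"
  shows "sr e < n" "ds e < n"
proof -
  have "Suc (cl e) mod r < r" using assms(3) by simp
  then show "sr e < n" "ds e < n" using assms unfolding sound_def by blast+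
qed

lemma sound_weight:
  assumes S: "sound F E col n k M r sr ds cl wt" "e < M" "cl e < r"
    and E: "\<And>u v. E u v \<Longrightarrow> u < n \<and> col u < k"
  shows "wt e \<le> k * n ^ (k + 1)"
proof -
  obtain l where l: "gpath E col n (l (cl e)) (sr e) (ds e) (wt e)" "(\<Sum>i<r. l i) = k"
    using S unfolding sound_def by blast
  have "l (cl e) \<le> (\<Sum>i<r. l i)" by (rule member_le_sum) (use S in auto)
  then show ?thesis using gpath_bound[OF E l(1)] l by simp
qed

text \<open>Any set of edge indices spans a subgraph of \<open>G\<close>, hence again a member of
  \<open>F\<close>, to which the density bound applies.\<close>

lemma dense_at_graph:
  assumes cl: "graph_closed F" and d: "\<And>G. G \<in> F \<Longrightarrow> card (edges G) \<le> d * card (verts G)"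
    and G: "G \<in> F" and A: "finite A" "\<And>e. e \<in> A \<Longrightarrow> {sr e, ds e} \<in> edges G" "inj_on (\<lambda>e. {sr e, ds e}) A"
  shows "dense_at d sr ds A"
  unfolding dense_at_def
proof (intro allI impI)
  fix Y assume Y: "Y \<subseteq> A"
  let ?H = "\<lparr>verts = sr ` Y \<union> ds ` Y, edges = (\<lambda>e. {sr e, ds e}) ` Y\<rparr>"
  have sub: "(\<lambda>e. {sr e, ds e}) ` Y \<subseteq> edges G" using A(2) Y by auto
  have "subgraph ?H G"
  proof -
    have sG: "simple_graph G" using cl G unfolding graph_closed_def by blast
    have "{sr e, ds e} \<subseteq> verts G" if "e \<in> Y" for e
      using sub sG that unfolding simple_graph_def by blast
    then have "sr ` Y \<union> ds ` Y \<subseteq> verts G" by blast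
    moreover have "simple_graph ?H" using sub sG finite_subset[OF Y A(1)] unfolding simple_graph_def by auto
    ultimately show ?thesis using sub by (simp add: subgraph_def)
  qed
  then have "?H \<in> F" using cl G unfolding graph_closed_def by blast
  from d[OF this] have "card ((\<lambda>e. {sr e, ds e}) ` Y) \<le> d * card (sr ` Y \<union> ds ` Y)" by simp
  moreover have "inj_on (\<lambda>e. {sr e, ds e}) Y" using inj_on_subset[OF A(3) Y] .
  ultimately show "card Y \<le> d * card (sr ` Y \<union> ds ` Y)" by (simp add: card_image)
qed

text \<open>Records of class \<open>r\<close> run between the disjoint parts \<open>X r\<close> and
  \<open>X 0\<close>, so records with different end pairs are different undirected edges.\<close>

lemma sound_dense:
  assumes cl: "graph_closed F" and d: "\<And>G. G \<in> F \<Longrightarrow> card (edges G) \<le> d * card (verts G)"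
    and S: "sound F E col n k M (Suc r) sr ds cl wt" "1 \<le> r"
    and A: "A \<subseteq> {e. e < M \<and> cl e = r}" "\<And>e e'. e \<in> A \<Longrightarrow> e' \<in> A \<Longrightarrow> sr e = sr e' \<Longrightarrow> ds e = ds e' \<Longrightarrow> e = e'"
  shows "dense_at d sr ds A"
proof -
  obtain X l where X: "\<forall>e<M. cl e < Suc r \<longrightarrow> sr e \<in> X (cl e) \<and> ds e \<in> X (Suc (cl e) mod Suc r) \<and>
        gpath E col n (l (cl e)) (sr e) (ds e) (wt e)"
     "\<forall>i<Suc r. \<forall>j<Suc r. i \<noteq> j \<longrightarrow> X i \<inter> X j = {}"
     and "2 \<le> Suc r \<longrightarrow> (\<exists>U. \<lparr>verts = U, edges = {{sr e, ds e} | e. e < M \<and> cl e < Suc r}\<rparr> \<in> F)"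
    using S(1) unfolding sound_def by blast
  note X = X[rule_format]
  have "2 \<le> Suc r" using S(2) by simp
  then obtain U where G: "\<lparr>verts = U, edges = {{sr e, ds e} | e. e < M \<and> cl e < Suc r}\<rparr> \<in> F" (is "?G \<in> F")
    using \<open>2 \<le> Suc r \<longrightarrow> _\<close> by blast
  have XA: "sr e \<in> X r" "ds e \<in> X 0" "e < M" "cl e = r" if "e \<in> A" for e
    using X(1)[of e] that A(1) by auto
  have disj: "X r \<inter> X 0 = {}" using X(2)[of r 0] S(2) by simp
  show ?thesis
  proof (rule dense_at_graph[OF cl d G])
    show "finite A" using A(1) finite_subset[of A "{..<M}"] by auto
    show "{sr e, ds e} \<in> edges ?G" if "e \<in> A" for e using XA[OF that] by auto
    show "inj_on (\<lambda>e. {sr e, ds e}) A"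
    proof (rule inj_onI)
      fix e e' assume e: "e \<in> A" "e' \<in> A" and eq: "{sr e, ds e} = {sr e', ds e'}"
      have "sr e \<noteq> ds e'" using XA[OF e(1)] XA[OF e(2)] disj by auto
      then have "sr e = sr e'" "ds e = ds e'" using eq by (auto simp: doubleton_eq_iff)
      then show "e = e'" using A(2) e by blast
    qed
  qed
qed

section \<open>The search for a coloured cycle\<close>

text \<open>The array \<open>TT\<close> is an \<open>n\<close> by \<open>n\<close> table of end
  pairs, too large to be initialised in linear time; only the cells that \<open>collect\<close> will
  read are cleared.\<close>

definition clear :: "nat \<Rightarrow> nat \<Rightarrow> pprog" where
  "clear R r = Put (LAB R) (V Ve) (N 0) ;;
     Cond (Eq (Ar (CLS R) (V Ve)) (N r))
       (Put TT (Pl (Ti (Ar (SRC R) (V Ve)) (V Vn)) (Ar (DST R) (V Ve))) (N 0)) Nop"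

text \<open>Contractions create parallel records, and the density bound counts them only once, so
  one record of each end pair is kept for the orientation.\<close>

definition collect :: "nat \<Rightarrow> nat \<Rightarrow> pprog" where
  "collect R r =
     Cond (Eq (Ar (CLS R) (V Ve)) (N r))
       (Cond (Ar TT (Pl (Ti (Ar (SRC R) (V Ve)) (V Vn)) (Ar (DST R) (V Ve)))) Nop
         (Put TT (Pl (Ti (Ar (SRC R) (V Ve)) (V Vn)) (Ar (DST R) (V Ve))) (N 1) ;;
          Put LL (V Vlen) (V Ve) ;; Asg Vlen (Pl (V Vlen) (N 1)))) Nop"

definition select :: "nat \<Rightarrow> nat \<Rightarrow> pprog" where
  "select R r = For Ve (V Vm) (clear R r) ;; Asg Vlen (N 0) ;; For Ve (V Vm) (collect R r)"

text \<open>Entries of \<open>FF\<close> are edge numbers plus one, so that \<open>0\<close> means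
  that a vertex has no star edge.\<close>

definition fwrite :: "nat \<Rightarrow> nat \<Rightarrow> pprog" where
  "fwrite R D = Cond (Eq (Ar (LAB R) (V Ve)) (Pl (V Vp) (N 1)))
     (Cond (Ls (V Vp) (N D)) (Put FF (Ar (SRC R) (V Ve)) (Pl (V Ve) (N 1)))
        (Put FF (Ar (DST R) (V Ve)) (Pl (V Ve) (N 1)))) Nop"

definition merge :: "nat \<Rightarrow> nat \<Rightarrow> pprog" where
  "merge R D = For Vi (V Vn) (Put FF (V Vi) (N 0)) ;; For Ve (V Vm) (fwrite R D)"

text \<open>For \<open>p < D\<close> the tails of the star edges are their sources and lie in the
  last part, which is therefore merged into part \<open>0\<close>; otherwise the roles are
  exchanged. Level \<open>Suc r\<close> stays intact, so the next label can start from it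
  again.\<close>

definition move :: "nat \<Rightarrow> nat \<Rightarrow> nat \<Rightarrow> pprog" where
  "move r D k =
     Put (CLS r) (V Ve) (Ar (CLS (Suc r)) (V Ve)) ;; Put (SRC r) (V Ve) (Ar (SRC (Suc r)) (V Ve)) ;;
     Put (DST r) (V Ve) (Ar (DST (Suc r)) (V Ve)) ;; Put (WIT r) (V Ve) (Ar (WIT (Suc r)) (V Ve)) ;;
     Cond (Ls (V Vp) (N D))
       (Cond (Eq (Ar (CLS (Suc r)) (V Ve)) (N (r - 1)))
         (Cond (Ar FF (Ar (DST (Suc r)) (V Ve)))
           (Put (DST r) (V Ve) (Ar (DST (Suc r)) (Mi (Ar FF (Ar (DST (Suc r)) (V Ve))) (N 1))) ;;
            Put (WIT r) (V Ve) (Pl (Ar (WIT (Suc r)) (V Ve))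
              (Ar (WIT (Suc r)) (Mi (Ar FF (Ar (DST (Suc r)) (V Ve))) (N 1)))))
           (Put (CLS r) (V Ve) (N k))) Nop)
       (Cond (Eq (Ar (CLS (Suc r)) (V Ve)) (N 0))
         (Cond (Ar FF (Ar (SRC (Suc r)) (V Ve)))
           (Put (SRC r) (V Ve) (Ar (SRC (Suc r)) (Mi (Ar FF (Ar (SRC (Suc r)) (V Ve))) (N 1))) ;;
            Put (WIT r) (V Ve) (Pl (Ar (WIT (Suc r)) (V Ve))
              (Ar (WIT (Suc r)) (Mi (Ar FF (Ar (SRC (Suc r)) (V Ve))) (N 1)))))
           (Put (CLS r) (V Ve) (N k))) Nop)"

definition final :: pprog where
  "final = Cond (Eq (Ar (CLS 1) (V Ve)) (N 0))
     (Cond (Eq (Ar (SRC 1) (V Ve)) (Ar (DST 1) (V Ve)))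
       (Asg Vfound (N 1) ;; Asg Vans (Ar (WIT 1) (V Ve))) Nop) Nop"

text \<open>All levels share the loop variable \<open>Vp\<close>. This is harmless: it is set anew
  at the beginning of each iteration and not read after the recursive call.\<close>

fun solve :: "nat \<Rightarrow> nat \<Rightarrow> nat \<Rightarrow> pprog" where
  "solve D k 0 = Nop"
| "solve D k (Suc 0) = For Ve (V Vm) final"
| "solve D k (Suc (Suc r)) =
     select (Suc (Suc r)) (Suc r) ;; orient (Suc (Suc r)) D ;;
     For Vp (N (2 * D)) (merge (Suc (Suc r)) D ;; For Ve (V Vm) (move (Suc r) D k) ;; solve D k (Suc r))"

lemma mods_solve [simp]:
  "mvars (clear R r) = {}" "marrs (clear R r) = {LAB R, TT}"
  "mvars (collect R r) = {Vlen}" "marrs (collect R r) = {LL, TT}"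
  "mvars (select R r) = {Ve, Vlen}" "marrs (select R r) = {LAB R, TT, LL}"
  "mvars (fwrite R D) = {}" "marrs (fwrite R D) = {FF}"
  "mvars (merge R D) = {Vi, Ve}" "marrs (merge R D) = {FF}"
  "mvars (move r D k) = {}" "marrs (move r D k) = {CLS r, SRC r, DST r, WIT r}"
  "mvars final = {Vfound, Vans}" "marrs final = {}"
  by (auto simp: clear_def collect_def select_def fwrite_def merge_def move_def final_def)

definition solve_vars :: "vname set" where
  "solve_vars = {Ve, Vu, Vv, Vi, Vlen, Vnew, Vrd, Vp, Vfound, Vans}"

text \<open>Of the arrays of its own level the search changes only the labels; the records are read
  but not written.\<close>

definition solve_arrs :: "nat \<Rightarrow> aname set" where
  "solve_arrs R = {a. case a of TT \<Rightarrow> True | LL \<Rightarrow> True | DEG \<Rightarrow> True | OC \<Rightarrow> True | FF \<Rightarrow> True |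
     CLS i \<Rightarrow> i < R | SRC i \<Rightarrow> i < R | DST i \<Rightarrow> i < R | WIT i \<Rightarrow> i < R | LAB i \<Rightarrow> i \<le> R | _ \<Rightarrow> False}"

lemma solve_arrs_Suc: "a \<in> solve_arrs R \<Longrightarrow> a \<in> solve_arrs (Suc R)"
  by (cases a) (simp_all add: solve_arrs_def)

lemma mvars_solve: "mvars (solve D k R) \<subseteq> solve_vars"
  by (induction D k R rule: solve.induct) (auto simp: solve_vars_def)

lemma marrs_solve: "marrs (solve D k R) \<subseteq> solve_arrs R"
proof (induction D k R rule: solve.induct)
  case (3 D k r)
  have "marrs (solve D k (Suc r)) \<subseteq> solve_arrs (Suc (Suc r))" using 3 solve_arrs_Suc by blast
  then show ?case by (simp add: solve_arrs_def)
qed (auto simp: solve_arrs_def)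

definition select_c :: "nat \<Rightarrow> nat \<Rightarrow> nat" where
  "select_c R r = 20 + scost (clear R r) + scost (Asg Vlen (N 0) :: pprog) + scost (collect R r)"

lemma key_inject:
  "u * n + v = u' * n + v' \<Longrightarrow> v < n \<Longrightarrow> v' < (n::nat) \<Longrightarrow> u = u' \<and> v = v'"
  by (rule address_inject)

lemma select_spec:
  fixes s :: pst
  assumes as: "vr s Vn = n" "vr s Vm = M" "n \<le> b" "M \<le> b" "1 \<le> b"
    and sr: "sr = ar s (SRC R)" and ds: "ds = ar s (DST R)" and cl: "cl = ar s (CLS R)"
    and rng: "\<And>e. e < M \<Longrightarrow> cl e = r \<Longrightarrow> sr e < n \<and> ds e < n"
  shows "tri b (select R r) s (select_c R r * (M + 1)) (\<lambda>s'. \<exists>xs. holds s' xs \<and> distinct xs \<and>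
    set xs \<subseteq> {e. e < M \<and> cl e = r} \<and>
    (\<forall>e\<in>set xs. \<forall>e'\<in>set xs. sr e = sr e' \<longrightarrow> ds e = ds e' \<longrightarrow> e = e') \<and>
    (\<forall>e<M. cl e = r \<longrightarrow> (\<exists>e'\<in>set xs. sr e' = sr e \<and> ds e' = ds e)) \<and>
    (\<forall>e<M. ar s' (LAB R) e = 0))" (is "tri b _ s _ ?Q")
proof -
  define ky where "ky e = sr e * n + ds e" for e
  have ky: "sr e = sr e' \<and> ds e = ds e'" if "ky e = ky e'" "e < M" "e' < M" "cl e = r" "cl e' = r" for e e'
    using key_inject[of "sr e" n "ds e" "sr e'" "ds e'"] that rng by (simp add: ky_def)
  have "tri b (select R r) s ((1 + 2 + M * (scost (clear R r) + 4)) + (scost (Asg Vlen (N 0) :: pprog) +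
      (1 + 2 + M * (scost (collect R r) + 4)))) ?Q"
    unfolding select_def
  proof (rule tri_Sq)
    let ?I = "\<lambda>m (s' :: pst). (\<forall>e<m. ar s' (LAB R) e = 0) \<and> (\<forall>e<m. cl e = r \<longrightarrow> ar s' TT (ky e) = 0)"
    have "tri b (For Ve (V Vm) (clear R r)) s (ecost (V Vm :: (vname, aname) aexp) + 2 + M * (scost (clear R r) + 4)) (?I M)"
    proof (rule tri_For_straight[where I = ?I])
      fix i and s' :: pst assume i: "i < M" "frame (For Ve (V Vm) (clear R r)) s s'" "?I i s'"
      then have f: "ar s' (SRC R) = sr" "ar s' (DST R) = ds" "ar s' (CLS R) = cl" "vr s' Vn = n"
        using as by (auto simp: frame_def sr ds cl)
      show "ok b (clear R r) (setv Ve i s') \<and> ?I (Suc i) (ev (clear R r) (setv Ve i s'))"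
        using i f by (auto simp: clear_def less_Suc_eq ky_def)
    qed (use as in \<open>auto simp: clear_def\<close>)
    then show "tri b (For Ve (V Vm) (clear R r)) s (1 + 2 + M * (scost (clear R r) + 4)) (?I M)" by simp
  next
    fix s1 :: pst assume s1: "frame (For Ve (V Vm) (clear R r)) s s1"
      "(\<forall>e<M. ar s1 (LAB R) e = 0) \<and> (\<forall>e<M. cl e = r \<longrightarrow> ar s1 TT (ky e) = 0)"
    have f1: "ar s1 (SRC R) = sr" "ar s1 (DST R) = ds" "ar s1 (CLS R) = cl" "vr s1 Vn = n" "vr s1 Vm = M"
      using s1(1) as by (auto simp: frame_def sr ds cl)
    show "tri b (Asg Vlen (N 0) ;; For Ve (V Vm) (collect R r)) s1
      (scost (Asg Vlen (N 0) :: pprog) + (1 + 2 + M * (scost (collect R r) + 4))) ?Q"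
    proof (rule tri_Sq)
      show "tri b (Asg Vlen (N 0)) s1 (scost (Asg Vlen (N 0) :: pprog)) (\<lambda>s'. vr s' Vlen = 0)"
        by (rule tri_straight) auto
    next
      fix s2 :: pst assume s2: "frame (Asg Vlen (N 0)) s1 s2" "vr s2 Vlen = 0"
      have f2: "ar s2 (SRC R) = sr" "ar s2 (DST R) = ds" "ar s2 (CLS R) = cl" "vr s2 Vn = n" "vr s2 Vm = M"
        "ar s2 TT = ar s1 TT" "ar s2 (LAB R) = ar s1 (LAB R)"
        using s2(1) f1 by (auto simp: frame_def)
      let ?J = "\<lambda>m (s' :: pst) xs. holds s' xs \<and> distinct xs \<and> set xs \<subseteq> {e. e < m \<and> cl e = r} \<and>
        inj_on ky (set xs) \<and> (\<forall>e<m. cl e = r \<longrightarrow> ky e \<in> ky ` set xs) \<and>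
        (\<forall>e<M. cl e = r \<longrightarrow> (0 < ar s' TT (ky e) \<longleftrightarrow> ky e \<in> ky ` set xs))"
      have "tri b (For Ve (V Vm) (collect R r)) s2 (ecost (V Vm :: (vname, aname) aexp) + 2 + M * (scost (collect R r) + 4))
          (\<lambda>s'. Ex (?J M s'))"
      proof (rule tri_For_straight[where I = "\<lambda>m s'. Ex (?J m s')"])
        fix i and s' :: pst assume i: "i < M" "bdd b s'" "frame (For Ve (V Vm) (collect R r)) s2 s'" "Ex (?J i s')"
        have f: "ar s' (SRC R) = sr" "ar s' (DST R) = ds" "ar s' (CLS R) = cl" "vr s' Vn = n"
          using i(3) f2 by (auto simp: frame_def)
        from i(4) obtain xs where xs: "holds s' xs" "distinct xs" "set xs \<subseteq> {e. e < i \<and> cl e = r}"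
          "inj_on ky (set xs)" "\<forall>e<i. cl e = r \<longrightarrow> ky e \<in> ky ` set xs"
          "\<forall>e<M. cl e = r \<longrightarrow> (0 < ar s' TT (ky e) \<longleftrightarrow> ky e \<in> ky ` set xs)" by blast
        have kyi: "sr i * n + ds i = ky i" by (simp add: ky_def)
        show "ok b (collect R r) (setv Ve i s') \<and> Ex (?J (Suc i) (ev (collect R r) (setv Ve i s')))"
        proof (cases "cl i = r \<and> ky i \<notin> ky ` set xs")
          case False
          then have "ok b (collect R r) (setv Ve i s')" "ev (collect R r) (setv Ve i s') = setv Ve i s'"
            using xs(6) i(1) by (auto simp: collect_def f kyi)
          moreover have "?J (Suc i) (setv Ve i s') xs"
            using xs False by (auto simp: less_Suc_eq holds_def)
          ultimately show ?thesis by auto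
        next
          case True
          then have "ar s' TT (ky i) = 0" using xs(6) i(1) by auto
          moreover have "vr s' Vlen = length xs" using xs(1) by (simp add: holds_def)
          moreover have "length xs \<le> i"
          proof -
            have "length xs = card (set xs)" using xs(2) by (simp add: distinct_card)
            also have "\<dots> \<le> card {..<i}" by (rule card_mono) (use xs(3) in auto)
            finally show ?thesis by simp
          qed
          ultimately have ok: "ok b (collect R r) (setv Ve i s')"
            and upd: "vr (ev (collect R r) (setv Ve i s')) Vlen = length xs + 1"
              "ar (ev (collect R r) (setv Ve i s')) LL = (ar s' LL)(length xs := i)"
              "ar (ev (collect R r) (setv Ve i s')) TT = (ar s' TT)(ky i := 1)"
            using True as i(1) by (auto simp: collect_def f kyi)
          have "?J (Suc i) (ev (collect R r) (setv Ve i s')) (xs @ [i])"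
            using xs True upd by (auto simp: less_Suc_eq holds_def nth_append)
          then show ?thesis using ok by blast
        qed
      next
        show "Ex (?J 0 s2)"
          using s2 s1 f2 by (intro exI[of _ "[]"]) (auto simp: holds_def)
      qed (use as f2 in \<open>auto simp: collect_def\<close>)
      then show "tri b (For Ve (V Vm) (collect R r)) s2 (1 + 2 + M * (scost (collect R r) + 4)) ?Q"
      proof (rule tri_conseq)
        fix s' :: pst assume fr: "frame (For Ve (V Vm) (collect R r)) s2 s'" and "Ex (?J M s')"
        then obtain xs where xs: "holds s' xs" "distinct xs" "set xs \<subseteq> {e. e < M \<and> cl e = r}"
          "inj_on ky (set xs)" "\<forall>e<M. cl e = r \<longrightarrow> ky e \<in> ky ` set xs" by blast
        have "\<forall>e\<in>set xs. \<forall>e'\<in>set xs. sr e = sr e' \<longrightarrow> ds e = ds e' \<longrightarrow> e = e'"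
          using xs(4) by (auto simp: inj_on_def ky_def)
        moreover have "\<exists>e'\<in>set xs. sr e' = sr e \<and> ds e' = ds e" if e: "e < M" "cl e = r" for e
        proof -
          obtain e' where "e' \<in> set xs" "ky e = ky e'" using xs(5) e by blast
          moreover from this have "e' < M \<and> cl e' = r" using xs(3) by blast
          ultimately show ?thesis using ky[of e e'] e by auto
        qed
        moreover have "ar s' (LAB R) e = 0" if "e < M" for e
          using fr f2 s1(2) that by (simp add: frame_def)
        ultimately show "?Q s'" using xs(1-3) by blast
      qed simp
    qed
  qed
  then show ?thesis by (rule tri_conseq) (simp_all add: select_c_def algebra_simps)
qed

definition merge_c :: "nat \<Rightarrow> nat \<Rightarrow> nat" where
  "merge_c R D = 20 + scost (Put FF (V Vi) (N 0) :: pprog) + scost (fwrite R D)"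

text \<open>Edges with the same label have different tails, so no entry of \<open>FF\<close> is
  overwritten by another edge and each edge with label \<open>p + 1\<close> is found at its tail.
  Records left out by the selection carry label \<open>0\<close>.\<close>

lemma merge_spec:
  fixes s :: pst
  assumes as: "vr s Vn = n" "vr s Vm = M" "n \<le> b" "M < b" "vr s Vp = p"
    and sr: "sr = ar s (SRC R)" and ds: "ds = ar s (DST R)" and lb: "lb = ar s (LAB R)"
    and lab: "labelled D sr ds lb A" "\<And>e. e < M \<Longrightarrow> e \<notin> A \<Longrightarrow> lb e = 0"
  shows "tri b (merge R D) s (merge_c R D * (n + M + 1)) (\<lambda>s'.
    (\<forall>v<n. 0 < ar s' FF v \<longrightarrow> ar s' FF v - 1 < M \<and> lb (ar s' FF v - 1) = p + 1 \<and>
       tail D sr ds (p + 1) (ar s' FF v - 1) = v) \<and>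
    (\<forall>e<M. lb e = p + 1 \<longrightarrow> ar s' FF (tail D sr ds (p + 1) e) = e + 1))" (is "tri b _ s _ ?Q")
proof -
  define c1 where "c1 = (Put FF (V Vi) (N 0) :: pprog)"
  have uniq: "e = e'" if "e < M" "e' < M" "lb e = p + 1" "lb e' = p + 1" "tail D sr ds (p + 1) e = tail D sr ds (p + 1) e'" for e e'
  proof -
    have "e \<in> A" "e' \<in> A" using lab(2)[of e] lab(2)[of e'] that by auto
    then show ?thesis using lab(1) that by (auto simp: labelled_def)
  qed
  have "tri b (merge R D) s ((1 + 2 + n * (scost c1 + 4)) + (1 + 2 + M * (scost (fwrite R D) + 4))) ?Q"
    unfolding merge_def c1_def[symmetric]
  proof (rule tri_Sq)
    have "tri b (For Vi (V Vn) c1) s (ecost (V Vn :: (vname, aname) aexp) + 2 + n * (scost c1 + 4))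
        (\<lambda>s'. \<forall>v<n. ar s' FF v = 0)"
      by (rule tri_For_straight[where I = "\<lambda>m s'. \<forall>v<m. ar s' FF v = 0"])
        (use as in \<open>auto simp: c1_def less_Suc_eq\<close>)
    then show "tri b (For Vi (V Vn) c1) s (1 + 2 + n * (scost c1 + 4)) (\<lambda>s'. \<forall>v<n. ar s' FF v = 0)" by simp
  next
    fix s1 :: pst assume s1: "frame (For Vi (V Vn) c1) s s1" "\<forall>v<n. ar s1 FF v = 0"
    have f1: "ar s1 (SRC R) = sr" "ar s1 (DST R) = ds" "ar s1 (LAB R) = lb" "vr s1 Vp = p" "vr s1 Vm = M"
      using s1(1) as by (auto simp: frame_def sr ds lb c1_def)
    let ?I = "\<lambda>m (s' :: pst). (\<forall>v<n. 0 < ar s' FF v \<longrightarrow> ar s' FF v - 1 < m \<and> lb (ar s' FF v - 1) = p + 1 \<and>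
         tail D sr ds (p + 1) (ar s' FF v - 1) = v) \<and>
      (\<forall>e<m. lb e = p + 1 \<longrightarrow> ar s' FF (tail D sr ds (p + 1) e) = e + 1)"
    have "tri b (For Ve (V Vm) (fwrite R D)) s1 (ecost (V Vm :: (vname, aname) aexp) + 2 + M * (scost (fwrite R D) + 4)) (?I M)"
    proof (rule tri_For_straight[where I = ?I])
      fix i and s' :: pst assume i: "i < M" "frame (For Ve (V Vm) (fwrite R D)) s1 s'" "?I i s'"
      have f: "ar s' (SRC R) = sr" "ar s' (DST R) = ds" "ar s' (LAB R) = lb" "vr s' Vp = p"
        using i(2) f1 by (auto simp: frame_def)
      show "ok b (fwrite R D) (setv Ve i s') \<and> ?I (Suc i) (ev (fwrite R D) (setv Ve i s'))"
      proof (cases "lb i = p + 1")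
        case False
        then have "ok b (fwrite R D) (setv Ve i s')" "ev (fwrite R D) (setv Ve i s') = setv Ve i s'"
          by (auto simp: fwrite_def f)
        then show ?thesis using i(3) False by (auto simp: less_Suc_eq)
      next
        case True
        then have ok: "ok b (fwrite R D) (setv Ve i s')"
          and upd: "ar (ev (fwrite R D) (setv Ve i s')) FF = (ar s' FF)(tail D sr ds (p + 1) i := i + 1)"
          using i(1) as by (auto simp: fwrite_def f tail_def)
        have "tail D sr ds (p + 1) e \<noteq> tail D sr ds (p + 1) i" if "e < i" "lb e = p + 1" for e
          using uniq[of e i] that True i(1) by auto
        then show ?thesis using ok i(3) True unfolding upd by (auto simp: less_Suc_eq)
      qed
    qed (use s1 f1 as in \<open>auto simp: fwrite_def\<close>)
    then show "tri b (For Ve (V Vm) (fwrite R D)) s1 (1 + 2 + M * (scost (fwrite R D) + 4)) ?Q" by simp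
  qed
  then show ?thesis by (rule tri_conseq) (simp_all add: merge_c_def c1_def algebra_simps)
qed

lemma move_ev:
  fixes s :: pst and k :: nat
  assumes f: "vr s Ve = e" "vr s Vp = p"
    "ar s (SRC (Suc r)) = sr" "ar s (DST (Suc r)) = ds" "ar s (CLS (Suc r)) = cl" "ar s (WIT (Suc r)) = wt" "ar s FF = ff"
    and fw: "fw \<longleftrightarrow> p < D"
  defines "s' \<equiv> ev (move r D k) s" and "hit \<equiv> cl e = target fw r"
    and "g \<equiv> ff (key fw sr ds e)"
  shows "ar s' (CLS r) = (ar s (CLS r))(e := if hit \<and> g = 0 then k else cl e)"
    "ar s' (SRC r) = (ar s (SRC r))(e := if hit \<and> g \<noteq> 0 \<and> \<not> fw then sr (g - 1) else sr e)"
    "ar s' (DST r) = (ar s (DST r))(e := if hit \<and> g \<noteq> 0 \<and> fw then ds (g - 1) else ds e)"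
    "ar s' (WIT r) = (ar s (WIT r))(e := if hit \<and> g \<noteq> 0 then wt e + wt (g - 1) else wt e)"
    "bdd b s \<Longrightarrow> k \<le> b \<Longrightarrow> (hit \<and> g \<noteq> 0 \<Longrightarrow> wt e + wt (g - 1) \<le> b) \<Longrightarrow> ok b (move r D k) s"
proof -
  have bb: "cl e \<le> b" "sr x \<le> b" "ds x \<le> b" "wt e \<le> b" if "bdd b s" for b x
    using bdd_arr[OF that] f by metis+
  show "ar s' (CLS r) = (ar s (CLS r))(e := if hit \<and> g = 0 then k else cl e)"
    "ar s' (SRC r) = (ar s (SRC r))(e := if hit \<and> g \<noteq> 0 \<and> \<not> fw then sr (g - 1) else sr e)"
    "ar s' (DST r) = (ar s (DST r))(e := if hit \<and> g \<noteq> 0 \<and> fw then ds (g - 1) else ds e)"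
    "ar s' (WIT r) = (ar s (WIT r))(e := if hit \<and> g \<noteq> 0 then wt e + wt (g - 1) else wt e)"
    using fw by (auto simp: s'_def move_def f hit_def g_def target_def key_def)
  show "ok b (move r D k) s" if "bdd b s" "k \<le> b" "hit \<and> g \<noteq> 0 \<Longrightarrow> wt e + wt (g - 1) \<le> b"
    using that bb[OF that(1)] fw by (auto simp: move_def f hit_def g_def target_def key_def)
qed

section \<open>Correctness of the recursive search\<close>

fun solve_c :: "nat \<Rightarrow> nat \<Rightarrow> nat \<Rightarrow> nat" where
  "solve_c D k 0 = 0"
| "solve_c D k (Suc 0) = 7 + scost final"
| "solve_c D k (Suc (Suc r)) = select_c (Suc (Suc r)) (Suc r) + (orient_c (Suc (Suc r)) D + (3 + 2 * D *
     (merge_c (Suc (Suc r)) D + (7 + scost (move (Suc r) D k) + solve_c D k (Suc r)) + 4)))"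

text \<open>The predicate \<open>Good\<close> hides what closed walks are used for: the search only
  guarantees that its answer is the label of a closed walk of length \<open>k\<close>.\<close>

locale search =
  fixes F :: "ugraph set" and E :: "nat \<Rightarrow> nat \<Rightarrow> bool" and col :: "nat \<Rightarrow> nat"
    and n k M d rr b :: nat and Good :: "nat \<Rightarrow> bool"
  assumes closed: "graph_closed F" and density: "\<And>G. G \<in> F \<Longrightarrow> card (edges G) \<le> d * card (verts G)"
    and E_range: "\<And>u v. E u v \<Longrightarrow> u < n \<and> col u < k"
    and Good: "\<And>u w. gpath E col n k u u w \<Longrightarrow> Good w"
    and bounds: "n \<le> b" "2 * M < b" "rr \<le> b" "8 * d \<le> b" "k \<le> b" "k * n ^ (k + 1) \<le> b"
    and rounds: "M < 2 ^ rr"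
begin

definition inv :: "pst \<Rightarrow> bool" where
  "inv s \<longleftrightarrow> vr s Vn = n \<and> vr s Vm = M \<and> vr s Vr = rr \<and> vr s Vfound \<le> 1 \<and>
     (vr s Vfound = 1 \<longrightarrow> Good (vr s Vans))"

definition snd_at :: "nat \<Rightarrow> pst \<Rightarrow> bool" where
  "snd_at R s \<longleftrightarrow> sound F E col n k M R (ar s (SRC R)) (ar s (DST R)) (ar s (CLS R)) (ar s (WIT R))"

definition srv_at :: "nat \<Rightarrow> pst \<Rightarrow> bool" where
  "srv_at R s \<longleftrightarrow> surv M R (ar s (SRC R)) (ar s (DST R)) (ar s (CLS R))"

lemma build_spec:
  fixes s :: pst
  assumes s: "vr s Vm = M" "vr s Vp = p" "snd_at (Suc r) s" and r: "1 \<le> r" "r \<le> k"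
    and fw: "fw \<longleftrightarrow> p < D"
    and fn: "sr = ar s (SRC (Suc r))" "ds = ar s (DST (Suc r))" "cl = ar s (CLS (Suc r))" "ff = ar s FF"
    and ff: "\<And>v. v < n \<Longrightarrow> ff v \<noteq> 0 \<Longrightarrow> ff v - 1 < M \<and> cl (ff v - 1) = r \<and> key (\<not> fw) sr ds (ff v - 1) = v"
  shows "tri b (For Ve (V Vm) (move r D k)) s (3 + M * (scost (move r D k) + 4)) (\<lambda>s'. snd_at r s' \<and>
    (\<forall>x e0. (\<forall>i<Suc r. \<exists>e<M. cl e = i \<and> sr e = x i \<and> ds e = x (Suc i mod Suc r)) \<longrightarrow>
       sr e0 = x r \<longrightarrow> ds e0 = x 0 \<longrightarrow> ff (if fw then x r else x 0) = Suc e0 \<longrightarrow> srv_at r s'))" (is "tri b _ s _ ?Q")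
proof -
  define wt where "wt = ar s (WIT (Suc r))"
  define cl' where "cl' e = (if cl e = target fw r \<and> ff (key fw sr ds e) = 0 then k else cl e)" for e
  define sr' where "sr' e = (if cl e = target fw r \<and> ff (key fw sr ds e) \<noteq> 0 \<and> \<not> fw then sr (ff (key fw sr ds e) - 1) else sr e)" for e
  define ds' where "ds' e = (if cl e = target fw r \<and> ff (key fw sr ds e) \<noteq> 0 \<and> fw then ds (ff (key fw sr ds e) - 1) else ds e)" for e
  define wt' where "wt' e = (if cl e = target fw r \<and> ff (key fw sr ds e) \<noteq> 0 then wt e + wt (ff (key fw sr ds e) - 1) else wt e)" for e
  have S: "sound F E col n k M (Suc r) sr ds cl wt" using s(3) by (simp add: snd_at_def fn wt_def)
  have ch: "sr' e = (if fw then sr e else sr (ff (sr e) - 1)) \<and> ds' e = (if fw then ds (ff (ds e) - 1) else ds e) \<and>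
      wt' e = wt e + wt (ff (key fw sr ds e) - 1)" if "cl e = target fw r" "ff (key fw sr ds e) \<noteq> 0" for e
    using that by (auto simp: sr'_def ds'_def wt'_def key_def)
  have same: "sr' e = sr e \<and> ds' e = ds e \<and> wt' e = wt e" if "cl e \<noteq> target fw r" for e
    using that by (auto simp: sr'_def ds'_def wt'_def)
  \<comment> \<open>Absence of overflow needs a bound on the new labels, which follows from
    soundness of the new level. Soundness is therefore proved first for functions describing that
    level, and below once more for the arrays actually written.\<close>
  have S': "sound F E col n k M r sr' ds' cl' wt'"
    by (rule sound_step[OF closed S r ff cl'_def ch same])
  have wb: "wt e + wt (ff (key fw sr ds e) - 1) \<le> b"
    if "e < M" "cl e = target fw r" "ff (key fw sr ds e) \<noteq> 0" for e
  proof -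
    have "cl' e < r" using that r by (simp add: cl'_def target_def split: if_splits)
    have "wt' e \<le> k * n ^ (k + 1)"
      by (rule sound_weight[OF S' that(1) \<open>cl' e < r\<close>]) (rule E_range)
    then show ?thesis using that bounds by (simp add: wt'_def)
  qed
  let ?I = "\<lambda>m (s' :: pst). \<forall>e<m. ar s' (CLS r) e = cl' e \<and> ar s' (SRC r) e = sr' e \<and>
      ar s' (DST r) e = ds' e \<and> ar s' (WIT r) e = wt' e"
  have "tri b (For Ve (V Vm) (move r D k)) s (ecost (V Vm :: (vname, aname) aexp) + 2 + M * (scost (move r D k) + 4)) (?I M)"
  proof (rule tri_For_straight[where I = ?I])
    fix i and s' :: pst assume i: "i < M" "bdd b s'" "frame (For Ve (V Vm) (move r D k)) s s'" "?I i s'"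
    let ?s = "setv Ve i s'"
    have f: "vr ?s Ve = i" "vr ?s Vp = p" "ar ?s (SRC (Suc r)) = sr" "ar ?s (DST (Suc r)) = ds"
      "ar ?s (CLS (Suc r)) = cl" "ar ?s (WIT (Suc r)) = wt" "ar ?s FF = ff"
      using i(3) s by (auto simp: frame_def fn wt_def)
    have bd: "bdd b ?s" using i bounds by simp
    note mv = move_ev[OF f fw]
    have "ok b (move r D k) ?s"
      by (rule mv(5)[OF bd]) (use bounds wb[OF i(1)] in auto)
    moreover have "?I (Suc i) (ev (move r D k) ?s)"
      unfolding mv(1-4) using i(4) by (auto simp: less_Suc_eq cl'_def sr'_def ds'_def wt'_def)
    ultimately show "ok b (move r D k) ?s \<and> ?I (Suc i) (ev (move r D k) ?s)" by blast
  qed (use s bounds in \<open>auto simp: move_def\<close>)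
  then show ?thesis
  proof (rule tri_conseq)
    fix s' :: pst assume I: "?I M s'"
    have cl2: "ar s' (CLS r) e = (if cl e = target fw r \<and> ff (key fw sr ds e) = 0 then k else cl e)" if "e < M" for e
      using I that by (simp add: cl'_def)
    have ch2: "ar s' (SRC r) e = (if fw then sr e else sr (ff (sr e) - 1)) \<and>
       ar s' (DST r) e = (if fw then ds (ff (ds e) - 1) else ds e) \<and>
       ar s' (WIT r) e = wt e + wt (ff (key fw sr ds e) - 1)" if "e < M" "cl e = target fw r" "ff (key fw sr ds e) \<noteq> 0" for e
      using I that(1) ch[OF that(2,3)] by simp
    have same2: "ar s' (SRC r) e = sr e \<and> ar s' (DST r) e = ds e \<and> ar s' (WIT r) e = wt e"
      if "e < M" "cl e \<noteq> target fw r" for e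
      using I that(1) same[OF that(2)] by simp
    have "snd_at r s'" unfolding snd_at_def
      by (rule sound_step[OF closed S r ff cl2 ch2 same2])
    moreover have "srv_at r s'" if "\<forall>i<Suc r. \<exists>e<M. cl e = i \<and> sr e = x i \<and> ds e = x (Suc i mod Suc r)"
       "sr e0 = x r" "ds e0 = x 0" "ff (if fw then x r else x 0) = Suc e0" for x e0
      unfolding srv_at_def
      by (rule surv_step[OF that(1)[rule_format] r(1) that(2-4) cl2 ch2 same2])
    ultimately show "?Q s'" by blast
  qed simp
qed

abbreviation post :: "nat \<Rightarrow> pst \<Rightarrow> pst \<Rightarrow> bool" where
  "post R s s' \<equiv> inv s' \<and> (vr s Vfound = 1 \<longrightarrow> vr s' Vfound = 1) \<and> (srv_at R s \<longrightarrow> vr s' Vfound = 1)"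

text \<open>At level \<open>1\<close> the only class has path length \<open>k\<close>, so a record
  with equal ends stands for a closed walk of length \<open>k\<close>.\<close>

lemma solve_1_spec:
  assumes "inv s" "snd_at 1 s"
  shows "tri b (solve D k 1) s (solve_c D k 1 * (n + rr + M + 1)) (post 1 s)"
proof -
  let ?hit = "\<lambda>e. ar s (CLS 1) e = 0 \<and> ar s (SRC 1) e = ar s (DST 1) e"
  have g: "Good (ar s (WIT 1) e)" if "e < M" "?hit e" for e
  proof -
    obtain X l where l: "\<forall>e<M. ar s (CLS 1) e < 1 \<longrightarrow> ar s (SRC 1) e \<in> X (ar s (CLS 1) e) \<and>
        ar s (DST 1) e \<in> X (Suc (ar s (CLS 1) e) mod 1) \<and> gpath E col n (l (ar s (CLS 1) e)) (ar s (SRC 1) e) (ar s (DST 1) e) (ar s (WIT 1) e)" "(\<Sum>i<1. l i) = k"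
      using assms(2) unfolding snd_at_def sound_def by blast
    then have "gpath E col n k (ar s (SRC 1) e) (ar s (SRC 1) e) (ar s (WIT 1) e)"
      using l(1)[rule_format, OF that(1)] that(2) by simp
    then show ?thesis by (rule Good)
  qed
  let ?I = "\<lambda>m (s' :: pst). inv s' \<and> (vr s Vfound = 1 \<longrightarrow> vr s' Vfound = 1) \<and> ((\<exists>e<m. ?hit e) \<longrightarrow> vr s' Vfound = 1)"
  have "tri b (For Ve (V Vm) final) s (ecost (V Vm :: (vname, aname) aexp) + 2 + M * (scost final + 4)) (?I M)"
  proof (rule tri_For_straight[where I = ?I])
    fix i and s' :: pst assume i: "i < M" "bdd b s'" "frame (For Ve (V Vm) final) s s'" "?I i s'"
    have f: "ar s' = ar s" using i(3) by (auto simp: frame_def)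
    have "ar s' (WIT 1) i \<le> b" using i(2) by (rule bdd_arr)
    then show "ok b final (setv Ve i s') \<and> ?I (Suc i) (ev final (setv Ve i s'))"
      using i(4) g[OF i(1)] bounds by (auto simp: final_def f inv_def less_Suc_eq)
  qed (use assms bounds in \<open>auto simp: inv_def final_def\<close>)
  moreover have "solve D k 1 = For Ve (V Vm) final" "solve_c D k 1 = 7 + scost final" by simp_all
  ultimately show ?thesis
    unfolding \<open>solve D k 1 = _\<close> \<open>solve_c D k 1 = _\<close>
  proof (rule_tac tri_conseq)
    show "ecost (V Vm :: (vname, aname) aexp) + 2 + M * (scost final + 4) \<le> (7 + scost final) * (n + rr + M + 1)"
      by (simp add: algebra_simps)
    fix s' :: pst assume I: "?I M s'"
    have "\<exists>e<M. ?hit e" if "srv_at 1 s" using that by (auto simp: srv_at_def surv_def)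
    then show "post 1 s s'" using I by blast
  qed
qed

lemma solve_step_spec:
  assumes D: "D = 4 * d" and r: "1 \<le> r" "Suc r \<le> k"
    and IH: "\<And>s. inv s \<Longrightarrow> snd_at r s \<Longrightarrow> tri b (solve D k r) s (solve_c D k r * (n + rr + M + 1)) (post r s)"
    and s: "inv s" "snd_at (Suc r) s"
  shows "tri b (solve D k (Suc r)) s (solve_c D k (Suc r) * (n + rr + M + 1)) (post (Suc r) s)"
proof -
  obtain q where q: "r = Suc q" using r by (cases r) auto
  let ?R = "Suc r" and ?T = "n + rr + M + 1"
  define sr where "sr = ar s (SRC ?R)"
  define ds where "ds = ar s (DST ?R)"
  define cl where "cl = ar s (CLS ?R)"
  define wt where "wt = ar s (WIT ?R)"
  have S: "sound F E col n k M ?R sr ds cl wt" using s(2) by (simp add: snd_at_def sr_def ds_def cl_def wt_def)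
  have srv: "srv_at ?R s \<longleftrightarrow> surv M ?R sr ds cl" by (simp add: srv_at_def sr_def ds_def cl_def)
  let ?loop = "For Vp (N (2 * D)) (merge ?R D ;; For Ve (V Vm) (move r D k) ;; solve D k r)"
  let ?body = "merge_c ?R D + (7 + scost (move r D k) + solve_c D k r)"
  have "tri b (select ?R r ;; orient ?R D ;; ?loop) s
    (select_c ?R r * (M + 1) + (orient_c ?R D * (n + rr + M + 1) + (3 + 2 * D * (?body * ?T + 4)))) (post ?R s)"
  proof (rule tri_Sq)
    show "tri b (select ?R r) s (select_c ?R r * (M + 1)) (\<lambda>s'. \<exists>xs. holds s' xs \<and> distinct xs \<and>
      set xs \<subseteq> {e. e < M \<and> cl e = r} \<and>
      (\<forall>e\<in>set xs. \<forall>e'\<in>set xs. sr e = sr e' \<longrightarrow> ds e = ds e' \<longrightarrow> e = e') \<and>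
      (\<forall>e<M. cl e = r \<longrightarrow> (\<exists>e'\<in>set xs. sr e' = sr e \<and> ds e' = ds e)) \<and>
      (\<forall>e<M. ar s' (LAB ?R) e = 0))"
      by (rule select_spec) (use s(1) bounds sound_range[OF S] in \<open>auto simp: inv_def sr_def ds_def cl_def\<close>)
  next
    fix s1 :: pst assume fr1: "frame (select ?R r) s s1" and "\<exists>xs. holds s1 xs \<and> distinct xs \<and>
      set xs \<subseteq> {e. e < M \<and> cl e = r} \<and>
      (\<forall>e\<in>set xs. \<forall>e'\<in>set xs. sr e = sr e' \<longrightarrow> ds e = ds e' \<longrightarrow> e = e') \<and>
      (\<forall>e<M. cl e = r \<longrightarrow> (\<exists>e'\<in>set xs. sr e' = sr e \<and> ds e' = ds e)) \<and>
      (\<forall>e<M. ar s1 (LAB ?R) e = 0)"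
    then obtain xs where xs: "holds s1 xs" "distinct xs" "set xs \<subseteq> {e. e < M \<and> cl e = r}"
      "\<And>e e'. e \<in> set xs \<Longrightarrow> e' \<in> set xs \<Longrightarrow> sr e = sr e' \<Longrightarrow> ds e = ds e' \<Longrightarrow> e = e'"
      "\<And>e. e < M \<Longrightarrow> cl e = r \<Longrightarrow> \<exists>e'\<in>set xs. sr e' = sr e \<and> ds e' = ds e"
      "\<And>e. e < M \<Longrightarrow> ar s1 (LAB ?R) e = 0" by blast
    have len: "length xs \<le> M"
    proof -
      have "card (set xs) \<le> card {..<M}" by (rule card_mono) (use xs(3) in auto)
      then show ?thesis using xs(2) by (simp add: distinct_card)
    qed
    have i1: "inv s1" using s(1) fr1 by (auto simp: inv_def frame_def)
    have f1: "ar s1 (SRC ?R) = sr" "ar s1 (DST ?R) = ds" "ar s1 (CLS ?R) = cl" "ar s1 (WIT ?R) = wt" "vr s1 Vfound = vr s Vfound"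
      using fr1 by (auto simp: frame_def sr_def ds_def cl_def wt_def)
    show "tri b (orient ?R D ;; ?loop) s1
      (orient_c ?R D * (n + rr + M + 1) + (3 + 2 * D * (?body * ?T + 4))) (post ?R s)"
    proof (rule tri_Sq)
      have "tri b (orient ?R (4 * d)) s1 (orient_c ?R (4 * d) * (n + rr + length xs + 1)) (\<lambda>s'.
          labelled (4 * d) sr ds (ar s' (LAB ?R)) (set xs) \<and>
          (\<forall>e. e \<notin> set xs \<longrightarrow> ar s' (LAB ?R) e = ar s1 (LAB ?R) e))"
      proof (rule orient_spec)
        show "dense_at d sr ds (set xs)"
          by (rule sound_dense[OF closed density S r(1) xs(3,4)])
        show "\<forall>e\<in>set xs. sr e < n \<and> ds e < n" using sound_range[OF S] xs(3) by auto
      qed (use i1 f1 xs bounds len rounds in \<open>auto simp: inv_def\<close>)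
      then show "tri b (orient ?R D) s1 (orient_c ?R D * (n + rr + M + 1)) (\<lambda>s'.
          labelled D sr ds (ar s' (LAB ?R)) (set xs) \<and>
          (\<forall>e. e \<notin> set xs \<longrightarrow> ar s' (LAB ?R) e = ar s1 (LAB ?R) e))"
        unfolding D by (rule tri_conseq) (use len in auto)
    next
      fix s2 :: pst assume fr2: "frame (orient ?R D) s1 s2" and lab: "labelled D sr ds (ar s2 (LAB ?R)) (set xs) \<and>
          (\<forall>e. e \<notin> set xs \<longrightarrow> ar s2 (LAB ?R) e = ar s1 (LAB ?R) e)"
      define lb where "lb = ar s2 (LAB ?R)"
      have lab1: "labelled D sr ds lb (set xs)" "\<And>e. e < M \<Longrightarrow> e \<notin> set xs \<Longrightarrow> lb e = 0"
        using lab xs(6) by (auto simp: lb_def)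
      have i2: "inv s2" using i1 fr2 by (auto simp: inv_def frame_def)
      have f2: "ar s2 (SRC ?R) = sr" "ar s2 (DST ?R) = ds" "ar s2 (CLS ?R) = cl" "ar s2 (WIT ?R) = wt" "vr s2 Vfound = vr s Vfound"
        using fr2 f1 by (auto simp: frame_def)
      \<comment> \<open>Cycles are classified by the label of their record of class
        \<open>r\<close>. That record may have been discarded as a parallel one; \<open>e0\<close>
        is the selected record with the same ends.\<close>
      let ?surv = "\<lambda>p. \<exists>x e0. (\<forall>i<?R. \<exists>e<M. cl e = i \<and> sr e = x i \<and> ds e = x (Suc i mod ?R)) \<and>
         e0 \<in> set xs \<and> sr e0 = x r \<and> ds e0 = x 0 \<and> lb e0 = p + 1"
      let ?I = "\<lambda>m s'. inv s' \<and> (vr s Vfound = 1 \<longrightarrow> vr s' Vfound = 1) \<and> ((\<exists>p<m. ?surv p) \<longrightarrow> vr s' Vfound = 1)"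
      let ?loop1 = "merge ?R D ;; For Ve (V Vm) (move r D k) ;; solve D k r"
      have "tri b ?loop s2 (ecost (N (2 * D) :: (vname, aname) aexp) + 2 + 2 * D * (?body * ?T + 4)) (?I (2 * D))"
      proof (rule tri_For[where I = ?I])
        fix p and s3 :: pst assume p: "p < 2 * D" "bdd b s3" "frame ?loop s2 s3" "?I p s3"
        have nin: "SRC ?R \<notin> marrs ?loop" "DST ?R \<notin> marrs ?loop" "CLS ?R \<notin> marrs ?loop"
          "WIT ?R \<notin> marrs ?loop" "LAB ?R \<notin> marrs ?loop"
          by (auto simp: solve_arrs_def dest: subsetD[OF marrs_solve])
        have same: "ar s3 a = ar s2 a" if "a \<notin> marrs ?loop" for a
          using p(3) that unfolding frame_def by blast
        have f3: "ar s3 (SRC ?R) = sr" "ar s3 (DST ?R) = ds" "ar s3 (CLS ?R) = cl" "ar s3 (WIT ?R) = wt" "ar s3 (LAB ?R) = lb"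
          using same[OF nin(1)] same[OF nin(2)] same[OF nin(3)] same[OF nin(4)] same[OF nin(5)] f2
          by (simp_all only: lb_def)
        let ?s = "setv Vp p s3"
        have i3: "inv ?s" using p(4) by (simp add: inv_def)
        have "tri b ?loop1 ?s (merge_c ?R D * (n + M + 1) + ((3 + M * (scost (move r D k) + 4)) + solve_c D k r * ?T)) (?I (Suc p))"
        proof (rule tri_Sq)
          show "tri b (merge ?R D) ?s (merge_c ?R D * (n + M + 1)) (\<lambda>s'.
            (\<forall>v<n. 0 < ar s' FF v \<longrightarrow> ar s' FF v - 1 < M \<and> lb (ar s' FF v - 1) = p + 1 \<and>
               tail D sr ds (p + 1) (ar s' FF v - 1) = v) \<and>
            (\<forall>e<M. lb e = p + 1 \<longrightarrow> ar s' FF (tail D sr ds (p + 1) e) = e + 1))"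
            by (rule merge_spec[where A = "set xs"]) (use i3 bounds f3 lab1 in \<open>auto simp: inv_def\<close>)
        next
          fix s4 :: pst assume fr4: "frame (merge ?R D) ?s s4" and m:
            "(\<forall>v<n. 0 < ar s4 FF v \<longrightarrow> ar s4 FF v - 1 < M \<and> lb (ar s4 FF v - 1) = p + 1 \<and>
               tail D sr ds (p + 1) (ar s4 FF v - 1) = v) \<and>
            (\<forall>e<M. lb e = p + 1 \<longrightarrow> ar s4 FF (tail D sr ds (p + 1) e) = e + 1)"
          define ff where "ff = ar s4 FF"
          have i4: "inv s4" using i3 fr4 by (auto simp: inv_def frame_def)
          have f4: "sr = ar s4 (SRC ?R)" "ds = ar s4 (DST ?R)" "cl = ar s4 (CLS ?R)" "wt = ar s4 (WIT ?R)" "vr s4 Vp = p"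
            "vr s4 Vfound = vr s3 Vfound"
            using fr4 f3 by (auto simp: frame_def)
          have tl: "tail D sr ds (p + 1) e = key (\<not> p < D) sr ds e" for e by (simp add: tail_def key_def)
          have ff: "ff v - 1 < M \<and> cl (ff v - 1) = r \<and> key (\<not> p < D) sr ds (ff v - 1) = v"
            if "v < n" "ff v \<noteq> 0" for v
          proof -
            have g: "ff v - 1 < M" "lb (ff v - 1) = p + 1" "key (\<not> p < D) sr ds (ff v - 1) = v"
              using m that unfolding tl by (auto simp: ff_def)
            then have "ff v - 1 \<in> set xs" using lab1(2)[of "ff v - 1"] by auto
            then show ?thesis using g xs(3) by auto
          qed
          show "tri b (For Ve (V Vm) (move r D k) ;; solve D k r) s4
            ((3 + M * (scost (move r D k) + 4)) + solve_c D k r * ?T) (?I (Suc p))"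
          proof (rule tri_Sq)
            show "tri b (For Ve (V Vm) (move r D k)) s4 (3 + M * (scost (move r D k) + 4)) (\<lambda>s'. snd_at r s' \<and>
              (\<forall>x e0. (\<forall>i<Suc r. \<exists>e<M. cl e = i \<and> sr e = x i \<and> ds e = x (Suc i mod Suc r)) \<longrightarrow>
                sr e0 = x r \<longrightarrow> ds e0 = x 0 \<longrightarrow> ff (if p < D then x r else x 0) = Suc e0 \<longrightarrow> srv_at r s'))"
            proof (rule build_spec)
              show "snd_at (Suc r) s4" using S f4 by (simp add: snd_at_def)
            qed (use i4 f4 r ff in \<open>auto simp: inv_def ff_def\<close>)
          next
            fix s5 :: pst assume fr5: "frame (For Ve (V Vm) (move r D k)) s4 s5" and b5: "snd_at r s5 \<and>
              (\<forall>x e0. (\<forall>i<Suc r. \<exists>e<M. cl e = i \<and> sr e = x i \<and> ds e = x (Suc i mod Suc r)) \<longrightarrow>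
                sr e0 = x r \<longrightarrow> ds e0 = x 0 \<longrightarrow> ff (if p < D then x r else x 0) = Suc e0 \<longrightarrow> srv_at r s5)"
            have i5: "inv s5" using i4 fr5 by (auto simp: inv_def frame_def)
            have f5: "vr s5 Vfound = vr s3 Vfound" using fr5 f4 by (auto simp: frame_def)
            have surv5: "srv_at r s5" if "?surv p"
            proof -
              from that obtain x e0 where x: "\<forall>i<?R. \<exists>e<M. cl e = i \<and> sr e = x i \<and> ds e = x (Suc i mod ?R)"
                "e0 \<in> set xs" "sr e0 = x r" "ds e0 = x 0" "lb e0 = p + 1" by blast
              have "e0 < M" using x(2) xs(3) by auto
              then have "ff (key (\<not> p < D) sr ds e0) = e0 + 1" using m x(5) unfolding tl ff_def by blast
              then have "ff (if p < D then x r else x 0) = Suc e0" using x(3,4) by (auto simp: key_def split: if_splits)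
              then show ?thesis using b5 x by blast
            qed
            show "tri b (solve D k r) s5 (solve_c D k r * ?T) (?I (Suc p))"
            proof (rule tri_conseq[OF IH[OF i5]])
              show "snd_at r s5" using b5 by blast
              fix s' :: pst assume po: "post r s5 s'"
              have "vr s' Vfound = 1" if "p' < Suc p" "?surv p'" for p'
              proof (cases "p' = p")
                case True
                then show ?thesis using surv5 po that(2) by blast
              next
                case False
                then have "\<exists>p'<p. ?surv p'" using that by (intro exI[of _ p'] conjI) auto
                then have "vr s3 Vfound = 1" using p(4) by blast
                then show ?thesis using po f5 by simp
              qed
              then show "?I (Suc p) s'" using po p(4) f5 by auto
            qed simp
          qed
        qed
        then show "tri b ?loop1 ?s (?body * ?T) (?I (Suc p))"
          by (rule tri_conseq) (simp_all add: algebra_simps)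
      qed (use i2 f2 D bounds in auto)
      then show "tri b ?loop s2 (3 + 2 * D * (?body * ?T + 4)) (post ?R s)"
      proof (rule tri_conseq)
        fix s' :: pst assume I: "?I (2 * D) s'"
        have "\<exists>p<2 * D. ?surv p" if sv: "srv_at ?R s"
        proof -
          from sv obtain x where x: "\<forall>i<?R. \<exists>e<M. cl e = i \<and> sr e = x i \<and> ds e = x (Suc i mod ?R)"
            unfolding srv surv_def by blast
          then obtain e where "e < M" "cl e = r" "sr e = x r" "ds e = x 0" by (auto dest: spec[of _ r])
          with xs(5) obtain e0 where e0: "e0 \<in> set xs" "sr e0 = x r" "ds e0 = x 0" by metis
          have "1 \<le> lb e0" "lb e0 \<le> 2 * D" using lab1(1) e0(1) by (auto simp: labelled_def)
          then show ?thesis using x e0 by (intro exI[of _ "lb e0 - 1"]) auto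
        qed
        then show "post ?R s s'" using I by blast
      qed simp
    qed
  qed
  then show ?thesis unfolding q solve.simps
  proof (rule tri_conseq)
    have "select_c (Suc (Suc q)) (Suc q) * (M + 1) \<le> select_c (Suc (Suc q)) (Suc q) * (n + rr + M + 1)" by simp
    then show "select_c (Suc (Suc q)) (Suc q) * (M + 1) + (orient_c (Suc (Suc q)) D * (n + rr + M + 1) +
        (3 + 2 * D * ((merge_c (Suc (Suc q)) D + (7 + scost (move (Suc q) D k) + solve_c D k (Suc q))) * (n + rr + M + 1) + 4)))
      \<le> solve_c D k (Suc (Suc q)) * (n + rr + M + 1)"
      by (simp add: algebra_simps)
  qed
qed

lemma solve_spec:
  assumes "1 \<le> R" "R \<le> k" "inv s" "snd_at R s"
  shows "tri b (solve (4 * d) k R) s (solve_c (4 * d) k R * (n + rr + M + 1)) (post R s)"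
  using assms
proof (induction R arbitrary: s rule: nat_induct_at_least)
  case base
  then show ?case by (intro solve_1_spec)
next
  case (Suc R)
  then show ?case by (intro solve_step_spec) auto
qed

end

section \<open>Induced cycles and colourings\<close>

definition consec :: "nat \<Rightarrow> nat \<Rightarrow> nat \<Rightarrow> bool" where
  "consec k i j \<longleftrightarrow> (i + 1) mod k = j \<or> (j + 1) mod k = i"

definition indcyc :: "(nat \<Rightarrow> nat \<Rightarrow> bool) \<Rightarrow> nat \<Rightarrow> nat \<Rightarrow> (nat \<Rightarrow> nat) \<Rightarrow> bool" where
  "indcyc A n k p \<longleftrightarrow> (\<forall>i<k. p i < n) \<and> inj_on p {..<k} \<and> (\<forall>i<k. \<forall>j<k. A (p i) (p j) \<longleftrightarrow> consec k i j)"

text \<open>Colour \<open>k\<close> stands for uncoloured; edges to such vertices are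
  ignored.\<close>

definition badv :: "(nat \<Rightarrow> nat \<Rightarrow> bool) \<Rightarrow> (nat \<Rightarrow> nat) \<Rightarrow> nat \<Rightarrow> nat \<Rightarrow> bool" where
  "badv Or col k u \<longleftrightarrow> (\<exists>v. Or u v \<and> col u < k \<and> col v < k \<and> \<not> consec k (col u) (col v))"

definition gE :: "(nat \<Rightarrow> nat \<Rightarrow> bool) \<Rightarrow> (nat \<Rightarrow> nat \<Rightarrow> bool) \<Rightarrow> (nat \<Rightarrow> nat) \<Rightarrow> nat \<Rightarrow> nat \<Rightarrow> nat \<Rightarrow> bool" where
  "gE A Or col k u v \<longleftrightarrow> A u v \<and> col u < k \<and> (col u + 1) mod k = col v \<and> \<not> badv Or col k u \<and> \<not> badv Or col k v"

text \<open>Colours increase by one along the walk, so a closed walk of length \<open>k\<close>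
  meets every colour exactly once. A chord would be an out-edge of one of its ends into a class that
  is not consecutive, and that end would be bad.\<close>

lemma cycle_of_gpath:
  assumes k: "3 \<le> k" and A: "\<And>u v. A u v \<Longrightarrow> A v u \<and> u < n" and Or: "\<And>u v. A u v \<Longrightarrow> Or u v \<or> Or v u"
    and g: "gpath (gE A Or col k) col n k u u w"
  shows "\<exists>p. indcyc A n k p \<and> w = (\<Sum>i<k. p i * n ^ i)"
proof -
  obtain f where f: "f 0 = u" "f k = u" "\<And>i. i < k \<Longrightarrow> gE A Or col k (f i) (f (Suc i))"
    "w = (\<Sum>i<k. f i * n ^ col (f i))" using g by (auto simp: gpath_def)
  define c where "c = col u"
  have ck: "c < k" using f(3)[of 0] f(1) k by (simp add: gE_def c_def)
  have col: "i \<le> k \<Longrightarrow> col (f i) = (c + i) mod k" for i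
  proof (induction i)
    case 0
    then show ?case using f(1) ck by (simp add: c_def)
  next
    case (Suc i)
    then have "col (f (Suc i)) = (col (f i) + 1) mod k" using f(3)[of i] by (simp add: gE_def)
    then show ?case using Suc by (simp add: mod_Suc_eq)
  qed
  \<comment> \<open>The time at which the walk, starting in colour \<open>c\<close>, meets colour
    \<open>j\<close>; so \<open>p\<close> lists the cycle by colours.\<close>
  define r where "r j = (j + k - c) mod k" for j
  define p where "p j = f (r j)" for j
  have rk: "r j < k" for j using k by (simp add: r_def)
  have cr: "(c + r j) mod k = j" if "j < k" for j
  proof -
    have "(c + r j) mod k = (c + (j + k - c)) mod k" by (simp add: r_def mod_add_right_eq)
    also have "\<dots> = j" using ck that by simp
    finally show ?thesis .
  qed
  have colp: "col (p j) = j" if "j < k" for j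
    using col[of "r j"] rk[of j] cr[OF that] by (simp add: p_def)
  have good: "\<not> badv Or col k (p j)" for j
    using f(3)[OF rk[of j]] by (simp add: p_def gE_def)
  have fmod: "f (i mod k) = f i" if "i \<le> k" for i
    using that f(1,2) by (cases "i = k") auto
  have next_adj: "A (p i) (p ((i + 1) mod k))" if "i < k" for i
  proof -
    have "r ((i + 1) mod k) = Suc (r i) mod k"
    proof -
      have S: "Suc (r i) mod k = (i + k - c + 1) mod k" by (simp add: r_def mod_Suc_eq)
      show ?thesis
      proof (cases "i + 1 = k")
        case True
        then have "i + k - c + 1 = (k - c) + k" using ck by simp
        then have "Suc (r i) mod k = (k - c + k) mod k" using S by (simp only:)
        then show ?thesis using True by (simp add: r_def)
      next
        case False
        then have "(i + 1) mod k = i + 1" using that by simp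
        moreover have "i + 1 + k - c = i + k - c + 1" using ck by simp
        ultimately show ?thesis using S by (simp only: r_def)
      qed
    qed
    then have "p ((i + 1) mod k) = f (Suc (r i))" using fmod[of "Suc (r i)"] rk[of i] by (simp add: p_def)
    then show ?thesis using f(3)[OF rk[of i]] by (simp add: p_def gE_def)
  qed
  have "A (p i) (p j) \<longleftrightarrow> consec k i j" if ij: "i < k" "j < k" for i j
  proof
    assume "consec k i j"
    then show "A (p i) (p j)" using next_adj[OF ij(1)] next_adj[OF ij(2)] A by (auto simp: consec_def)
  next
    assume "A (p i) (p j)"
    from Or[OF this] show "consec k i j"
    proof
      assume "Or (p i) (p j)"
      moreover have "Or (p i) v \<longrightarrow> col (p i) < k \<longrightarrow> col v < k \<longrightarrow> consec k (col (p i)) (col v)" for v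
        using good[of i] by (auto simp: badv_def)
      from this[of "p j"] have "Or (p i) (p j) \<longrightarrow> consec k i j"
        unfolding colp[OF ij(1)] colp[OF ij(2)] using ij by blast
      ultimately show ?thesis by blast
    next
      assume "Or (p j) (p i)"
      moreover have "Or (p j) v \<longrightarrow> col (p j) < k \<longrightarrow> col v < k \<longrightarrow> consec k (col (p j)) (col v)" for v
        using good[of j] by (auto simp: badv_def)
      from this[of "p i"] have "Or (p j) (p i) \<longrightarrow> consec k j i"
        unfolding colp[OF ij(1)] colp[OF ij(2)] using ij by blast
      ultimately show ?thesis by (auto simp: consec_def)
    qed
  qed
  moreover have "inj_on p {..<k}" by (rule inj_on_inverseI[of _ col]) (use colp in auto)
  moreover have "p i < n" if "i < k" for i using A next_adj[OF that] by blast
  moreover have "w = (\<Sum>j<k. p j * n ^ j)"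
  proof -
    have rinj: "inj_on r {..<k}" by (rule inj_on_inverseI[of _ "\<lambda>i. (c + i) mod k"]) (use cr in auto)
    have "r ` {..<k} = {..<k}"
      by (rule card_subset_eq) (use rk rinj in \<open>auto simp: card_image\<close>)
    then have "bij_betw r {..<k} {..<k}" using rinj by (simp add: bij_betw_def)
    then have "w = (\<Sum>j<k. f (r j) * n ^ col (f (r j)))"
      unfolding f(4) by (rule sum.reindex_bij_betw[symmetric])
    also have "\<dots> = (\<Sum>j<k. p j * n ^ j)"
      by (rule sum.cong) (use colp in \<open>auto simp: p_def\<close>)
    finally show ?thesis .
  qed
  ultimately show ?thesis unfolding indcyc_def by blast
qed

lemma digit_sum_less:
  fixes a :: "nat \<Rightarrow> nat"
  assumes "\<And>i. i < k \<Longrightarrow> a i < q"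
  shows "(\<Sum>i<k. a i * q ^ i) < q ^ k"
  using assms
proof (induction k)
  case (Suc k)
  then have "(\<Sum>i<k. a i * q ^ i) < q ^ k" "Suc (a k) \<le> q" by (auto simp: Suc_le_eq)
  then have "(\<Sum>i<Suc k. a i * q ^ i) < q ^ k + a k * q ^ k" by simp
  also have "\<dots> = Suc (a k) * q ^ k" by simp
  also have "\<dots> \<le> q * q ^ k" using \<open>Suc (a k) \<le> q\<close> by (rule mult_le_mono1)
  finally show ?case by simp
qed simp

lemma digit_sum:
  fixes a :: "nat \<Rightarrow> nat"
  assumes "\<And>i. i < k \<Longrightarrow> a i < q" "j < k"
  shows "(\<Sum>i<k. a i * q ^ i) div q ^ j mod q = a j"
  using assms
proof (induction j arbitrary: k a)
  case 0
  then obtain k' where k: "k = Suc k'" by (cases k) auto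
  have "(\<Sum>i<k. a i * q ^ i) = a 0 + q * (\<Sum>i<k'. a (Suc i) * q ^ i)"
    unfolding k by (subst sum.lessThan_Suc_shift) (simp add: sum_distrib_left ac_simps)
  then show ?case using 0 by simp
next
  case (Suc j)
  then obtain k' where k: "k = Suc k'" by (cases k) auto
  have q: "a 0 < q" using Suc.prems k by auto
  have "(\<Sum>i<k. a i * q ^ i) = a 0 + q * (\<Sum>i<k'. a (Suc i) * q ^ i)"
    unfolding k by (subst sum.lessThan_Suc_shift) (simp add: sum_distrib_left ac_simps)
  then have "(\<Sum>i<k. a i * q ^ i) div q = (\<Sum>i<k'. a (Suc i) * q ^ i)" using q by simp
  then have "(\<Sum>i<k. a i * q ^ i) div q ^ Suc j mod q = (\<Sum>i<k'. a (Suc i) * q ^ i) div q ^ j mod q"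
    by (simp add: div_mult2_eq)
  also have "\<dots> = a (Suc j)" using Suc.IH[of k' "\<lambda>i. a (Suc i)"] Suc.prems k by auto
  finally show ?case .
qed

section \<open>Induced cycles as vertex sets and as cyclic sequences of indices\<close>

lemma doubleton_image_eq:
  assumes "inj_on f B" "a \<in> B" "b \<in> B" "c \<in> B" "d \<in> B"
  shows "{f a, f b} = {f c, f d} \<longleftrightarrow> {a, b} = {c, d}"
  using assms by (auto simp: doubleton_eq_iff inj_on_def)

lemma consec_iff: "i < k \<Longrightarrow> j < k \<Longrightarrow> consec k i j \<longleftrightarrow> (\<exists>m<k. {i, j} = {m, (m + 1) mod k})"
  unfolding consec_def by (auto simp: doubleton_eq_iff)

definition idx_adj :: "ugraph \<Rightarrow> nat list \<Rightarrow> nat \<Rightarrow> nat \<Rightarrow> bool" where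
  "idx_adj G vs u v \<longleftrightarrow> u < length vs \<and> v < length vs \<and> {vs ! u, vs ! v} \<in> edges G"

lemma induced_cycle_of_indcyc:
  assumes G: "simple_graph G" and vs: "distinct vs" "set vs = verts G" and k: "3 \<le> k"
    and p: "indcyc (idx_adj G vs) (length vs) k p"
  shows "induced_cycle k G ((\<lambda>i. vs ! p i) ` {..<k})"
proof -
  let ?f = "\<lambda>i. vs ! p i" and ?S = "(\<lambda>i. vs ! p i) ` {..<k}"
  have lt: "p i < length vs" if "i < k" for i using p that by (simp add: indcyc_def)
  have inj: "inj_on ?f {..<k}"
    using p lt nth_eq_iff_index_eq[OF vs(1)] by (auto simp: indcyc_def inj_on_def)
  have adj: "{?f i, ?f j} \<in> edges G \<longleftrightarrow> consec k i j" if "i < k" "j < k" for i j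
    using p that lt by (auto simp: indcyc_def idx_adj_def)
  have "?S \<subseteq> verts G" using lt vs(2) by auto
  moreover have "card ?S = k" using inj by (simp add: card_image)
  moreover have "isomorphic (cycle_graph k) (induced_subgraph G ?S)"
    unfolding isomorphic_def
  proof (intro exI conjI)
    show "bij_betw ?f (verts (cycle_graph k)) (verts (induced_subgraph G ?S))"
      using inj by (simp add: bij_betw_def cycle_graph_def induced_subgraph_def)
    show "edges (induced_subgraph G ?S) = (\<lambda>e. ?f ` e) ` edges (cycle_graph k)"
    proof (intro equalityI subsetI)
      fix e assume "e \<in> edges (induced_subgraph G ?S)"
      then have e: "e \<in> edges G" "e \<subseteq> ?S" by (auto simp: induced_subgraph_def)
      obtain x y where "e = {x, y}" using edgeE[OF G e(1)] by blast
      then obtain i j where ij: "i < k" "j < k" "e = {?f i, ?f j}" using e(2) by auto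
      then obtain m where m: "m < k" "{i, j} = {m, (m + 1) mod k}"
        using adj[OF ij(1,2)] e(1) consec_iff by auto
      have "e = ?f ` {i, j}" using ij by simp
      also note m(2)
      finally show "e \<in> (\<lambda>e. ?f ` e) ` edges (cycle_graph k)" 
        by (rule image_eqI) (use m(1) in \<open>auto simp: cycle_graph_def\<close>)
    next
      fix e assume "e \<in> (\<lambda>e. ?f ` e) ` edges (cycle_graph k)"
      then obtain m where m: "m < k" "e = {?f m, ?f ((m + 1) mod k)}" by (auto simp: cycle_graph_def)
      moreover have "(m + 1) mod k < k" using k by simp
      ultimately show "e \<in> edges (induced_subgraph G ?S)"
        using adj[of m "(m + 1) mod k"] by (auto simp: induced_subgraph_def consec_def)
    qed
  qed
  ultimately show ?thesis using k by (auto simp: induced_cycle_def is_cycle_def)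
qed

lemma indcyc_of_induced_cycle:
  assumes G: "simple_graph G" and vs: "distinct vs" "set vs = verts G" and S: "induced_cycle k G S"
  shows "\<exists>p. indcyc (idx_adj G vs) (length vs) k p"
proof -
  from S have S: "S \<subseteq> verts G" "card S = k" by (auto simp: induced_cycle_def)
  from assms(4) obtain l where l: "3 \<le> l" and iso: "isomorphic (cycle_graph l) (induced_subgraph G S)"
    unfolding induced_cycle_def is_cycle_def by blast
  from iso obtain f where "bij_betw f (verts (cycle_graph l)) (verts (induced_subgraph G S))"
    "edges (induced_subgraph G S) = (\<lambda>e. f ` e) ` edges (cycle_graph l)"
    unfolding isomorphic_def by blast
  then have f: "bij_betw f {..<l} S" "{e \<in> edges G. e \<subseteq> S} = (\<lambda>e. f ` e) ` {{i, (i + 1) mod l} | i. i < l}"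
    by (simp_all add: cycle_graph_def induced_subgraph_def)
  have lk: "l = k" using bij_betw_same_card[OF f(1)] S(2) by simp
  have inj: "inj_on f {..<k}" and fS: "f i \<in> S" if "i < k" for i
    using f(1) that lk by (auto simp: bij_betw_def)
  have injf: "inj_on f {..<k}" using f(1) lk by (simp add: bij_betw_def)
  define p where "p i = (SOME j. j < length vs \<and> vs ! j = f i)" for i
  have p: "p i < length vs \<and> vs ! p i = f i" if "i < k" for i
  proof -
    have "f i \<in> set vs" using fS[OF that] S(1) vs(2) by blast
    then have "\<exists>j. j < length vs \<and> vs ! j = f i" by (simp add: in_set_conv_nth)
    then show ?thesis unfolding p_def by (rule someI_ex)
  qed
  have "inj_on p {..<k}"
  proof (rule inj_onI)
    fix i j assume "i \<in> {..<k}" "j \<in> {..<k}" "p i = p j"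
    then have "f i = f j" using p[of i] p[of j] by auto
    then show "i = j" using injf \<open>i \<in> {..<k}\<close> \<open>j \<in> {..<k}\<close> by (auto simp: inj_on_def)
  qed
  moreover have "idx_adj G vs (p i) (p j) \<longleftrightarrow> consec k i j" if ij: "i < k" "j < k" for i j
  proof -
    have "idx_adj G vs (p i) (p j) \<longleftrightarrow> {f i, f j} \<in> {e \<in> edges G. e \<subseteq> S}"
      using p[OF ij(1)] p[OF ij(2)] fS ij by (simp add: idx_adj_def)
    also have "\<dots> \<longleftrightarrow> (\<exists>m<k. {f i, f j} = {f m, f ((m + 1) mod k)})"
      unfolding f(2) lk image_iff by (auto simp del: image_insert) (metis image_insert image_empty)+
    also have "\<dots> \<longleftrightarrow> (\<exists>m<k. {i, j} = {m, (m + 1) mod k})"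
    proof (intro ex_cong1 conj_cong refl)
      fix m assume "m < k"
      then show "{f i, f j} = {f m, f ((m + 1) mod k)} \<longleftrightarrow> {i, j} = {m, (m + 1) mod k}"
        using ij l lk by (intro doubleton_image_eq[OF injf]) auto
    qed
    also have "\<dots> \<longleftrightarrow> consec k i j" using consec_iff[OF ij] by simp
    finally show ?thesis .
  qed
  ultimately show ?thesis using p unfolding indcyc_def by blast
qed

text \<open>Taking the last hit matches a loop in which later hits overwrite earlier ones; the
  default, \<open>k\<close> in \<open>colour\<close>, means uncoloured.\<close>

primrec lastm :: "(nat \<Rightarrow> nat) \<Rightarrow> nat \<Rightarrow> nat \<Rightarrow> nat \<Rightarrow> nat" where
  "lastm z x d 0 = d"
| "lastm z x d (Suc m) = (if z m = x then m else lastm z x d m)"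

definition colour :: "(nat \<Rightarrow> nat) \<Rightarrow> (nat \<Rightarrow> nat) \<Rightarrow> nat \<Rightarrow> nat \<Rightarrow> nat" where
  "colour z h k v = lastm z (h v) k k"

lemma lastm_found: "i < m \<Longrightarrow> z i = x \<Longrightarrow> lastm z x d m < m \<and> z (lastm z x d m) = x"
  by (induction m) (auto simp: less_Suc_eq)

lemma lastm_value: "m \<le> d \<Longrightarrow> lastm z x d m < d \<Longrightarrow> z (lastm z x d m) = x"
  by (induction m) (auto split: if_splits)

text \<open>If the hash function separates the cycle together with all out-neighbours of its vertices, the
  digits chosen as the hash values of the cycle colour it in cyclic order and leave no vertex of it bad.\<close>

lemma good_colouring:
  assumes p: "indcyc A n k p" and Or: "\<And>u v. Or u v \<Longrightarrow> A u v"
    and inj: "inj_on h (p ` {..<k} \<union> {v. \<exists>i<k. Or (p i) v})"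
    and z: "\<And>i. i < k \<Longrightarrow> z i = h (p i)" and i: "i < k" and k: "2 \<le> k"
  shows "gE A Or (colour z h k) k (p i) (p ((i + 1) mod k))" "colour z h k (p i) = i"
proof -
  let ?U = "p ` {..<k} \<union> {v. \<exists>i<k. Or (p i) v}"
  have pinj: "inj_on p {..<k}" using p by (simp add: indcyc_def)
  have col1: "v = p j" if "v \<in> ?U" "j < k" "z j = h v" for v j
    using inj that z by (auto simp: inj_on_def)
  have colp: "colour z h k (p i) = i" if "i < k" for i
  proof -
    let ?j = "colour z h k (p i)"
    have j: "?j < k" "z ?j = h (p i)" using lastm_found[of i k z "h (p i)" k] that z by (auto simp: colour_def)
    then have "p i = p ?j" using that by (intro col1) auto
    then show ?thesis using pinj j that by (auto simp: inj_on_def)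
  qed
  \<comment> \<open>A coloured out-neighbour shares its hash value with the cycle vertex of that
    colour and equals it by injectivity. So coloured out-neighbours lie on the cycle, which has no
    chords.\<close>
  have colv: "v = p (colour z h k v)" if "v \<in> ?U" "colour z h k v < k" for v
  proof -
    have "z (colour z h k v) = h v" using that(2) lastm_value[of k k z "h v"] by (simp add: colour_def)
    then show ?thesis using col1 that by blast
  qed
  have good: "\<not> badv Or (colour z h k) k (p i)" if i: "i < k" for i
  proof
    assume "badv Or (colour z h k) k (p i)"
    then obtain v where v: "Or (p i) v" "colour z h k v < k" "\<not> consec k i (colour z h k v)"
      using colp[OF i] by (auto simp: badv_def)
    define j where "j = colour z h k v"
    have "v = p j" using colv[of v] v i by (auto simp: j_def)
    then have "A (p i) (p j)" using Or v(1) by simp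
    then show False using p v(2,3) i by (simp add: indcyc_def j_def)
  qed
  show "colour z h k (p i) = i" using colp i .
  have "(i + 1) mod k < k" using k by simp
  moreover have "A (p i) (p ((i + 1) mod k))"
    using p i \<open>(i + 1) mod k < k\<close> by (auto simp: indcyc_def consec_def)
  ultimately show "gE A Or (colour z h k) k (p i) (p ((i + 1) mod k))"
    using colp good i by (simp add: gE_def)
qed

section \<open>Reading and preparing the input\<close>

text \<open>The machine has no logarithm or square root. A power of two and a square root, both
  rounded up, are found by raising each candidate until it is large enough; \<open>n\<close>
  iterations suffice for both.\<close>

definition sizes_step :: pprog where
  "sizes_step =
     Cond (Ls (V Vp) (V Vn)) (Asg Vp (Pl (V Vp) (V Vp)) ;; Asg Vl (Pl (V Vl) (N 1))) Nop ;;
     Cond (Ls (Ti (V VM) (V VM)) (V Vn)) (Asg VM (Pl (V VM) (N 1))) Nop"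

definition sizes :: pprog where
  "sizes = Get Vn (N 0) ;; Asg Vp (N 1) ;; For Vi (V Vn) sizes_step"

definition read_edge :: "nat \<Rightarrow> pprog" where
  "read_edge R = Get Vx (Pl (V Vu) (V Vj)) ;; Put (SRC R) (V Vm) (V Vi) ;; Put (DST R) (V Vm) (V Vx) ;;
     Asg Vm (Pl (V Vm) (N 1))"

definition read_list :: "nat \<Rightarrow> pprog" where
  "read_list R = Get Vu (Pl (N 1) (V Vi)) ;; Get Vv (Pl (N 2) (V Vi)) ;; For Vj (Mi (V Vv) (V Vu)) (read_edge R)"

definition read_edges :: "nat \<Rightarrow> pprog" where
  "read_edges R = For Vi (V Vn) (read_list R)"

definition weight1 :: pprog where
  "weight1 = Put WT (Pl (Ti (V Vx) (V VM)) (V Vy)) (N 1)"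

definition weights :: pprog where
  "weights = For Vx (V VM) (For Vy (V VM) weight1)"

text \<open>Of the two arcs of an edge only the one with the smaller source is oriented; label
  \<open>0\<close> marks the other.\<close>

definition pick :: "nat \<Rightarrow> pprog" where
  "pick R = Put (LAB R) (V Ve) (N 0) ;;
     Cond (Ls (Ar (SRC R) (V Ve)) (Ar (DST R) (V Ve))) (Put LL (V Vlen) (V Ve) ;; Asg Vlen (Pl (V Vlen) (N 1))) Nop"

text \<open>The program \<open>find_cycle\<close> uses \<open>c = 2 * d\<close>: there are at most
  \<open>2 * d * n\<close> arcs, fewer than \<open>2 ^ (l + 2 * d)\<close>. The same number of
  rounds in \<open>Vr\<close> serves all levels of the search.\<close>

definition prepare :: "nat \<Rightarrow> nat \<Rightarrow> nat \<Rightarrow> pprog" where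
  "prepare R D c = Asg Vr (Pl (V Vl) (N c)) ;; Asg Vlen (N 0) ;; For Ve (V Vm) (pick R) ;; orient R D"

definition power1 :: pprog where
  "power1 = Put PW (V Vi) (V Vp) ;; Asg Vp (Ti (V Vp) (V Vn))"

definition powers :: "nat \<Rightarrow> pprog" where
  "powers k = Asg Vp (N 1) ;; For Vi (N k) power1"

lemma mods_setup [simp]:
  "mvars sizes_step = {Vp, Vl, VM}" "marrs sizes_step = {}"
  "mvars sizes = {Vn, Vp, Vi, Vl, VM}" "marrs sizes = {}"
  "mvars (read_edge R) = {Vx, Vm}" "marrs (read_edge R) = {SRC R, DST R}"
  "mvars (read_list R) = {Vu, Vv, Vj, Vx, Vm}" "marrs (read_list R) = {SRC R, DST R}"
  "mvars (read_edges R) = {Vi, Vu, Vv, Vj, Vx, Vm}" "marrs (read_edges R) = {SRC R, DST R}"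
  "mvars weight1 = {}" "marrs weight1 = {WT}" "mvars weights = {Vx, Vy}" "marrs weights = {WT}"
  "mvars (pick R) = {Vlen}" "marrs (pick R) = {LAB R, LL}"
  "mvars (prepare R D c) = {Vr, Ve, Vu, Vv, Vi, Vlen, Vnew, Vrd}" "marrs (prepare R D c) = {DEG, LAB R, OC, LL}"
  "mvars power1 = {Vp}" "marrs power1 = {PW}" "mvars (powers k) = {Vp, Vi}" "marrs (powers k) = {PW}"
  by (auto simp: sizes_step_def sizes_def read_edge_def read_list_def read_edges_def weight1_def weights_def
      pick_def prepare_def power1_def powers_def)

definition sizes_c :: nat where "sizes_c = 20 + scost sizes_step"

lemma sizes_spec:
  fixes s :: pst
  assumes s: "inp s \<noteq> []" "inp s ! 0 = n" "vr s = (\<lambda>_. 0)" and b: "2 * n + 2 \<le> b"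
  shows "tri b sizes s (sizes_c * (n + 1)) (\<lambda>s'. vr s' Vn = n \<and> n \<le> 2 ^ vr s' Vl \<and> 2 ^ vr s' Vl \<le> 2 * n + 1 \<and>
    vr s' Vl \<le> n \<and> n \<le> vr s' VM * vr s' VM \<and> vr s' VM * vr s' VM \<le> 4 * n \<and> vr s' VM \<le> n)" (is "tri b _ s _ ?Q")
proof -
  have "tri b (Get Vn (N 0) ;; Asg Vp (N 1) ;; For Vi (V Vn) sizes_step) s
     (scost (Get Vn (N 0) :: pprog) + (scost (Asg Vp (N 1) :: pprog) + (1 + 2 + n * (scost sizes_step + 4)))) ?Q"
  proof (rule tri_Sq)
    show "tri b (Get Vn (N 0)) s (scost (Get Vn (N 0) :: pprog)) (\<lambda>s'. vr s' = (\<lambda>_. 0)(Vn := n))"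
      by (rule tri_straight) (use s b in auto)
  next
    fix s1 :: pst assume s1: "vr s1 = (\<lambda>_. 0)(Vn := n)"
    show "tri b (Asg Vp (N 1) ;; For Vi (V Vn) sizes_step) s1
      (scost (Asg Vp (N 1) :: pprog) + (1 + 2 + n * (scost sizes_step + 4))) ?Q"
    proof (rule tri_Sq)
      show "tri b (Asg Vp (N 1)) s1 (scost (Asg Vp (N 1) :: pprog)) (\<lambda>s'. vr s' = (\<lambda>_. 0)(Vn := n, Vp := 1))"
        by (rule tri_straight) (use s1 b in auto)
    next
      fix s2 :: pst assume s2: "vr s2 = (\<lambda>_. 0)(Vn := n, Vp := 1)"
      \<comment> \<open>Either a target is reached or every iteration so far has raised its
        candidate. The previous candidate was too small, which gives the upper bounds.\<close>
      let ?I = "\<lambda>m (s' :: pst). vr s' Vn = n \<and> vr s' Vp = 2 ^ vr s' Vl \<and> (n \<le> vr s' Vp \<or> vr s' Vl = m) \<and>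
        (vr s' Vl = 0 \<or> vr s' Vp < 2 * n) \<and> vr s' Vl \<le> m \<and>
        (n \<le> vr s' VM * vr s' VM \<or> vr s' VM = m) \<and> (vr s' VM = 0 \<or> (vr s' VM - 1) * (vr s' VM - 1) < n) \<and> vr s' VM \<le> m"
      have "tri b (For Vi (V Vn) sizes_step) s2 (ecost (V Vn :: (vname, aname) aexp) + 2 + n * (scost sizes_step + 4)) (?I n)"
      proof (rule tri_For_straight[where I = ?I])
        fix i and s' :: pst assume i: "i < n" "?I i s'"
        show "ok b sizes_step (setv Vi i s') \<and> ?I (Suc i) (ev sizes_step (setv Vi i s'))"
          using i b by (auto simp: sizes_step_def)
      qed (use s2 b in \<open>auto simp: sizes_step_def\<close>)
      then show "tri b (For Vi (V Vn) sizes_step) s2 (1 + 2 + n * (scost sizes_step + 4)) ?Q"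
      proof (rule tri_conseq)
        fix s' :: pst assume I: "?I n s'"
        define l where "l = vr s' Vl"
        define m where "m = vr s' VM"
        have "n \<le> 2 ^ l" using I less_exp[of n] by (auto simp: l_def less_imp_le)
        moreover have "2 ^ l \<le> 2 * n + 1" using I by (auto simp: l_def)
        moreover have "n \<le> m * m" using I by (auto simp: m_def)
        moreover have "m * m \<le> 4 * n"
        proof (cases "m \<le> 1")
          case True
          then have "m = 0 \<or> m = 1" by auto
          then show ?thesis using I by (auto simp: m_def)
        next
          case False
          then have "m * m \<le> (2 * (m - 1)) * (2 * (m - 1))" by (intro mult_mono) auto
          also have "\<dots> = 4 * ((m - 1) * (m - 1))" by simp
          also have "\<dots> \<le> 4 * n" using I False by (auto simp: m_def)
          finally show ?thesis .
        qed
        ultimately show "?Q s'" using I unfolding l_def m_def by blast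
      qed simp
    qed
  qed
  then show ?thesis unfolding sizes_def
    by (rule tri_conseq) (simp_all add: sizes_c_def algebra_simps)
qed

section \<open>Reading the adjacency lists\<close>

definition arcs :: "nat list list \<Rightarrow> (nat \<times> nat) list" where
  "arcs adj = concat (map (\<lambda>i. map (Pair i) (adj ! i)) [0..<length adj])"

lemma length_concat_take_arcs:
  "i \<le> length adj \<Longrightarrow> length (concat (take i (map (\<lambda>i. map (Pair i) (adj ! i)) [0..<length adj]))) = length (concat (take i adj))"
  by (induction i) (simp_all add: take_Suc_conv_app_nth)

lemma length_arcs: "length (arcs adj) = length (concat adj)"
  using length_concat_take_arcs[of "length adj" adj] by (simp add: arcs_def)

lemma arcs_nth:
  "i < length adj \<Longrightarrow> j < length (adj ! i) \<Longrightarrow> arcs adj ! (length (concat (take i adj)) + j) = (i, adj ! i ! j)"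
  using concat_take_nth[of i "map (\<lambda>i. map (Pair i) (adj ! i)) [0..<length adj]" j] length_concat_take_arcs[of i adj]
  by (simp add: arcs_def)

lemma set_arcs: "set (arcs adj) = {(i, j). i < length adj \<and> j \<in> set (adj ! i)}"
  by (auto simp: arcs_def)

lemma distinct_arcs:
  assumes "\<And>i. i < length adj \<Longrightarrow> distinct (adj ! i)"
  shows "distinct (arcs adj)"
proof -
  have "distinct (concat (map (\<lambda>i. map (Pair i) (adj ! i)) [0..<m]))" if "m \<le> length adj" for m
    using that by (induction m) (auto simp: assms distinct_map inj_on_def)
  then show ?thesis by (simp add: arcs_def)
qed

lemma length_concat_take_le: "length (concat (take i xs)) \<le> length (concat xs)"
proof -
  have "concat xs = concat (take i xs) @ concat (drop i xs)" by (metis append_take_drop_id concat_append)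
  then show ?thesis by simp
qed

definition read_c :: "nat \<Rightarrow> nat" where
  "read_c R = 40 + scost (Get Vu (Pl (N 1) (V Vi)) :: pprog) + scost (Get Vv (Pl (N 2) (V Vi)) :: pprog) + scost (read_edge R)"

text \<open>The length of one list is bounded only in total, so the potential
  \<open>c * (M - ?off i)\<close> pays for the entries not yet read.\<close>

lemma read_edges_spec:
  fixes s :: pst
  assumes s: "inp s = encode_adj adj" "vr s Vn = n" "vr s Vm = 0" and n: "length adj = n"
    and M: "length (arcs adj) = M" and b: "n + 2 + M \<le> b" and rng: "\<And>i j. i < n \<Longrightarrow> j \<in> set (adj ! i) \<Longrightarrow> j < n"
  shows "tri b (read_edges R) s (read_c R * (n + M + 1)) (\<lambda>s'. vr s' Vm = M \<and>
    (\<forall>e<M. ar s' (SRC R) e = fst (arcs adj ! e) \<and> ar s' (DST R) e = snd (arcs adj ! e)))"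
proof -
  let ?off = "\<lambda>i. length (concat (take i adj))"
  let ?J = "\<lambda>m (s' :: pst). vr s' Vm = m \<and> (\<forall>e<m. ar s' (SRC R) e = fst (arcs adj ! e) \<and> ar s' (DST R) e = snd (arcs adj ! e))"
  define c where "c = scost (read_edge R) + 4"
  define c0 where "c0 = scost (Get Vu (Pl (N 1) (V Vi)) :: pprog) + (scost (Get Vv (Pl (N 2) (V Vi)) :: pprog) + 5)"
  have len: "length (encode_adj adj) = n + 2 + M" by (simp add: length_encode_adj n M[symmetric] length_arcs)
  have offS: "?off (Suc i) = ?off i + length (adj ! i)" if "i < n" for i
    using that n by (simp add: take_Suc_conv_app_nth)
  have offM: "?off i \<le> M" for i using length_concat_take_le[of i adj] M by (simp add: length_arcs)
  have "tri b (For Vi (V Vn) (read_list R)) s (ecost (V Vn :: (vname, aname) aexp) + 2 + n * (c0 + 4) + c * (M - ?off 0)) (\<lambda>s'. ?J (?off n) s')"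
  proof (rule trq_For[where I = "\<lambda>i s'. ?J (?off i) s'" and \<phi> = "\<lambda>i _. c * (M - ?off i)"])
    fix i and s' :: pst assume i: "i < n" "bdd b s'" "frame (For Vi (V Vn) (read_list R)) s s'" "?J (?off i) s'"
    have inp: "inp s' = encode_adj adj" using i(3) s by (simp add: frame_def)
    have g1: "encode_adj adj ! (1 + i) = n + 2 + ?off i" using encode_adj_nth_start[of i adj] i n by simp
    have g2: "encode_adj adj ! (2 + i) = n + 2 + ?off (Suc i)" using encode_adj_nth_start[of "Suc i" adj] i n by simp
    let ?s = "setv Vi i s'"
    have "tri b (read_list R) ?s (scost (Get Vu (Pl (N 1) (V Vi)) :: pprog) + (scost (Get Vv (Pl (N 2) (V Vi)) :: pprog) +
        (3 + 2 + length (adj ! i) * c))) (\<lambda>s''. ?J (?off (Suc i)) s'')"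
      unfolding read_list_def
    proof (rule tri_Sq)
      show "tri b (Get Vu (Pl (N 1) (V Vi))) ?s (scost (Get Vu (Pl (N 1) (V Vi)) :: pprog)) (\<lambda>s''. vr s'' Vu = n + 2 + ?off i)"
        by (rule tri_straight) (use i inp g1 len offM[of i] b in auto)
    next
      fix s1 :: pst assume s1: "frame (Get Vu (Pl (N 1) (V Vi))) ?s s1" "vr s1 Vu = n + 2 + ?off i"
      show "tri b (Get Vv (Pl (N 2) (V Vi)) ;; For Vj (Mi (V Vv) (V Vu)) (read_edge R)) s1
        (scost (Get Vv (Pl (N 2) (V Vi)) :: pprog) + (3 + 2 + length (adj ! i) * c)) (\<lambda>s''. ?J (?off (Suc i)) s'')"
      proof (rule tri_Sq)
        show "tri b (Get Vv (Pl (N 2) (V Vi))) s1 (scost (Get Vv (Pl (N 2) (V Vi)) :: pprog)) (\<lambda>s''. vr s'' Vv = n + 2 + ?off (Suc i))"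
          by (rule tri_straight) (use i inp g2 len offM[of "Suc i"] b s1(1) in \<open>auto simp: frame_def\<close>)
      next
        fix s2 :: pst assume s2: "frame (Get Vv (Pl (N 2) (V Vi))) s1 s2" "vr s2 Vv = n + 2 + ?off (Suc i)"
        have f2: "vr s2 Vu = n + 2 + ?off i" "vr s2 Vi = i" "inp s2 = encode_adj adj" "?J (?off i) s2"
          using s2(1) s1 i inp by (auto simp: frame_def)
        let ?K = "\<lambda>j (s' :: pst). ?J (?off i + j) s'"
        have "tri b (For Vj (Mi (V Vv) (V Vu)) (read_edge R)) s2
            (ecost (Mi (V Vv) (V Vu) :: (vname, aname) aexp) + 2 + length (adj ! i) * (scost (read_edge R) + 4)) (?K (length (adj ! i)))"
        proof (rule tri_For_straight[where I = ?K])
          fix j and s3 :: pst assume j: "j < length (adj ! i)" "bdd b s3"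
            "frame (For Vj (Mi (V Vv) (V Vu)) (read_edge R)) s2 s3" "?K j s3"
          have f3: "vr s3 Vu = n + 2 + ?off i" "vr s3 Vi = i" "inp s3 = encode_adj adj"
            using j(3) f2 by (auto simp: frame_def)
          have lt: "?off i + j < M" using offS[OF i(1)] offM[of "Suc i"] j(1) by linarith
          have rd: "encode_adj adj ! (n + 2 + ?off i + j) = adj ! i ! j"
            using encode_adj_nth_list[of i adj j] i j n by simp
          have "adj ! i ! j < n" using rng[OF i(1)] j(1) by simp
          then have ok: "ok b (read_edge R) (setv Vj j s3)" and
            upd: "vr (ev (read_edge R) (setv Vj j s3)) Vm = ?off i + j + 1"
              "ar (ev (read_edge R) (setv Vj j s3)) (SRC R) = (ar s3 (SRC R))(?off i + j := i)"
              "ar (ev (read_edge R) (setv Vj j s3)) (DST R) = (ar s3 (DST R))(?off i + j := adj ! i ! j)"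
            using j(4) f3 rd lt len b i(1) by (auto simp: read_edge_def)
          have "arcs adj ! (?off i + j) = (i, adj ! i ! j)" using arcs_nth[of i adj j] i(1) n j(1) by simp
          then show "ok b (read_edge R) (setv Vj j s3) \<and> ?K (Suc j) (ev (read_edge R) (setv Vj j s3))"
            using ok j(4) unfolding upd by (auto simp: less_Suc_eq)
        qed (use f2 s2(2) offS[OF i(1)] offM[of "Suc i"] b in \<open>auto simp: read_edge_def\<close>)
        then show "tri b (For Vj (Mi (V Vv) (V Vu)) (read_edge R)) s2 (3 + 2 + length (adj ! i) * c) (\<lambda>s''. ?J (?off (Suc i)) s'')"
          by (rule tri_conseq) (simp_all add: c_def offS[OF i(1)])
      qed
    qed
    then show "trq b (read_list R) ?s (\<lambda>t s''. t + 4 + c * (M - ?off (Suc i)) \<le> c0 + 4 + c * (M - ?off i) \<and> ?J (?off (Suc i)) s'')"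
      unfolding tri_def
    proof (rule trq_conseq)
      fix t and s'' :: pst
      assume t: "t \<le> scost (Get Vu (Pl (N 1) (V Vi)) :: pprog) + (scost (Get Vv (Pl (N 2) (V Vi)) :: pprog) + (3 + 2 + length (adj ! i) * c)) \<and>
        ?J (?off (Suc i)) s''"
      have "M - ?off i = length (adj ! i) + (M - ?off (Suc i))" using offS[OF i(1)] offM[of "Suc i"] by linarith
      then have "c * (M - ?off i) = length (adj ! i) * c + c * (M - ?off (Suc i))" by (simp add: algebra_simps)
      then show "t + 4 + c * (M - ?off (Suc i)) \<le> c0 + 4 + c * (M - ?off i) \<and> ?J (?off (Suc i)) s''"
        using t unfolding c0_def by auto
    qed
  qed (use s b in auto)
  then show ?thesis unfolding read_edges_def
  proof (rule tri_conseq)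
    show "ecost (V Vn :: (vname, aname) aexp) + 2 + n * (c0 + 4) + c * (M - ?off 0) \<le> read_c R * (n + M + 1)"
      by (simp add: c0_def c_def read_c_def algebra_simps)
    have "?off n = M" using n M by (simp add: length_arcs)
    then show "?J (?off n) s' \<Longrightarrow> vr s' Vm = M \<and>
      (\<forall>e<M. ar s' (SRC R) e = fst (arcs adj ! e) \<and> ar s' (DST R) e = snd (arcs adj ! e))" for s' :: pst by simp
  qed
qed

lemma weights_spec:
  fixes s :: pst
  assumes s: "vr s VM = M" and b: "1 \<le> b" "M \<le> b"
  shows "tri b weights s ((scost weight1 + 14) * (M * M + 1)) (\<lambda>s'. \<forall>x<M. \<forall>y<M. ar s' WT (x * M + y) = 1)"
proof -
  have "tri b weights s (ecost (V VM :: (vname, aname) aexp) + 2 + M * ((3 + M * (scost weight1 + 4)) + 4))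
      (\<lambda>s'. \<forall>x<M. \<forall>y<M. ar s' WT (x * M + y) = 1)"
    unfolding weights_def
  proof (rule tri_For[where I = "\<lambda>m s'. \<forall>x<m. \<forall>y<M. ar s' WT (x * M + y) = 1"])
    fix i and s' :: pst assume i: "i < M" "frame (For Vx (V VM) (For Vy (V VM) weight1)) s s'"
      "\<forall>x<i. \<forall>y<M. ar s' WT (x * M + y) = 1"
    let ?s = "setv Vx i s'"
    let ?I = "\<lambda>m (s' :: pst). (\<forall>x<i. \<forall>y<M. ar s' WT (x * M + y) = 1) \<and> (\<forall>y<m. ar s' WT (i * M + y) = 1)"
    have f: "vr s' VM = M" using i(2) s by (auto simp: frame_def)
    have "tri b (For Vy (V VM) weight1) ?s (ecost (V VM :: (vname, aname) aexp) + 2 + M * (scost weight1 + 4)) (?I M)"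
    proof (rule tri_For_straight[where I = ?I])
      fix j and s2 :: pst assume j: "j < M" "frame (For Vy (V VM) weight1) ?s s2" "?I j s2"
      have "vr s2 VM = M" "vr s2 Vx = i" using j(2) f by (auto simp: frame_def)
      then show "ok b weight1 (setv Vy j s2) \<and> ?I (Suc j) (ev weight1 (setv Vy j s2))"
        using j b by (auto simp: weight1_def less_Suc_eq)
    qed (use f b i in \<open>auto simp: weight1_def\<close>)
    then show "tri b (For Vy (V VM) weight1) ?s (3 + M * (scost weight1 + 4)) (\<lambda>s'. \<forall>x<Suc i. \<forall>y<M. ar s' WT (x * M + y) = 1)"
      by (rule tri_conseq) (auto simp: less_Suc_eq)
  qed (use s b in auto)
  then show ?thesis
  proof (rule tri_conseq)
    have "M \<le> M * M" by simp
    moreover have "M * ((3 + M * (scost weight1 + 4)) + 4) = 7 * M + (scost weight1 + 4) * (M * M)" by (simp add: algebra_simps)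
    ultimately have "M * ((3 + M * (scost weight1 + 4)) + 4) \<le> (scost weight1 + 11) * (M * M)" by (simp add: algebra_simps)
    moreover have "(scost weight1 + 14) * (M * M + 1) = (scost weight1 + 11) * (M * M) + 3 * (M * M) + (scost weight1 + 14)"
      by (simp add: algebra_simps)
    moreover have "ecost (V VM :: (vname, aname) aexp) = 1" by simp
    ultimately show "ecost (V VM :: (vname, aname) aexp) + 2 + M * ((3 + M * (scost weight1 + 4)) + 4) \<le> (scost weight1 + 14) * (M * M + 1)"
      by linarith
  qed
qed

definition prepare_c :: "nat \<Rightarrow> nat \<Rightarrow> nat \<Rightarrow> nat" where
  "prepare_c R D c = 20 + scost (Asg Vr (Pl (V Vl) (N c)) :: pprog) + scost (Asg Vlen (N 0) :: pprog) + scost (pick R) + orient_c R D"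

lemma prepare_spec:
  fixes s :: pst
  assumes s: "vr s Vn = n" "vr s Vm = M" "vr s Vl = l" "sr = ar s (SRC R)" "ds = ar s (DST R)"
    and b: "n \<le> b" "2 * M \<le> b" "l + c \<le> b" "8 * d \<le> b" and rounds: "M < 2 ^ (l + c)"
    and rng: "\<And>e. e < M \<Longrightarrow> sr e < n \<and> ds e < n" and dns: "dense_at d sr ds {e. e < M \<and> sr e < ds e}"
  shows "tri b (prepare R (4 * d) c) s (prepare_c R (4 * d) c * (n + M + (l + c) + 1)) (\<lambda>s'. vr s' Vr = l + c \<and>
    labelled (4 * d) sr ds (ar s' (LAB R)) {e. e < M \<and> sr e < ds e} \<and>
    (\<forall>e<M. \<not> sr e < ds e \<longrightarrow> ar s' (LAB R) e = 0))" (is "tri b _ s _ ?Q")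
proof -
  let ?f = "\<lambda>m. filter (\<lambda>e. sr e < ds e) [0..<m]"
  have flen: "length (?f m) \<le> m" for m using length_filter_le[of "\<lambda>e. sr e < ds e" "[0..<m]"] by simp
  have fset: "set (?f M) = {e. e < M \<and> sr e < ds e}" by auto
  have "tri b (prepare R (4 * d) c) s (scost (Asg Vr (Pl (V Vl) (N c)) :: pprog) + (scost (Asg Vlen (N 0) :: pprog) +
      ((1 + 2 + M * (scost (pick R) + 4)) + orient_c R (4 * d) * (n + (l + c) + length (?f M) + 1)))) ?Q"
    unfolding prepare_def
  proof (rule tri_Sq)
    show "tri b (Asg Vr (Pl (V Vl) (N c))) s (scost (Asg Vr (Pl (V Vl) (N c)) :: pprog)) (\<lambda>s'. vr s' Vr = l + c)"
      by (rule tri_straight) (use s b in auto)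
  next
    fix s1 :: pst assume s1: "frame (Asg Vr (Pl (V Vl) (N c))) s s1" "vr s1 Vr = l + c"
    show "tri b (Asg Vlen (N 0) ;; For Ve (V Vm) (pick R) ;; orient R (4 * d)) s1 (scost (Asg Vlen (N 0) :: pprog) +
      ((1 + 2 + M * (scost (pick R) + 4)) + orient_c R (4 * d) * (n + (l + c) + length (?f M) + 1))) ?Q"
    proof (rule tri_Sq)
      show "tri b (Asg Vlen (N 0)) s1 (scost (Asg Vlen (N 0) :: pprog)) (\<lambda>s'. vr s' Vlen = 0)"
        by (rule tri_straight) auto
    next
      fix s2 :: pst assume s2: "frame (Asg Vlen (N 0)) s1 s2" "vr s2 Vlen = 0"
      have f2: "vr s2 Vn = n" "vr s2 Vm = M" "vr s2 Vr = l + c" "ar s2 (SRC R) = sr" "ar s2 (DST R) = ds"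
        using s2(1) s1 s by (auto simp: frame_def)
      let ?I = "\<lambda>m (s' :: pst). holds s' (?f m) \<and> (\<forall>e<m. ar s' (LAB R) e = 0)"
      show "tri b (For Ve (V Vm) (pick R) ;; orient R (4 * d)) s2
        ((1 + 2 + M * (scost (pick R) + 4)) + orient_c R (4 * d) * (n + (l + c) + length (?f M) + 1)) ?Q"
      proof (rule tri_Sq)
        have "tri b (For Ve (V Vm) (pick R)) s2 (ecost (V Vm :: (vname, aname) aexp) + 2 + M * (scost (pick R) + 4)) (?I M)"
        proof (rule tri_For_straight[where I = ?I])
          fix i and s' :: pst assume i: "i < M" "frame (For Ve (V Vm) (pick R)) s2 s'" "?I i s'"
          have f: "ar s' (SRC R) = sr" "ar s' (DST R) = ds" using i(2) f2 by (auto simp: frame_def)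
          have h: "vr s' Vlen = length (?f i)" "\<forall>j<length (?f i). ar s' LL j = ?f i ! j" using i(3) by (auto simp: holds_def)
          show "ok b (pick R) (setv Ve i s') \<and> ?I (Suc i) (ev (pick R) (setv Ve i s'))"
          proof (cases "sr i < ds i")
            case False
            then show ?thesis using i(3) f h by (auto simp: pick_def holds_def less_Suc_eq)
          next
            case True
            have "length (?f i) + 1 \<le> b" using flen[of i] i(1) b by linarith
            then show ?thesis using True i(1,3) f h b by (auto simp: pick_def holds_def less_Suc_eq nth_append)
          qed
        qed (use f2 s2(2) b in \<open>auto simp: pick_def holds_def\<close>)
        then show "tri b (For Ve (V Vm) (pick R)) s2 (1 + 2 + M * (scost (pick R) + 4)) (?I M)" by simp
      next
        fix s3 :: pst assume s3: "frame (For Ve (V Vm) (pick R)) s2 s3" "?I M s3"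
        have f3: "vr s3 Vn = n" "vr s3 Vr = l + c" "ar s3 (SRC R) = sr" "ar s3 (DST R) = ds"
          using s3(1) f2 by (auto simp: frame_def)
        have "tri b (orient R (4 * d)) s3 (orient_c R (4 * d) * (n + (l + c) + length (?f M) + 1)) (\<lambda>s'.
          labelled (4 * d) sr ds (ar s' (LAB R)) (set (?f M)) \<and> (\<forall>e. e \<notin> set (?f M) \<longrightarrow> ar s' (LAB R) e = ar s3 (LAB R) e))"
        proof (rule orient_spec)
          show "dense_at d sr ds (set (?f M))" unfolding fset by (rule dns)
          show "2 * length (?f M) \<le> b" "length (?f M) < 2 ^ (l + c)" using flen[of M] b rounds by linarith+
        qed (use s3 f3 b rng in auto)
        then show "tri b (orient R (4 * d)) s3 (orient_c R (4 * d) * (n + (l + c) + length (?f M) + 1)) ?Q"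
        proof (rule tri_conseq)
          fix s' :: pst assume "frame (orient R (4 * d)) s3 s'" and
            "labelled (4 * d) sr ds (ar s' (LAB R)) (set (?f M)) \<and> (\<forall>e. e \<notin> set (?f M) \<longrightarrow> ar s' (LAB R) e = ar s3 (LAB R) e)"
          then show "?Q s'" using s3(2) f3 unfolding fset by (auto simp: frame_def)
        qed simp
      qed
    qed
  qed
  then show ?thesis
  proof (rule tri_conseq)
    define X where "X = n + M + (l + c) + 1"
    let ?a = "scost (Asg Vr (Pl (V Vl) (N c)) :: pprog)" and ?b = "scost (Asg Vlen (N 0) :: pprog)"
    have "orient_c R (4 * d) * (n + (l + c) + length (?f M) + 1) \<le> orient_c R (4 * d) * X"
      using flen[of M] by (intro mult_left_mono) (auto simp: X_def)
    moreover have "M * (scost (pick R) + 4) \<le> X * (scost (pick R) + 4)" by (intro mult_le_mono1) (simp add: X_def)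
    then have "M * (scost (pick R) + 4) \<le> scost (pick R) * X + 4 * X" by (simp add: algebra_simps)
    moreover have "prepare_c R (4 * d) c * X = 20 * X + ?a * X + ?b * X + scost (pick R) * X + orient_c R (4 * d) * X"
      by (simp add: prepare_c_def algebra_simps)
    moreover have "1 \<le> X" "?a \<le> ?a * X" "?b \<le> ?b * X" by (simp_all add: X_def)
    ultimately have "?a + (?b + ((1 + 2 + M * (scost (pick R) + 4)) + orient_c R (4 * d) * (n + (l + c) + length (?f M) + 1)))
      \<le> prepare_c R (4 * d) c * X" by linarith
    then show "?a + (?b + ((1 + 2 + M * (scost (pick R) + 4)) + orient_c R (4 * d) * (n + (l + c) + length (?f M) + 1)))
      \<le> prepare_c R (4 * d) c * (n + M + (l + c) + 1)" unfolding X_def .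
  qed
qed

lemma powers_spec:
  fixes s :: pst
  assumes s: "vr s Vn = n" and b: "k \<le> b" "1 \<le> b" "n ^ k \<le> b"
  shows "tri b (powers k) s (5 + k * (scost power1 + 4)) (\<lambda>s'. \<forall>i<k. ar s' PW i = n ^ i)" (is "tri b _ s _ ?Q")
proof -
  have "tri b (powers k) s (scost (Asg Vp (N 1) :: pprog) + (ecost (N k :: (vname, aname) aexp) + 2 + k * (scost power1 + 4))) ?Q"
    unfolding powers_def
  proof (rule tri_Sq)
    show "tri b (Asg Vp (N 1)) s (scost (Asg Vp (N 1) :: pprog)) (\<lambda>s'. vr s' Vp = 1)"
      by (rule tri_straight) (use b in auto)
  next
    fix s1 :: pst assume s1: "frame (Asg Vp (N 1)) s s1" "vr s1 Vp = 1"
    have f1: "vr s1 Vn = n" using s1(1) s by (auto simp: frame_def)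
    let ?I = "\<lambda>m (s' :: pst). vr s' Vp = n ^ m \<and> (\<forall>i<m. ar s' PW i = n ^ i)"
    have "tri b (For Vi (N k) power1) s1 (ecost (N k :: (vname, aname) aexp) + 2 + k * (scost power1 + 4)) (?I k)"
    proof (rule tri_For_straight[where I = ?I])
      fix i and s' :: pst assume i: "i < k" "bdd b s'" "frame (For Vi (N k) power1) s1 s'" "?I i s'"
      have f: "vr s' Vn = n" using i(3) f1 by (auto simp: frame_def)
      have pi: "n ^ i \<le> b" using i(2,4) bdd_var[of b s' Vp] by simp
      have "n ^ Suc i \<le> b"
      proof (cases "n = 0")
        case False
        then have "n ^ Suc i \<le> n ^ k" using i(1) by (intro power_increasing) auto
        then show ?thesis using b by linarith
      qed simp
      then show "ok b power1 (setv Vi i s') \<and> ?I (Suc i) (ev power1 (setv Vi i s'))"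
        using i(4) f pi by (auto simp: power1_def less_Suc_eq mult.commute)
    qed (use s1 b in \<open>auto simp: power1_def\<close>)
    then show "tri b (For Vi (N k) power1) s1 (ecost (N k :: (vname, aname) aexp) + 2 + k * (scost power1 + 4)) ?Q"
      by (rule tri_conseq) auto
  qed
  then show ?thesis by (rule tri_conseq) auto
qed

section \<open>One colouring\<close>

text \<open>The variable \<open>Vq\<close> encodes a guess of the hash values of the
  \<open>k\<close> cycle vertices as digits of base \<open>Q\<close>.\<close>

definition digit_step :: "nat \<Rightarrow> pprog" where
  "digit_step Q = Put ZZ (V Vi) (Md (V Vp) (N Q)) ;; Asg Vp (Dv (V Vp) (N Q))"

definition digits :: "nat \<Rightarrow> nat \<Rightarrow> pprog" where
  "digits k Q = Asg Vp (V Vq) ;; For Vi (N k) (digit_step Q)"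

definition colour1 :: "nat \<Rightarrow> pprog" where
  "colour1 q = Cond (Eq (Ar ZZ (V Vi)) (Pl (Ti (Ar HH (Dv (V Vv) (V VM))) (N q)) (Ar HH (Md (V Vv) (V VM)))))
     (Put COL (V Vv) (V Vi)) Nop"

definition colours :: "nat \<Rightarrow> nat \<Rightarrow> pprog" where
  "colours k q = For Vv (V Vn) (Put COL (V Vv) (N k) ;; Put BAD (V Vv) (N 0) ;; For Vi (N k) (colour1 q))"

text \<open>Products act as conjunctions and \<open>1\<close> minus an \<open>Eq\<close> as a
  negation; the two negated equations are the two cases of \<open>consec\<close>.\<close>

definition bad1 :: "nat \<Rightarrow> nat \<Rightarrow> nat \<Rightarrow> pprog" where
  "bad1 R D k = Cond (Ar (LAB R) (V Ve))
     (Cond (Ls (Ar (LAB R) (V Ve)) (N (D + 1)))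
        (Asg Vu (Ar (SRC R) (V Ve)) ;; Asg Vx (Ar (DST R) (V Ve)))
        (Asg Vu (Ar (DST R) (V Ve)) ;; Asg Vx (Ar (SRC R) (V Ve))) ;;
      Cond (Ti (Ls (Ar COL (V Vu)) (N k)) (Ti (Ls (Ar COL (V Vx)) (N k))
          (Ti (Mi (N 1) (Eq (Md (Pl (Ar COL (V Vu)) (N 1)) (N k)) (Ar COL (V Vx))))
              (Mi (N 1) (Eq (Md (Pl (Ar COL (V Vx)) (N 1)) (N k)) (Ar COL (V Vu)))))))
        (Put BAD (V Vu) (N 1)) Nop) Nop"

text \<open>Arcs that do not respect the colouring get class \<open>k\<close>, the mark of deleted
  records.\<close>

definition record1 :: "nat \<Rightarrow> nat \<Rightarrow> pprog" where
  "record1 R k = Asg Vu (Ar (SRC R) (V Ve)) ;; Asg Vx (Ar (DST R) (V Ve)) ;;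
     Put (SRC k) (V Ve) (V Vu) ;; Put (DST k) (V Ve) (V Vx) ;;
     Cond (Ti (Ls (Ar COL (V Vu)) (N k)) (Ti (Eq (Md (Pl (Ar COL (V Vu)) (N 1)) (N k)) (Ar COL (V Vx)))
         (Ti (Mi (N 1) (Ar BAD (V Vu))) (Mi (N 1) (Ar BAD (V Vx))))))
       (Put (CLS k) (V Ve) (Ar COL (V Vu)) ;; Put (WIT k) (V Ve) (Ti (V Vu) (Ar PW (Ar COL (V Vu)))))
       (Put (CLS k) (V Ve) (N k))"

definition trial :: "nat \<Rightarrow> nat \<Rightarrow> nat \<Rightarrow> pprog" where
  "trial q D k = digits k (q * q) ;; colours k q ;; For Ve (V Vm) (bad1 (Suc k) D k) ;;
     For Ve (V Vm) (record1 (Suc k) k) ;; solve D k k"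

lemma mods_trial [simp]:
  "mvars (digit_step Q) = {Vp}" "marrs (digit_step Q) = {ZZ}" "mvars (digits k Q) = {Vp, Vi}" "marrs (digits k Q) = {ZZ}"
  "mvars (colour1 q) = {}" "marrs (colour1 q) = {COL}" "mvars (colours k q) = {Vv, Vi}" "marrs (colours k q) = {COL, BAD}"
  "mvars (bad1 R D k) = {Vu, Vx}" "marrs (bad1 R D k) = {BAD}"
  "mvars (record1 R k) = {Vu, Vx}" "marrs (record1 R k) = {SRC k, DST k, CLS k, WIT k}"
  by (auto simp: digit_step_def digits_def colour1_def colours_def bad1_def record1_def)

lemma frame_trial:
  assumes "frame (trial q D k) s s'"
  shows "x \<in> {Vn, Vm, VM, Vr, Vq, Vt, Vl} \<Longrightarrow> vr s' x = vr s x"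
    and "a \<in> {HH, WT, PW, SRC (Suc k), DST (Suc k), LAB (Suc k)} \<Longrightarrow> ar s' a = ar s a"
proof -
  assume "x \<in> {Vn, Vm, VM, Vr, Vq, Vt, Vl}"
  then have "x \<notin> mvars (trial q D k)"
    using mvars_solve[of D k k] by (auto simp: trial_def solve_vars_def)
  then show "vr s' x = vr s x" using assms by (simp add: frame_def)
next
  assume "a \<in> {HH, WT, PW, SRC (Suc k), DST (Suc k), LAB (Suc k)}"
  then have "a \<notin> marrs (trial q D k)"
    by (auto simp: trial_def solve_arrs_def dest: subsetD[OF marrs_solve])
  then show "ar s' a = ar s a" using assms by (simp add: frame_def)
qed

lemma digits_spec:
  fixes s :: pst
  assumes s: "vr s Vq = z" and b: "k \<le> b"
  shows "tri b (digits k Q) s (5 + k * (scost (digit_step Q) + 4)) (\<lambda>s'. \<forall>i<k. ar s' ZZ i = z div Q ^ i mod Q)" (is "tri b _ s _ ?P")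
proof -
  have "tri b (digits k Q) s (scost (Asg Vp (V Vq) :: pprog) + (ecost (N k :: (vname, aname) aexp) + 2 + k * (scost (digit_step Q) + 4))) ?P"
    unfolding digits_def
  proof (rule tri_Sq)
    show "tri b (Asg Vp (V Vq)) s (scost (Asg Vp (V Vq) :: pprog)) (\<lambda>s'. vr s' Vp = z)"
      by (rule tri_straight) (use s bdd_var in auto)
  next
    fix s1 :: pst assume s1: "vr s1 Vp = z"
    let ?I = "\<lambda>m (s' :: pst). vr s' Vp = z div Q ^ m \<and> (\<forall>i<m. ar s' ZZ i = z div Q ^ i mod Q)"
    have "tri b (For Vi (N k) (digit_step Q)) s1 (ecost (N k :: (vname, aname) aexp) + 2 + k * (scost (digit_step Q) + 4)) (?I k)"
    proof (rule tri_For_straight[where I = ?I])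
      fix i and s' :: pst assume i: "i < k" "bdd b s'" "?I i s'"
      have "vr s' Vp \<le> b" using i(2) by (rule bdd_var)
      then have le: "z div Q ^ i \<le> b" using i(3) by simp
      then have "z div Q ^ i mod Q \<le> b" "z div Q ^ i div Q \<le> b"
        by (meson mod_less_eq_dividend div_le_dividend le_trans)+
      moreover have "vr s' Vp = z div Q ^ i" using i(3) by blast
      ultimately have "ok b (digit_step Q) (setv Vi i s')"
        and upd: "vr (ev (digit_step Q) (setv Vi i s')) Vp = z div Q ^ i div Q"
          "ar (ev (digit_step Q) (setv Vi i s')) ZZ = (ar s' ZZ)(i := z div Q ^ i mod Q)"
        by (auto simp: digit_step_def)
      moreover have "z div Q ^ i div Q = z div Q ^ Suc i" by (simp add: div_mult2_eq[symmetric] mult.commute)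
      ultimately show "ok b (digit_step Q) (setv Vi i s') \<and> ?I (Suc i) (ev (digit_step Q) (setv Vi i s'))"
        using i(3) unfolding upd by (auto simp: less_Suc_eq)
    qed (use s1 b in \<open>auto simp: digit_step_def\<close>)
    then show "tri b (For Vi (N k) (digit_step Q)) s1 (ecost (N k :: (vname, aname) aexp) + 2 + k * (scost (digit_step Q) + 4)) ?P"
      by (rule tri_conseq) auto
  qed
  then show ?thesis by (rule tri_conseq) auto
qed

definition colours_c :: "nat \<Rightarrow> nat \<Rightarrow> nat" where
  "colours_c k q = 20 + scost (Put COL (V Vv) (N k) :: pprog) + scost (Put BAD (V Vv) (N 0) :: pprog) + k * (scost (colour1 q) + 4)"

lemma colours_spec:
  fixes s :: pst
  assumes s: "vr s Vn = n" "vr s VM = M" and b: "k \<le> b" "n \<le> b"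
    and h: "h = ar s HH" and z: "z = ar s ZZ"
  shows "tri b (colours k q) s (colours_c k q * (n + 1)) (\<lambda>s'. \<forall>v<n. ar s' COL v = colour z (hashv q M h) k v \<and> ar s' BAD v = 0)"
    (is "tri b _ s _ ?P")
proof -
  let ?c = "colour z (hashv q M h) k"
  let ?a = "scost (Put COL (V Vv) (N k) :: pprog)" and ?b = "scost (Put BAD (V Vv) (N 0) :: pprog)"
  have "tri b (colours k q) s (ecost (V Vn :: (vname, aname) aexp) + 2 + n * ((?a + (?b + (1 + 2 + k * (scost (colour1 q) + 4)))) + 4)) ?P"
    unfolding colours_def
  proof (rule tri_For[where I = "\<lambda>m s'. \<forall>v<m. ar s' COL v = ?c v \<and> ar s' BAD v = 0"])
    let ?loop = "For Vv (V Vn) (Put COL (V Vv) (N k) ;; Put BAD (V Vv) (N 0) ;; For Vi (N k) (colour1 q))"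
    fix v and s' :: pst assume v: "v < n" "bdd b s'" "frame ?loop s s'" "\<forall>u<v. ar s' COL u = ?c u \<and> ar s' BAD u = 0"
    have f: "vr s' VM = M" "ar s' HH = h" "ar s' ZZ = z" using v(3) s h z by (auto simp: frame_def)
    let ?s = "setv Vv v s'"
    show "tri b (Put COL (V Vv) (N k) ;; Put BAD (V Vv) (N 0) ;; For Vi (N k) (colour1 q)) ?s
      (?a + (?b + (1 + 2 + k * (scost (colour1 q) + 4)))) (\<lambda>s''. \<forall>u<Suc v. ar s'' COL u = ?c u \<and> ar s'' BAD u = 0)"
    proof (rule tri_Sq)
      show "tri b (Put COL (V Vv) (N k)) ?s ?a (\<lambda>s''. ar s'' COL = (ar s' COL)(v := k))"
        by (rule tri_straight) (use b in auto)
    next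
      fix s1 :: pst assume s1: "frame (Put COL (V Vv) (N k)) ?s s1" "ar s1 COL = (ar s' COL)(v := k)"
      show "tri b (Put BAD (V Vv) (N 0) ;; For Vi (N k) (colour1 q)) s1 (?b + (1 + 2 + k * (scost (colour1 q) + 4)))
        (\<lambda>s''. \<forall>u<Suc v. ar s'' COL u = ?c u \<and> ar s'' BAD u = 0)"
      proof (rule tri_Sq)
        have "vr s1 Vv = v" using s1(1) by (simp add: frame_def)
        then show "tri b (Put BAD (V Vv) (N 0)) s1 ?b (\<lambda>s''. ar s'' BAD = (ar s1 BAD)(v := 0))"
          by (intro tri_straight) auto
      next
        fix s2 :: pst assume s2: "frame (Put BAD (V Vv) (N 0)) s1 s2" "ar s2 BAD = (ar s1 BAD)(v := 0)"
        have f2: "vr s2 Vv = v" "vr s2 VM = M" "ar s2 HH = h" "ar s2 ZZ = z" "ar s2 COL = (ar s' COL)(v := k)"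
          "\<forall>u<Suc v. ar s2 BAD u = 0"
          using s2 s1 f v(4) by (auto simp: frame_def less_Suc_eq)
        let ?I = "\<lambda>m (s3 :: pst). ar s3 COL = (ar s' COL)(v := lastm z (hashv q M h v) k m)"
        have "tri b (For Vi (N k) (colour1 q)) s2 (ecost (N k :: (vname, aname) aexp) + 2 + k * (scost (colour1 q) + 4)) (?I k)"
        proof (rule tri_For_straight[where I = ?I])
          fix i and s3 :: pst assume i: "i < k" "frame (For Vi (N k) (colour1 q)) s2 s3" "?I i s3"
          then have "vr s3 Vv = v" "vr s3 VM = M" "ar s3 HH = h" "ar s3 ZZ = z" using f2 by (auto simp: frame_def)
          then show "ok b (colour1 q) (setv Vi i s3) \<and> ?I (Suc i) (ev (colour1 q) (setv Vi i s3))"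
            using i b by (auto simp: colour1_def hashv_def)
        qed (use f2 b in \<open>auto simp: colour1_def\<close>)
        then show "tri b (For Vi (N k) (colour1 q)) s2 (1 + 2 + k * (scost (colour1 q) + 4))
            (\<lambda>s''. \<forall>u<Suc v. ar s'' COL u = ?c u \<and> ar s'' BAD u = 0)"
        proof (rule tri_conseq)
          fix s3 :: pst assume "frame (For Vi (N k) (colour1 q)) s2 s3" "?I k s3"
          then show "\<forall>u<Suc v. ar s3 COL u = ?c u \<and> ar s3 BAD u = 0"
            using f2(6) v(4) by (auto simp: frame_def colour_def less_Suc_eq)
        qed simp
      qed
    qed
  qed (use s b in auto)
  then show ?thesis by (rule tri_conseq) (simp_all add: colours_c_def algebra_simps)
qed

definition trial_c :: "nat \<Rightarrow> nat \<Rightarrow> nat \<Rightarrow> nat" where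
  "trial_c q D k = 20 + k * (scost (digit_step (q * q)) + 4) + colours_c k q + scost (bad1 (Suc k) D k) +
     scost (record1 (Suc k) k) + solve_c D k k"

section \<open>Correctness of one trial\<close>

locale inst =
  fixes F :: "ugraph set" and d k n M rr b q Mh :: nat and sr ds lb :: "nat \<Rightarrow> nat"
  assumes closed: "graph_closed F" and density: "\<And>G. G \<in> F \<Longrightarrow> card (edges G) \<le> d * card (verts G)"
    and k3: "3 \<le> k"
    and rng: "\<And>e. e < M \<Longrightarrow> sr e < n \<and> ds e < n \<and> sr e \<noteq> ds e"
    and sym: "\<And>e. e < M \<Longrightarrow> \<exists>e'<M. sr e' = ds e \<and> ds e' = sr e"
    and graph: "\<exists>U. \<lparr>verts = U, edges = {{sr e, ds e} | e. e < M}\<rparr> \<in> F"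
    and lab: "labelled (4 * d) sr ds lb {e. e < M \<and> sr e < ds e}"
    and lab0: "\<And>e. e < M \<Longrightarrow> \<not> sr e < ds e \<Longrightarrow> lb e = 0"
    and bounds: "n \<le> b" "2 * M < b" "rr \<le> b" "8 * d \<le> b" "k \<le> b" "k * n ^ (k + 1) \<le> b" "(q * q) ^ k \<le> b" "q \<le> b"
    and rounds: "M < 2 ^ rr" and q1: "1 \<le> q" and Mh: "n \<le> Mh * Mh" "Mh \<le> n"
begin

definition A :: "nat \<Rightarrow> nat \<Rightarrow> bool" where
  "A u v \<longleftrightarrow> (\<exists>e<M. sr e = u \<and> ds e = v)"

definition hd_of :: "nat \<Rightarrow> nat" where
  "hd_of e = (if lb e \<le> 4 * d then ds e else sr e)"

definition Or :: "nat \<Rightarrow> nat \<Rightarrow> bool" where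
  "Or u v \<longleftrightarrow> (\<exists>e<M. lb e \<noteq> 0 \<and> u = tail (4 * d) sr ds (lb e) e \<and> v = hd_of e)"

definition Good :: "nat \<Rightarrow> bool" where
  "Good w \<longleftrightarrow> (\<exists>p. indcyc A n k p \<and> w = (\<Sum>i<k. p i * n ^ i))"

definition static :: "pst \<Rightarrow> bool" where
  "static s \<longleftrightarrow> vr s VM = Mh \<and> ar s (SRC (Suc k)) = sr \<and> ar s (DST (Suc k)) = ds \<and> ar s (LAB (Suc k)) = lb \<and>
     (\<forall>i<k. ar s PW i = n ^ i)"

definition separated :: "(nat \<Rightarrow> nat) \<Rightarrow> (nat \<Rightarrow> nat) \<Rightarrow> bool" where
  "separated h p \<longleftrightarrow> indcyc A n k p \<and> inj_on (hashv q Mh h) (p ` {..<k} \<union> {v. \<exists>i<k. Or (p i) v})"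

lemma A_props: "A u v \<Longrightarrow> A v u \<and> u < n" "A u v \<Longrightarrow> v < n"
  using rng sym unfolding A_def by metis+

lemma lab_iff: "e < M \<Longrightarrow> lb e \<noteq> 0 \<longleftrightarrow> sr e < ds e"
  using lab lab0 by (force simp: labelled_def)

lemma Or_A: "Or u v \<Longrightarrow> A u v"
  unfolding Or_def hd_of_def tail_def using A_props(1) by (auto simp: A_def split: if_splits)

lemma A_Or:
  assumes "A u v"
  shows "Or u v \<or> Or v u"
proof -
  obtain e where e: "e < M" "sr e = u" "ds e = v" using assms by (auto simp: A_def)
  obtain e' where e': "e' < M" "sr e' = v" "ds e' = u" using sym[OF e(1)] e by auto
  have "sr e < ds e \<or> sr e' < ds e'" using rng[OF e(1)] e e' by auto
  then show ?thesis
  proof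
    assume "sr e < ds e"
    then have "lb e \<noteq> 0" using lab_iff e by blast
    then show ?thesis using e unfolding Or_def hd_of_def tail_def by (auto split: if_splits)
  next
    assume "sr e' < ds e'"
    then have "lb e' \<noteq> 0" using lab_iff e' by blast
    then show ?thesis using e' unfolding Or_def hd_of_def tail_def by (auto split: if_splits)
  qed
qed

text \<open>Edges with the same tail have different labels, and there are \<open>2 * (4 * d)\<close>
  labels.\<close>

lemma card_out: "card {v. Or u v} \<le> 8 * d" "finite {v. Or u v}"
proof -
  let ?T = "{e. e < M \<and> lb e \<noteq> 0 \<and> u = tail (4 * d) sr ds (lb e) e}"
  have T: "{v. Or u v} = hd_of ` ?T" by (auto simp: Or_def)
  have fin: "finite ?T" by simp
  have "inj_on lb ?T"
  proof (rule inj_onI)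
    fix e e' assume e: "e \<in> ?T" "e' \<in> ?T" "lb e = lb e'"
    then have "sr e < ds e" "sr e' < ds e'" using lab_iff[of e] lab_iff[of e'] by auto
    then show "e = e'" using lab e unfolding labelled_def by auto
  qed
  then have "card ?T = card (lb ` ?T)" by (simp add: card_image)
  also have "\<dots> \<le> card {1..8 * d}"
  proof (rule card_mono)
    show "lb ` ?T \<subseteq> {1..8 * d}" using lab lab_iff by (auto simp: labelled_def)
  qed simp
  finally have "card ?T \<le> 8 * d" by simp
  then show "card {v. Or u v} \<le> 8 * d" unfolding T using card_image_le[OF fin, of hd_of] by linarith
  show "finite {v. Or u v}" unfolding T using fin by simp
qed

abbreviation cyc_inv :: "pst \<Rightarrow> bool" where
  "cyc_inv \<equiv> search.inv n M rr Good"

text \<open>The invariant depends neither on the edge relation nor on the colouring, so the locale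
  is interpreted with the empty relation just to unfold it; no walk of length \<open>k\<close>
  exists then, and the condition on \<open>Good\<close> is vacuous.\<close>

lemma inv_iff: "search.inv n M rr Good s \<longleftrightarrow> vr s Vn = n \<and> vr s Vm = M \<and> vr s Vr = rr \<and> vr s Vfound \<le> 1 \<and>
     (vr s Vfound = 1 \<longrightarrow> Good (vr s Vans))"
proof -
  have "\<not> gpath (\<lambda>_ _. False) col n k u u w" for col u w
    using k3 by (auto simp: gpath_def intro: exI[of _ 0])
  then interpret search F "\<lambda>_ _. False" "\<lambda>_. 0" n k M d rr b Good
    by unfold_locales (use closed density bounds rounds in auto)
  show ?thesis by (rule inv_def)
qed

lemma bad_spec:
  fixes s :: pst
  assumes s: "static s" "vr s Vm = M" and c: "\<And>v. v < n \<Longrightarrow> ar s COL v = col v \<and> ar s BAD v = 0"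
  shows "tri b (For Ve (V Vm) (bad1 (Suc k) (4 * d) k)) s (1 + 2 + M * (scost (bad1 (Suc k) (4 * d) k) + 4))
    (\<lambda>s'. \<forall>v<n. ar s' BAD v = (if badv Or col k v then 1 else 0))"
proof -
  let ?bad = "\<lambda>m v. \<exists>e<m. lb e \<noteq> 0 \<and> v = tail (4 * d) sr ds (lb e) e \<and> col v < k \<and> col (hd_of e) < k \<and>
    \<not> consec k (col v) (col (hd_of e))"
  have "tri b (For Ve (V Vm) (bad1 (Suc k) (4 * d) k)) s (ecost (V Vm :: (vname, aname) aexp) + 2 + M * (scost (bad1 (Suc k) (4 * d) k) + 4))
    (\<lambda>s'. \<forall>v<n. ar s' BAD v = (if ?bad M v then 1 else 0))"
  proof (rule tri_For_straight[where I = "\<lambda>m s'. \<forall>v<n. ar s' BAD v = (if ?bad m v then 1 else 0)"])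
    fix i and s' :: pst assume i: "i < M" "bdd b s'" "frame (For Ve (V Vm) (bad1 (Suc k) (4 * d) k)) s s'"
      "\<forall>v<n. ar s' BAD v = (if ?bad i v then 1 else 0)"
    have f: "ar s' (SRC (Suc k)) = sr" "ar s' (DST (Suc k)) = ds" "ar s' (LAB (Suc k)) = lb"
      using i(3) s by (auto simp: frame_def static_def)
    have fc: "ar s' COL v = col v" if "v < n" for v using i(3) c[OF that] by (simp add: frame_def)
    let ?u = "tail (4 * d) sr ds (lb i) i" and ?x = "hd_of i"
    have bb: "sr i \<le> b" "ds i \<le> b" "1 \<le> b" using rng[OF i(1)] bounds by linarith+
    let ?P = "lb i \<noteq> 0 \<and> col ?u < k \<and> col ?x < k \<and> \<not> consec k (col ?u) (col ?x)"
    have rI: "col (sr i) = ar s' COL (sr i)" "col (ds i) = ar s' COL (ds i)" using fc rng[OF i(1)] by auto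
    have ok: "ok b (bad1 (Suc k) (4 * d) k) (setv Ve i s')"
      using bb by (auto simp: bad1_def f)
    have upd: "ar (ev (bad1 (Suc k) (4 * d) k) (setv Ve i s')) BAD = (if ?P then (ar s' BAD)(?u := 1) else ar s' BAD)"
    proof (cases "lb i \<le> 4 * d")
      case True
      then have "?u = sr i" "?x = ds i" by (simp_all add: tail_def hd_of_def)
      then show ?thesis using True by (auto simp: bad1_def f rI consec_def)
    next
      case False
      then have "?u = ds i" "?x = sr i" by (simp_all add: tail_def hd_of_def)
      then show ?thesis using False by (auto simp: bad1_def f rI consec_def)
    qed
    have S: "?bad (Suc i) v \<longleftrightarrow> ?bad i v \<or> (?P \<and> v = ?u)" for v
      unfolding less_Suc_eq by blast
    show "ok b (bad1 (Suc k) (4 * d) k) (setv Ve i s') \<and>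
        (\<forall>v<n. ar (ev (bad1 (Suc k) (4 * d) k) (setv Ve i s')) BAD v = (if ?bad (Suc i) v then 1 else 0))"
      unfolding upd S using ok i(4) by auto
  qed (use s c bounds in \<open>auto simp: bad1_def\<close>)
  then show ?thesis
  proof (rule tri_conseq)
    have eq: "badv Or col k v \<longleftrightarrow> ?bad M v" for v
      unfolding badv_def Or_def by blast
    show "\<forall>v<n. ar s' BAD v = (if badv Or col k v then 1 else 0)"
      if "\<forall>v<n. ar s' BAD v = (if ?bad M v then 1 else 0)" for s' :: pst
      using that unfolding eq .
  qed simp
qed

lemma record_spec:
  fixes s :: pst
  assumes s: "static s" "vr s Vm = M" and c: "\<And>v. v < n \<Longrightarrow> ar s COL v = col v \<and> ar s BAD v = (if badv Or col k v then 1 else 0)"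
  shows "tri b (For Ve (V Vm) (record1 (Suc k) k)) s (1 + 2 + M * (scost (record1 (Suc k) k) + 4)) (\<lambda>s'. \<forall>e<M.
    ar s' (SRC k) e = sr e \<and> ar s' (DST k) e = ds e \<and>
    (if gE A Or col k (sr e) (ds e) then ar s' (CLS k) e = col (sr e) \<and> ar s' (WIT k) e = sr e * n ^ col (sr e)
     else ar s' (CLS k) e = k))"
proof -
  let ?I = "\<lambda>m (s' :: pst). \<forall>e<m. ar s' (SRC k) e = sr e \<and> ar s' (DST k) e = ds e \<and>
    (if gE A Or col k (sr e) (ds e) then ar s' (CLS k) e = col (sr e) \<and> ar s' (WIT k) e = sr e * n ^ col (sr e)
     else ar s' (CLS k) e = k)"
  have "tri b (For Ve (V Vm) (record1 (Suc k) k)) s (ecost (V Vm :: (vname, aname) aexp) + 2 + M * (scost (record1 (Suc k) k) + 4)) (?I M)"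
  proof (rule tri_For_straight[where I = ?I])
    fix i and s' :: pst assume i: "i < M" "bdd b s'" "frame (For Ve (V Vm) (record1 (Suc k) k)) s s'" "?I i s'"
    have f: "ar s' (SRC (Suc k)) = sr" "ar s' (DST (Suc k)) = ds"
      using i(3) s by (auto simp: frame_def static_def)
    have pw: "ar s' PW j = n ^ j" if "j < k" for j using i(3) s that by (auto simp: frame_def static_def)
    have fc: "ar s' COL v = col v" "ar s' BAD v = (if badv Or col k v then 1 else 0)" if "v < n" for v
      using i(3) c[OF that] by (simp_all add: frame_def)
    have r: "sr i < n" "ds i < n" using rng[OF i(1)] by auto
    have bb: "sr i \<le> b" "ds i \<le> b" using r bounds by linarith+
    have cb: "col (sr i) \<le> b" using i(2) fc(1)[OF r(1)] bdd_arr[of b s' COL "sr i"] by simp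
    let ?g = "col (sr i) < k \<and> (col (sr i) + 1) mod k = col (ds i) \<and> \<not> badv Or col k (sr i) \<and> \<not> badv Or col k (ds i)"
    have g: "gE A Or col k (sr i) (ds i) \<longleftrightarrow> ?g" using i(1) by (auto simp: gE_def A_def)
    have w: "sr i * n ^ col (sr i) \<le> b" if "col (sr i) < k"
    proof -
      have "n ^ col (sr i) \<le> n ^ k" using that r by (intro power_increasing) auto
      then have "sr i * n ^ col (sr i) \<le> n * n ^ k" using r by (intro mult_mono) auto
      also have "\<dots> \<le> k * n ^ (k + 1)" using k3 by simp
      finally show ?thesis using bounds by linarith
    qed
    have ok: "ok b (record1 (Suc k) k) (setv Ve i s')"
      using bb cb w bounds by (auto simp: record1_def f fc[OF r(1)] fc[OF r(2)] pw)
    have upd: "ar (ev (record1 (Suc k) k) (setv Ve i s')) (SRC k) = (ar s' (SRC k))(i := sr i)"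
      "ar (ev (record1 (Suc k) k) (setv Ve i s')) (DST k) = (ar s' (DST k))(i := ds i)"
      "ar (ev (record1 (Suc k) k) (setv Ve i s')) (CLS k) = (ar s' (CLS k))(i := if ?g then col (sr i) else k)"
      "ar (ev (record1 (Suc k) k) (setv Ve i s')) (WIT k) = (if ?g then (ar s' (WIT k))(i := sr i * n ^ col (sr i)) else ar s' (WIT k))"
      by (auto simp: record1_def f fc[OF r(1)] fc[OF r(2)] pw)
    show "ok b (record1 (Suc k) k) (setv Ve i s') \<and> ?I (Suc i) (ev (record1 (Suc k) k) (setv Ve i s'))"
      unfolding upd using ok i(4) g by (simp add: less_Suc_eq)
  qed (use s bounds in \<open>auto simp: record1_def\<close>)
  then show ?thesis by simp
qed

text \<open>At level \<open>k\<close> the parts are the colour classes and every record is a single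
  edge, so all path lengths are \<open>1\<close>.\<close>

lemma initial_sound:
  assumes rec: "\<And>e. e < M \<Longrightarrow> sr' e = sr e \<and> ds' e = ds e \<and>
    (if gE A Or col k (sr e) (ds e) then cl e = col (sr e) \<and> wt e = sr e * n ^ col (sr e) else cl e = k)"
  shows "sound F (gE A Or col k) col n k M k sr' ds' cl wt"
  unfolding sound_def
proof (intro exI[of _ "\<lambda>i. {v. v < n \<and> col v = i}"] exI[of _ "\<lambda>_. 1"] conjI)
  let ?X = "\<lambda>i. {v. v < n \<and> col v = i}"
  have g: "gE A Or col k (sr e) (ds e) \<and> cl e = col (sr e) \<and> wt e = sr e * n ^ col (sr e)" if "e < M" "cl e < k" for e
    using rec[OF that(1)] that(2) by (auto split: if_splits)
  show "\<forall>e<M. cl e < k \<longrightarrow> sr' e \<in> ?X (cl e) \<and> ds' e \<in> ?X (Suc (cl e) mod k) \<and>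
      gpath (gE A Or col k) col n 1 (sr' e) (ds' e) (wt e)"
  proof (intro allI impI)
    fix e assume e: "e < M" "cl e < k"
    note g = g[OF e]
    have "gpath (gE A Or col k) col n 1 (sr e) (ds e) (sr e * n ^ col (sr e))" using g by (intro gpath_edge) blast
    then show "sr' e \<in> ?X (cl e) \<and> ds' e \<in> ?X (Suc (cl e) mod k) \<and>
      gpath (gE A Or col k) col n 1 (sr' e) (ds' e) (wt e)"
      using g rec[OF e(1)] rng[OF e(1)] by (simp add: gE_def)
  qed
  obtain U where U: "\<lparr>verts = U, edges = {{sr e, ds e} | e. e < M}\<rparr> \<in> F" (is "?G \<in> F") using graph by blast
  let ?H = "\<lparr>verts = U, edges = {{sr' e, ds' e} | e. e < M \<and> cl e < k}\<rparr>"
  have sG: "simple_graph ?G" using closed U unfolding graph_closed_def by blast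
  have "edges ?H \<subseteq> edges ?G" using rec by fastforce
  then have "subgraph ?H ?G" using sG unfolding subgraph_def simple_graph_def by auto
  then show "2 \<le> k \<longrightarrow> (\<exists>U. \<lparr>verts = U, edges = {{sr' e, ds' e} | e. e < M \<and> cl e < k}\<rparr> \<in> F)"
    using closed U unfolding graph_closed_def by blast
qed auto

lemma initial_surv:
  assumes rec: "\<And>e. e < M \<Longrightarrow> sr' e = sr e \<and> ds' e = ds e \<and>
    (if gE A Or (colour z h k) k (sr e) (ds e) then cl e = colour z h k (sr e) \<and> wt e = sr e * n ^ colour z h k (sr e) else cl e = k)"
    and p: "indcyc A n k p" "inj_on h (p ` {..<k} \<union> {v. \<exists>i<k. Or (p i) v})" "\<And>i. i < k \<Longrightarrow> z i = h (p i)"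
  shows "surv M k sr' ds' cl"
  unfolding surv_def
proof (rule exI[of _ p], intro allI impI)
  fix i assume i: "i < k"
  have g: "gE A Or (colour z h k) k (p i) (p ((i + 1) mod k))" "colour z h k (p i) = i"
    using good_colouring[where A = A and Or = Or and n = n and p = p and z = z and h = h, OF p(1) Or_A p(2,3) i] k3 by auto
  then obtain e where e: "e < M" "sr e = p i" "ds e = p ((i + 1) mod k)" by (auto simp: gE_def A_def)
  then show "\<exists>e<M. cl e = i \<and> sr' e = p i \<and> ds' e = p (Suc i mod k)"
    using rec[OF e(1)] g by (intro exI[of _ e]) simp
qed

text \<open>Success is required only for the guess that lists the hash values of a separated cycle.
  After any other guess a positive answer is still right, by \<open>Good\<close>.\<close>

lemma trial_spec:
  fixes s :: pst
  assumes s: "static s" "cyc_inv s" "vr s Vq = z" "h = ar s HH"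
  shows "tri b (trial q (4 * d) k) s (trial_c q (4 * d) k * (n + rr + M + 1)) (\<lambda>s'. cyc_inv s' \<and>
    (vr s Vfound = 1 \<longrightarrow> vr s' Vfound = 1) \<and>
    ((\<exists>p. separated h p \<and> (\<forall>i<k. z div (q * q) ^ i mod (q * q) = hashv q Mh h (p i))) \<longrightarrow> vr s' Vfound = 1))"
    (is "tri b _ s _ ?P")
proof -
  let ?Q = "q * q"
  let ?b = "bad1 (Suc k) (4 * d) k" and ?r = "record1 (Suc k) k"
  let ?T = "n + rr + M + 1"
  have static_frame: "static s'" if "frame c s1 s'" "static s1" "VM \<notin> mvars c" "SRC (Suc k) \<notin> marrs c" "DST (Suc k) \<notin> marrs c"
    "LAB (Suc k) \<notin> marrs c" "PW \<notin> marrs c" for c and s1 s' :: pst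
    using that by (simp add: static_def frame_def)
  have inv_frame: "cyc_inv s'" if "frame c s1 s'" "cyc_inv s1" "{Vn, Vm, Vr, Vfound, Vans} \<inter> mvars c = {}" for c and s1 s' :: pst
    using that by (auto simp: inv_iff frame_def)
  have "tri b (trial q (4 * d) k) s ((5 + k * (scost (digit_step ?Q) + 4)) + (colours_c k q * (n + 1) +
      ((1 + 2 + M * (scost ?b + 4)) + ((1 + 2 + M * (scost ?r + 4)) + solve_c (4 * d) k k * ?T)))) ?P"
    unfolding trial_def
  proof (rule tri_Sq)
    show "tri b (digits k ?Q) s (5 + k * (scost (digit_step ?Q) + 4)) (\<lambda>s'. \<forall>i<k. ar s' ZZ i = z div ?Q ^ i mod ?Q)"
      by (rule digits_spec) (use s bounds in auto)
  next
    fix s1 :: pst assume s1: "frame (digits k ?Q) s s1" "\<forall>i<k. ar s1 ZZ i = z div ?Q ^ i mod ?Q"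
    have st1: "static s1" "cyc_inv s1" using static_frame[OF s1(1) s(1)] inv_frame[OF s1(1) s(2)] by auto
    have f1: "ar s1 HH = h" "vr s1 Vfound = vr s Vfound" using s1(1) s by (auto simp: frame_def)
    define zz where "zz = ar s1 ZZ"
    define col where "col = colour zz (hashv q Mh h) k"
    show "tri b (colours k q ;; For Ve (V Vm) ?b ;; For Ve (V Vm) ?r ;; solve (4 * d) k k) s1
      (colours_c k q * (n + 1) + ((1 + 2 + M * (scost ?b + 4)) + ((1 + 2 + M * (scost ?r + 4)) + solve_c (4 * d) k k * ?T))) ?P"
    proof (rule tri_Sq)
      show "tri b (colours k q) s1 (colours_c k q * (n + 1)) (\<lambda>s'. \<forall>v<n. ar s' COL v = col v \<and> ar s' BAD v = 0)"
        unfolding col_def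
        by (rule colours_spec) (use st1 f1 bounds in \<open>auto simp: inv_iff static_def zz_def\<close>)
    next
      fix s2 :: pst assume s2: "frame (colours k q) s1 s2" "\<forall>v<n. ar s2 COL v = col v \<and> ar s2 BAD v = 0"
      have st2: "static s2" "cyc_inv s2" using static_frame[OF s2(1) st1(1)] inv_frame[OF s2(1) st1(2)] by auto
      have f2: "vr s2 Vfound = vr s Vfound" using s2(1) f1 by (auto simp: frame_def)
      show "tri b (For Ve (V Vm) ?b ;; For Ve (V Vm) ?r ;; solve (4 * d) k k) s2
        ((1 + 2 + M * (scost ?b + 4)) + ((1 + 2 + M * (scost ?r + 4)) + solve_c (4 * d) k k * ?T)) ?P"
      proof (rule tri_Sq)
        show "tri b (For Ve (V Vm) ?b) s2 (1 + 2 + M * (scost ?b + 4)) (\<lambda>s'. \<forall>v<n. ar s' BAD v = (if badv Or col k v then 1 else 0))"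
          by (rule bad_spec) (use st2 s2(2) in \<open>auto simp: inv_iff\<close>)
      next
        fix s3 :: pst assume s3: "frame (For Ve (V Vm) ?b) s2 s3" "\<forall>v<n. ar s3 BAD v = (if badv Or col k v then 1 else 0)"
        have st3: "static s3" "cyc_inv s3" using static_frame[OF s3(1) st2(1)] inv_frame[OF s3(1) st2(2)] by auto
        have f3: "vr s3 Vfound = vr s Vfound" "\<And>v. v < n \<Longrightarrow> ar s3 COL v = col v" using s3(1) f2 s2(2) by (auto simp: frame_def)
        show "tri b (For Ve (V Vm) ?r ;; solve (4 * d) k k) s3 ((1 + 2 + M * (scost ?r + 4)) + solve_c (4 * d) k k * ?T) ?P"
        proof (rule tri_Sq)
          show "tri b (For Ve (V Vm) ?r) s3 (1 + 2 + M * (scost ?r + 4)) (\<lambda>s'. \<forall>e<M.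
            ar s' (SRC k) e = sr e \<and> ar s' (DST k) e = ds e \<and>
            (if gE A Or col k (sr e) (ds e) then ar s' (CLS k) e = col (sr e) \<and> ar s' (WIT k) e = sr e * n ^ col (sr e)
             else ar s' (CLS k) e = k))"
            by (rule record_spec) (use st3 s3(2) f3 in \<open>auto simp: inv_iff\<close>)
        next
          fix s4 :: pst assume s4: "frame (For Ve (V Vm) ?r) s3 s4" and rec: "\<forall>e<M.
            ar s4 (SRC k) e = sr e \<and> ar s4 (DST k) e = ds e \<and>
            (if gE A Or col k (sr e) (ds e) then ar s4 (CLS k) e = col (sr e) \<and> ar s4 (WIT k) e = sr e * n ^ col (sr e)
             else ar s4 (CLS k) e = k)"
          have st4: "cyc_inv s4" using inv_frame[OF s4 st3(2)] by auto
          have f4: "vr s4 Vfound = vr s Vfound" using s4 f3 by (auto simp: frame_def)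
          interpret S: search F "gE A Or col k" col n k M d rr b Good
          proof unfold_locales
            fix u w assume "gpath (gE A Or col k) col n k u u w"
            from cycle_of_gpath[OF k3 A_props(1) A_Or this] show "Good w" by (simp add: Good_def)
          next
            show "\<And>u v. gE A Or col k u v \<Longrightarrow> u < n \<and> col u < k" using A_props(1) by (auto simp: gE_def)
          qed (use closed density bounds rounds in auto)
          have snd: "S.snd_at k s4" unfolding S.snd_at_def by (rule initial_sound) (use rec in blast)
          have srv: "S.srv_at k s4" if "separated h p" "\<forall>i<k. z div ?Q ^ i mod ?Q = hashv q Mh h (p i)" for p
            unfolding S.srv_at_def
          proof (rule initial_surv[where p = p and z = zz and h = "hashv q Mh h"])
            show "indcyc A n k p" "inj_on (hashv q Mh h) (p ` {..<k} \<union> {v. \<exists>i<k. Or (p i) v})"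
              using that(1) by (auto simp: separated_def)
            show "zz i = hashv q Mh h (p i)" if "i < k" for i
              using that \<open>\<forall>i<k. z div ?Q ^ i mod ?Q = hashv q Mh h (p i)\<close> s1(2) by (simp add: zz_def)
          qed (use rec in \<open>unfold col_def, blast\<close>)
          have "1 \<le> k" using k3 by simp
          from S.solve_spec[OF this order_refl st4 snd]
          show "tri b (solve (4 * d) k k) s4 (solve_c (4 * d) k k * ?T) ?P"
            by (rule tri_conseq) (use srv f4 in auto)
        qed
      qed
    qed
  qed
  then show ?thesis
  proof (rule tri_conseq)
    have T: "1 \<le> ?T" "n + 1 \<le> ?T" "M \<le> ?T" by auto
    let ?x = "k * (scost (digit_step ?Q) + 4)"
    have "?x \<le> ?x * ?T" using T(1) by (metis mult_le_mono2 nat_mult_1_right)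
    moreover have "colours_c k q * (n + 1) \<le> colours_c k q * ?T" using T(2) by (rule mult_le_mono2)
    moreover have "M * (scost ?b + 4) \<le> scost ?b * ?T + 4 * ?T" "M * (scost ?r + 4) \<le> scost ?r * ?T + 4 * ?T"
      using mult_le_mono1[OF T(3), of "scost ?b + 4"] mult_le_mono1[OF T(3), of "scost ?r + 4"] by (simp_all add: algebra_simps)
    moreover have "trial_c q (4 * d) k * ?T = 20 * ?T + ?x * ?T + colours_c k q * ?T + scost ?b * ?T + scost ?r * ?T + solve_c (4 * d) k k * ?T"
      unfolding trial_c_def by (simp only: add_mult_distrib)
    moreover have "(5 + x) + (c + ((1 + 2 + m1) + ((1 + 2 + m2) + sT))) \<le> 20 * T + xT + cT + bT + rT + sT"
      if "1 \<le> T" "x \<le> xT" "c \<le> cT" "m1 \<le> bT + 4 * T" "m2 \<le> rT + 4 * T" for T x xT c cT m1 m2 bT rT sT :: nat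
      using that by linarith
    ultimately show "(5 + ?x) + (colours_c k q * (n + 1) +
      ((1 + 2 + M * (scost ?b + 4)) + ((1 + 2 + M * (scost ?r + 4)) + solve_c (4 * d) k k * ?T))) \<le> trial_c q (4 * d) k * ?T"
      using T(1) by (simp only:)
  qed
qed

end

section \<open>The algorithm\<close>

definition main_step :: "nat \<Rightarrow> nat \<Rightarrow> nat \<Rightarrow> pprog" where
  "main_step q D k = hash_step q ;; For Vq (N ((q * q) ^ k)) (trial q D k)"

definition main_loop :: "nat \<Rightarrow> nat \<Rightarrow> nat \<Rightarrow> pprog" where
  "main_loop q D k = For Vt (Ti (N q) (Pl (V Vl) (N 1))) (main_step q D k)"

definition main_step_c :: "nat \<Rightarrow> nat \<Rightarrow> nat \<Rightarrow> nat" where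
  "main_step_c q D k = 2 * hash_row_c q + 10 + (q * q) ^ k * (trial_c q D k + 4)"

text \<open>The number \<open>K\<close> bounds the vertices to be separated: \<open>k\<close> on the
  cycle and \<open>8 * d\<close> out-neighbours of each. The number \<open>q\<close> has two roles:
  it is the range of a hash function, and \<open>q * (l + 1)\<close>, the number of functions,
  exceeds the \<open>4 * K * K * (l + 1)\<close> collisions that \<open>K * K\<close> pairs can
  account for.\<close>

locale family = inst +
  fixes l K :: nat
  assumes K: "K = k + k * (8 * d)" and q: "q = 4 * (K * K) + 1"
    and Ml: "Mh * Mh \<le> 2 ^ (l + 2)" and b2: "2 * 2 ^ (3 * l + 4) \<le> b" "q * (l + 1) \<le> b"
begin

definition hashes :: "pst \<Rightarrow> (nat \<Rightarrow> nat) list \<Rightarrow> bool" where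
  "hashes s hs \<longleftrightarrow> (\<forall>h\<in>set hs. \<forall>x<Mh. h x < q) \<and>
     real (pot hs Mh) \<le> (1 + 1 / real q) ^ length hs * (Mh * Mh) \<and>
     (\<forall>x<Mh. \<forall>y<x. ar s WT (x * Mh + y) = 2 ^ agree hs x y)"

lemma hashv_less: "(\<And>x. x < Mh \<Longrightarrow> h x < q) \<Longrightarrow> v < n \<Longrightarrow> hashv q Mh h v < q * q"
proof -
  assume h: "\<And>x. x < Mh \<Longrightarrow> h x < q" and "v < n"
  then have "v < Mh * Mh" using Mh by linarith
  moreover from this have "0 < Mh" by (cases Mh) auto
  ultimately have "h (v div Mh) < q" "h (v mod Mh) < q" using h by (auto simp: less_mult_imp_div_less)
  then have "h (v div Mh) * q + h (v mod Mh) < h (v div Mh) * q + q" by simp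
  moreover have "Suc (h (v div Mh)) * q \<le> q * q" by (rule mult_le_mono1) (use \<open>h (v div Mh) < q\<close> in simp)
  ultimately show ?thesis by (simp add: hashv_def)
qed

lemma main_step_spec:
  fixes s :: pst
  assumes s: "static s" "cyc_inv s" "hashes s hs" and len: "length hs < q * (l + 1)"
  shows "tri b (main_step q (4 * d) k) s (main_step_c q (4 * d) k * (n + rr + M + Mh * Mh + 1)) (\<lambda>s'. static s' \<and> cyc_inv s' \<and>
    (vr s Vfound = 1 \<longrightarrow> vr s' Vfound = 1) \<and>
    (\<exists>h. hashes s' (hs @ [h]) \<and> ((\<exists>p. separated h p) \<longrightarrow> vr s' Vfound = 1)))" (is "tri b _ s _ ?P")
proof -
  let ?Q = "(q * q) ^ k" and ?T = "n + rr + M + 1"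
  have pot: "pot hs Mh \<le> 2 ^ (3 * l + 4)"
    using s(3) len by (intro pot_bound[where t = "length hs", OF q1 _ Ml]) (auto simp: hashes_def)
  have "tri b (main_step q (4 * d) k) s ((2 * hash_row_c q + 7) * (Mh * Mh + 1) + (1 + 2 + ?Q * (trial_c q (4 * d) k * ?T + 4))) ?P"
    unfolding main_step_def
  proof (rule tri_Sq)
    show "tri b (hash_step q) s ((2 * hash_row_c q + 7) * (Mh * Mh + 1)) (\<lambda>s'.
       (\<forall>x<Mh. ar s' HH x < q) \<and>
       q * (\<Sum>x<Mh. \<Sum>y<x. if ar s' HH y = ar s' HH x then 2 ^ agree hs x y else 0) \<le> pot hs Mh \<and>
       (\<forall>x<Mh. \<forall>y<x. ar s' WT (x * Mh + y) = 2 ^ agree (hs @ [ar s' HH]) x y))"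
      by (rule hash_step_spec) (use s q1 bounds Mh pot b2 in \<open>auto simp: static_def hashes_def\<close>)
  next
    fix s1 :: pst assume fr: "frame (hash_step q) s s1" and h1: "(\<forall>x<Mh. ar s1 HH x < q) \<and>
       q * (\<Sum>x<Mh. \<Sum>y<x. if ar s1 HH y = ar s1 HH x then 2 ^ agree hs x y else 0) \<le> pot hs Mh \<and>
       (\<forall>x<Mh. \<forall>y<x. ar s1 WT (x * Mh + y) = 2 ^ agree (hs @ [ar s1 HH]) x y)"
    define h where "h = ar s1 HH"
    have st1: "static s1" "cyc_inv s1" "vr s1 Vfound = vr s Vfound"
      using s fr by (auto simp: static_def inv_iff frame_def)
    have hs1: "hashes s1 (hs @ [h])"
      unfolding hashes_def
    proof (intro conjI)
      show "real (pot (hs @ [h]) Mh) \<le> (1 + 1 / real q) ^ length (hs @ [h]) * (Mh * Mh)"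
        using pot_step[OF q1, of hs Mh "length hs" h] s(3) h1 by (simp add: hashes_def h_def)
    qed (use s(3) h1 in \<open>auto simp: hashes_def h_def\<close>)
    let ?c = "\<lambda>z p. separated h p \<and> (\<forall>i<k. z div (q * q) ^ i mod (q * q) = hashv q Mh h (p i))"
    let ?I = "\<lambda>m (s' :: pst). static s' \<and> cyc_inv s' \<and> ar s' HH = h \<and> ar s' WT = ar s1 WT \<and>
      (vr s Vfound = 1 \<longrightarrow> vr s' Vfound = 1) \<and> ((\<exists>z<m. \<exists>p. ?c z p) \<longrightarrow> vr s' Vfound = 1)"
    have "tri b (For Vq (N ?Q) (trial q (4 * d) k)) s1 (ecost (N ?Q :: (vname, aname) aexp) + 2 + ?Q * (trial_c q (4 * d) k * ?T + 4)) (?I ?Q)"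
    proof (rule tri_For[where I = ?I])
      fix z and s' :: pst assume z: "z < ?Q" "?I z s'"
      let ?s = "setv Vq z s'"
      have st: "static ?s" "cyc_inv ?s" using z(2) by (auto simp: static_def inv_iff)
      have "tri b (trial q (4 * d) k) ?s (trial_c q (4 * d) k * ?T) (\<lambda>s''. cyc_inv s'' \<and>
        (vr ?s Vfound = 1 \<longrightarrow> vr s'' Vfound = 1) \<and> ((\<exists>p. ?c z p) \<longrightarrow> vr s'' Vfound = 1))"
        by (rule trial_spec[OF st]) (use z(2) in auto)
      then show "tri b (trial q (4 * d) k) ?s (trial_c q (4 * d) k * ?T) (?I (Suc z))"
      proof (rule tri_conseq)
        fix s'' :: pst assume fr: "frame (trial q (4 * d) k) ?s s''" and po: "cyc_inv s'' \<and>
          (vr ?s Vfound = 1 \<longrightarrow> vr s'' Vfound = 1) \<and> ((\<exists>p. ?c z p) \<longrightarrow> vr s'' Vfound = 1)"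
        have "static s''" using st(1) frame_trial[OF fr] by (simp add: static_def)
        moreover have "ar s'' HH = h" "ar s'' WT = ar s1 WT" using z(2) frame_trial(2)[OF fr] by auto
        moreover have "vr s'' Vfound = 1" if "\<exists>z'<Suc z. \<exists>p. ?c z' p"
        proof -
          have "(\<exists>z'<z. \<exists>p. ?c z' p) \<or> (\<exists>p. ?c z p)" using that unfolding less_Suc_eq by blast
          then show ?thesis
          proof
            assume "\<exists>z'<z. \<exists>p. ?c z' p"
            then have "vr s' Vfound = 1" using z(2) by blast
            then show ?thesis using po by simp
          next
            assume "\<exists>p. ?c z p"
            then show ?thesis using po by blast
          qed
        qed
        ultimately show "?I (Suc z) s''" using po z(2) by auto
      qed simp
    qed (use st1 h_def bounds in auto)
    then show "tri b (For Vq (N ?Q) (trial q (4 * d) k)) s1 (1 + 2 + ?Q * (trial_c q (4 * d) k * ?T + 4)) ?P"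
    proof (rule tri_conseq)
      fix s' :: pst assume I: "?I ?Q s'"
      have "hashes s' (hs @ [h])" using hs1 I by (simp add: hashes_def)
      moreover have "vr s' Vfound = 1" if sep: "separated h p" for p
      proof -
        have pn: "p i < n" if "i < k" for i using sep that by (simp add: separated_def indcyc_def)
        have hv: "hashv q Mh h (p i) < q * q" if "i < k" for i
          by (rule hashv_less) (use h1 pn that in \<open>auto simp: h_def\<close>)
        \<comment> \<open>The guess made of the true hash values; it is among the values that the
          loop runs through.\<close>
        define z where "z = (\<Sum>i<k. hashv q Mh h (p i) * (q * q) ^ i)"
        have "z < ?Q" unfolding z_def by (rule digit_sum_less) (rule hv)
        moreover have "z div (q * q) ^ i mod (q * q) = hashv q Mh h (p i)" if "i < k" for i
          unfolding z_def by (rule digit_sum[OF hv that])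
        ultimately show ?thesis using I sep by blast
      qed
      ultimately show "?P s'" using I by blast
    qed simp
  qed
  then show ?thesis
  proof (rule tri_conseq)
    define X where "X = n + rr + M + Mh * Mh + 1"
    have "(2 * hash_row_c q + 7) * (Mh * Mh + 1) \<le> (2 * hash_row_c q + 7) * X" by (intro mult_le_mono2) (simp add: X_def)
    moreover have "trial_c q (4 * d) k * ?T \<le> trial_c q (4 * d) k * X" by (intro mult_le_mono2) (simp add: X_def)
    then have "trial_c q (4 * d) k * ?T + 4 \<le> (trial_c q (4 * d) k + 4) * X" by (simp add: X_def algebra_simps)
    then have "?Q * (trial_c q (4 * d) k * ?T + 4) \<le> ?Q * ((trial_c q (4 * d) k + 4) * X)" by (rule mult_le_mono2)
    moreover have "main_step_c q (4 * d) k * X = (2 * hash_row_c q + 7) * X + 3 * X + ?Q * ((trial_c q (4 * d) k + 4) * X)"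
      by (simp add: main_step_c_def algebra_simps)
    moreover have "1 \<le> X" by (simp add: X_def)
    ultimately have "(2 * hash_row_c q + 7) * (Mh * Mh + 1) + (1 + 2 + ?Q * (trial_c q (4 * d) k * ?T + 4)) \<le> main_step_c q (4 * d) k * X" by linarith
    then show "(2 * hash_row_c q + 7) * (Mh * Mh + 1) + (1 + 2 + ?Q * (trial_c q (4 * d) k * ?T + 4)) \<le>
      main_step_c q (4 * d) k * (n + rr + M + Mh * Mh + 1)" unfolding X_def .
  qed
qed

lemma separated_exists:
  assumes hs: "hashes s hs" "length hs = q * (l + 1)" and p: "indcyc A n k p"
  shows "\<exists>i<length hs. separated (hs ! i) p"
proof -
  let ?U = "p ` {..<k} \<union> (\<Union>i<k. {v. Or (p i) v})"
  have U: "?U = p ` {..<k} \<union> {v. \<exists>i<k. Or (p i) v}" by auto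
  have "card ?U \<le> card (p ` {..<k}) + card (\<Union>i<k. {v. Or (p i) v})" by (rule card_Un_le)
  also have "card (p ` {..<k}) \<le> k" using card_image_le[of "{..<k}" p] by simp
  also have "card (\<Union>i<k. {v. Or (p i) v}) \<le> card {..<k} * (8 * d)" by (rule card_UN_bound) (auto simp: card_out)
  finally have "card ?U \<le> K" by (simp add: K)
  moreover have "finite ?U" using card_out(2) by auto
  moreover have "?U \<subseteq> {..<Mh * Mh}"
  proof -
    have "?U \<subseteq> {..<n}" using p Or_A A_props(2) by (auto simp: indcyc_def)
    also have "{..<n} \<subseteq> {..<Mh * Mh}" using Mh(1) by auto
    finally show ?thesis .
  qed
  moreover have "pot hs Mh \<le> 2 ^ (3 * l + 4)"
    using hs by (intro pot_bound[where t = "length hs", OF q1 _ Ml]) (auto simp: hashes_def)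
  moreover have "length hs = (4 * (K * K) + 1) * (l + 1)" using hs(2) unfolding q .
  moreover have "\<And>h x. h \<in> set hs \<Longrightarrow> x < Mh \<Longrightarrow> h x < q" using hs(1) by (simp add: hashes_def)
  ultimately have "\<exists>i<length hs. inj_on (hashv q Mh (hs ! i)) ?U"
    by (intro separating_hash[where K = K and l = l])
  then show ?thesis using p unfolding separated_def U by blast
qed

lemma main_loop_spec:
  fixes s :: pst
  assumes s: "static s" "cyc_inv s" "hashes s []" "vr s Vl = l"
  shows "tri b (main_loop q (4 * d) k) s (7 + q * (l + 1) * (main_step_c q (4 * d) k * (n + rr + M + Mh * Mh + 1) + 4)) (\<lambda>s'. cyc_inv s' \<and>
    ((\<exists>p. indcyc A n k p) \<longrightarrow> vr s' Vfound = 1))" (is "tri b _ s _ ?P")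
proof -
  let ?T = "main_step_c q (4 * d) k * (n + rr + M + Mh * Mh + 1)"
  let ?J = "\<lambda>m (s' :: pst) hs. static s' \<and> cyc_inv s' \<and> length hs = m \<and> hashes s' hs \<and>
    ((\<exists>i<m. \<exists>p. separated (hs ! i) p) \<longrightarrow> vr s' Vfound = 1)"
  have "tri b (main_loop q (4 * d) k) s (ecost (Ti (N q) (Pl (V Vl) (N 1)) :: (vname, aname) aexp) + 2 + q * (l + 1) * (?T + 4))
      (\<lambda>s'. Ex (?J (q * (l + 1)) s'))"
    unfolding main_loop_def
  proof (rule tri_For[where I = "\<lambda>m s'. Ex (?J m s')"])
    fix t and s' :: pst assume t: "t < q * (l + 1)" "Ex (?J t s')"
    then obtain hs where hs: "?J t s' hs" by blast
    let ?s = "setv Vt t s'"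
    have st: "static ?s" "cyc_inv ?s" "hashes ?s hs" using hs by (auto simp: static_def inv_iff hashes_def)
    have len: "length hs < q * (l + 1)" using hs t by blast
    show "tri b (main_step q (4 * d) k) ?s ?T (\<lambda>s'. Ex (?J (Suc t) s'))"
    proof (rule tri_conseq[OF main_step_spec[OF st len]])
      fix s'' :: pst assume "static s'' \<and> cyc_inv s'' \<and> (vr ?s Vfound = 1 \<longrightarrow> vr s'' Vfound = 1) \<and>
        (\<exists>h. hashes s'' (hs @ [h]) \<and> ((\<exists>p. separated h p) \<longrightarrow> vr s'' Vfound = 1))"
      then obtain h where h: "static s''" "cyc_inv s''" "vr s' Vfound = 1 \<longrightarrow> vr s'' Vfound = 1"
        "hashes s'' (hs @ [h])" "(\<exists>p. separated h p) \<longrightarrow> vr s'' Vfound = 1" by auto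
      have "vr s'' Vfound = 1" if "i < Suc t" "separated ((hs @ [h]) ! i) p" for i p
      proof (cases "i = t")
        case True
        then have "separated h p" using that hs by (simp add: nth_append)
        then show ?thesis using h(5) by blast
      next
        case False
        then have "i < t" "separated (hs ! i) p" using that hs by (auto simp: nth_append)
        then show ?thesis using hs h(3) by blast
      qed
      then have "?J (Suc t) s'' (hs @ [h])" using h hs by auto
      then show "Ex (?J (Suc t) s'')" by blast
    qed simp
  qed (use s b2 in auto)
  then show ?thesis
  proof (rule tri_conseq)
    fix s' :: pst assume "Ex (?J (q * (l + 1)) s')"
    then obtain hs where hs: "?J (q * (l + 1)) s' hs" by blast
    have "vr s' Vfound = 1" if p: "indcyc A n k p" for p
    proof -
      obtain i where "i < length hs" "separated (hs ! i) p" using separated_exists[of s' hs p] hs p by blast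
      then show ?thesis using hs by auto
    qed
    then show "?P s'" using hs by blast
  qed simp
qed

end

text \<open>On success the answer is the label of a closed walk, whose base-\<open>n\<close> digit
  at place \<open>i\<close> is the cycle vertex of colour \<open>i\<close>.\<close>

primrec write_output :: "nat \<Rightarrow> pprog" where
  "write_output 0 = Asg Vp (V Vans) ;; Asg (Vout 0) (V Vfound)"
| "write_output (Suc i) = write_output i ;; Asg (Vout (Suc i)) (Md (V Vp) (V Vn)) ;; Asg Vp (Dv (V Vp) (V Vn))"

lemma straight_write_output: "straight (write_output k)"
  by (induction k) auto

lemma write_output_ev:
  "vr (ev (write_output k) s) Vp = vr s Vans div vr s Vn ^ k" "vr (ev (write_output k) s) Vn = vr s Vn"
  "vr (ev (write_output k) s) (Vout 0) = vr s Vfound"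
  "i < k \<Longrightarrow> vr (ev (write_output k) s) (Vout (Suc i)) = vr s Vans div vr s Vn ^ i mod vr s Vn"
proof (induction k arbitrary: i)
  case (Suc k)
  {
    case 1
    show ?case using Suc by (simp add: div_mult2_eq[symmetric] mult.commute)
  next
    case 2
    show ?case using Suc by simp
  next
    case 3
    show ?case using Suc by simp
  next
    case (4 i)
    then show ?case using Suc by (auto simp: less_Suc_eq)
  }
qed auto

lemma write_output_ok: "bdd b s \<Longrightarrow> ok b (write_output k) s"
proof (induction k)
  case (Suc k)
  then have "bdd b (ev (write_output k) s)" by (auto intro: ok_bdd)
  then have le: "vr (ev (write_output k) s) Vp \<le> b" by (rule bdd_var)
  let ?x = "vr (ev (write_output k) s) Vp" and ?n = "vr (ev (write_output k) s) Vn"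
  have "?x mod ?n \<le> b" "?x div ?n \<le> b" using le by (meson mod_less_eq_dividend div_le_dividend le_trans)+
  then show ?case using Suc by simp
qed (auto simp: bdd_var)

section \<open>The complete program and its running time\<close>

definition find_cycle :: "nat \<Rightarrow> nat \<Rightarrow> nat \<Rightarrow> pprog" where
  "find_cycle q d k = sizes ;; read_edges (Suc k) ;; weights ;; prepare (Suc k) (4 * d) (2 * d) ;; powers k ;;
     main_loop q (4 * d) k ;; write_output k"

definition idx_graph :: "nat list list \<Rightarrow> ugraph" where
  "idx_graph adj = \<lparr>verts = {..<length adj}, edges = {{u, v} | u v. (u, v) \<in> set (arcs adj)}\<rparr>"

lemma arcs_idx_adj:
  assumes "adjacency_lists G vs adj"
  shows "(u, v) \<in> set (arcs adj) \<longleftrightarrow> idx_adj G vs u v"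
  using assms by (auto simp: adjacency_lists_def set_arcs idx_adj_def)

lemma idx_adj_props:
  assumes "simple_graph G" "distinct vs" "idx_adj G vs u v"
  shows "u < length vs" "v < length vs" "u \<noteq> v" "idx_adj G vs v u"
proof -
  have e: "{vs ! u, vs ! v} \<in> edges G" "u < length vs" "v < length vs" using assms(3) by (auto simp: idx_adj_def)
  then have "card {vs ! u, vs ! v} = 2" using assms(1) by (simp add: simple_graph_def)
  then show "u \<noteq> v" by auto
  show "u < length vs" "v < length vs" using e by auto
  show "idx_adj G vs v u" using e by (simp add: idx_adj_def insert_commute)
qed

text \<open>The program sees indices instead of vertices; this isomorphism puts the graph it works
  on into the family.\<close>

lemma idx_graph_isomorphic:
  assumes G: "simple_graph G" and adj: "adjacency_lists G vs adj"
  shows "isomorphic G (idx_graph adj)"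
proof -
  have vs: "distinct vs" "set vs = verts G" "length adj = length vs" using adj by (auto simp: adjacency_lists_def)
  define f where "f = the_inv_into {..<length vs} ((!) vs)"
  have bij: "bij_betw ((!) vs) {..<length vs} (verts G)" using vs bij_betw_nth[of vs "{..<length vs}" "verts G"] by simp
  have inj: "inj_on ((!) vs) {..<length vs}" using bij by (simp add: bij_betw_def)
  have f: "f (vs ! i) = i" if "i < length vs" for i
    unfolding f_def using that by (intro the_inv_into_f_f[OF inj]) simp
  show ?thesis unfolding isomorphic_def
  proof (intro exI conjI)
    show "bij_betw f (verts G) (verts (idx_graph adj))"
      unfolding f_def idx_graph_def using bij_betw_the_inv_into[OF bij] vs by simp
    show "edges (idx_graph adj) = (\<lambda>e. f ` e) ` edges G"
    proof (intro equalityI subsetI)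
      fix e assume "e \<in> edges (idx_graph adj)"
      then obtain u v where "e = {u, v}" "idx_adj G vs u v"
        using arcs_idx_adj[OF adj] by (auto simp: idx_graph_def)
      then have "{vs ! u, vs ! v} \<in> edges G" "e = f ` {vs ! u, vs ! v}" using f by (auto simp: idx_adj_def)
      then show "e \<in> (\<lambda>e. f ` e) ` edges G" by blast
    next
      fix e assume "e \<in> (\<lambda>e. f ` e) ` edges G"
      then obtain e' where e': "e' \<in> edges G" "e = f ` e'" by blast
      obtain x y where xy: "e' = {x, y}" "x \<in> verts G" "y \<in> verts G" using edgeE[OF G e'(1)] by metis
      then obtain u v where uv: "u < length vs" "v < length vs" "x = vs ! u" "y = vs ! v"
        using vs(2) by (metis in_set_conv_nth)
      then have "e = {u, v}" "idx_adj G vs u v" using e' xy f by (auto simp: idx_adj_def)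
      then show "e \<in> edges (idx_graph adj)" using arcs_idx_adj[OF adj] by (auto simp: idx_graph_def)
    qed
  qed
qed

lemma length_arcs_bound:
  assumes G: "simple_graph G" and adj: "adjacency_lists G vs adj"
    and d: "card (edges (idx_graph adj)) \<le> d * card (verts (idx_graph adj))"
  shows "length (arcs adj) \<le> 2 * d * length adj"
proof -
  have vs: "distinct vs" "length adj = length vs" "\<And>i. i < length adj \<Longrightarrow> distinct (adj ! i)"
    using adj by (auto simp: adjacency_lists_def)
  let ?I = "idx_graph adj"
  have edge: "{u, v} \<in> edges ?I \<longleftrightarrow> idx_adj G vs u v" for u v
    unfolding idx_graph_def using arcs_idx_adj[OF adj] idx_adj_props(4)[OF G vs(1)]
    by (auto simp: doubleton_eq_iff)
  have sI: "simple_graph ?I"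
    unfolding simple_graph_def
  proof (intro conjI ballI)
    show "finite (verts ?I)" by (simp add: idx_graph_def)
    fix e assume "e \<in> edges ?I"
    then obtain u v where "e = {u, v}" "idx_adj G vs u v"
      using arcs_idx_adj[OF adj] by (auto simp: idx_graph_def)
    then show "e \<subseteq> verts ?I" "card e = 2" using idx_adj_props[OF G vs(1)] vs(2) by (auto simp: idx_graph_def)
  qed
  have "nbrs ?I u = set (adj ! u)" if "u < length adj" for u
    unfolding nbrs_def edge using that arcs_idx_adj[OF adj, symmetric] by (simp add: set_arcs)
  then have "card (nbrs ?I u) = length (adj ! u)" if "u < length adj" for u
    using that vs(3) by (simp add: distinct_card)
  then have "(\<Sum>u<length adj. length (adj ! u)) = (\<Sum>u\<in>verts ?I. card (nbrs ?I u))"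
    by (simp add: idx_graph_def)
  also have "\<dots> = 2 * card (edges ?I)" by (rule sum_degrees[OF sI])
  also have "\<dots> \<le> 2 * (d * length adj)" using d by (simp add: idx_graph_def)
  finally show ?thesis by (simp add: length_arcs length_concat sum_list_sum_nth atLeast0LessThan)
qed

definition total_c :: "nat \<Rightarrow> nat \<Rightarrow> nat \<Rightarrow> nat" where
  "total_c q d k = (2 * d + 6) * (sizes_c + read_c (Suc k) + (scost weight1 + 14) + prepare_c (Suc k) (4 * d) (2 * d) +
     (5 + k * (scost power1 + 4)) + 7 + q * (main_step_c q (4 * d) k + 4) + scost (write_output k))"

text \<open>The exponent \<open>l\<close> found by \<open>sizes\<close> is replaced by the bound
  \<open>ll\<close> to obtain a time depending on \<open>n\<close> alone. Only the main loop repeats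
  linear work, \<open>q * (l + 1)\<close> times, and gives the logarithmic factor.\<close>

lemma find_cycle_spec:
  fixes F :: "ugraph set"
  assumes F: "graph_closed F" "\<forall>G\<in>F. \<forall>H. isomorphic G H \<longrightarrow> H \<in> F"
    and dens: "\<forall>G\<in>F. card (edges G) \<le> d * card (verts G)"
    and k: "3 \<le> k" and G: "G \<in> F" and adj: "adjacency_lists G vs adj"
    and n: "n = card (verts G)" and q: "q = 4 * ((k + k * (8 * d)) * (k + k * (8 * d))) + 1"
    and b: "n + 2 + 2 * (2 * d * n) + 1 \<le> b" "2 * n + 2 \<le> b" "n + 2 * d \<le> b" "8 * d \<le> b" "k \<le> b" "k * n ^ (k + 1) \<le> b"
      "(q * q) ^ k \<le> b" "q \<le> b" "32 * (2 * n + 1) ^ 3 \<le> b" "q * (n + 1) \<le> b" "n ^ k \<le> b"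
    and ll: "\<forall>l. 2 ^ l \<le> 2 * n + 1 \<longrightarrow> l \<le> ll"
  shows "bdd b (init_st adj :: pst)"
    "tri b (find_cycle q d k) (init_st adj) (total_c q d k * ((n + 1) * (ll + 1)))
       (\<lambda>s. correct_output k G vs \<lparr>regs = (\<lambda>_. 0), mem = (\<lambda>i. vr s (Vout i))\<rparr>)" (is "tri b _ _ _ ?P")
proof -
  note dens = dens[rule_format]
  have sG: "simple_graph G" using F(1) G unfolding graph_closed_def by blast
  have vs: "distinct vs" "set vs = verts G" "length adj = length vs" "\<And>i. i < length adj \<Longrightarrow> distinct (adj ! i)"
    using adj by (auto simp: adjacency_lists_def)
  have len: "length vs = n" "length adj = n" using vs distinct_card[of vs] n by auto
  let ?I = "idx_graph adj"
  have I: "?I \<in> F" using F(2) G idx_graph_isomorphic[OF sG adj] by blast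
  define M where "M = length (arcs adj)"
  have M: "M \<le> 2 * d * n" using length_arcs_bound[OF sG adj dens[OF I]] by (simp add: M_def len)
  have da: "distinct (arcs adj)" using vs(4) by (rule distinct_arcs)
  have arc: "idx_adj G vs (fst (arcs adj ! e)) (snd (arcs adj ! e))" if "e < M" for e
    using arcs_idx_adj[OF adj, of "fst (arcs adj ! e)" "snd (arcs adj ! e)"] that by (simp add: M_def)
  let ?s0 = "init_st adj :: pst"
  have Mb: "n + 2 + M \<le> b" "2 * M < b" using b(1) M by linarith+
  show "bdd b ?s0"
    using Mb(1) by (simp add: bdd_def init_st_def length_encode_adj length_arcs[symmetric] len M_def[symmetric])
  let ?R = "Suc k" and ?D = "4 * d"
  \<comment> \<open>A common linear bound for vertices, arcs, rounds and the weight table.\<close>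
  define N1 where "N1 = (2 * d + 6) * (n + 1)"
  have N1: "n + M + 1 \<le> N1" "4 * n + 1 \<le> N1" "n + M + (n + 2 * d) + 1 \<le> N1" "n + (n + 2 * d) + M + 4 * n + 1 \<le> N1"
    using M by (simp_all add: N1_def algebra_simps)
  let ?t1 = "sizes_c * (n + 1)" and ?t2 = "read_c ?R * N1" and ?t3 = "(scost weight1 + 14) * N1"
    and ?t4 = "prepare_c ?R ?D (2 * d) * N1" and ?t5 = "5 + k * (scost power1 + 4)"
    and ?t6 = "7 + q * (ll + 1) * (main_step_c q ?D k * N1 + 4)" and ?t7 = "scost (write_output k)"
  have "tri b (find_cycle q d k) ?s0 (?t1 + (?t2 + (?t3 + (?t4 + (?t5 + (?t6 + ?t7)))))) ?P"
    unfolding find_cycle_def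
  proof (rule tri_Sq)
    show "tri b sizes ?s0 ?t1 (\<lambda>s'. vr s' Vn = n \<and> n \<le> 2 ^ vr s' Vl \<and> 2 ^ vr s' Vl \<le> 2 * n + 1 \<and>
      vr s' Vl \<le> n \<and> n \<le> vr s' VM * vr s' VM \<and> vr s' VM * vr s' VM \<le> 4 * n \<and> vr s' VM \<le> n)"
    proof (rule sizes_spec)
      have "length (encode_adj adj) \<noteq> 0" by (simp add: length_encode_adj)
      then show "inp ?s0 \<noteq> []" by (simp add: init_st_def)
      show "inp ?s0 ! 0 = n" by (simp add: init_st_def encode_adj_nth_0 len)
      show "vr ?s0 = (\<lambda>_. 0)" by (simp add: init_st_def)
    qed (rule b(2))
  next
    fix s1 :: pst assume fr1: "frame sizes ?s0 s1" and s1: "vr s1 Vn = n \<and> n \<le> 2 ^ vr s1 Vl \<and> 2 ^ vr s1 Vl \<le> 2 * n + 1 \<and>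
      vr s1 Vl \<le> n \<and> n \<le> vr s1 VM * vr s1 VM \<and> vr s1 VM * vr s1 VM \<le> 4 * n \<and> vr s1 VM \<le> n"
    define l where "l = vr s1 Vl"
    define Mh where "Mh = vr s1 VM"
    have lM: "n \<le> 2 ^ l" "2 ^ l \<le> 2 * n + 1" "l \<le> n" "n \<le> Mh * Mh" "Mh * Mh \<le> 4 * n" "Mh \<le> n"
      using s1 by (auto simp: l_def Mh_def)
    have lll: "l \<le> ll" using ll lM(2) by blast
    have f1: "vr s1 Vn = n" "vr s1 Vl = l" "vr s1 VM = Mh" "vr s1 Vm = 0" "vr s1 Vfound = 0" "inp s1 = encode_adj adj"
      using s1 fr1 by (auto simp: l_def Mh_def frame_def init_st_def)
    show "tri b (read_edges ?R ;; weights ;; prepare ?R ?D (2 * d) ;; powers k ;; main_loop q ?D k ;; write_output k) s1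
      (?t2 + (?t3 + (?t4 + (?t5 + (?t6 + ?t7))))) ?P"
    proof (rule tri_Sq)
      have "tri b (read_edges ?R) s1 (read_c ?R * (n + M + 1)) (\<lambda>s'. vr s' Vm = M \<and>
        (\<forall>e<M. ar s' (SRC ?R) e = fst (arcs adj ! e) \<and> ar s' (DST ?R) e = snd (arcs adj ! e)))"
      proof (rule read_edges_spec)
        show "j < n" if "i < n" "j \<in> set (adj ! i)" for i j
          using adj that len by (auto simp: adjacency_lists_def)
      qed (use f1 len Mb in \<open>auto simp: M_def\<close>)
      then show "tri b (read_edges ?R) s1 ?t2 (\<lambda>s'. vr s' Vm = M \<and>
        (\<forall>e<M. ar s' (SRC ?R) e = fst (arcs adj ! e) \<and> ar s' (DST ?R) e = snd (arcs adj ! e)))"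
        by (rule tri_conseq[OF _ mult_le_mono2[OF N1(1)]])
    next
      fix s2 :: pst assume fr2: "frame (read_edges ?R) s1 s2" and s2: "vr s2 Vm = M \<and>
        (\<forall>e<M. ar s2 (SRC ?R) e = fst (arcs adj ! e) \<and> ar s2 (DST ?R) e = snd (arcs adj ! e))"
      define sr where "sr = ar s2 (SRC ?R)"
      define ds where "ds = ar s2 (DST ?R)"
      have ed: "arcs adj ! e = (sr e, ds e)" if "e < M" for e using s2 that by (simp add: sr_def ds_def)
      have adjE: "idx_adj G vs (sr e) (ds e)" if "e < M" for e using arc[OF that] ed[OF that] by simp
      have exE: "\<exists>e<M. sr e = u \<and> ds e = v" if "idx_adj G vs u v" for u v
      proof -
        have "(u, v) \<in> set (arcs adj)" using that arcs_idx_adj[OF adj] by blast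
        then obtain e where "e < M" "arcs adj ! e = (u, v)" by (auto simp: in_set_conv_nth M_def)
        then show ?thesis using ed by auto
      qed
      have rng: "sr e < n \<and> ds e < n \<and> sr e \<noteq> ds e" if "e < M" for e
        using idx_adj_props[OF sG vs(1) adjE[OF that]] len by simp
      have edI: "{{sr e, ds e} | e. e < M} = edges ?I"
      proof (intro equalityI subsetI)
        fix x assume "x \<in> {{sr e, ds e} | e. e < M}"
        then show "x \<in> edges ?I" using adjE arcs_idx_adj[OF adj] by (auto simp: idx_graph_def)
      next
        fix x assume "x \<in> edges ?I"
        then obtain u v where "x = {u, v}" "idx_adj G vs u v" using arcs_idx_adj[OF adj] by (auto simp: idx_graph_def)
        then show "x \<in> {{sr e, ds e} | e. e < M}" using exE[of u v] by blast
      qed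
      have gI: "\<lparr>verts = {..<n}, edges = {{sr e, ds e} | e. e < M}\<rparr> \<in> F"
        using I unfolding edI by (simp add: idx_graph_def len)
      have rounds: "M < 2 ^ (l + 2 * d)"
      proof -
        have "M \<le> 2 * d * 2 ^ l" using M lM(1) by (meson le_trans mult_le_mono2)
        also have "\<dots> < 2 ^ (2 * d) * 2 ^ l" using less_exp[of "2 * d"] by simp
        finally show ?thesis by (simp add: power_add mult.commute)
      qed
      have f2: "vr s2 Vn = n" "vr s2 Vl = l" "vr s2 VM = Mh" "vr s2 Vm = M" "vr s2 Vfound = 0"
        using f1 s2 fr2 by (auto simp: frame_def)
      show "tri b (weights ;; prepare ?R ?D (2 * d) ;; powers k ;; main_loop q ?D k ;; write_output k) s2
        (?t3 + (?t4 + (?t5 + (?t6 + ?t7)))) ?P"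
      proof (rule tri_Sq)
        have "tri b weights s2 ((scost weight1 + 14) * (Mh * Mh + 1)) (\<lambda>s'. \<forall>x<Mh. \<forall>y<Mh. ar s' WT (x * Mh + y) = 1)"
          by (rule weights_spec[OF f2(3)]) (use b(2) lM(6) in linarith)+
        then show "tri b weights s2 ?t3 (\<lambda>s'. \<forall>x<Mh. \<forall>y<Mh. ar s' WT (x * Mh + y) = 1)"
        proof (rule tri_conseq[OF _ mult_le_mono2])
          show "Mh * Mh + 1 \<le> N1" using N1(2) lM(5) by linarith
        qed
      next
        fix s3 :: pst assume fr3: "frame weights s2 s3" and s3: "\<forall>x<Mh. \<forall>y<Mh. ar s3 WT (x * Mh + y) = 1"
        have f3: "vr s3 Vn = n" "vr s3 Vl = l" "vr s3 VM = Mh" "vr s3 Vm = M" "vr s3 Vfound = 0"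
          "ar s3 (SRC ?R) = sr" "ar s3 (DST ?R) = ds"
          using f2 fr3 by (auto simp: frame_def sr_def ds_def)
        let ?E = "{e. e < M \<and> sr e < ds e}"
        show "tri b (prepare ?R ?D (2 * d) ;; powers k ;; main_loop q ?D k ;; write_output k) s3
          (?t4 + (?t5 + (?t6 + ?t7))) ?P"
        proof (rule tri_Sq)
          have "tri b (prepare ?R ?D (2 * d)) s3 (prepare_c ?R ?D (2 * d) * (n + M + (l + 2 * d) + 1)) (\<lambda>s'. vr s' Vr = l + 2 * d \<and>
            labelled ?D sr ds (ar s' (LAB ?R)) ?E \<and> (\<forall>e<M. \<not> sr e < ds e \<longrightarrow> ar s' (LAB ?R) e = 0))"
          proof (rule prepare_spec)
            show "dense_at d sr ds ?E"
            proof (rule dense_at_graph[OF F(1) dens gI])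
              show "{sr e, ds e} \<in> edges \<lparr>verts = {..<n}, edges = {{sr e, ds e} | e. e < M}\<rparr>" if "e \<in> ?E" for e
                using that by auto
              show "inj_on (\<lambda>e. {sr e, ds e}) ?E"
              proof (rule inj_onI)
                fix e e' assume e: "e \<in> ?E" "e' \<in> ?E" "{sr e, ds e} = {sr e', ds e'}"
                then have "arcs adj ! e = arcs adj ! e'" using ed by (auto simp: doubleton_eq_iff)
                then show "e = e'" using e(1,2) nth_eq_iff_index_eq[OF da] by (simp add: M_def)
              qed
            qed auto
            show "n \<le> b" "2 * M \<le> b" "l + 2 * d \<le> b" using Mb b(3) lM(3) by linarith+
          qed (use f3 b(4) rng rounds in auto)
          then show "tri b (prepare ?R ?D (2 * d)) s3 ?t4 (\<lambda>s'. vr s' Vr = l + 2 * d \<and>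
            labelled ?D sr ds (ar s' (LAB ?R)) ?E \<and> (\<forall>e<M. \<not> sr e < ds e \<longrightarrow> ar s' (LAB ?R) e = 0))"
          proof (rule tri_conseq[OF _ mult_le_mono2])
            show "n + M + (l + 2 * d) + 1 \<le> N1" using N1(3) lM(3) by linarith
          qed
        next
          fix s4 :: pst assume fr4: "frame (prepare ?R ?D (2 * d)) s3 s4" and s4: "vr s4 Vr = l + 2 * d \<and>
            labelled ?D sr ds (ar s4 (LAB ?R)) ?E \<and> (\<forall>e<M. \<not> sr e < ds e \<longrightarrow> ar s4 (LAB ?R) e = 0)"
          define lb where "lb = ar s4 (LAB ?R)"
          have f4: "vr s4 Vn = n" "vr s4 Vl = l" "vr s4 VM = Mh" "vr s4 Vm = M" "vr s4 Vfound = 0" "vr s4 Vr = l + 2 * d"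
            "ar s4 (SRC ?R) = sr" "ar s4 (DST ?R) = ds" "ar s4 WT = ar s3 WT"
            using f3 fr4 s4 by (auto simp: frame_def)
          show "tri b (powers k ;; main_loop q ?D k ;; write_output k) s4 (?t5 + (?t6 + ?t7)) ?P"
          proof (rule tri_Sq)
            show "tri b (powers k) s4 ?t5 (\<lambda>s'. \<forall>i<k. ar s' PW i = n ^ i)"
              by (rule powers_spec[OF f4(1)]) (use b(2,5,11) in linarith)+
          next
            fix s5 :: pst assume fr5: "frame (powers k) s4 s5" and s5: "\<forall>i<k. ar s5 PW i = n ^ i"
            interpret C: family F d k n M "l + 2 * d" b q Mh sr ds lb l "k + k * (8 * d)"
            proof unfold_locales
              show "\<exists>e'<M. sr e' = ds e \<and> ds e' = sr e" if "e < M" for e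
                using exE[OF idx_adj_props(4)[OF sG vs(1) adjE[OF that]]] .
              show "\<exists>U. \<lparr>verts = U, edges = {{sr e, ds e} | e. e < M}\<rparr> \<in> F" using gI by blast
              show "Mh * Mh \<le> 2 ^ (l + 2)" using lM(1,5) by (simp add: power_add)
              \<comment> \<open>The doubled potential bound is \<open>32\<close> times the cube of
                \<open>2 ^ l\<close>, hence polynomial in \<open>n\<close>, so the weights fit into
                words.\<close>
              have "(2 ^ l) ^ 3 \<le> (2 * n + 1) ^ 3" using lM(2) by (rule power_mono) simp
              moreover have "2 * 2 ^ (3 * l + 4) = 32 * ((2 :: nat) ^ l) ^ 3" by (simp add: power_add power_mult[symmetric] mult.commute)
              ultimately show "2 * 2 ^ (3 * l + 4) \<le> b" using b(9) by linarith
              have "q * (l + 1) \<le> q * (n + 1)" using lM(3) by (intro mult_le_mono2) simp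
              then show "q * (l + 1) \<le> b" using b(10) by linarith
              show "n \<le> b" "l + 2 * d \<le> b" using Mb b(3) lM(3) by linarith+
              show "1 \<le> q" by (simp add: q)
            qed (use F(1) dens k rng s4 b Mb lM rounds q in \<open>auto simp: lb_def\<close>)
            have A: "C.A = idx_adj G vs"
              using adjE exE by (intro ext) (auto simp: C.A_def)
            have f5: "C.static s5" "C.cyc_inv s5" "vr s5 Vl = l"
              unfolding C.static_def C.inv_iff using f4 fr5 s5 by (auto simp: frame_def lb_def)
            have h5: "C.hashes s5 []"
            proof -
              have "real (pot [] Mh) \<le> real (Mh * Mh)" using pot_Nil[of Mh] unfolding of_nat_le_iff .
              moreover have "ar s5 WT = ar s3 WT" using fr5 f4 by (simp add: frame_def)
              ultimately show ?thesis using s3 by (simp add: C.hashes_def agree_def)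
            qed
            show "tri b (main_loop q ?D k ;; write_output k) s5 (?t6 + ?t7) ?P"
            proof (rule tri_Sq)
              show "tri b (main_loop q ?D k) s5 ?t6 (\<lambda>s'. C.cyc_inv s' \<and> ((\<exists>p. indcyc C.A n k p) \<longrightarrow> vr s' Vfound = 1))"
              proof (rule tri_conseq[OF C.main_loop_spec[OF f5(1,2) h5 f5(3)]])
                have "n + (l + 2 * d) + M + Mh * Mh + 1 \<le> N1" using N1(4) lM(3,5) by linarith
                then have "q * (l + 1) * (main_step_c q ?D k * (n + (l + 2 * d) + M + Mh * Mh + 1) + 4) \<le>
                    q * (ll + 1) * (main_step_c q ?D k * N1 + 4)"
                  using lll by (intro mult_le_mono add_mono) auto
                then show "7 + q * (l + 1) * (main_step_c q ?D k * (n + (l + 2 * d) + M + Mh * Mh + 1) + 4) \<le> ?t6" by linarith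
              qed
            next
              fix s6 :: pst assume s6: "C.cyc_inv s6 \<and> ((\<exists>p. indcyc C.A n k p) \<longrightarrow> vr s6 Vfound = 1)"
              show "tri b (write_output k) s6 ?t7 ?P"
              proof (rule tri_straight[OF straight_write_output], intro conjI)
                assume "bdd b s6"
                then show "ok b (write_output k) s6" by (rule write_output_ok)
                let ?o = "\<lambda>i. vr (ev (write_output k) s6) (Vout i)"
                have i6: "vr s6 Vn = n" "vr s6 Vfound \<le> 1" "vr s6 Vfound = 1 \<longrightarrow> C.Good (vr s6 Vans)"
                  using s6 by (auto simp: C.inv_iff)
                have found: "induced_cycle k G ((\<lambda>i. vs ! ?o i) ` {1..k}) \<and> (\<forall>i\<in>{1..k}. ?o i < length vs)"
                  if fnd: "vr s6 Vfound = 1"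
                proof -
                  obtain p where p: "indcyc (idx_adj G vs) n k p" "vr s6 Vans = (\<Sum>i<k. p i * n ^ i)"
                    using i6(3) fnd by (auto simp: C.Good_def A)
                  have pn: "p i < n" if "i < k" for i using p(1) that by (simp add: indcyc_def)
                  have o: "?o (Suc i) = p i" if "i < k" for i
                    using write_output_ev(4)[OF that, of s6] digit_sum[of k p n i, OF pn that] by (simp add: i6 p(2))
                  have img: "{1..k} = Suc ` {..<k}" by (rule image_Suc_lessThan[symmetric])
                  have "(\<lambda>i. vs ! ?o i) ` {1..k} = (\<lambda>i. vs ! p i) ` {..<k}"
                    unfolding img image_image by (rule image_cong) (use o in auto)
                  moreover have "induced_cycle k G ((\<lambda>i. vs ! p i) ` {..<k})"
                    by (rule induced_cycle_of_indcyc[OF sG vs(1,2) k]) (use p(1) len in simp)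
                  moreover have "\<forall>i\<in>{1..k}. ?o i < length vs" unfolding img using o pn len by auto
                  ultimately show ?thesis by simp
                qed
                show "?P (ev (write_output k) s6)"
                proof (cases "\<exists>S. induced_cycle k G S")
                  case True
                  then obtain p where "indcyc (idx_adj G vs) (length vs) k p"
                    using indcyc_of_induced_cycle[OF sG vs(1,2)] by blast
                  then have "vr s6 Vfound = 1" using s6 len A by auto
                  then show ?thesis using True found write_output_ev(3)[of k s6] by (simp add: correct_output_def)
                next
                  case False
                  then have "vr s6 Vfound \<noteq> 1" using found by blast
                  then have "vr s6 Vfound = 0" using i6(2) by linarith
                  then show ?thesis using False write_output_ev(3)[of k s6] by (simp add: correct_output_def)
                qed
              qed
            qed
          qed
        qed
      qed
    qed
  qed
  then show "tri b (find_cycle q d k) ?s0 (total_c q d k * ((n + 1) * (ll + 1))) ?P"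
  proof (rule tri_conseq)
    define Z where "Z = N1 * (ll + 1)"
    have "N1 * 1 \<le> Z" unfolding Z_def by (rule mult_le_mono2) simp
    then have le: "N1 \<le> Z" "1 \<le> Z" "n + 1 \<le> Z" using N1(1) by linarith+
    have "a \<le> a * Z" for a :: nat using le(2) by simp
    note one = this
    have t: "?t1 \<le> sizes_c * Z" "?t2 \<le> read_c ?R * Z" "?t3 \<le> (scost weight1 + 14) * Z" "?t4 \<le> prepare_c ?R ?D (2 * d) * Z"
      by (intro mult_le_mono2 le)+
    have "main_step_c q ?D k * N1 + 4 \<le> (main_step_c q ?D k + 4) * N1" by (simp add: N1_def algebra_simps)
    then have "q * (ll + 1) * (main_step_c q ?D k * N1 + 4) \<le> q * (ll + 1) * ((main_step_c q ?D k + 4) * N1)"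
      by (rule mult_le_mono2)
    also have "\<dots> = q * (main_step_c q ?D k + 4) * Z" by (simp add: Z_def algebra_simps)
    finally have t6: "?t6 \<le> 7 * Z + q * (main_step_c q ?D k + 4) * Z" using le(2) by linarith
    have arith: "x1 + (x2 + (x3 + (x4 + (x5 + (x6 + x7))))) \<le> y1 + y2 + y3 + y4 + y5 + y6a + y6b + y7"
      if "x1 \<le> y1" "x2 \<le> y2" "x3 \<le> y3" "x4 \<le> y4" "x5 \<le> y5" "x6 \<le> y6a + y6b" "x7 \<le> y7"
      for x1 x2 x3 x4 x5 x6 x7 y1 y2 y3 y4 y5 y6a y6b y7 :: nat using that by linarith
    have "total_c q d k * ((n + 1) * (ll + 1)) = (sizes_c + read_c ?R + (scost weight1 + 14) + prepare_c ?R ?D (2 * d) +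
        ?t5 + 7 + q * (main_step_c q ?D k + 4) + ?t7) * Z"
      unfolding total_c_def Z_def N1_def by (simp only: ac_simps)
    also have "\<dots> = sizes_c * Z + read_c ?R * Z + (scost weight1 + 14) * Z + prepare_c ?R ?D (2 * d) * Z +
        ?t5 * Z + 7 * Z + q * (main_step_c q ?D k + 4) * Z + ?t7 * Z" by (simp only: add_mult_distrib)
    finally have eq: "total_c q d k * ((n + 1) * (ll + 1)) = sizes_c * Z + read_c ?R * Z + (scost weight1 + 14) * Z +
        prepare_c ?R ?D (2 * d) * Z + ?t5 * Z + 7 * Z + q * (main_step_c q ?D k + 4) * Z + ?t7 * Z" .
    show "?t1 + (?t2 + (?t3 + (?t4 + (?t5 + (?t6 + ?t7))))) \<le> total_c q d k * ((n + 1) * (ll + 1))"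
      unfolding eq by (rule arith[OF t one t6 one])
  qed
qed

text \<open>Only \<open>n\<close> tending to infinity matters, so the additive constants and the
  zeros of \<open>n * ln n\<close> at \<open>0\<close> and \<open>1\<close> are harmless.\<close>

lemma time_bound:
  "(\<lambda>n. real (c * ((n + 1) * (nat \<lfloor>log 2 (real (2 * n + 1))\<rfloor> + 1)) + c')) \<in> O(\<lambda>n. real n * ln (real n))"
proof -
  have le: "real (nat \<lfloor>log 2 (real (2 * n + 1))\<rfloor>) \<le> log 2 (real (2 * n + 1))" for n :: nat
  proof -
    have "0 \<le> \<lfloor>log 2 (real (2 * n + 1))\<rfloor>" by simp
    then have "real (nat \<lfloor>log 2 (real (2 * n + 1))\<rfloor>) = real_of_int \<lfloor>log 2 (real (2 * n + 1))\<rfloor>" by (rule of_nat_nat)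
    also have "\<dots> \<le> log 2 (real (2 * n + 1))" by (rule of_int_floor_le)
    finally show ?thesis .
  qed
  have "(\<lambda>n. real (c * ((n + 1) * (nat \<lfloor>log 2 (real (2 * n + 1))\<rfloor> + 1)) + c'))
      \<in> O(\<lambda>n. real c * ((real n + 1) * (log 2 (2 * real n + 1) + 1)) + real c')"
  proof (rule bigoI[of _ 1], rule always_eventually, rule allI)
    fix n :: nat
    let ?x = "nat \<lfloor>log 2 (real (2 * n + 1))\<rfloor>" and ?y = "log 2 (real (2 * n + 1))"
    have gen: "real (c * ((n + 1) * (x + 1)) + c') \<le> real c * ((real n + 1) * (y + 1)) + real c'" if "real x \<le> y" for x y
    proof -
      have "real (c * ((n + 1) * (x + 1)) + c') = real c * ((real n + 1) * (real x + 1)) + real c'"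
        by (simp only: of_nat_add of_nat_mult of_nat_1)
      also have "\<dots> \<le> real c * ((real n + 1) * (y + 1)) + real c'"
        using that by (intro add_mono mult_left_mono) auto
      finally show ?thesis .
    qed
    have "real (c * ((n + 1) * (?x + 1)) + c') \<le> real c * ((real n + 1) * (?y + 1)) + real c'" by (rule gen[OF le])
    moreover have "real (2 * n + 1) = 2 * real n + 1" by simp
    ultimately have "real (c * ((n + 1) * (?x + 1)) + c') \<le> real c * ((real n + 1) * (log 2 (2 * real n + 1) + 1)) + real c'"
      by (simp only:)
    moreover have "0 \<le> log 2 (2 * real n + 1)" by simp
    ultimately show "norm (real (c * ((n + 1) * (nat \<lfloor>log 2 (real (2 * n + 1))\<rfloor> + 1)) + c')) \<le>
        1 * norm (real c * ((real n + 1) * (log 2 (2 * real n + 1) + 1)) + real c')"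
      unfolding real_norm_def mult_1 by (subst abs_of_nonneg, simp) (rule order_trans[OF _ abs_ge_self])
  qed
  also have "(\<lambda>n. real c * ((real n + 1) * (log 2 (2 * real n + 1) + 1)) + real c') \<in> O(\<lambda>n. real n * ln (real n))"
    unfolding log_def by real_asymp
  finally show ?thesis .
qed

theorem theorem8:
  fixes F :: "ugraph set" and k :: nat
  assumes "\<forall>G\<in>F. simple_graph G"
    and "minor_closed F"
    and "nontrivial_family F"
    and "k \<ge> 3"
  shows "\<exists>P T. finds_induced_cycles_in_time P F k T \<and>
           (\<lambda>n. real (T n)) \<in> O(\<lambda>n. real n * ln (real n))"
proof -
  obtain d where d: "d \<ge> 1" "\<And>G. G \<in> F \<Longrightarrow> card (edges G) \<le> d * card (verts G)"
    using minor_closed_density[OF assms(1-3)] by blast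
  have closed: "graph_closed F" by (rule minor_closed_graph_closed[OF assms(1,2)])
  have iso: "\<forall>G\<in>F. \<forall>H. isomorphic G H \<longrightarrow> H \<in> F"
    using minor_closed_isomorphic[OF assms(1,2)] by blast
  have dens: "\<forall>G\<in>F. card (edges G) \<le> d * card (verts G)" using d(2) by blast
  define q where "q = 4 * ((k + k * (8 * d)) * (k + k * (8 * d))) + 1"
  \<comment> \<open>The sum of all magnitudes that have to fit into a word; it is polynomial, hence
    below one power of \<open>n + 2\<close>.\<close>
  define B where "B n = (n + 2 + 2 * (2 * d * n) + 1) + (2 * n + 2) + (n + 2 * d) + 8 * d + k + k * n ^ (k + 1) +
    (q * q) ^ k + q + 32 * (2 * n + 1) ^ 3 + q * (n + 1) + n ^ k" for n
  have "poly_bd B"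
    unfolding B_def by (intro poly_bd_add poly_bd_mult poly_bd_power poly_bd_self poly_bd_const)
  then obtain c0 where c0: "\<And>n. B n \<le> (n + 2) ^ c0" by (auto simp: poly_bd_def)
  define ll where "ll n = nat \<lfloor>log 2 (real (2 * n + 1))\<rfloor>" for n :: nat
  have ll: "\<forall>l. 2 ^ l \<le> 2 * n + 1 \<longrightarrow> l \<le> ll n" for n
  proof (intro allI impI)
    fix l :: nat assume "2 ^ l \<le> 2 * n + 1"
    then have "real (2 ^ l) \<le> real (2 * n + 1)" unfolding of_nat_le_iff .
    then have "real l \<le> log 2 (real (2 * n + 1))" by (simp add: le_log_iff powr_realpow)
    then show "l \<le> ll n" unfolding ll_def by linarith
  qed
  let ?T = "\<lambda>n. total_c q d k * ((n + 1) * (ll n + 1))"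
  have "\<exists>P'. finds_induced_cycles_in_time P' F k (\<lambda>n. ?T n + (2 * k + 7))"
  proof (rule ram_program[where ?c0.0 = c0 and P = "find_cycle q d k" and out = Vout])
    fix G vs adj assume G: "G \<in> F" "adjacency_lists G vs adj"
    let ?n = "card (verts G)"
    have b: "?n + 2 + 2 * (2 * d * ?n) + 1 \<le> (?n + 2) ^ c0" "2 * ?n + 2 \<le> (?n + 2) ^ c0" "?n + 2 * d \<le> (?n + 2) ^ c0"
      "8 * d \<le> (?n + 2) ^ c0" "k \<le> (?n + 2) ^ c0" "k * ?n ^ (k + 1) \<le> (?n + 2) ^ c0" "(q * q) ^ k \<le> (?n + 2) ^ c0"
      "q \<le> (?n + 2) ^ c0" "32 * (2 * ?n + 1) ^ 3 \<le> (?n + 2) ^ c0" "q * (?n + 1) \<le> (?n + 2) ^ c0" "?n ^ k \<le> (?n + 2) ^ c0"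
      by (rule order_trans[OF _ c0[of ?n]], unfold B_def, linarith)+
    show "bdd ((?n + 2) ^ c0) (init_st adj :: pst) \<and>
      tri ((?n + 2) ^ c0) (find_cycle q d k) (init_st adj) (?T ?n)
        (\<lambda>s. correct_output k G vs \<lparr>regs = (\<lambda>_. 0), mem = (\<lambda>i. vr s (Vout i))\<rparr>)"
      using find_cycle_spec[OF closed iso dens assms(4) G refl q_def b ll] by blast
  qed
  then obtain P' where "finds_induced_cycles_in_time P' F k (\<lambda>n. ?T n + (2 * k + 7))" by blast
  moreover have "(\<lambda>n. real (?T n + (2 * k + 7))) \<in> O(\<lambda>n. real n * ln (real n))"
    unfolding ll_def by (rule time_bound)
  ultimately show ?thesis by blast
qed

end
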